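(* Let $\mathcal{M}$ be a countable recursively saturated model of $\mathsf{PA}$. There are arbitrarily large proper cuts $I$ of $\mathcal{M}$ for which $I\prec\mathcal{M}$ and $I\cong\mathcal{M}$ (that is, for every $c\in M$ there is such an $I$ with $c\in I$), and for each such cut $I$ there is a full truth class $T$ on $\mathcal{M}$ that is both $I$-disjunctively correct and strongly $I$-deductively correct.
   Context: $\mathsf{PA}$ is Peano Arithmetic in the language $\mathcal{L}_{\mathsf{PA}}=\{+,\cdot,\mathrm{S},0\}$; $M$ is the universe of $\mathcal{M}$. A cut of $\mathcal{M}$ is an initial segment of $\mathcal{M}$ with no last element; it is proper if it is not all of $M$. $I\prec\mathcal{M}$ and $I\cong\mathcal{M}$ refer to $I$ as an $\mathcal{L}_{\mathsf{PA}}$-substructure of $\mathcal{M}$. Syntax (built from atomic formulae $s=t$ with $\neg,\vee,\exists$) is arithmetized in $\mathsf{PA}$ in a standard way. $\mathsf{Form}^{\mathcal{M}}$ and $\mathsf{Sent}^{\mathcal{M}}$ are the sets of elements of $M$ that $\mathcal{M}$ regards as (codes of) $\mathcal{L}_{\mathsf{PA}}$-formulae and $\mathcal{L}_{\mathsf{PA}}$-sentences. For a closed term $s$, $s^{\circ}$ is its value (as computed in $\mathcal{M}$); $\underline{x}$ is the numeral for $x$; $\varphi[\underline{x}/v]$ is the result of substituting $\underline{x}$ for the variable $v$ in $\varphi$. A subset of $M$ is $\mathcal{M}$-finite (or $\mathcal{M}$-coded) if it has the form $\{m\in M:\mathcal{M}\models$ "the $m$-th bit of the binary expansion of $c$ is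 $1$"$\}$ for some $c\in M$. Full truth class: $T\subseteq M$ is a full truth class on $\mathcal{M}$ if $(\mathcal{M},T)$ satisfies the theory $\mathsf{CT}^-$, which consists of the following axioms for a unary predicate $\mathsf{T}$ (with $s,t$ ranging over closed terms and $\sigma$'s over sentences, all in the sense of the model): (0) $\mathsf{T}(x)\to x$ is an $\mathcal{L}_{\mathsf{PA}}$-sentence; (1) $\mathsf{T}(s=t)\leftrightarrow s^{\circ}=t^{\circ}$; (2) $\mathsf{T}(\neg\sigma)\leftrightarrow\neg\mathsf{T}(\sigma)$; (3) $\mathsf{T}(\sigma_1\vee\sigma_2)\leftrightarrow(\mathsf{T}(\sigma_1)\vee\mathsf{T}(\sigma_2))$; (4) for every formula $\varphi(v)$ with at most the one free variable $v$: $\mathsf{T}(\exists v\,\varphi)\leftrightarrow\exists x\,\mathsf{T}(\varphi[\underline{x}/v])$. $I$-disjunctive correctness: a full truth class $T$ is $I$-disjunctively correct if, whenever $m\in I$, $\{\varphi_i:i<m\}$ is an $\mathcal{M}$-coded subset of $\mathsf{Sent}^{\mathcal{M}}$, and $\delta\in\mathsf{Sent}^{\mathcal{M}}$ is such that $\mathcal{M}\models\delta=\bigvee_{i<m}\varphi_i$ (any grouping of the disjuncts may be used in $\mathcal{M}$ to form $\delta$), we have: $\delta\in T$ iff $\varphi_i\in T$ for some $i<m$. Strong $I$-deductive correctness: fix a standard Hilbert-style proof system for first-order logic, arithmetized in $\mathsf{PA}$. $T$ is strongly $I$-deductively correct if $\sigma'\in T$ whenever $\sigma'$ is (in $\mathcal{M}$)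 an $\mathcal{L}_{\mathsf{PA}}$-sentence obtained by substituting closed terms for the free variables of a formula in $\mathsf{Form}^{\mathcal{M}}\cap I$, and there are an $\mathcal{M}$-finite $T_0\subseteq T$ and some $\pi\in M$ such that $\mathcal{M}$ satisfies "$\pi$ is a Hilbert-style proof of $\sigma'$ from $T_0$" and the number of steps of $\pi$ is in $I$. *)

theory Defs
  imports "HOL-Library.Countable_Set"
begin

section \<open>First-order logic of arithmetic\<close>

datatype tm = Var nat | Zero | Sc tm | Add tm tm | Mul tm tm

datatype fm = Eq tm tm | Neg fm | Dsj fm fm | Exi nat fm

primrec tm_vars :: "tm \<Rightarrow> nat set" where
  "tm_vars (Var k) = {k}"
| "tm_vars Zero = {}"
| "tm_vars (Sc t) = tm_vars t"
| "tm_vars (Add s t) = tm_vars s \<union> tm_vars t"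
| "tm_vars (Mul s t) = tm_vars s \<union> tm_vars t"

primrec fm_vars :: "fm \<Rightarrow> nat set" where
  "fm_vars (Eq s t) = tm_vars s \<union> tm_vars t"
| "fm_vars (Neg p) = fm_vars p"
| "fm_vars (Dsj p q) = fm_vars p \<union> fm_vars q"
| "fm_vars (Exi k p) = fm_vars p - {k}"

record 'a lpa =
  univ :: "'a set"
  zer :: 'a
  suc :: "'a \<Rightarrow> 'a"
  pls :: "'a \<Rightarrow> 'a \<Rightarrow> 'a"
  tms :: "'a \<Rightarrow> 'a \<Rightarrow> 'a"

definition lpa_structure :: "'a lpa \<Rightarrow> bool" where
  "lpa_structure M \<longleftrightarrow> zer M \<in> univ M \<and> (\<forall>x\<in>univ M. suc M x \<in> univ M) \<and>
     (\<forall>x\<in>univ M. \<forall>y\<in>univ M. pls M x y \<in> univ M \<and> tms M x y \<in> univ M)"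

primrec tm_val :: "'a lpa \<Rightarrow> (nat \<Rightarrow> 'a) \<Rightarrow> tm \<Rightarrow> 'a" where
  "tm_val M e (Var k) = e k"
| "tm_val M e Zero = zer M"
| "tm_val M e (Sc t) = suc M (tm_val M e t)"
| "tm_val M e (Add s t) = pls M (tm_val M e s) (tm_val M e t)"
| "tm_val M e (Mul s t) = tms M (tm_val M e s) (tm_val M e t)"

primrec sat :: "'a lpa \<Rightarrow> (nat \<Rightarrow> 'a) \<Rightarrow> fm \<Rightarrow> bool" where
  "sat M e (Eq s t) \<longleftrightarrow> tm_val M e s = tm_val M e t"
| "sat M e (Neg p) \<longleftrightarrow> \<not> sat M e p"
| "sat M e (Dsj p q) \<longleftrightarrow> sat M e p \<or> sat M e q"
| "sat M e (Exi k p) \<longleftrightarrow> (\<exists>x\<in>univ M. sat M (e(k := x)) p)"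

definition PA_model :: "'a lpa \<Rightarrow> bool" where
  "PA_model M \<longleftrightarrow> lpa_structure M \<and>
     (\<forall>x\<in>univ M. suc M x \<noteq> zer M) \<and>
     (\<forall>x\<in>univ M. \<forall>y\<in>univ M. suc M x = suc M y \<longrightarrow> x = y) \<and>
     (\<forall>x\<in>univ M. pls M x (zer M) = x) \<and>
     (\<forall>x\<in>univ M. \<forall>y\<in>univ M. pls M x (suc M y) = suc M (pls M x y)) \<and>
     (\<forall>x\<in>univ M. tms M x (zer M) = zer M) \<and>
     (\<forall>x\<in>univ M. \<forall>y\<in>univ M. tms M x (suc M y) = pls M (tms M x y) x) \<and>
     (\<forall>p k e. range e \<subseteq> univ M \<longrightarrow>
        sat M (e(k := zer M)) p \<longrightarrow>
        (\<forall>x\<in>univ M. sat M (e(k := x)) p \<longrightarrow> sat M (e(k := suc M x)) p) \<longrightarrow>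
        (\<forall>x\<in>univ M. sat M (e(k := x)) p))"

definition restr :: "'a lpa \<Rightarrow> 'a set \<Rightarrow> 'a lpa" where
  "restr M I = M\<lparr>univ := I\<rparr>"

definition elementary :: "'a set \<Rightarrow> 'a lpa \<Rightarrow> bool" where
  "elementary I M \<longleftrightarrow> I \<subseteq> univ M \<and> lpa_structure (restr M I) \<and>
     (\<forall>p e. range e \<subseteq> I \<longrightarrow> (sat (restr M I) e p \<longleftrightarrow> sat M e p))"

definition lpa_iso :: "'a lpa \<Rightarrow> 'b lpa \<Rightarrow> bool" where
  "lpa_iso M N \<longleftrightarrow> (\<exists>f. bij_betw f (univ M) (univ N) \<and> f (zer M) = zer N \<and>
     (\<forall>x\<in>univ M. f (suc M x) = suc N (f x)) \<and>
     (\<forall>x\<in>univ M. \<forall>y\<in>univ M. f (pls M x y) = pls N (f x) (f y)) \<and>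
     (\<forall>x\<in>univ M. \<forall>y\<in>univ M. f (tms M x y) = tms N (f x) (f y)))"


section \<open>Syntax arithmetized in a structure\<close>

text \<open>
  Below, an arithmetized notion R is given directly as the relation defined in M by an
  arithmetical formula: every quantifier ranges over the universe of M, every atom is an
  equation between terms, so \<open>R M x\<close> reads ``M satisfies R(x)''.
  A notion that is recursive along syntax is expressed by an M-finite certificate c, i.e. a
  set of facts each of which follows by one clause of the recursion from other facts in c.
  Components of a code are smaller than the code, so certificates are well-founded in the
  sense of M.
\<close>

context
  fixes M :: "'a lpa"
begin

abbreviation (input) U :: "'a set" where "U \<equiv> univ M"
abbreviation (input) plus_M (infixl "\<oplus>" 65) where "x \<oplus> y \<equiv> pls M x y"
abbreviation (input) times_M (infixl "\<otimes>" 70) where "x \<otimes> y \<equiv> tms M x y"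

definition lt :: "'a \<Rightarrow> 'a \<Rightarrow> bool" (infix "\<lhd>" 50) where
  "x \<lhd> y \<longleftrightarrow> (\<exists>w\<in>U. y = x \<oplus> suc M w)"

text \<open>Goedel's beta function: x is the remainder of a modulo 1 + (i + 1)b.\<close>

definition beta :: "'a \<Rightarrow> 'a \<Rightarrow> 'a \<Rightarrow> 'a \<Rightarrow> bool" where
  "beta a b i x \<longleftrightarrow>
     (\<exists>q\<in>U. a = q \<otimes> suc M (suc M i \<otimes> b) \<oplus> x) \<and> x \<lhd> suc M (suc M i \<otimes> b)"

definition pow2 :: "'a \<Rightarrow> 'a \<Rightarrow> bool" where
  "pow2 m p \<longleftrightarrow> (\<exists>a\<in>U. \<exists>b\<in>U. beta a b (zer M) (suc M (zer M)) \<and>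
     (\<forall>i\<in>U. i \<lhd> m \<longrightarrow> (\<forall>x\<in>U. beta a b i x \<longrightarrow> beta a b (suc M i) (x \<oplus> x))) \<and>
     beta a b m p)"

text \<open>The m-th bit of the binary expansion of c is 1.\<close>

definition bit :: "'a \<Rightarrow> 'a \<Rightarrow> bool" (infix "\<epsilon>" 50) where
  "m \<epsilon> c \<longleftrightarrow> (\<exists>p\<in>U. \<exists>q\<in>U. \<exists>r\<in>U.
     pow2 m p \<and> c = suc M (q \<oplus> q) \<otimes> p \<oplus> r \<and> r \<lhd> p)"

definition coded_set :: "'a \<Rightarrow> 'a set" where
  "coded_set c = {m \<in> U. m \<epsilon> c}"

text \<open>An injective (not surjective) pairing; it dominates both arguments.\<close>

definition pair :: "'a \<Rightarrow> 'a \<Rightarrow> 'a" where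
  "pair x y = (x \<oplus> y) \<otimes> (x \<oplus> y) \<oplus> x"

text \<open>s codes a sequence of length m, its i-th entry being the x with \<open>pair i x \<epsilon> s\<close>.\<close>

definition is_seq :: "'a \<Rightarrow> 'a \<Rightarrow> bool" where
  "is_seq m s \<longleftrightarrow> (\<forall>i\<in>U. i \<lhd> m \<longrightarrow> (\<exists>!x. x \<in> U \<and> pair i x \<epsilon> s))"

definition tagged :: "nat \<Rightarrow> 'a \<Rightarrow> 'a" where
  "tagged n x = pair ((suc M ^^ n) (zer M)) x"

definition "c_var k = tagged 1 k"
definition "c_zero = tagged 2 (zer M)"
definition "c_suc t = tagged 3 t"
definition "c_add s t = tagged 4 (pair s t)"
definition "c_mul s t = tagged 5 (pair s t)"
definition "c_eq s t = tagged 6 (pair s t)"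
definition "c_neg x = tagged 7 x"
definition "c_dsj x y = tagged 8 (pair x y)"
definition "c_exi k x = tagged 9 (pair k x)"

definition is_term :: "'a \<Rightarrow> bool" where
  "is_term t \<longleftrightarrow> (\<exists>c\<in>U. t \<epsilon> c \<and> (\<forall>y\<in>U. y \<epsilon> c \<longrightarrow>
      (\<exists>k\<in>U. y = c_var k) \<or> y = c_zero \<or>
      (\<exists>r\<in>U. r \<epsilon> c \<and> y = c_suc r) \<or>
      (\<exists>r\<in>U. \<exists>s\<in>U. r \<epsilon> c \<and> s \<epsilon> c \<and> (y = c_add r s \<or> y = c_mul r s))))"

text \<open>For occurrence, the certificate is a path down to an occurrence.\<close>

definition occurs :: "'a \<Rightarrow> 'a \<Rightarrow> bool" where
  "occurs v t \<longleftrightarrow> (\<exists>c\<in>U. t \<epsilon> c \<and> (\<forall>y\<in>U. y \<epsilon> c \<longrightarrow>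
      y = c_var v \<or>
      (\<exists>r\<in>U. r \<epsilon> c \<and> y = c_suc r) \<or>
      (\<exists>r\<in>U. \<exists>s\<in>U. (r \<epsilon> c \<or> s \<epsilon> c) \<and> (y = c_add r s \<or> y = c_mul r s))))"

definition is_closed_term :: "'a \<Rightarrow> bool" where
  "is_closed_term t \<longleftrightarrow> is_term t \<and> (\<forall>v\<in>U. \<not> occurs v t)"

definition is_form :: "'a \<Rightarrow> bool" where
  "is_form x \<longleftrightarrow> (\<exists>c\<in>U. x \<epsilon> c \<and> (\<forall>y\<in>U. y \<epsilon> c \<longrightarrow>
      (\<exists>s\<in>U. \<exists>t\<in>U. is_term s \<and> is_term t \<and> y = c_eq s t) \<or>
      (\<exists>z\<in>U. z \<epsilon> c \<and> y = c_neg z) \<or>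
      (\<exists>z\<in>U. \<exists>w\<in>U. z \<epsilon> c \<and> w \<epsilon> c \<and> y = c_dsj z w) \<or>
      (\<exists>k\<in>U. \<exists>z\<in>U. z \<epsilon> c \<and> y = c_exi k z)))"

definition free_in :: "'a \<Rightarrow> 'a \<Rightarrow> bool" where
  "free_in v x \<longleftrightarrow> (\<exists>c\<in>U. x \<epsilon> c \<and> (\<forall>y\<in>U. y \<epsilon> c \<longrightarrow>
      (\<exists>s\<in>U. \<exists>t\<in>U. (occurs v s \<or> occurs v t) \<and> y = c_eq s t) \<or>
      (\<exists>z\<in>U. z \<epsilon> c \<and> y = c_neg z) \<or>
      (\<exists>z\<in>U. \<exists>w\<in>U. (z \<epsilon> c \<or> w \<epsilon> c) \<and> y = c_dsj z w) \<or>
      (\<exists>k\<in>U. \<exists>z\<in>U. k \<noteq> v \<and> z \<epsilon> c \<and> y = c_exi k z)))"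

definition Form :: "'a set" where
  "Form = {x \<in> U. is_form x}"

definition Sent :: "'a set" where
  "Sent = {x \<in> Form. \<forall>v\<in>U. \<not> free_in v x}"

definition ClTerm :: "'a set" where
  "ClTerm = {t \<in> U. is_closed_term t}"

text \<open>The closed term t has value a.\<close>

definition value_of :: "'a \<Rightarrow> 'a \<Rightarrow> bool" where
  "value_of t a \<longleftrightarrow> (\<exists>c\<in>U. pair t a \<epsilon> c \<and> (\<forall>p\<in>U. p \<epsilon> c \<longrightarrow>
      p = pair c_zero (zer M) \<or>
      (\<exists>r\<in>U. \<exists>x\<in>U. pair r x \<epsilon> c \<and> p = pair (c_suc r) (suc M x)) \<or>
      (\<exists>r\<in>U. \<exists>x\<in>U. \<exists>s\<in>U. \<exists>y\<in>U. pair r x \<epsilon> c \<and> pair s y \<epsilon> c \<and>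
         (p = pair (c_add r s) (x \<oplus> y) \<or> p = pair (c_mul r s) (x \<otimes> y)))))"

text \<open>t is the numeral of x.\<close>

definition numeral_of :: "'a \<Rightarrow> 'a \<Rightarrow> bool" where
  "numeral_of x t \<longleftrightarrow> (\<exists>c\<in>U. pair x t \<epsilon> c \<and> (\<forall>p\<in>U. p \<epsilon> c \<longrightarrow>
      p = pair (zer M) c_zero \<or>
      (\<exists>y\<in>U. \<exists>s\<in>U. pair y s \<epsilon> c \<and> p = pair (suc M y) (c_suc s))))"

text \<open>
  Simultaneous substitution. The code e of a finite partial function stands for the
  assignment mapping variable k to the term t when \<open>pair k t \<epsilon> e\<close>; variables outside the
  domain stay put. Passing below a quantifier binding k deletes k from the assignment.
\<close>

definition tm_subst :: "'a \<Rightarrow> 'a \<Rightarrow> 'a \<Rightarrow> bool" where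
  "tm_subst e t t' \<longleftrightarrow> (\<exists>c\<in>U. pair t t' \<epsilon> c \<and> (\<forall>p\<in>U. p \<epsilon> c \<longrightarrow>
      (\<exists>k\<in>U. \<exists>s\<in>U. pair k s \<epsilon> e \<and> p = pair (c_var k) s) \<or>
      (\<exists>k\<in>U. (\<forall>s\<in>U. \<not> pair k s \<epsilon> e) \<and> p = pair (c_var k) (c_var k)) \<or>
      p = pair c_zero c_zero \<or>
      (\<exists>r\<in>U. \<exists>r'\<in>U. pair r r' \<epsilon> c \<and> p = pair (c_suc r) (c_suc r')) \<or>
      (\<exists>r\<in>U. \<exists>r'\<in>U. \<exists>s\<in>U. \<exists>s'\<in>U. pair r r' \<epsilon> c \<and> pair s s' \<epsilon> c \<and>
         (p = pair (c_add r s) (c_add r' s') \<or> p = pair (c_mul r s) (c_mul r' s')))))"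

definition drop_var :: "'a \<Rightarrow> 'a \<Rightarrow> 'a \<Rightarrow> bool" where
  "drop_var k d d' \<longleftrightarrow> (\<forall>q\<in>U. q \<epsilon> d' \<longleftrightarrow> q \<epsilon> d \<and> \<not> (\<exists>s\<in>U. q = pair k s))"

definition fm_subst :: "'a \<Rightarrow> 'a \<Rightarrow> 'a \<Rightarrow> bool" where
  "fm_subst e x x' \<longleftrightarrow> (\<exists>c\<in>U. pair e (pair x x') \<epsilon> c \<and> (\<forall>p\<in>U. p \<epsilon> c \<longrightarrow> (\<exists>d\<in>U.
      (\<exists>s\<in>U. \<exists>s'\<in>U. \<exists>t\<in>U. \<exists>t'\<in>U. tm_subst d s s' \<and> tm_subst d t t' \<and>
         p = pair d (pair (c_eq s t) (c_eq s' t'))) \<or>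
      (\<exists>y\<in>U. \<exists>y'\<in>U. pair d (pair y y') \<epsilon> c \<and>
         p = pair d (pair (c_neg y) (c_neg y'))) \<or>
      (\<exists>y\<in>U. \<exists>y'\<in>U. \<exists>z\<in>U. \<exists>z'\<in>U. pair d (pair y y') \<epsilon> c \<and> pair d (pair z z') \<epsilon> c \<and>
         p = pair d (pair (c_dsj y z) (c_dsj y' z'))) \<or>
      (\<exists>k\<in>U. \<exists>y\<in>U. \<exists>y'\<in>U. \<exists>d'\<in>U. drop_var k d d' \<and> pair d' (pair y y') \<epsilon> c \<and>
         p = pair d (pair (c_exi k y) (c_exi k y'))))))"

text \<open>x' is the result of substituting the term t for the variable v in x.\<close>

definition subst1 :: "'a \<Rightarrow> 'a \<Rightarrow> 'a \<Rightarrow> 'a \<Rightarrow> bool" where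
  "subst1 v t x x' \<longleftrightarrow>
     (\<exists>e\<in>U. (\<forall>q\<in>U. q \<epsilon> e \<longleftrightarrow> q = pair v t) \<and> fm_subst e x x')"

text \<open>The term t may be substituted for v in x without capture.\<close>

definition free_for :: "'a \<Rightarrow> 'a \<Rightarrow> 'a \<Rightarrow> bool" where
  "free_for t v x \<longleftrightarrow> (\<exists>c\<in>U. x \<epsilon> c \<and> (\<forall>y\<in>U. y \<epsilon> c \<longrightarrow>
      (\<exists>r\<in>U. \<exists>s\<in>U. y = c_eq r s) \<or>
      (\<exists>z\<in>U. z \<epsilon> c \<and> y = c_neg z) \<or>
      (\<exists>z\<in>U. \<exists>w\<in>U. z \<epsilon> c \<and> w \<epsilon> c \<and> y = c_dsj z w) \<or>
      (\<exists>k\<in>U. \<exists>z\<in>U. y = c_exi k z \<and> (\<not> free_in v y \<or> z \<epsilon> c \<and> \<not> occurs k t))))"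


section \<open>Truth classes\<close>

definition full_truth_class :: "'a set \<Rightarrow> bool" where
  "full_truth_class T \<longleftrightarrow>
     T \<subseteq> Sent \<and>
     (\<forall>s\<in>ClTerm. \<forall>t\<in>ClTerm.
        c_eq s t \<in> T \<longleftrightarrow> (\<exists>a\<in>U. value_of s a \<and> value_of t a)) \<and>
     (\<forall>x\<in>Sent. c_neg x \<in> T \<longleftrightarrow> x \<notin> T) \<and>
     (\<forall>x\<in>Sent. \<forall>y\<in>Sent. c_dsj x y \<in> T \<longleftrightarrow> x \<in> T \<or> y \<in> T) \<and>
     (\<forall>v\<in>U. \<forall>x\<in>Form. (\<forall>u\<in>U. free_in u x \<longrightarrow> u = v) \<longrightarrow>
        (c_exi v x \<in> T \<longleftrightarrow>
         (\<exists>a\<in>U. \<exists>n\<in>U. \<exists>x'\<in>U. numeral_of a n \<and> subst1 v n x x' \<and> x' \<in> T)))"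

text \<open>
  d is a disjunction, with some grouping, of the entries of the sequence s with indices
  below m in this order; this requires m to be nonzero. The certificate consists of triples
  (i, j, y) such that y is a grouping of the entries with indices from i to j - 1.
\<close>

definition is_disjunction :: "'a \<Rightarrow> 'a \<Rightarrow> 'a \<Rightarrow> bool" where
  "is_disjunction m s d \<longleftrightarrow> (\<exists>c\<in>U. pair (zer M) (pair m d) \<epsilon> c \<and> (\<forall>p\<in>U. p \<epsilon> c \<longrightarrow>
      (\<exists>i\<in>U. \<exists>y\<in>U. pair i y \<epsilon> s \<and> p = pair i (pair (suc M i) y)) \<or>
      (\<exists>i\<in>U. \<exists>k\<in>U. \<exists>j\<in>U. \<exists>y\<in>U. \<exists>z\<in>U. i \<lhd> k \<and> k \<lhd> j \<and>
         pair i (pair k y) \<epsilon> c \<and> pair k (pair j z) \<epsilon> c \<and>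
         p = pair i (pair j (c_dsj y z)))))"

definition disj_correct :: "'a set \<Rightarrow> 'a set \<Rightarrow> bool" where
  "disj_correct I T \<longleftrightarrow> (\<forall>m\<in>I. \<forall>s\<in>U. \<forall>d\<in>Sent.
     is_seq m s \<and> (\<forall>i\<in>U. i \<lhd> m \<longrightarrow> (\<forall>x\<in>U. pair i x \<epsilon> s \<longrightarrow> x \<in> Sent)) \<and>
     is_disjunction m s d \<longrightarrow>
     (d \<in> T \<longleftrightarrow> (\<exists>i\<in>U. i \<lhd> m \<and> (\<exists>x\<in>U. pair i x \<epsilon> s \<and> x \<in> T))))"


section \<open>An arithmetized Hilbert-style proof system\<close>

text \<open>
  The calculus of Shoenfield's Mathematical Logic, whose primitive connectives are
  negation, disjunction and existential quantification.
\<close>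

definition c_imp :: "'a \<Rightarrow> 'a \<Rightarrow> 'a" where
  "c_imp x y = c_dsj (c_neg x) y"

definition c_eqv :: "'a \<Rightarrow> 'a \<Rightarrow> 'a" where
  "c_eqv u v = c_eq (c_var u) (c_var v)"

definition logical_axiom :: "'a \<Rightarrow> bool" where
  "logical_axiom A \<longleftrightarrow>
     \<comment> \<open>propositional axioms\<close>
     (\<exists>x\<in>Form. A = c_dsj (c_neg x) x) \<or>
     \<comment> \<open>substitution axioms\<close>
     (\<exists>x\<in>Form. \<exists>v\<in>U. \<exists>t\<in>U. \<exists>x'\<in>U. is_term t \<and> free_for t v x \<and> subst1 v t x x' \<and>
        A = c_imp x' (c_exi v x)) \<or>
     \<comment> \<open>identity axioms\<close>
     (\<exists>v\<in>U. A = c_eqv v v) \<or>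
     \<comment> \<open>equality axioms for the function symbols and for the predicate symbol =\<close>
     (\<exists>u\<in>U. \<exists>v\<in>U. A = c_imp (c_eqv u v) (c_eq (c_suc (c_var u)) (c_suc (c_var v)))) \<or>
     (\<exists>u\<in>U. \<exists>v\<in>U. \<exists>u'\<in>U. \<exists>v'\<in>U.
        A = c_imp (c_eqv u v) (c_imp (c_eqv u' v')
              (c_eq (c_add (c_var u) (c_var u')) (c_add (c_var v) (c_var v')))) \<or>
        A = c_imp (c_eqv u v) (c_imp (c_eqv u' v')
              (c_eq (c_mul (c_var u) (c_var u')) (c_mul (c_var v) (c_var v')))) \<or>
        A = c_imp (c_eqv u v) (c_imp (c_eqv u' v') (c_imp (c_eqv u u') (c_eqv v v'))))"

definition rule1 :: "'a \<Rightarrow> 'a \<Rightarrow> bool" where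
  "rule1 B A \<longleftrightarrow>
     \<comment> \<open>expansion\<close>
     (\<exists>x\<in>Form. A = c_dsj x B) \<or>
     \<comment> \<open>contraction\<close>
     B = c_dsj A A \<or>
     \<comment> \<open>associativity\<close>
     (\<exists>x\<in>Form. \<exists>y\<in>Form. \<exists>z\<in>Form. B = c_dsj x (c_dsj y z) \<and> A = c_dsj (c_dsj x y) z) \<or>
     \<comment> \<open>existential introduction\<close>
     (\<exists>x\<in>Form. \<exists>y\<in>Form. \<exists>v\<in>U. \<not> free_in v y \<and> B = c_imp x y \<and> A = c_imp (c_exi v x) y)"

text \<open>The cut rule.\<close>

definition rule2 :: "'a \<Rightarrow> 'a \<Rightarrow> 'a \<Rightarrow> bool" where
  "rule2 B C A \<longleftrightarrow>
     (\<exists>x\<in>Form. \<exists>y\<in>Form. \<exists>z\<in>Form.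
        B = c_dsj x y \<and> C = c_dsj (c_neg x) z \<and> A = c_dsj y z)"

text \<open>
  \<open>is_proof h p n x\<close>: p is a proof, with n steps, of x from the set of formulae coded by h.
\<close>

definition is_proof :: "'a \<Rightarrow> 'a \<Rightarrow> 'a \<Rightarrow> 'a \<Rightarrow> bool" where
  "is_proof h p n x \<longleftrightarrow> (\<exists>s\<in>U. p = pair n s \<and> is_seq n s \<and>
     (\<exists>k\<in>U. n = suc M k \<and> pair k x \<epsilon> s) \<and>
     (\<forall>i\<in>U. i \<lhd> n \<longrightarrow> (\<forall>A\<in>U. pair i A \<epsilon> s \<longrightarrow> A \<in> Form \<and>
        (logical_axiom A \<or> A \<epsilon> h \<or>
         (\<exists>j\<in>U. \<exists>B\<in>U. j \<lhd> i \<and> pair j B \<epsilon> s \<and> rule1 B A) \<or>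
         (\<exists>j\<in>U. \<exists>k\<in>U. \<exists>B\<in>U. \<exists>C\<in>U. j \<lhd> i \<and> k \<lhd> i \<and>
            pair j B \<epsilon> s \<and> pair k C \<epsilon> s \<and> rule2 B C A)))))"

text \<open>e codes an assignment of closed terms to finitely many variables.\<close>

definition closed_assignment :: "'a \<Rightarrow> bool" where
  "closed_assignment e \<longleftrightarrow>
     (\<forall>q\<in>U. q \<epsilon> e \<longrightarrow> (\<exists>k\<in>U. \<exists>t\<in>ClTerm. q = pair k t)) \<and>
     (\<forall>k\<in>U. \<forall>t\<in>U. \<forall>t'\<in>U. pair k t \<epsilon> e \<and> pair k t' \<epsilon> e \<longrightarrow> t = t')"

definition strongly_deductively_correct :: "'a set \<Rightarrow> 'a set \<Rightarrow> bool" where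
  "strongly_deductively_correct I T \<longleftrightarrow> (\<forall>x'\<in>Sent.
     (\<exists>x\<in>Form \<inter> I. \<exists>e\<in>U. closed_assignment e \<and> fm_subst e x x') \<and>
     (\<exists>h\<in>U. coded_set h \<subseteq> T \<and> (\<exists>p\<in>U. \<exists>n\<in>I. is_proof h p n x')) \<longrightarrow>
     x' \<in> T)"


section \<open>Cuts\<close>

definition cut :: "'a set \<Rightarrow> bool" where
  "cut I \<longleftrightarrow> I \<noteq> {} \<and> I \<subseteq> U \<and> (\<forall>x\<in>I. \<forall>y\<in>U. y \<lhd> x \<longrightarrow> y \<in> I) \<and> (\<forall>x\<in>I. \<exists>y\<in>I. x \<lhd> y)"

definition proper_cut :: "'a set \<Rightarrow> bool" where
  "proper_cut I \<longleftrightarrow> cut I \<and> I \<noteq> U"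

end


section \<open>Recursive saturation\<close>

text \<open>
  The total recursive functions, with arity, by Kleene's characterization: minimization is
  only applied to functions that always have a zero. The last rule makes the
  predicate independent of the values on lists of the wrong length.
\<close>

inductive recursive_fun :: "nat \<Rightarrow> (nat list \<Rightarrow> nat) \<Rightarrow> bool" where
  zero: "recursive_fun n (\<lambda>xs. 0)"
| succ: "recursive_fun 1 (\<lambda>xs. Suc (hd xs))"
| proj: "i < n \<Longrightarrow> recursive_fun n (\<lambda>xs. xs ! i)"
| comp: "recursive_fun (length gs) f \<Longrightarrow> (\<forall>g\<in>set gs. recursive_fun n g) \<Longrightarrow>
    recursive_fun n (\<lambda>xs. f (map (\<lambda>g. g xs) gs))"
| prim_rec: "recursive_fun n f \<Longrightarrow> recursive_fun (Suc (Suc n)) g \<Longrightarrow>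
    recursive_fun (Suc n) (\<lambda>xs. rec_nat (f (tl xs)) (\<lambda>k r. g (k # r # tl xs)) (hd xs))"
| minimize: "recursive_fun (Suc n) f \<Longrightarrow> (\<forall>xs. length xs = n \<longrightarrow> (\<exists>y. f (y # xs) = 0)) \<Longrightarrow>
    recursive_fun n (\<lambda>xs. LEAST y. f (y # xs) = 0)"
| ext: "recursive_fun n f \<Longrightarrow> (\<forall>xs. length xs = n \<longrightarrow> f xs = g xs) \<Longrightarrow> recursive_fun n g"

definition recursive_set :: "nat set \<Rightarrow> bool" where
  "recursive_set A \<longleftrightarrow> recursive_fun 1 (\<lambda>xs. if hd xs \<in> A then 1 else 0)"

text \<open>Goedel numbers are the codes of the arithmetization as computed in the standard model.\<close>

definition nat_lpa :: "nat lpa" where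
  "nat_lpa = \<lparr>univ = UNIV, zer = 0, suc = Suc, pls = (+), tms = (*)\<rparr>"

primrec gn_tm :: "tm \<Rightarrow> nat" where
  "gn_tm (Var k) = c_var nat_lpa k"
| "gn_tm Zero = c_zero nat_lpa"
| "gn_tm (Sc t) = c_suc nat_lpa (gn_tm t)"
| "gn_tm (Add s t) = c_add nat_lpa (gn_tm s) (gn_tm t)"
| "gn_tm (Mul s t) = c_mul nat_lpa (gn_tm s) (gn_tm t)"

primrec gn :: "fm \<Rightarrow> nat" where
  "gn (Eq s t) = c_eq nat_lpa (gn_tm s) (gn_tm t)"
| "gn (Neg p) = c_neg nat_lpa (gn p)"
| "gn (Dsj p q) = c_dsj nat_lpa (gn p) (gn q)"
| "gn (Exi k p) = c_exi nat_lpa k (gn p)"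

text \<open>
  Variable 0 is the variable of the type G, variables 1, ..., n hold the parameters.
\<close>

definition recursively_saturated :: "'a lpa \<Rightarrow> bool" where
  "recursively_saturated M \<longleftrightarrow> (\<forall>G n e.
     recursive_set (gn ` G) \<and> (\<forall>p\<in>G. fm_vars p \<subseteq> {..n}) \<and> range e \<subseteq> univ M \<and>
     (\<forall>D. finite D \<and> D \<subseteq> G \<longrightarrow> (\<exists>x\<in>univ M. \<forall>p\<in>D. sat M (e(0 := x)) p)) \<longrightarrow>
     (\<exists>x\<in>univ M. \<forall>p\<in>G. sat M (e(0 := x)) p))"

end

theory Submission
  imports Defs
begin

text \<open>
  The nodes of a game are the pairs of an arithmetized formula and a coded assignment, modulo
  bisimilarity (the same connectives, and the same truth values of equations, along all paths),
  so that substituting a term and updating the assignment lead to the same node. An answer to a node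
  is ``false'' or ``true, because of this instance''.

  The key fact is that for every definable automaton whose queries depend on the earlier answers, and
  every possibly nonstandard \<open>n\<close>, the first \<open>n\<close> queries have answers that do not
  violate a Tarski clause. The nodes of a run get labels, smaller ones for instances. Starting with the
  answer ``false'' for every query, one repeatedly corrects an answer that is refuted by a queried
  instance, and forgets the answers with larger labels. As in the epsilon substitution method this
  stops, by induction on labels in the model, provided that the labels are bounded in advance. The
  depth of a formula is not bounded in advance; therefore labels are assigned during the run, to balls in the
  graph of formula shapes, whose radii shrink with the number of remaining queries.

  Applied to an automaton that plays against a hypothetical counterexample this yields, for every
  standard \<open>k\<close>, a set of answers that can be extended \<open>k\<close> times by plays of a
  fixed automaton from arbitrary states. By recursive saturation and countability there is a consistent
  set of answers with a play from every state, that is, a full truth class. The automaton walks down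
  disjunctions and proofs. Since a proper cut is bounded, it is enough to bound the number of its steps
  by one element of the model.

  The cuts are obtained by back-and-forth: a winning strategy in a game in which the responses in one copy of
  the model stay below a bound \<open>b\<close>, while all elements below the ones already chosen there have
  to be reached, gives an isomorphism onto an initial segment. That some \<open>b\<close> works for
  \<open>k\<close> rounds follows by collection, because there are boundedly many types of rank \<open>k\<close>.
\<close>

section \<open>Definable relations\<close>

text \<open>Saturation handles standard finite parts of a type, while correctness for disjunctions
  and proofs of nonstandard length constrains nonstandardly many answers at once. Hence a single
  round of the approximating game adds an M-coded play that answers a whole walk, and only the
  number of rounds is standard. As the start of the next walk is chosen with the earlier answers
  known, consistency is needed for adaptive queries.

  The labels are the main obstacle. A recorded witness is justified by the answer to its instance,
  under the label that the instance had then. If labels could depend on facts that are forgotten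
  later, the justification would be lost. Therefore the label of an instance is settled no later
  than that of its parent: a whole ball of components is labelled together with its centre, and the
  boundary of what is kept runs through a layer that the next ball avoids.

  Truth need not be definable in M, so facts about substitution cannot be proved by induction on
  formulae once truth is there; they are built into the nodes beforehand.\<close>

primrec ren_tm :: "(nat \<Rightarrow> nat) \<Rightarrow> tm \<Rightarrow> tm" where
  "ren_tm r (Var k) = Var (r k)"
| "ren_tm r Zero = Zero"
| "ren_tm r (Sc t) = Sc (ren_tm r t)"
| "ren_tm r (Add s t) = Add (ren_tm r s) (ren_tm r t)"
| "ren_tm r (Mul s t) = Mul (ren_tm r s) (ren_tm r t)"

primrec ren :: "(nat \<Rightarrow> nat) \<Rightarrow> fm \<Rightarrow> fm" where
  "ren r (Eq s t) = Eq (ren_tm r s) (ren_tm r t)"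
| "ren r (Neg p) = Neg (ren r p)"
| "ren r (Dsj p q) = Dsj (ren r p) (ren r q)"
| "ren r (Exi k p) = Exi (r k) (ren r p)"

lemma tm_val_ren: "tm_val M e (ren_tm r t) = tm_val M (\<lambda>n. e (r n)) t"
  by (induction t) auto

lemma sat_ren: "inj r \<Longrightarrow> sat M e (ren r p) = sat M (\<lambda>n. e (r n)) p"
proof (induction p arbitrary: e)
  case (Exi k p)
  have "(\<lambda>n. (e(r k := x)) (r n)) = (\<lambda>n. e (r n))(k := x)" for x
    using Exi.prems by (auto simp: fun_eq_iff inj_def)
  then show ?case
    using Exi by simp
qed (auto simp: tm_val_ren)

lemma finite_tm_vars: "finite (tm_vars t)"
  by (induction t) auto

lemma finite_fm_vars: "finite (fm_vars p)"
  by (induction p) (auto simp: finite_tm_vars)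

text \<open>Even places carry the arguments of a relation and odd places its parameters, so both can
  be unlimited in number.\<close>

definition mix :: "(nat \<Rightarrow> 'a) \<Rightarrow> (nat \<Rightarrow> 'a) \<Rightarrow> nat \<Rightarrow> 'a" where
  "mix e c n = (if even n then e (n div 2) else c (n div 2))"

lemma mix_simps [simp]: "mix e c (2 * n) = e n" "mix e c (Suc (2 * n)) = c n"
  by (auto simp: mix_def)

named_theorems dfn

locale pa =
  fixes M :: "'a lpa"
  assumes PA: "PA_model M" and UN: "univ M = UNIV"
begin

abbreviation zro ("\<zero>") where "\<zero> \<equiv> zer M"
abbreviation sc where "sc \<equiv> suc M"
abbreviation add (infixl "\<oplus>" 65) where "x \<oplus> y \<equiv> pls M x y"
abbreviation mul (infixl "\<otimes>" 70) where "x \<otimes> y \<equiv> tms M x y"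

text \<open>Definability with parameters; \<open>P\<close> is a relation between the entries of a sequence.\<close>

definition D :: "((nat \<Rightarrow> 'a) \<Rightarrow> bool) \<Rightarrow> bool" where
  "D P \<longleftrightarrow> (\<exists>p c. \<forall>e. P e = sat M (mix e c) p)"

definition df :: "((nat \<Rightarrow> 'a) \<Rightarrow> 'a) \<Rightarrow> bool" where
  "df f \<longleftrightarrow> D (\<lambda>e. e 0 = f (\<lambda>n. e (Suc n)))"

lemma DI: "(\<And>e. P e = sat M (mix e c) p) \<Longrightarrow> D P"
  unfolding D_def by blast

text \<open>The parameters of \<open>p\<close> move to the places congruent to 1 modulo 4, those of
  \<open>q\<close> to the places congruent to 3, and the arguments stay; so one parameter sequence
  serves both formulae.\<close>

lemma D_merge:
  assumes "D P" "D Q"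
  shows "\<exists>p q c. (\<forall>e. P e = sat M (mix e c) p) \<and> (\<forall>e. Q e = sat M (mix e c) q)"
proof -
  obtain p c where p: "\<And>e. P e = sat M (mix e c) p" using assms(1) unfolding D_def by blast
  obtain q c' where q: "\<And>e. Q e = sat M (mix e c') q" using assms(2) unfolding D_def by blast
  let ?c = "mix c c'"
  let ?r = "\<lambda>n::nat. if even n then n else 4 * (n div 2) + (1::nat)"
  let ?r' = "\<lambda>n::nat. if even n then n else 4 * (n div 2) + (3::nat)"
  have *: "odd n \<Longrightarrow> (4 * (n div 2) + 1 + 1) div 2 = n" "odd n \<Longrightarrow> (4 * (n div 2) + 3 - 1) div 2 = n"
    for n :: nat by presburger+
  have "inj_on ?r UNIV"
    using *(1) by (intro inj_on_inverseI[where g = "\<lambda>m. if even m then m else (m + 1) div 2"]) simp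
  moreover have "inj_on ?r' UNIV"
    using *(2) by (intro inj_on_inverseI[where g = "\<lambda>m. if even m then m else (m - 1) div 2"]) simp
  ultimately have i: "inj ?r" and i': "inj ?r'" .
  have 43: "(4 * m + 3) div 2 = 2 * m + 1" for m :: nat by presburger
  have "mix e ?c (?r n) = mix e c n" "mix e ?c (?r' n) = mix e c' n" for e n
  proof -
    consider m where "n = 2 * m" | m where "n = Suc (2 * m)"
      by (metis evenE oddE Suc_eq_plus1)
    then have "mix e ?c (?r n) = mix e c n \<and> mix e ?c (?r' n) = mix e c' n"
      by cases (auto simp: mix_def 43)
    then show "mix e ?c (?r n) = mix e c n" "mix e ?c (?r' n) = mix e c' n" by auto
  qed
  then have a: "(\<lambda>n. mix e ?c (?r n)) = mix e c" and a': "(\<lambda>n. mix e ?c (?r' n)) = mix e c'" for e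
    by auto
  have "P e = sat M (mix e ?c) (ren ?r p)" "Q e = sat M (mix e ?c) (ren ?r' q)" for e
    by (simp_all only: p q sat_ren[OF i] sat_ren[OF i'] a a')
  then show ?thesis by blast
qed

lemma D_const [dfn]: "D (\<lambda>e. b)"
  by (rule DI[of _ "\<lambda>_. \<zero>" "if b then Eq Zero Zero else Neg (Eq Zero Zero)"]) auto

lemma D_not [dfn]: "D P \<Longrightarrow> D (\<lambda>e. \<not> P e)"
  unfolding D_def using sat.simps(2) by blast

lemma D_disj [dfn]: "D P \<Longrightarrow> D Q \<Longrightarrow> D (\<lambda>e. P e \<or> Q e)"
proof -
  assume "D P" "D Q"
  then obtain p q c where "\<forall>e. P e = sat M (mix e c) p" "\<forall>e. Q e = sat M (mix e c) q"
    using D_merge by metis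
  then have "\<And>e. (P e \<or> Q e) = sat M (mix e c) (Dsj p q)" by simp
  then show ?thesis by (rule DI)
qed

lemma D_conj [dfn]:
  assumes "D P" "D Q" shows "D (\<lambda>e. P e \<and> Q e)"
proof -
  have "D (\<lambda>e. \<not> (\<not> P e \<or> \<not> Q e))" by (intro D_not D_disj assms)
  then show ?thesis by simp
qed

lemma D_imp [dfn]:
  assumes "D P" "D Q" shows "D (\<lambda>e. P e \<longrightarrow> Q e)"
proof -
  have "D (\<lambda>e. \<not> P e \<or> Q e)" by (intro D_not D_disj assms)
  then show ?thesis unfolding imp_conv_disj .
qed

lemma D_iff [dfn]:
  assumes "D P" "D Q" shows "D (\<lambda>e. P e = Q e)"
proof -
  have "D (\<lambda>e. (P e \<longrightarrow> Q e) \<and> (Q e \<longrightarrow> P e))" by (intro D_imp D_conj assms)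
  moreover have "(\<lambda>e. (P e \<longrightarrow> Q e) \<and> (Q e \<longrightarrow> P e)) = (\<lambda>e. P e = Q e)" by blast
  ultimately show ?thesis by (rule back_subst)
qed

lemma D_ex [dfn]:
  assumes "D (\<lambda>e. Q (\<lambda>n. e (Suc n)) (e 0))"
  shows "D (\<lambda>e. \<exists>x. Q e x)"
proof -
  obtain p c where p: "\<And>e. Q (\<lambda>n. e (Suc n)) (e 0) = sat M (mix e c) p"
    using assms unfolding D_def by blast
  \<comment> \<open>Place 1 becomes free for the bound variable when the parameters move up by one.
    Entry 0, the quantified one, goes there, and the other arguments move down.\<close>
  let ?r = "\<lambda>n::nat. if n = 0 then 1 else if even n then n - 2 else n + 2"
  let ?c = "\<lambda>n. c (n - 1)"
  have i: "inj ?r"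
  proof (rule inj_on_inverseI[where g = "\<lambda>m. if m = 1 then 0 else if even m then m + 2 else m - 2"])
    fix n :: nat
    show "(if ?r n = 1 then 0 else if even (?r n) then ?r n + 2 else ?r n - 2) = n"
      by (cases n; cases "n - 1") auto
  qed
  have 1: "(\<lambda>n. ((mix e ?c)(1 := x)) (?r n)) = mix (case_nat x e) c" for e x
  proof
    fix n :: nat
    consider "n = 0" | m where "n = Suc (Suc (2 * m))" | m where "n = Suc (2 * m)"
      by (metis evenE not0_implies_Suc oddE Suc_eq_plus1 even_Suc)
    then show "((mix e ?c)(1 := x)) (?r n) = mix (case_nat x e) c n"
      by cases (auto simp: mix_def)
  qed
  have "(\<exists>x. Q e x) = sat M (mix e ?c) (Exi 1 (ren ?r p))" for e
  proof -
    have "Q e x = sat M ((mix e ?c)(1 := x)) (ren ?r p)" for x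
      unfolding sat_ren[OF i] 1 using p[of "case_nat x e"] by simp
    then show ?thesis by (simp add: UN del: One_nat_def)
  qed
  then show ?thesis by (rule DI)
qed

lemma D_all [dfn]:
  assumes "D (\<lambda>e. Q (\<lambda>n. e (Suc n)) (e 0))"
  shows "D (\<lambda>e. \<forall>x. Q e x)"
proof -
  have "D (\<lambda>e. \<not> (\<exists>x. \<not> Q e x))" by (intro D_not D_ex assms)
  then show ?thesis by simp
qed

lemma D_bex [dfn]: "D (\<lambda>e. Q (\<lambda>n. e (Suc n)) (e 0)) \<Longrightarrow> D (\<lambda>e. \<exists>x\<in>univ M. Q e x)"
  using D_ex[of Q] by (simp add: UN)

lemma D_ball [dfn]: "D (\<lambda>e. Q (\<lambda>n. e (Suc n)) (e 0)) \<Longrightarrow> D (\<lambda>e. \<forall>x\<in>univ M. Q e x)"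
  using D_all[of Q] by (simp add: UN)

lemma D_inj:
  assumes "D P" "inj r" shows "D (\<lambda>e. P (\<lambda>n. e (r n)))"
proof -
  obtain p c where p: "\<And>e. P e = sat M (mix e c) p"
    using assms unfolding D_def by blast
  let ?r = "\<lambda>n::nat. if even n then 2 * r (n div 2) else n"
  have i: "inj ?r"
  proof (rule injI)
    fix m n assume eq: "?r m = ?r n"
    then have "even m = even n" by (auto split: if_splits)
    with eq injD[OF assms(2), of "m div 2" "n div 2"] show "m = n"
      by (cases "even m") (auto elim!: evenE)
  qed
  have "(\<lambda>n. mix e c (?r n)) = mix (\<lambda>n. e (r n)) c" for e
    by (auto simp: fun_eq_iff mix_def)
  then have "P (\<lambda>n. e (r n)) = sat M (mix e c) (ren ?r p)" for e
    by (simp add: p sat_ren[OF i])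
  then show ?thesis by (rule DI)
qed

text \<open>Arguments held constant become parameters, at the places congruent to 1 modulo 4, while
  the old parameters move to those congruent to 3. The rule for recursion specialises functions with
  further free entries in this way.\<close>

lemma D_freeze:
  assumes "D P" shows "D (\<lambda>e. P (\<lambda>n. if n < k then e n else d n))"
proof -
  obtain p c where p: "\<And>e. P e = sat M (mix e c) p"
    using assms unfolding D_def by blast
  let ?r = "\<lambda>n::nat. if even n then if n < 2 * k then n else 2 * n + 1 else 2 * n + 1"
  have i: "inj ?r"
    by (intro inj_on_inverseI[where g = "\<lambda>m. if even m then m else m div 2"]) auto
  have "(\<lambda>n. mix e (\<lambda>m. if even m then d (m div 2) else c (m div 2)) (?r n)) =
    mix (\<lambda>n. if n < k then e n else d n) c" for e
    by (auto simp: fun_eq_iff mix_def)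
  then have "P (\<lambda>n. if n < k then e n else d n) =
      sat M (mix e (\<lambda>m. if even m then d (m div 2) else c (m div 2))) (ren ?r p)" for e
    by (simp add: p sat_ren[OF i])
  then show ?thesis by (rule DI)
qed

lemma D_proj_eq: "D (\<lambda>e. e i = e j)"
  by (rule DI[of _ "\<lambda>_. \<zero>" "Eq (Var (2 * i)) (Var (2 * j))"]) simp

lemma df_proj [dfn]: "df (\<lambda>e. e k)"
  unfolding df_def by (rule D_proj_eq)

lemma df_const [dfn]: "df (\<lambda>e. a)"
  unfolding df_def by (rule DI[of _ "\<lambda>_. a" "Eq (Var 0) (Var 1)"]) (simp add: mix_def)

lemma df_inj:
  assumes "df f" "inj r" shows "df (\<lambda>e. f (\<lambda>n. e (r n)))"
proof -
  have "inj (case_nat 0 (\<lambda>n. Suc (r n)))"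
    by (rule injI) (auto simp: inj_eq[OF assms(2)] split: nat.splits)
  from D_inj[OF assms(1)[unfolded df_def] this] show ?thesis
    unfolding df_def by simp
qed

lemma df_shift: "df f \<Longrightarrow> df (\<lambda>e. f (\<lambda>n. e (Suc n)))"
  using df_inj[of f Suc] by simp

lemma D_at: assumes "D (\<lambda>e. P (e 0))" shows "D (\<lambda>e. P (e i))"
proof -
  have "inj (\<lambda>n. i + n)" by (simp add: inj_def)
  from D_inj[OF assms this] show ?thesis by simp
qed

lemma D_at2:
  assumes "D (\<lambda>e. R (e 0) (e 1))" shows "D (\<lambda>e. R (e i) (e j))"
proof (cases "i = j")
  case False
  obtain r :: "nat \<Rightarrow> nat" where r: "inj r" "r 0 = i" "r 1 = j"
  proof
    let ?r = "\<lambda>n. if n = 0 then i else if n = 1 then j else i + j + n"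
    show "inj ?r" using False by (auto simp: inj_def)
  qed auto
  from D_inj[OF assms r(1)] r(2,3) show ?thesis by simp
next
  case True
  \<comment> \<open>Identifying two variables is not an injective renaming, so a fresh entry with
    the same value is introduced.\<close>
  have "D (\<lambda>e. \<exists>y. y = e i \<and> R (e i) y)"
  proof (intro D_ex D_conj)
    show "D (\<lambda>e. e 0 = e (Suc i))" by (rule D_proj_eq)
    have "inj (\<lambda>n. if n = 0 then Suc i else if n = 1 then 0 else i + n)" by (auto simp: inj_def)
    from D_inj[OF assms this] show "D (\<lambda>e. R (e (Suc i)) (e 0))" by simp
  qed
  then show ?thesis using True by simp
qed

lemma D_at3:
  assumes "D (\<lambda>e. R (e 0) (e 1) (e 2))" shows "D (\<lambda>e. R (e i) (e j) (e k))"
proof -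
  have "D (\<lambda>e. \<exists>x. x = e i \<and> (\<exists>y. y = e j \<and> (\<exists>z. z = e k \<and> R x y z)))"
  proof (intro D_ex D_conj D_proj_eq)
    have "inj (\<lambda>n::nat. if n = 0 then 2::nat else if n = 1 then 1 else if n = 2 then 0 else n)" by (auto simp: inj_def)
    from D_inj[OF assms this] show "D (\<lambda>e. R (e (Suc (Suc 0))) (e (Suc 0)) (e 0))" by (simp add: numeral_2_eq_2)
  qed
  then show ?thesis by simp
qed

text \<open>Renaming only handles variables; a term is substituted by quantifying over its
  value.\<close>

lemma D_app1:
  assumes "\<And>i. D (\<lambda>e. R (e i))" "df f" shows "D (\<lambda>e. R (f e))"
proof -
  have "D (\<lambda>e. \<exists>x. x = f e \<and> R x)"
    by (intro D_ex D_conj assms(1) assms(2)[unfolded df_def])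
  then show ?thesis by simp
qed

lemma D_app2:
  assumes R: "\<And>i j. D (\<lambda>e. R (e i) (e j))" and f: "df f" and g: "df g"
  shows "D (\<lambda>e. R (f e) (g e))"
proof -
  have "D (\<lambda>e. \<exists>x. x = f e \<and> (\<exists>y. y = g e \<and> R x y))"
    by (intro D_ex D_conj R f[unfolded df_def] df_shift[OF g, unfolded df_def])
  then show ?thesis by simp
qed

lemma D_app3:
  assumes R: "\<And>i j k. D (\<lambda>e. R (e i) (e j) (e k))" and f: "df f" and g: "df g" and h: "df h"
  shows "D (\<lambda>e. R (f e) (g e) (h e))"
proof -
  have "D (\<lambda>e. \<exists>x. x = f e \<and> (\<exists>y. y = g e \<and> (\<exists>z. z = h e \<and> R x y z)))"
    by (intro D_ex D_conj R f[unfolded df_def] df_shift[OF g, unfolded df_def]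
        df_shift[OF df_shift[OF h], unfolded df_def])
  then show ?thesis by simp
qed

lemma D_app4:
  assumes R: "\<And>i j k l. D (\<lambda>e. R (e i) (e j) (e k) (e l))"
    and f: "df f" and g: "df g" and h: "df h" and h': "df h'"
  shows "D (\<lambda>e. R (f e) (g e) (h e) (h' e))"
proof -
  have "D (\<lambda>e. \<exists>x. x = f e \<and> (\<exists>y. y = g e \<and> (\<exists>z. z = h e \<and> (\<exists>w. w = h' e \<and> R x y z w))))"
    by (intro D_ex D_conj R f[unfolded df_def] df_shift[OF g, unfolded df_def]
        df_shift[OF df_shift[OF h], unfolded df_def]
        df_shift[OF df_shift[OF df_shift[OF h']], unfolded df_def])
  then show ?thesis by simp
qed

lemma D_eq [dfn]: "df f \<Longrightarrow> df g \<Longrightarrow> D (\<lambda>e. f e = g e)"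
  by (rule D_app2[where R = "(=)"]) (auto intro: D_proj_eq)

lemma df_app1:
  assumes F: "\<And>i j. D (\<lambda>e. e j = F (e i))" and "df f"
  shows "df (\<lambda>e. F (f e))"
  unfolding df_def by (rule D_app2[where R = "\<lambda>x y. x = F y", OF F df_proj df_shift[OF assms(2)]])

lemma df_app2:
  assumes F: "\<And>i j k. D (\<lambda>e. e k = F (e i) (e j))" and "df f" "df g"
  shows "df (\<lambda>e. F (f e) (g e))"
  unfolding df_def
  by (rule D_app3[where R = "\<lambda>z x y. z = F x y", OF F df_proj df_shift[OF assms(2)] df_shift[OF assms(3)]])

lemma df_app3:
  assumes F: "\<And>i j k l. D (\<lambda>e. e l = F (e i) (e j) (e k))" and "df f" "df g" "df h"
  shows "df (\<lambda>e. F (f e) (g e) (h e))"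
  unfolding df_def
  by (rule D_app4[where R = "\<lambda>w x y z. w = F x y z",
        OF F df_proj df_shift[OF assms(2)] df_shift[OF assms(3)] df_shift[OF assms(4)]])

lemma df_sc [dfn]:
  assumes "df f" shows "df (\<lambda>e. sc (f e))"
proof (rule df_app1[OF _ assms])
  show "D (\<lambda>e. e j = sc (e i))" for i j
    by (rule DI[of _ "\<lambda>_. \<zero>" "Eq (Var (2 * j)) (Sc (Var (2 * i)))"]) simp
qed

lemma df_add [dfn]:
  assumes "df f" "df g" shows "df (\<lambda>e. f e \<oplus> g e)"
proof (rule df_app2[OF _ assms])
  show "D (\<lambda>e. e k = e i \<oplus> e j)" for i j k
    by (rule DI[of _ "\<lambda>_. \<zero>" "Eq (Var (2 * k)) (Add (Var (2 * i)) (Var (2 * j)))"]) simp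
qed

lemma df_mul [dfn]:
  assumes "df f" "df g" shows "df (\<lambda>e. f e \<otimes> g e)"
proof (rule df_app2[OF _ assms])
  show "D (\<lambda>e. e k = e i \<otimes> e j)" for i j k
    by (rule DI[of _ "\<lambda>_. \<zero>" "Eq (Var (2 * k)) (Mul (Var (2 * i)) (Var (2 * j)))"]) simp
qed

lemma df_if [dfn]:
  assumes c: "D c" and f: "df f" and g: "df g"
  shows "df (\<lambda>e. if c e then f e else g e)"
proof -
  have "D (\<lambda>e. (c (\<lambda>n. e (Suc n)) \<longrightarrow> e 0 = f (\<lambda>n. e (Suc n))) \<and>
      (\<not> c (\<lambda>n. e (Suc n)) \<longrightarrow> e 0 = g (\<lambda>n. e (Suc n))))"
    using D_inj[OF c, of Suc] by (intro D_conj D_imp D_not f[unfolded df_def] g[unfolded df_def]) simp_all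
  moreover have "(\<lambda>e. (c (\<lambda>n. e (Suc n)) \<longrightarrow> e 0 = f (\<lambda>n. e (Suc n))) \<and>
      (\<not> c (\<lambda>n. e (Suc n)) \<longrightarrow> e 0 = g (\<lambda>n. e (Suc n)))) =
      (\<lambda>e. e 0 = (if c (\<lambda>n. e (Suc n)) then f (\<lambda>n. e (Suc n)) else g (\<lambda>n. e (Suc n))))"
    by (simp add: fun_eq_iff)
  ultimately show ?thesis unfolding df_def by simp
qed

lemma df_freeze:
  assumes "df f" shows "df (\<lambda>e. f (\<lambda>n. if n < k then e n else d n))"
  using D_freeze[OF assms[unfolded df_def], of "Suc k" "\<lambda>n. d (n - 1)"] unfolding df_def
  by (simp cong: if_cong)

lemma df_at: assumes "df (\<lambda>e. f (e 0))" shows "df (\<lambda>e. f (e i))"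
proof -
  have "inj (\<lambda>n. i + n)" by (simp add: inj_def)
  from df_inj[OF assms this] show ?thesis by simp
qed

lemma df_comp: "df (\<lambda>e. f (e 0)) \<Longrightarrow> df g \<Longrightarrow> df (\<lambda>e. f (g e))"
  by (rule df_app1) (rule D_eq[OF df_proj df_at])

text \<open>The shape in which the induction scheme of \<open>PA_model\<close> speaks of a
  predicate: variable 0 is the induction variable and all other variables have fixed values.\<close>

lemma D_inst:
  assumes "D P" shows "\<exists>p c. \<forall>x. P (case_nat x e) = sat M (c(0 := x)) p"
proof -
  obtain p c where p: "\<And>e. P e = sat M (mix e c) p"
    using assms unfolding D_def by blast
  have "P (case_nat x e) = sat M ((mix (case_nat \<zero> e) c)(0 := x)) p" for x
  proof -
    have "(mix (case_nat \<zero> e) c)(0 := x) = mix (case_nat x e) c"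
      by (auto simp: fun_eq_iff mix_def split: nat.splits)
    then show ?thesis by (simp add: p)
  qed
  then show ?thesis by blast
qed

text \<open>The case \<open>D\<close> of each induction below proves that the predicate is definable
  with parameters; M need not satisfy induction for other predicates.\<close>

lemma ind [case_names Z S D]:
  assumes 0: "P \<zero>" "\<And>x. P x \<Longrightarrow> P (sc x)" and "D (\<lambda>e. P (e 0))"
  shows "P x"
proof -
  obtain p c where p: "\<And>x. P x = sat M (c(0 := x)) p"
    using D_inst[OF assms(3), of "\<lambda>_. \<zero>"] by auto
  have "sat M (c(0 := \<zero>)) p \<longrightarrow> (\<forall>x. sat M (c(0 := x)) p \<longrightarrow> sat M (c(0 := sc x)) p)
    \<longrightarrow> (\<forall>x. sat M (c(0 := x)) p)"
  proof -
    have "range c \<subseteq> univ M \<longrightarrow> sat M (c(0 := \<zero>)) p \<longrightarrow>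
      (\<forall>x\<in>univ M. sat M (c(0 := x)) p \<longrightarrow> sat M (c(0 := sc x)) p) \<longrightarrow> (\<forall>x\<in>univ M. sat M (c(0 := x)) p)"
      by (rule PA[unfolded PA_model_def, THEN conjunct2, THEN conjunct2, THEN conjunct2, THEN conjunct2,
          THEN conjunct2, THEN conjunct2, THEN conjunct2, THEN spec, THEN spec, THEN spec])
    then show ?thesis by (simp only: UN ball_UNIV subset_UNIV simp_thms)
  qed
  then show ?thesis unfolding p[symmetric] using 0 by blast
qed

end

context pa
begin

section \<open>Arithmetic\<close>

lemma sc_neq [simp]: "sc x \<noteq> \<zero>" "\<zero> \<noteq> sc x"
  and sc_inj [simp]: "sc x = sc y \<longleftrightarrow> x = y"
  and add_0 [simp]: "x \<oplus> \<zero> = x"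
  and add_S [simp]: "x \<oplus> sc y = sc (x \<oplus> y)"
  and mul_0 [simp]: "x \<otimes> \<zero> = \<zero>"
  and mul_S [simp]: "x \<otimes> sc y = x \<otimes> y \<oplus> x"
proof -
  note ax = PA[unfolded PA_model_def UN ball_UNIV, THEN conjunct2]
  note ax1 = ax[THEN conjunct2] note ax2 = ax1[THEN conjunct2] note ax3 = ax2[THEN conjunct2]
  note ax4 = ax3[THEN conjunct2] note ax5 = ax4[THEN conjunct2]
  show 1: "sc x \<noteq> \<zero>" by (rule ax[THEN conjunct1, THEN spec])
  then show "\<zero> \<noteq> sc x" by metis
  show "sc x = sc y \<longleftrightarrow> x = y" using ax1[THEN conjunct1] by blast
  show "x \<oplus> \<zero> = x" by (rule ax2[THEN conjunct1, THEN spec])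
  show "x \<oplus> sc y = sc (x \<oplus> y)" by (rule ax3[THEN conjunct1, THEN spec, THEN spec])
  show "x \<otimes> \<zero> = \<zero>" by (rule ax4[THEN conjunct1, THEN spec])
  show "x \<otimes> sc y = x \<otimes> y \<oplus> x" by (rule ax5[THEN conjunct1, THEN spec, THEN spec])
qed

lemma add_0_left [simp]: "\<zero> \<oplus> x = x"
proof (induction x rule: ind)
  case D show ?case by (intro dfn)
qed auto

lemma add_S_left [simp]: "sc x \<oplus> y = sc (x \<oplus> y)"
proof (induction y rule: ind)
  case D show ?case by (intro dfn)
qed auto

lemma add_commute: "x \<oplus> y = y \<oplus> x"
proof (induction y rule: ind)
  case D show ?case by (intro dfn)
qed auto

lemma add_assoc: "(x \<oplus> y) \<oplus> z = x \<oplus> (y \<oplus> z)"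
proof (induction z rule: ind)
  case D show ?case by (intro dfn)
qed auto

lemma add_left_commute: "y \<oplus> (x \<oplus> z) = x \<oplus> (y \<oplus> z)"
  by (metis add_assoc add_commute)

lemma mul_0_left [simp]: "\<zero> \<otimes> x = \<zero>"
proof (induction x rule: ind)
  case D show ?case by (intro dfn)
qed auto

lemma mul_S_left [simp]: "sc x \<otimes> y = x \<otimes> y \<oplus> y"
proof (induction y rule: ind)
  case D show ?case by (intro dfn)
next
  case (S y) then show ?case by simp (metis add_assoc add_commute)
qed auto

lemma mul_commute: "x \<otimes> y = y \<otimes> x"
proof (induction y rule: ind)
  case D show ?case by (intro dfn)
qed auto

lemma distrib_left: "x \<otimes> (y \<oplus> z) = x \<otimes> y \<oplus> x \<otimes> z"
proof (induction z rule: ind)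
  case D show ?case by (intro dfn)
next
  case (S y) then show ?case by simp (metis add_assoc)
qed auto

lemma mul_assoc: "(x \<otimes> y) \<otimes> z = x \<otimes> (y \<otimes> z)"
proof (induction z rule: ind)
  case D show ?case by (intro dfn)
next
  case (S y) then show ?case by (simp add: distrib_left)
qed auto

lemma add_cancel_right: "x \<oplus> z = y \<oplus> z \<longleftrightarrow> x = y"
proof (induction z rule: ind)
  case D show ?case by (intro dfn)
qed auto

lemma add_cancel_left: "z \<oplus> x = z \<oplus> y \<longleftrightarrow> x = y"
  by (metis add_cancel_right add_commute)

lemma cases0: obtains "x = \<zero>" | y where "x = sc y"
proof -
  have "x = \<zero> \<or> (\<exists>y. x = sc y)"
  proof (induction x rule: ind)
    case D show ?case by (intro dfn)
  qed auto
  then show ?thesis using that by blast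
qed

lemma add_eq_0: "x \<oplus> y = \<zero> \<longleftrightarrow> x = \<zero> \<and> y = \<zero>"
  by (cases y rule: cases0) auto

definition le :: "'a \<Rightarrow> 'a \<Rightarrow> bool" (infix "\<sqsubseteq>" 50) where
  "x \<sqsubseteq> y \<longleftrightarrow> (\<exists>w. y = x \<oplus> w)"

abbreviation less :: "'a \<Rightarrow> 'a \<Rightarrow> bool" (infix "\<sqsubset>" 50) where
  "x \<sqsubset> y \<equiv> lt M x y"

text \<open>Truncated subtraction, because the class of ordered semidomains instantiated below
  contains a difference.\<close>

definition mns :: "'a \<Rightarrow> 'a \<Rightarrow> 'a" (infixl "\<ominus>" 65) where
  "x \<ominus> y = (if y \<sqsubseteq> x then THE z. x = y \<oplus> z else \<zero>)"

lemma less_def: "x \<sqsubset> y \<longleftrightarrow> (\<exists>w. y = x \<oplus> sc w)"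
  by (simp add: lt_def UN)

lemma mns_add: "(x \<oplus> y) \<ominus> x = y"
  unfolding mns_def by (auto simp: le_def add_cancel_left)

lemma mns_zero: "\<zero> \<ominus> c = \<zero>" "c \<ominus> c = \<zero>"
  using mns_add[of \<zero> \<zero>] mns_add[of c \<zero>] by (metis add_0 add_eq_0 le_def mns_def)+

lemma le_total: "x \<sqsubseteq> y \<or> y \<sqsubseteq> x"
proof (induction x rule: ind)
  case D show ?case unfolding le_def by (intro dfn)
next
  case (S x)
  then show ?case unfolding le_def
    by (metis add_0 add_S add_S_left cases0)
qed (auto simp: le_def)

lemma le_antisym: "x \<sqsubseteq> y \<Longrightarrow> y \<sqsubseteq> x \<Longrightarrow> x = y"
  unfolding le_def by (metis add_0 add_assoc add_cancel_left add_eq_0)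

lemma less_le: "x \<sqsubset> y \<longleftrightarrow> x \<sqsubseteq> y \<and> \<not> y \<sqsubseteq> x"
proof -
  have "\<not> (x = (x \<oplus> sc w) \<oplus> u)" for w u
    by (metis add_0 add_assoc add_cancel_left add_eq_0 sc_neq(1))
  moreover have "y \<sqsubseteq> x" if "y = x \<oplus> \<zero>" using that by (metis add_0 le_def)
  ultimately show ?thesis unfolding less_def le_def by (metis cases0)
qed

lemma mul_eq_0: "x \<otimes> y = \<zero> \<longleftrightarrow> x = \<zero> \<or> y = \<zero>"
  by (cases x rule: cases0; cases y rule: cases0) auto

sublocale A: linordered_semidom where minus = mns and plus = "pls M" and zero = "\<zero>" and times = "tms M" and one = "sc \<zero>" and less_eq = le and less = "lt M"
proof
  fix a b c :: 'a
  show "a \<oplus> b \<oplus> c = a \<oplus> (b \<oplus> c)" by (rule add_assoc)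
  show "a \<oplus> b = b \<oplus> a" by (rule add_commute)
  show "\<zero> \<oplus> a = a" by simp
  show "a \<otimes> b \<otimes> c = a \<otimes> (b \<otimes> c)" by (rule mul_assoc)
  show "a \<otimes> b = b \<otimes> a" by (rule mul_commute)
  show "sc \<zero> \<otimes> a = a" by simp
  show "\<zero> \<noteq> sc \<zero>" by simp
  show "(a \<oplus> b) \<otimes> c = a \<otimes> c \<oplus> b \<otimes> c" by (metis distrib_left mul_commute)
  show "a \<noteq> \<zero> \<Longrightarrow> b \<noteq> \<zero> \<Longrightarrow> a \<otimes> b \<noteq> \<zero>" by (simp add: mul_eq_0)
  show "a \<oplus> b \<ominus> a = b" by (rule mns_add)
  show 1: "a \<ominus> b \<ominus> c = a \<ominus> (b \<oplus> c)" for a b c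
  proof (cases "b \<oplus> c \<sqsubseteq> a")
    case True
    then obtain w where "a = b \<oplus> c \<oplus> w" by (auto simp: le_def)
    then show ?thesis by (metis mns_add add_assoc)
  next
    case False
    show ?thesis
    proof (cases "b \<sqsubseteq> a")
      case True
      then obtain w where w: "a = b \<oplus> w" by (auto simp: le_def)
      then have "\<not> c \<sqsubseteq> w" using False by (auto simp: le_def add_assoc)
      then show ?thesis using w mns_add[of b w] False by (simp add: mns_def[of w c] mns_def[of "b \<oplus> w" "b \<oplus> c"])
    next
      case b: False
      then show ?thesis using False by (simp add: mns_zero mns_def[of a b] mns_def[of a "b \<oplus> c"])
    qed
  qed
  show "a \<otimes> (b \<ominus> c) = a \<otimes> b \<ominus> a \<otimes> c"
  proof (cases "c \<sqsubseteq> b")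
    case True
    then obtain w where "b = c \<oplus> w" by (auto simp: le_def)
    then show ?thesis by (metis mns_add distrib_left)
  next
    case False
    then obtain w where "c = b \<oplus> w" using le_total[of b c] unfolding le_def by blast
    then have "b \<otimes> a \<ominus> c \<otimes> a = (b \<otimes> a) \<ominus> (b \<otimes> a) \<ominus> w \<otimes> a"
      by (metis 1 distrib_left mul_commute)
    also have "... = \<zero>"
      by (simp add: mns_zero)
    finally show ?thesis using False by (simp add: mns_def[of b c] mul_commute)
  qed
  show "(a \<sqsubset> b) = (a \<sqsubseteq> b \<and> \<not> b \<sqsubseteq> a)" by (rule less_le)
  show "a \<sqsubseteq> a" unfolding le_def by (metis add_0)
  show "a \<sqsubseteq> b \<Longrightarrow> b \<sqsubseteq> c \<Longrightarrow> a \<sqsubseteq> c" unfolding le_def by (metis add_assoc)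
  show "a \<sqsubseteq> b \<Longrightarrow> b \<sqsubseteq> a \<Longrightarrow> a = b" by (rule le_antisym)
  show "a \<sqsubseteq> b \<or> b \<sqsubseteq> a" by (rule le_total)
  show "a \<sqsubseteq> b \<Longrightarrow> c \<oplus> a \<sqsubseteq> c \<oplus> b" unfolding le_def by (metis add_assoc)
  show "a \<sqsubset> b \<Longrightarrow> \<zero> \<sqsubset> c \<Longrightarrow> c \<otimes> a \<sqsubset> c \<otimes> b"
    unfolding less_def
    by (metis add_0_left add_S distrib_left mul_S)
  show "\<zero> \<sqsubset> sc \<zero>" unfolding less_def by auto
  show "b \<sqsubseteq> a \<Longrightarrow> a \<ominus> b \<oplus> b = a" unfolding le_def by (metis mns_add add_commute)
qed (simp_all add: distrib_left)


lemma D_less [dfn]: "df f \<Longrightarrow> df g \<Longrightarrow> D (\<lambda>e. f e \<sqsubset> g e)"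
  by (rule D_app2[where R = "lt M"]) (simp only: less_def, intro dfn)

lemma D_le [dfn]: "df f \<Longrightarrow> df g \<Longrightarrow> D (\<lambda>e. f e \<sqsubseteq> g e)"
  by (rule D_app2[where R = le]) (simp only: le_def, intro dfn)


lemma less_S [simp]: "x \<sqsubset> sc y \<longleftrightarrow> x \<sqsubseteq> y"
  unfolding less_def le_def by auto

lemma S_le [simp]: "sc x \<sqsubseteq> y \<longleftrightarrow> x \<sqsubset> y"
  unfolding less_def le_def by auto

lemma zero_le [simp]: "\<zero> \<sqsubseteq> x"
  unfolding le_def by auto

lemma not_less_zero [simp]: "\<not> x \<sqsubset> \<zero>"
  unfolding less_def by auto

lemma le_zero [simp]: "x \<sqsubseteq> \<zero> \<longleftrightarrow> x = \<zero>"
  using le_antisym zero_le by blast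

lemma less_add_S [simp]: "x \<sqsubset> x \<oplus> sc y"
  unfolding less_def by auto

lemma le_add [simp]: "x \<sqsubseteq> x \<oplus> y" "y \<sqsubseteq> x \<oplus> y"
  unfolding le_def by (auto simp: add_commute)

lemma pos_S: "\<zero> \<sqsubset> x \<longleftrightarrow> x \<noteq> \<zero>"
  by (cases x rule: cases0) auto

lemma le_mul: "m \<noteq> \<zero> \<Longrightarrow> x \<sqsubseteq> x \<otimes> m"
  by (cases m rule: cases0) auto

lemma le_mul': "m \<noteq> \<zero> \<Longrightarrow> x \<sqsubseteq> m \<otimes> x"
  using le_mul by (simp add: mul_commute)

lemma less_ind [case_names L D]:
  assumes "\<And>x. (\<And>y. y \<sqsubset> x \<Longrightarrow> P y) \<Longrightarrow> P x" and D: "D (\<lambda>e. P (e 0))"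
  shows "P x"
proof -
  have DP: "D (\<lambda>e. P (e i))" for i
    using D_at[OF D] .
  have "\<forall>y. y \<sqsubset> z \<longrightarrow> P y" for z
  proof (induction z rule: ind)
    case (S z)
    then show ?case using assms(1) by (metis A.le_less less_S)
  next
    case D show ?case by (intro dfn DP)
  qed auto
  then show ?thesis using assms(1) by blast
qed
lemma df_mns [dfn]: "df f \<Longrightarrow> df g \<Longrightarrow> df (\<lambda>e. f e \<ominus> g e)"
proof (rule df_app2[where F = mns])
  have "z = x \<ominus> y \<longleftrightarrow> x = y \<oplus> z \<or> \<not> y \<sqsubseteq> x \<and> z = \<zero>" for x y z
    using mns_add[of y z] by (auto simp: mns_def le_def)
  then show "D (\<lambda>e. e k = e i \<ominus> e j)" for i j k
    by (simp only:) (intro dfn)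
qed

lemma le_SI: "x \<sqsubseteq> y \<Longrightarrow> x \<sqsubseteq> sc y"
  using A.less_imp_le less_S by blast


section \<open>Least elements, collection, and division with remainder\<close>

lemma least:
  assumes "D (\<lambda>e. P (e 0))" "\<exists>x. P x"
  shows "\<exists>x. P x \<and> (\<forall>y. P y \<longrightarrow> x \<sqsubseteq> y)"
proof (rule ccontr)
  assume *: "\<not> ?thesis"
  have DP: "D (\<lambda>e. P (e i))" for i by (rule D_at[OF assms(1)])
  have "\<not> P x" for x
  proof (induction x rule: less_ind)
    case (L x)
    then show ?case using * by (metis A.not_le)
  next
    case D show ?case by (intro dfn DP)
  qed
  then show False using assms(2) by blast
qed

text \<open>A definable choice function, used in place of Skolem functions. The value is zero if
  there is no least element.\<close>

definition lst :: "('a \<Rightarrow> bool) \<Rightarrow> 'a" where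
  "lst P = (if \<exists>x. P x \<and> (\<forall>y. P y \<longrightarrow> x \<sqsubseteq> y) then THE x. P x \<and> (\<forall>y. P y \<longrightarrow> x \<sqsubseteq> y) else \<zero>)"

lemma lst_eq: "P x \<Longrightarrow> (\<And>y. P y \<Longrightarrow> x \<sqsubseteq> y) \<Longrightarrow> lst P = x"
  unfolding lst_def using le_antisym by (auto intro!: the_equality)

lemma lst_ex: "D (\<lambda>e. P (e 0)) \<Longrightarrow> \<exists>x. P x \<Longrightarrow> P (lst P)"
  using least[of P] lst_eq[of P] by metis

lemma lst_le: "D (\<lambda>e. P (e 0)) \<Longrightarrow> P x \<Longrightarrow> lst P \<sqsubseteq> x"
  using least[of P] lst_eq[of P] by metis

lemma df_lst [dfn]:
  assumes "D (\<lambda>e. P (\<lambda>n. e (Suc n)) (e 0))"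
  shows "df (\<lambda>e. lst (P e))"
proof -
  have i: "inj (\<lambda>n. if n = 0 then 1 else if n = Suc 0 then 0 else n)" "inj (\<lambda>n. if n = 0 then 0 else Suc n)"
    by (auto simp: inj_def)
  have 1: "D (\<lambda>e. P (\<lambda>n. e (Suc (Suc n))) (e 0))" 
    using D_inj[OF assms i(2)] by simp
  have 2: "D (\<lambda>e. P (\<lambda>n. e (Suc (Suc (Suc n)))) (e 0))" for i
    using D_inj[OF 1 i(2)] by simp
  have 3: "D (\<lambda>e. P (\<lambda>n. e (Suc n)) (e 0))" using assms .
  have 4: "D (\<lambda>e. P (\<lambda>n. e (Suc (Suc n))) (e (Suc 0)))"
    using D_inj[OF assms, of Suc] by simp
  have *: "z = lst Q \<longleftrightarrow> (Q z \<and> (\<forall>y. Q y \<longrightarrow> z \<sqsubseteq> y)) \<or>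
      \<not> (\<exists>x. Q x \<and> (\<forall>y. Q y \<longrightarrow> x \<sqsubseteq> y)) \<and> z = \<zero>" for z Q
  proof (cases "\<exists>x. Q x \<and> (\<forall>y. Q y \<longrightarrow> x \<sqsubseteq> y)")
    case True
    then show ?thesis using lst_eq[of Q] le_antisym by metis
  next
    case False
    then show ?thesis by (auto simp: lst_def[of Q])
  qed
  show ?thesis unfolding df_def *
    by (intro dfn 1 2 3 4 D_inj[OF 1, of Suc, simplified])
qed

text \<open>The least upper bound belongs to the set, since otherwise its predecessor would be a
  bound too.\<close>

lemma bounded_max:
  assumes "D (\<lambda>e. P (e 0))" "P x" "\<And>y. P y \<Longrightarrow> y \<sqsubseteq> b"
  shows "\<exists>z. P z \<and> (\<forall>y. P y \<longrightarrow> y \<sqsubseteq> z)"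
proof -
  have DP: "D (\<lambda>e. P (e i))" for i by (rule D_at[OF assms(1)])
  have "D (\<lambda>e. \<forall>y. P y \<longrightarrow> y \<sqsubseteq> e 0)" by (intro dfn DP)
  from least[OF this] obtain z where z: "\<forall>y. P y \<longrightarrow> y \<sqsubseteq> z" "\<And>w. \<forall>y. P y \<longrightarrow> y \<sqsubseteq> w \<Longrightarrow> z \<sqsubseteq> w"
    using assms(3) by blast
  have "P z"
  proof (cases z rule: cases0)
    case 1 then show ?thesis using z(1) assms(2) by auto
  next
    case (2 w)
    then have "\<not> (\<forall>y. P y \<longrightarrow> y \<sqsubseteq> w)" using z(2) by (metis A.not_le less_S A.order_refl)
    then show ?thesis using z(1) 2 by (metis A.le_less A.not_le less_S A.less_le_trans)
  qed
  then show ?thesis using z(1) by blast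
qed

lemma collection:
  assumes D: "D (\<lambda>e. R (e 0) (e 1))" and "\<And>x. x \<sqsubset> n \<Longrightarrow> \<exists>y. R x y"
  shows "\<exists>b. \<forall>x. x \<sqsubset> n \<longrightarrow> (\<exists>y. y \<sqsubset> b \<and> R x y)"
proof -
  have DR: "D (\<lambda>e. R (e i) (e j))" for i j by (rule D_at2[OF D])
  have "k \<sqsubseteq> n \<longrightarrow> (\<exists>b. \<forall>x. x \<sqsubset> k \<longrightarrow> (\<exists>y. y \<sqsubset> b \<and> R x y))" for k
  proof (induction k rule: ind)
    case (S k)
    show ?case
    proof
      assume "sc k \<sqsubseteq> n"
      then obtain y where y: "R k y" using assms(2) by auto
      obtain b where b: "\<forall>x. x \<sqsubset> k \<longrightarrow> (\<exists>y. y \<sqsubset> b \<and> R x y)"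
        using S \<open>sc k \<sqsubseteq> n\<close> A.less_imp_le[of k n] by auto
      have "y \<sqsubset> sc (y \<oplus> b)" "\<And>u. u \<sqsubset> b \<Longrightarrow> u \<sqsubset> sc (y \<oplus> b)"
        using A.order_trans[OF A.less_imp_le le_add(2)] by simp_all
      then show "\<exists>b. \<forall>x. x \<sqsubset> sc k \<longrightarrow> (\<exists>y. y \<sqsubset> b \<and> R x y)"
        using b y by (metis A.le_less less_S)
    qed
  next
    case D show ?case by (intro dfn DR)
  qed auto
  then show ?thesis by blast
qed

lemma division: assumes "m \<noteq> \<zero>" shows "\<exists>q r. a = q \<otimes> m \<oplus> r \<and> r \<sqsubset> m"
proof (induction a rule: ind)
  case Z show ?case using assms by (metis add_0 mul_0_left pos_S)
next
  case (S a)
  then obtain q r where *: "a = q \<otimes> m \<oplus> r" "r \<sqsubset> m" by blast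
  show ?case
  proof (cases "sc r = m")
    case True
    then have "sc a = sc q \<otimes> m \<oplus> \<zero>" using * by simp (metis add_S)
    then show ?thesis using assms pos_S by blast
  next
    case False
    then have "sc a = q \<otimes> m \<oplus> sc r" "sc r \<sqsubset> m" using * by (auto simp: A.less_le)
    then show ?thesis by blast
  qed
next
  case D show ?case by (intro dfn)
qed

lemma division_less: assumes "q \<sqsubset> q'" "r \<sqsubset> m" shows "q \<otimes> m \<oplus> r \<sqsubset> q' \<otimes> m \<oplus> r'"
proof -
  obtain w where "q' = q \<oplus> sc w" using assms(1) by (auto simp: less_def)
  then have "q' \<otimes> m \<oplus> r' = q \<otimes> m \<oplus> (m \<oplus> (w \<otimes> m \<oplus> r'))"
    by (simp add: A.distrib_right A.add_ac)
  moreover have "r \<sqsubset> m \<oplus> (w \<otimes> m \<oplus> r')" using assms(2) le_add(1) by (rule A.less_le_trans)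
  ultimately show ?thesis by simp
qed

lemma division_unique:
  assumes "q \<otimes> m \<oplus> r = q' \<otimes> m \<oplus> r'" "r \<sqsubset> m" "r' \<sqsubset> m"
  shows "q = q' \<and> r = r'"
  using division_less[of q q' r m r'] division_less[of q' q r' m r] assms
  by (metis A.less_irrefl A.neq_iff add_cancel_left)

section \<open>Goedel's beta function by Chinese remainders\<close>

definition md :: "'a \<Rightarrow> 'a \<Rightarrow> 'a" where "md b i = sc (sc i \<otimes> b)"

lemma beta_md: "beta M a b i x \<longleftrightarrow> (\<exists>q. a = q \<otimes> md b i \<oplus> x) \<and> x \<sqsubset> md b i"
  unfolding beta_def md_def UN by simp

lemma beta_unique: "beta M a b i x \<Longrightarrow> beta M a b i y \<Longrightarrow> x = y"
  unfolding beta_md using division_unique by blast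

lemma beta_ex: "\<exists>x. beta M a b i x"
  unfolding beta_md using division[of "md b i" a] unfolding md_def by auto

lemma D_beta [dfn]: "df f \<Longrightarrow> df g \<Longrightarrow> df h \<Longrightarrow> df k \<Longrightarrow> D (\<lambda>e. beta M (f e) (g e) (h e) (k e))"
  by (rule D_app4[where R = "beta M"]) (unfold beta_def, intro dfn)

text \<open>Invertibility of \<open>p\<close> modulo \<open>m\<close>, with the congruence written
  without subtraction. It replaces coprimality and is closed under products by a direct
  computation.\<close>

definition Inv :: "'a \<Rightarrow> 'a \<Rightarrow> bool" where "Inv p m \<longleftrightarrow> (\<exists>x y. p \<otimes> x = sc (m \<otimes> y))"

lemma Inv_mul: assumes "Inv p m" "Inv p' m" shows "Inv (p \<otimes> p') m"
proof -
  obtain x y where 1: "p \<otimes> x = sc (m \<otimes> y)" using assms(1) by (auto simp: Inv_def)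
  obtain x' y' where 2: "p' \<otimes> x' = sc (m \<otimes> y')" using assms(2) by (auto simp: Inv_def)
  have "p \<otimes> p' \<otimes> (x \<otimes> x') = (p \<otimes> x) \<otimes> (p' \<otimes> x')" by (simp add: A.mult_ac)
  also have "... = sc (m \<otimes> (y \<otimes> (m \<otimes> y') \<oplus> y \<oplus> y'))"
    unfolding 1 2 by (simp add: A.distrib_left A.add_ac A.mult_ac)
  finally show ?thesis unfolding Inv_def by blast
qed

lemma Inv_md:
  assumes "i \<sqsubset> j" "b \<noteq> \<zero>" "\<And>k. k \<noteq> \<zero> \<Longrightarrow> k \<sqsubseteq> j \<Longrightarrow> \<exists>l. b = k \<otimes> l"
  shows "Inv (md b i) (md b j)"
proof -
  obtain w where w: "j = i \<oplus> sc w" using assms(1) by (auto simp: less_def)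
  define d where "d = sc w"
  have d: "j = i \<oplus> d" "d \<noteq> \<zero>" using w by (auto simp: d_def)
  then obtain k where k: "b = d \<otimes> k" using assms(3)[of d] le_add(2)[of d i] by metis
  have kj: "k \<noteq> \<zero>" using k assms(2) by auto
  \<comment> \<open>As \<open>b\<close> is \<open>d \<otimes> k\<close>, the product
    \<open>md b i \<otimes> X\<close> is -1 modulo \<open>md b j\<close>, with quotient
    \<open>Y\<close>. Squaring turns -1 into 1.\<close>
  define X where "X = k \<otimes> (sc j \<otimes> sc j)"
  define Y where "Y = sc (k \<otimes> (sc j \<otimes> sc i))"
  have "sc (md b i \<otimes> X) = md b j \<otimes> Y"
    unfolding X_def Y_def md_def k d(1)
    by (simp add: A.distrib_left A.distrib_right A.add_ac A.mult_ac)
  moreover have "md b i \<otimes> X \<noteq> \<zero>"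
    unfolding X_def md_def using kj by (simp add: mul_eq_0 add_eq_0)
  then obtain z where z: "md b i \<otimes> X = sc z" using cases0 by metis
  ultimately have e: "sc (sc z) = md b j \<otimes> Y" by simp
  have "md b i \<otimes> (X \<otimes> sc z) = sc z \<otimes> sc z" using z by (metis mul_assoc)
  also have "... = sc (sc (sc z) \<otimes> z)" by (simp add: A.add_ac)
  also have "... = sc (md b j \<otimes> (Y \<otimes> z))" unfolding e by (simp add: mul_assoc)
  finally show ?thesis unfolding Inv_def by blast
qed

lemma common_multiple: "\<exists>b. b \<noteq> \<zero> \<and> (\<forall>k. k \<noteq> \<zero> \<and> k \<sqsubseteq> n \<longrightarrow> (\<exists>l. b = k \<otimes> l))"
proof (induction n rule: ind)
  case Z then show ?case by (auto intro: exI[of _ "sc \<zero>"])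
next
  case (S n)
  then obtain b where b: "b \<noteq> \<zero>" "\<And>k. k \<noteq> \<zero> \<Longrightarrow> k \<sqsubseteq> n \<Longrightarrow> \<exists>l. b = k \<otimes> l" by blast
  have "\<exists>l. b \<otimes> sc n = k \<otimes> l" if "k \<noteq> \<zero>" "k \<sqsubseteq> sc n" for k
  proof (cases "k = sc n")
    case True then show ?thesis using mul_commute by blast
  next
    case False
    then have "k \<sqsubseteq> n" using that(2) by (metis A.le_less less_S)
    then show ?thesis using b(2) that(1) mul_assoc by metis
  qed
  then show ?case using b(1) by (intro exI[of _ "b \<otimes> sc n"]) (auto simp: add_eq_0 mul_eq_0)
next
  case D show ?case by (intro dfn)
qed

text \<open>One modulus at a time: the induction carries a number \<open>a\<close> with the right
  remainders so far, and a multiple \<open>p\<close> of the moduli so far that is invertible modulo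
  the later ones. Adding multiples of \<open>p\<close> to \<open>a\<close> keeps the old
  remainders.\<close>

lemma beta_lemma:
  assumes F: "df (\<lambda>e. F (e 0))"
  shows "\<exists>a b. \<forall>i. i \<sqsubset> n \<longrightarrow> beta M a b i (F i)"
proof -
  have Fi: "df (\<lambda>e. F (e i))" for i using df_app1[of F "\<lambda>e. e i"] D_at2[of "\<lambda>x y. x = F y"] F
    unfolding df_def by (auto intro: df_proj[unfolded df_def])
  have "D (\<lambda>e. e 1 = F (e 0))" by (intro dfn Fi)
  from collection[of "\<lambda>x y. y = F x" n, OF this] obtain B0 where B0: "\<And>i. i \<sqsubset> n \<Longrightarrow> F i \<sqsubset> B0" by auto
  define B where "B = sc (n \<oplus> B0)"
  have B: "i \<sqsubset> n \<Longrightarrow> F i \<sqsubset> B" "n \<sqsubseteq> B" "B \<noteq> \<zero>" for i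
    using A.order_trans[OF A.less_imp_le[OF B0] le_add(2)] A.less_imp_le[of n "sc (n \<oplus> B0)"]
    unfolding B_def by simp_all
  \<comment> \<open>A nonzero multiple of all numbers up to \<open>B\<close> is divisible by all
    differences of indices below \<open>n\<close>, and it is large enough for the values to be
    remainders.\<close>
  obtain b where b: "b \<noteq> \<zero>" "\<And>k. k \<noteq> \<zero> \<Longrightarrow> k \<sqsubseteq> B \<Longrightarrow> \<exists>l. b = k \<otimes> l"
    using common_multiple[of B] by blast
  have "B \<sqsubseteq> b" using b(2)[of B] B(3) b(1) by (metis A.order_refl le_mul mul_0)
  have inv: "Inv (md b i) (md b j)" if "i \<sqsubset> j" "j \<sqsubset> n" for i j
    by (rule Inv_md[OF that(1) b(1)]) (metis b(2) that(2) B(2) A.less_imp_le A.order_trans)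
  have "k \<sqsubseteq> n \<longrightarrow> (\<exists>a p. (\<forall>i. i \<sqsubset> k \<longrightarrow> beta M a b i (F i)) \<and> (\<forall>i. i \<sqsubset> k \<longrightarrow> (\<exists>j. p = md b i \<otimes> j)) \<and>
    (\<forall>j. k \<sqsubseteq> j \<and> j \<sqsubset> n \<longrightarrow> Inv p (md b j)))" for k
  proof (induction k rule: ind)
    case Z
    have "Inv (sc \<zero>) m" for m
      unfolding Inv_def by (rule exI[of _ "sc \<zero>"], rule exI[of _ \<zero>]) simp
    then show ?case by auto
  next
    case (S k)
    show ?case
    proof
      assume "sc k \<sqsubseteq> n"
      then have kn: "k \<sqsubset> n" by simp
      then obtain a p where ap: "\<And>i. i \<sqsubset> k \<Longrightarrow> beta M a b i (F i)"
        "\<And>i. i \<sqsubset> k \<Longrightarrow> \<exists>j. p = md b i \<otimes> j" "\<And>j. k \<sqsubseteq> j \<Longrightarrow> j \<sqsubset> n \<Longrightarrow> Inv p (md b j)"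
        using S A.less_imp_le[OF kn] by metis
      obtain X Y where XY: "p \<otimes> X = sc (md b k \<otimes> Y)" using ap(3)[of k] kn by (auto simp: Inv_def)
      define c where "c = sc k \<otimes> b"
      have mdk: "md b k = sc c" unfolding md_def c_def ..
      \<comment> \<open>Modulo \<open>md b k\<close> the factor \<open>c\<close> is -1 and
        \<open>p \<otimes> X\<close> is 1, so adding \<open>p \<otimes> X \<otimes> t\<close>
        replaces the remainder of \<open>a\<close> by \<open>F k\<close>.\<close>
      define t where "t = F k \<oplus> a \<otimes> c"
      define a' where "a' = a \<oplus> p \<otimes> X \<otimes> t"
      have "a' = (Y \<otimes> t \<oplus> a) \<otimes> md b k \<oplus> F k"
        unfolding a'_def XY t_def mdk by (simp add: A.distrib_left A.distrib_right A.add_ac A.mult_ac)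
      moreover have "F k \<sqsubset> md b k"
      proof -
        have "b \<sqsubseteq> c" unfolding c_def by (rule le_mul') simp
        then show ?thesis using B(1)[OF kn] \<open>B \<sqsubseteq> b\<close> unfolding mdk
          by (meson A.less_imp_le A.order_trans less_S)
      qed
      ultimately have 1: "beta M a' b k (F k)" unfolding beta_md by blast
      have 2: "beta M a' b i (F i)" if ik: "i \<sqsubset> k" for i
      proof -
        obtain j where j: "p = md b i \<otimes> j" using ap(2) ik by blast
        obtain q where q: "a = q \<otimes> md b i \<oplus> F i" "F i \<sqsubset> md b i" using ap(1)[OF ik] by (auto simp: beta_md)
        have "a' = (q \<oplus> j \<otimes> X \<otimes> t) \<otimes> md b i \<oplus> F i"
          unfolding a'_def j by (subst q(1)) (simp add: A.distrib_left A.distrib_right A.add_ac A.mult_ac)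
        then show ?thesis using q(2) unfolding beta_md by blast
      qed
      have "\<forall>i. i \<sqsubset> sc k \<longrightarrow> beta M a' b i (F i)" using 1 2 by (auto simp: A.le_less)
      moreover have "\<exists>j. p \<otimes> md b k = md b i \<otimes> j" if "i \<sqsubset> sc k" for i
        using that ap(2)[of i] mul_commute mul_assoc by (metis A.le_less less_S)
      moreover have "Inv (p \<otimes> md b k) (md b j)" if "sc k \<sqsubseteq> j" "j \<sqsubset> n" for j
        using that by (intro Inv_mul ap(3) inv) (auto intro: A.less_imp_le)
      ultimately show "\<exists>a p. (\<forall>i. i \<sqsubset> sc k \<longrightarrow> beta M a b i (F i)) \<and>
          (\<forall>i. i \<sqsubset> sc k \<longrightarrow> (\<exists>j. p = md b i \<otimes> j)) \<and> (\<forall>j. sc k \<sqsubseteq> j \<and> j \<sqsubset> n \<longrightarrow> Inv p (md b j))"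
        by blast
    qed
  next
    case D
    show ?case unfolding Inv_def md_def by (intro dfn Fi)
  qed
  from this[of n] show ?thesis by auto
qed


section \<open>Recursion and coded sets\<close>

definition bval :: "'a \<Rightarrow> 'a \<Rightarrow> 'a \<Rightarrow> 'a" where "bval a b i = (THE x. beta M a b i x)"

lemma bval: "bval a b i = x \<longleftrightarrow> beta M a b i x"
  unfolding bval_def using beta_ex beta_unique by (metis the_equality)

lemma df_bval [dfn]: "df f \<Longrightarrow> df g \<Longrightarrow> df h \<Longrightarrow> df (\<lambda>e. bval (f e) (g e) (h e))"
  by (rule df_app3[where F = bval]) (unfold eq_commute[of _ "bval _ _ _"] bval, intro dfn)

definition mrecR :: "'a \<Rightarrow> ('a \<Rightarrow> 'a \<Rightarrow> 'a) \<Rightarrow> 'a \<Rightarrow> 'a \<Rightarrow> 'a \<Rightarrow> bool" where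
  "mrecR x0 f a b n \<longleftrightarrow> bval a b \<zero> = x0 \<and> (\<forall>i. i \<sqsubset> n \<longrightarrow> bval a b (sc i) = f i (bval a b i))"

text \<open>Recursion along all elements of M, nonstandard ones included; the value is read off any
  beta-coded computation of length \<open>n\<close>.\<close>

definition mrec :: "'a \<Rightarrow> ('a \<Rightarrow> 'a \<Rightarrow> 'a) \<Rightarrow> 'a \<Rightarrow> 'a" where
  "mrec x0 f n = (THE y. \<exists>a b. mrecR x0 f a b n \<and> bval a b n = y)"

lemma mrecR_unique: "mrecR x0 f a b n \<Longrightarrow> mrecR x0 f a' b' n \<Longrightarrow> bval a b n = bval a' b' n"
proof -
  assume *: "mrecR x0 f a b n" "mrecR x0 f a' b' n"
  have "i \<sqsubseteq> n \<longrightarrow> bval a b i = bval a' b' i" for i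
  proof (induction i rule: ind)
    case (S i)
    then show ?case using * A.less_imp_le[of i n] unfolding mrecR_def by simp
  next
    case D show ?case by (intro dfn)
  qed (use * in \<open>auto simp: mrecR_def\<close>)
  then show ?thesis by auto
qed

text \<open>Convention for functions of two arguments: entry 1 stands for the first and entry 0,
  bound last, for the second.\<close>

lemma df2:
  assumes f: "df (\<lambda>e. f (e 1) (e 0))" and g: "df g" and h: "df h"
  shows "df (\<lambda>e. f (g e) (h e))"
proof (rule df_app2[OF _ g h])
  fix i j k
  have "D (\<lambda>e. \<exists>x y. x = e i \<and> y = e j \<and> e k = f x y)"
  proof (intro D_ex D_conj)
    have "inj (\<lambda>n. case n of 0 \<Rightarrow> Suc (Suc k) | Suc 0 \<Rightarrow> 0 | Suc (Suc 0) \<Rightarrow> 1 | Suc (Suc (Suc m)) \<Rightarrow> k + m + 3)"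
      by (auto simp: inj_def split: nat.splits)
    from D_inj[OF f[unfolded df_def] this]
    show "D (\<lambda>e. e (Suc (Suc k)) = f (e (Suc 0)) (e 0))" by simp
  qed (intro dfn)+
  then show "D (\<lambda>e. e k = f (e i) (e j))" by simp
qed

lemma mrecR_ex:
  assumes f: "df (\<lambda>e. f (e 1) (e 0))"
  shows "\<exists>a b. mrecR x0 f a b n"
proof (induction n rule: ind)
  case Z
  obtain a b where "\<forall>i. i \<sqsubset> sc \<zero> \<longrightarrow> beta M a b i ((\<lambda>_. x0) i)"
    using beta_lemma[of "\<lambda>_. x0" "sc \<zero>"] df_const by blast
  then show ?case unfolding mrecR_def bval by auto
next
  case (S n)
  then obtain a b where ab: "mrecR x0 f a b n" by blast
  \<comment> \<open>A beta code cannot be extended in place, so the whole sequence with its new last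
    value is coded again.\<close>
  define F where "F i = (if i \<sqsubseteq> n then bval a b i else f n (bval a b n))" for i
  have "df (\<lambda>e. F (e 0))" unfolding F_def by (intro dfn)
  from beta_lemma[OF this, of "sc (sc n)"] obtain a' b' where
    "\<And>i. i \<sqsubseteq> sc n \<Longrightarrow> bval a' b' i = F i" by (auto simp: bval)
  moreover have "\<not> sc n \<sqsubseteq> n" by simp
  ultimately have "bval a' b' (sc n) = f n (bval a b n)" "\<And>i. i \<sqsubseteq> n \<Longrightarrow> bval a' b' i = bval a b i"
    by (auto simp: F_def A.le_less)
  then have "mrecR x0 f a' b' (sc n)"
    using ab S_le[of _ n] unfolding mrecR_def
    by (metis A.le_less less_S zero_le S_le)
  then show ?case by blast
next
  case D
  show ?case unfolding mrecR_def by (intro dfn df2[OF f])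
qed

lemma mrec_eq: assumes f: "df (\<lambda>e. f (e 1) (e 0))"
  shows "mrec x0 f n = y \<longleftrightarrow> (\<exists>a b. mrecR x0 f a b n \<and> bval a b n = y)"
proof -
  have ex: "\<exists>!y. \<exists>a b. mrecR x0 f a b n \<and> bval a b n = y"
    using mrecR_ex[OF f] mrecR_unique by blast
  then have "\<exists>a b. mrecR x0 f a b n \<and> bval a b n = mrec x0 f n"
    unfolding mrec_def by (rule theI')
  then show ?thesis by (metis mrecR_unique)
qed

lemma mrec_0: assumes f: "df (\<lambda>e. f (e 1) (e 0))"
  shows "mrec x0 f \<zero> = x0"
  unfolding mrec_eq[OF f] using mrecR_ex[OF f, of x0 \<zero>] unfolding mrecR_def by auto

lemma mrec_S: assumes f: "df (\<lambda>e. f (e 1) (e 0))"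
  shows "mrec x0 f (sc n) = f n (mrec x0 f n)"
proof -
  obtain a b where ab: "mrecR x0 f a b (sc n)" using mrecR_ex[OF f] by blast
  then have "mrecR x0 f a b n" unfolding mrecR_def by (auto intro: A.less_imp_le)
  then have "mrec x0 f n = bval a b n" unfolding mrec_eq[OF f] by blast
  moreover have "bval a b (sc n) = f n (bval a b n)" using ab unfolding mrecR_def by auto
  ultimately have "bval a b (sc n) = f n (mrec x0 f n)" by simp
  then show ?thesis using ab unfolding mrec_eq[OF f] by blast
qed

lemma df_mrec [dfn]:
  assumes F: "df (\<lambda>e. f (\<lambda>k. e (Suc (Suc k))) (e 1) (e 0))" and x: "df x0" and n: "df n"
  shows "df (\<lambda>e. mrec (x0 e) (f e) (n e))"
proof -
  have f: "df (\<lambda>e. f d (e 1) (e 0))" for d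
    using df_freeze[OF F, of 2 "\<lambda>n. d (n - 2)"] by simp
  have *: "z = mrec (x0 d) (f d) (n d) \<longleftrightarrow> (\<exists>a b. mrecR (x0 d) (f d) a b (n d) \<and> bval a b (n d) = z)" for z d
    by (subst eq_commute) (rule mrec_eq[OF f])
  have "df (\<lambda>e. f (\<lambda>k. e (k + 4)) (g e) (h e))" if g: "df g" and h: "df h" for g h
  proof -
    have "D (\<lambda>e. \<exists>i. i = g (\<lambda>n. e (Suc n)) \<and> (\<exists>x. x = h (\<lambda>n. e (Suc n)) \<and> e 0 = f (\<lambda>k. e (Suc (k + 4))) i x))"
    proof (intro D_ex D_conj)
      show "D (\<lambda>e. e 0 = g (\<lambda>n. e (Suc (Suc n))))"
        using D_eq[OF df_proj df_shift[OF df_shift[OF g]]] by simp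
      show "D (\<lambda>e. e 0 = h (\<lambda>n. e (Suc (Suc (Suc n)))))"
        using D_eq[OF df_proj df_shift[OF df_shift[OF df_shift[OF h]]]] by simp
      have "inj (\<lambda>n. if n = 0 then 2 else if n = 1 then 0 else if n = 2 then 1 else n + (4::nat))"
        by (auto simp: inj_def)
      from D_inj[OF F[unfolded df_def] this]
      show "D (\<lambda>e. e (Suc (Suc 0)) = f (\<lambda>k. e (Suc (Suc (Suc (k + 4))))) (e (Suc 0)) (e 0))"
        by (simp add: numeral_eq_Suc)
    qed
    then show ?thesis unfolding df_def by simp
  qed
  then have f4: "df g \<Longrightarrow> df h \<Longrightarrow> df (\<lambda>e. f (\<lambda>k. e (Suc (Suc (Suc (Suc k))))) (g e) (h e))" for g h
    by (simp add: numeral_eq_Suc)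
  have "D (\<lambda>e. \<exists>a b. mrecR (x0 (\<lambda>n. e (Suc n))) (f (\<lambda>n. e (Suc n))) a b (n (\<lambda>n. e (Suc n))) \<and>
      bval a b (n (\<lambda>n. e (Suc n))) = e 0)"
    unfolding mrecR_def
    by (intro dfn f4 df_shift[OF df_shift[OF df_shift[OF x]]] df_shift[OF df_shift[OF df_shift[OF n]]]
        df_shift[OF df_shift[OF df_shift[OF df_shift[OF n]]]])
  then show ?thesis unfolding df_def * .
qed


section \<open>Powers of two, binary digits, and bounded comprehension\<close>

definition p2 :: "'a \<Rightarrow> 'a" where "p2 m = mrec (sc \<zero>) (\<lambda>_ x. x \<oplus> x) m"

lemma p2_0 [simp]: "p2 \<zero> = sc \<zero>" and p2_S: "p2 (sc m) = p2 m \<oplus> p2 m"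
  unfolding p2_def by (rule mrec_0 mrec_S, intro dfn)+

lemma df_p2 [dfn]: "df f \<Longrightarrow> df (\<lambda>e. p2 (f e))"
  unfolding p2_def by (intro dfn)

lemma pow2_iff: "pow2 M m p \<longleftrightarrow> p = p2 m"
proof -
  have "df (\<lambda>e. (\<lambda>_ x. x \<oplus> x) (e 1) (e 0))" by (intro dfn)
  from mrec_eq[OF this, of "sc \<zero>" m p] show ?thesis
    unfolding pow2_def p2_def UN mrecR_def bval[symmetric] by auto
qed

lemma p2_neq_0 [simp]: "p2 m \<noteq> \<zero>"
proof (induction m rule: ind)
  case D show ?case by (intro dfn)
qed (auto simp: p2_S add_eq_0)

lemma less_p2: "m \<sqsubset> p2 m"
proof (induction m rule: ind)
  case (S m)
  then show ?case unfolding p2_S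
    by (metis A.add_less_le_mono S_le add_0 add_S le_antisym p2_neq_0 A.not_le zero_le A.less_imp_le A.add_mono)
next
  case D show ?case by (intro dfn)
qed simp

lemma p2_add: "p2 (m \<oplus> k) = p2 m \<otimes> p2 k"
proof (induction k rule: ind)
  case D show ?case by (intro dfn)
qed (auto simp: p2_S A.distrib_left)

lemma p2_mono: "m \<sqsubseteq> k \<Longrightarrow> p2 m \<sqsubseteq> p2 k"
  by (auto simp: le_def p2_add le_mul[unfolded le_def])

abbreviation mem (infix "\<epsilon>" 50) where "x \<epsilon> c \<equiv> bit M x c"

lemma bit_iff: "x \<epsilon> c \<longleftrightarrow> (\<exists>h r. c = sc (h \<oplus> h) \<otimes> p2 x \<oplus> r \<and> r \<sqsubset> p2 x)"
  unfolding bit_def UN pow2_iff by auto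

lemma D_bit [dfn]: "df f \<Longrightarrow> df g \<Longrightarrow> D (\<lambda>e. f e \<epsilon> g e)"
  unfolding bit_iff by (rule D_app2[where R = "\<lambda>x c. \<exists>h r. c = sc (h \<oplus> h) \<otimes> p2 x \<oplus> r \<and> r \<sqsubset> p2 x"]) (intro dfn)

lemma p2_le_bit: "x \<epsilon> c \<Longrightarrow> p2 x \<sqsubseteq> c"
  unfolding bit_iff by (auto intro: A.order_trans[OF _ le_add(1)])

lemma bit_less: "x \<epsilon> c \<Longrightarrow> x \<sqsubset> c"
  using less_p2 p2_le_bit A.less_le_trans by blast

lemma bit_div: "r \<sqsubset> p2 x \<Longrightarrow> x \<epsilon> q \<otimes> p2 x \<oplus> r \<longleftrightarrow> (\<exists>h. q = sc (h \<oplus> h))"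
  unfolding bit_iff using division_unique by blast

lemma odd_add: "(\<exists>h. q \<oplus> (t \<oplus> t) = sc (h \<oplus> h)) \<longleftrightarrow> (\<exists>h. q = sc (h \<oplus> h))"
proof
  assume "\<exists>h. q \<oplus> (t \<oplus> t) = sc (h \<oplus> h)"
  then obtain h where h: "q \<oplus> (t \<oplus> t) = sc (h \<oplus> h)" by blast
  show "\<exists>h. q = sc (h \<oplus> h)"
  proof (cases "t \<sqsubseteq> h")
    case True
    then obtain w where "h = t \<oplus> w" by (auto simp: le_def)
    then have "q \<oplus> (t \<oplus> t) = sc (w \<oplus> w) \<oplus> (t \<oplus> t)" using h by (simp add: A.add_ac)
    then show ?thesis using add_cancel_right by blast
  next
    case False
    then obtain w where "t = h \<oplus> sc w" by (metis A.not_le less_def)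
    then have "sc (h \<oplus> h) \<oplus> sc (q \<oplus> w \<oplus> w) = sc (h \<oplus> h) \<oplus> \<zero>" using h by (simp add: A.add_ac)
    then show ?thesis by (metis add_cancel_left sc_neq(1))
  qed
next
  assume "\<exists>h. q = sc (h \<oplus> h)"
  then obtain h where "q = sc (h \<oplus> h)" by blast
  then have "q \<oplus> (t \<oplus> t) = sc ((h \<oplus> t) \<oplus> (h \<oplus> t))" by (simp add: A.add_ac)
  then show "\<exists>h. q \<oplus> (t \<oplus> t) = sc (h \<oplus> h)" by blast
qed

text \<open>Above \<open>b\<close> both numbers are too small to have bits. Below \<open>b\<close>
  the added power is an even multiple of \<open>p2 x\<close>, so the parity of the quotient does not
  change.\<close>

lemma bit_add_p2:
  assumes "c \<sqsubset> p2 b" shows "x \<epsilon> c \<oplus> p2 b \<longleftrightarrow> x = b \<or> x \<epsilon> c"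
proof -
  consider "x = b" | k where "b = x \<oplus> sc k" | "b \<sqsubset> x" by (metis A.neq_iff less_def)
  then show ?thesis
  proof cases
    case 1
    have "c \<oplus> p2 b = sc (\<zero> \<oplus> \<zero>) \<otimes> p2 b \<oplus> c" by (simp add: add_commute)
    then show ?thesis using assms 1 unfolding bit_iff by blast
  next
    case 2
    obtain q r where qr: "c = q \<otimes> p2 x \<oplus> r" "r \<sqsubset> p2 x" using division[of "p2 x" c] by auto
    have "c \<oplus> p2 b = (q \<oplus> (p2 k \<oplus> p2 k)) \<otimes> p2 x \<oplus> r"
      unfolding qr(1) 2 p2_add p2_S by (simp add: A.distrib_left A.distrib_right A.add_ac A.mult_ac)
    moreover have "x \<noteq> b" using 2 by (metis add_0 add_cancel_left sc_neq(1))
    ultimately show ?thesis using bit_div[OF qr(2)] odd_add qr(1) by metis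
  next
    case 3
    have "c \<oplus> p2 b \<sqsubset> p2 (sc b)" unfolding p2_S using assms by simp
    also have "... \<sqsubseteq> p2 x" using 3 by (intro p2_mono) simp
    finally have "\<not> p2 x \<sqsubseteq> c \<oplus> p2 b" by (simp add: A.not_le)
    moreover have "\<not> p2 x \<sqsubseteq> c" using calculation le_add(1) A.order_trans by blast
    ultimately show ?thesis using p2_le_bit 3 by blast
  qed
qed

text \<open>The code is built bit by bit. The induction also keeps it below \<open>p2 b\<close>, so
  that the next power of two is added without a carry.\<close>

lemma comprehension:
  assumes D: "D (\<lambda>e. P (e 0))"
  shows "\<exists>c. \<forall>x. x \<epsilon> c \<longleftrightarrow> x \<sqsubset> b \<and> P x"
proof -
  have DP: "D (\<lambda>e. P (e i))" for i by (rule D_at[OF D])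
  have "\<exists>c. c \<sqsubset> p2 b \<and> (\<forall>x. x \<epsilon> c \<longleftrightarrow> x \<sqsubset> b \<and> P x)"
  proof (induction b rule: ind)
    case Z
    show ?case by (intro exI[of _ \<zero>]) (auto dest: bit_less)
  next
    case (S b)
    then obtain c where c: "c \<sqsubset> p2 b" "\<And>x. x \<epsilon> c \<longleftrightarrow> x \<sqsubset> b \<and> P x" by blast
    show ?case
    proof (cases "P b")
      case True
      have "c \<oplus> p2 b \<sqsubset> p2 (sc b)" unfolding p2_S using c(1) by simp
      moreover have "x \<epsilon> c \<oplus> p2 b \<longleftrightarrow> x \<sqsubset> sc b \<and> P x" for x
        unfolding bit_add_p2[OF c(1)] c(2) using True by (auto simp: A.le_less)
      ultimately show ?thesis by blast
    next
      case False
      have "c \<sqsubset> p2 (sc b)" unfolding p2_S using c(1) le_add(1) by (rule A.less_le_trans)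
      moreover have "x \<epsilon> c \<longleftrightarrow> x \<sqsubset> sc b \<and> P x" for x
        unfolding c(2) using False by (auto simp: A.le_less)
      ultimately show ?thesis by blast
    qed
  next
    case D show ?case by (intro dfn DP)
  qed
  then show ?thesis by blast
qed

text \<open>Taking the least code turns equality of definable sets into equality of elements of M;
  this is used for the types of finite rank.\<close>

definition cs :: "('a \<Rightarrow> bool) \<Rightarrow> 'a" where
  "cs P = lst (\<lambda>c. \<forall>x. x \<epsilon> c \<longleftrightarrow> P x)"

lemma mem_cs:
  assumes D: "D (\<lambda>e. P (e 0))" and "\<And>x. P x \<Longrightarrow> x \<sqsubset> b"
  shows "x \<epsilon> cs P \<longleftrightarrow> P x"
proof -
  have DP: "D (\<lambda>e. P (e i))" for i by (rule D_at[OF D])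
  have "\<exists>c. \<forall>x. x \<epsilon> c \<longleftrightarrow> P x" using comprehension[OF D, of b] assms(2) by blast
  moreover have "D (\<lambda>e. \<forall>x. x \<epsilon> e 0 \<longleftrightarrow> P x)" by (intro dfn DP)
  ultimately have "\<forall>x. x \<epsilon> cs P \<longleftrightarrow> P x" unfolding cs_def by (rule lst_ex[where P = "\<lambda>c. \<forall>x. x \<epsilon> c \<longleftrightarrow> P x", rotated])
  then show ?thesis by blast
qed

lemma df_cs [dfn]:
  assumes "D (\<lambda>e. P (\<lambda>n. e (Suc n)) (e 0))"
  shows "df (\<lambda>e. cs (P e))"
proof -
  have "inj (\<lambda>n. if n = 0 then 0 else Suc n)" by (auto simp: inj_def)
  from D_inj[OF assms this] have 1: "D (\<lambda>e. P (\<lambda>n. e (Suc (Suc n))) (e 0))" by simp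
  show ?thesis unfolding cs_def by (intro dfn 1)
qed

section \<open>Pairs and their projections\<close>

abbreviation pr where "pr \<equiv> pair M"

lemma df_pr [dfn]: "df f \<Longrightarrow> df g \<Longrightarrow> df (\<lambda>e. pr (f e) (g e))"
  unfolding pair_def by (intro dfn)

text \<open>Pairs with sum \<open>s\<close> have codes from the square of \<open>s\<close> up to
  this square plus \<open>s\<close>, hence below the next square.\<close>

lemma sq_less: "s \<sqsubset> t \<Longrightarrow> x \<sqsubseteq> s \<Longrightarrow> s \<otimes> s \<oplus> x \<sqsubset> t \<otimes> t \<oplus> y"
proof -
  assume s: "s \<sqsubset> t" and x: "x \<sqsubseteq> s"
  have "s \<otimes> s \<oplus> x \<sqsubset> sc (s \<otimes> s \<oplus> (s \<oplus> s))"
    using x A.order_trans[OF x le_add(1)] by (simp add: A.add_left_mono)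
  also have "... = sc s \<otimes> sc s" by (simp add: A.add_ac)
  also have "... \<sqsubseteq> t \<otimes> t \<oplus> y"
    using s by (intro A.order_trans[OF A.mult_mono le_add(1)]) auto
  finally show ?thesis .
qed

lemma pr_inj [simp]: "pr x y = pr u v \<longleftrightarrow> x = u \<and> y = v"
proof
  assume eq: "pr x y = pr u v"
  have "x \<oplus> y = u \<oplus> v"
    using sq_less[of "x \<oplus> y" "u \<oplus> v" x u] sq_less[of "u \<oplus> v" "x \<oplus> y" u x] eq le_add(1)
    unfolding pair_def by (metis A.less_irrefl A.neq_iff)
  then show "x = u \<and> y = v" using eq unfolding pair_def by (metis add_cancel_left)
qed simp

lemma le_sq: "x \<sqsubseteq> x \<otimes> x"
  by (cases x rule: cases0) auto

lemma pr_ge: "x \<sqsubseteq> pr x y" "y \<sqsubseteq> pr x y"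
  unfolding pair_def using A.order_trans[OF le_add(2) A.order_trans[OF le_sq le_add(1)]] by auto

text \<open>By the default of \<open>lst\<close>, both projections of an element that is not a pair
  are zero.\<close>

definition pf :: "'a \<Rightarrow> 'a" where "pf z = lst (\<lambda>x. \<exists>y. z = pr x y)"
definition ps :: "'a \<Rightarrow> 'a" where "ps z = lst (\<lambda>y. \<exists>x. z = pr x y)"

lemma pf_pr [simp]: "pf (pr x y) = x" and ps_pr [simp]: "ps (pr x y) = y"
  unfolding pf_def ps_def by (auto intro!: lst_eq)

lemma df_pf [dfn]: "df f \<Longrightarrow> df (\<lambda>e. pf (f e))" and df_ps [dfn]: "df f \<Longrightarrow> df (\<lambda>e. ps (f e))"
  unfolding pf_def ps_def
  by (rule df_comp[where f = "\<lambda>z. lst (\<lambda>x. \<exists>y. z = pr x y)"], intro dfn, assumption,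
      rule df_comp[where f = "\<lambda>z. lst (\<lambda>y. \<exists>x. z = pr x y)"], intro dfn, assumption)

end

section \<open>Labelled query games\<close>

locale game = pa M for M :: "'a lpa" +
  fixes inst :: "'a \<Rightarrow> 'a \<Rightarrow> 'a" and sg lf At :: "'a \<Rightarrow> bool"
  assumes inst_df: "df (\<lambda>e. inst (e 1) (e 0))"
    and sg_D: "D (\<lambda>e. sg (e 0))" and lf_D: "D (\<lambda>e. lf (e 0))" and At_D: "D (\<lambda>e. At (e 0))"
begin

lemma df_inst [dfn]: "df f \<Longrightarrow> df g \<Longrightarrow> df (\<lambda>e. inst (f e) (g e))"
  by (rule df2[OF inst_df])

lemma D_sg [dfn]: "df f \<Longrightarrow> D (\<lambda>e. sg (f e))"
  by (rule D_app1[OF D_at[OF sg_D]])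

lemma D_lf [dfn]: "df f \<Longrightarrow> D (\<lambda>e. lf (f e))"
  by (rule D_app1[OF D_at[OF lf_D]])

lemma D_At [dfn]: "df f \<Longrightarrow> D (\<lambda>e. At (f e))"
  by (rule D_app1[OF D_at[OF At_D]])

end

text \<open>Tarski's clauses for a partial answer function. An answer is zero for false and the
  successor of a witness for true; \<open>sg p\<close> tells whether \<open>p\<close> is made true
  by a true instance, as a disjunction or quantifier is, or by a false one, as a negation
  is.\<close>

definition (in game) okR :: "('a \<Rightarrow> 'a \<Rightarrow> bool) \<Rightarrow> bool" where
  "okR R \<longleftrightarrow> (\<forall>p a b. R p a \<and> R p b \<longrightarrow> a = b) \<and> (\<forall>p a. R p a \<and> lf p \<longrightarrow> (a \<noteq> \<zero>) = At p) \<and>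
     (\<forall>p a b. \<not> lf p \<and> R p (sc a) \<and> R (inst p a) b \<longrightarrow> (b \<noteq> \<zero>) = sg p) \<and>
     (\<forall>p a b. \<not> lf p \<and> R p \<zero> \<and> R (inst p a) b \<longrightarrow> (b \<noteq> \<zero>) \<noteq> sg p)"

locale lgame = game M inst sg lf At for M :: "'a lpa" and inst sg lf At +
  fixes s0 :: 'a and Q Lb :: "'a \<Rightarrow> 'a" and dl :: "'a \<Rightarrow> 'a \<Rightarrow> 'a" and n L :: 'a
  assumes Q_df: "df (\<lambda>e. Q (e 0))" and Lb_df: "df (\<lambda>e. Lb (e 0))"
    and dl_df: "df (\<lambda>e. dl (e 1) (e 0))"
begin

lemma df_Q [dfn]: "df f \<Longrightarrow> df (\<lambda>e. Q (f e))"
  by (rule df_comp[OF Q_df])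

lemma df_Lb [dfn]: "df f \<Longrightarrow> df (\<lambda>e. Lb (f e))"
  by (rule df_comp[OF Lb_df])

lemma df_dl [dfn]: "df f \<Longrightarrow> df g \<Longrightarrow> df (\<lambda>e. dl (f e) (g e))"
  by (rule df2[OF dl_df])

text \<open>
  A fact \<open>pr (pr p l) a\<close> says that the node \<open>p\<close>, asked with label \<open>l\<close>, is true with witness
  \<open>a\<close>. An answer is \<open>\<zero>\<close> for false and \<open>sc a\<close> for true with witness \<open>a\<close>.
\<close>

definition ans :: "'a \<Rightarrow> 'a \<Rightarrow> 'a" where
  "ans S s = (if lf (Q s) then if At (Q s) then sc \<zero> else \<zero>
     else if \<exists>a. pr (pr (Q s) (Lb s)) a \<epsilon> S then sc (lst (\<lambda>a. pr (pr (Q s) (Lb s)) a \<epsilon> S)) else \<zero>)"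

definition run :: "'a \<Rightarrow> 'a \<Rightarrow> 'a" where
  "run S i = mrec s0 (\<lambda>_ s. dl s (ans S s)) i"

definition cfl :: "'a \<Rightarrow> 'a \<Rightarrow> bool" where
  "cfl S w \<longleftrightarrow> (\<exists>i j a. w = pr i (pr j a) \<and> i \<sqsubset> n \<and> j \<sqsubset> n \<and> \<not> lf (Q (run S i)) \<and> ans S (run S i) = \<zero> \<and>
     Q (run S j) = inst (Q (run S i)) a \<and> (ans S (run S j) \<noteq> \<zero>) = sg (Q (run S i)))"

definition halt :: "'a \<Rightarrow> bool" where "halt S \<longleftrightarrow> \<not> (\<exists>w. cfl S w)"
definition cw :: "'a \<Rightarrow> 'a" where "cw S = lst (cfl S)"
definition ci :: "'a \<Rightarrow> 'a" where "ci S = run S (pf (cw S))"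
definition lv :: "'a \<Rightarrow> 'a" where "lv S = Lb (ci S)"
definition nf :: "'a \<Rightarrow> 'a" where "nf S = pr (pr (Q (ci S)) (lv S)) (ps (ps (cw S)))"
text \<open>Facts on the level of the correction are kept. The instance that justifies the new fact
  has a smaller label, so its answer survives the correction.\<close>

definition upd :: "'a \<Rightarrow> 'a" where
  "upd S = cs (\<lambda>x. x \<epsilon> S \<and> ps (pf x) \<sqsubseteq> lv S \<or> x = nf S)"
definition st :: "'a \<Rightarrow> 'a" where
  "st t = mrec \<zero> (\<lambda>_ S. if halt S then S else upd S) t"

lemma df_ans [dfn]: "df f \<Longrightarrow> df g \<Longrightarrow> df (\<lambda>e. ans (f e) (g e))"
  by (rule df_app2[where F = ans]) (unfold ans_def, intro dfn)

lemma df_run [dfn]: "df f \<Longrightarrow> df g \<Longrightarrow> df (\<lambda>e. run (f e) (g e))"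
  by (rule df_app2[where F = run]) (unfold run_def, intro dfn)

lemma D_cfl [dfn]: "df f \<Longrightarrow> df g \<Longrightarrow> D (\<lambda>e. cfl (f e) (g e))"
  by (rule D_app2[where R = cfl]) (unfold cfl_def, intro dfn)

lemma D_halt [dfn]: "df f \<Longrightarrow> D (\<lambda>e. halt (f e))"
  by (rule D_app1[where R = halt]) (unfold halt_def, intro dfn)

lemma df_cw [dfn]: "df f \<Longrightarrow> df (\<lambda>e. cw (f e))"
  by (rule df_app1[where F = cw]) (unfold cw_def, intro dfn)

lemma df_ci [dfn]: "df f \<Longrightarrow> df (\<lambda>e. ci (f e))"
  by (rule df_app1[where F = ci]) (unfold ci_def, intro dfn)

lemma df_lv [dfn]: "df f \<Longrightarrow> df (\<lambda>e. lv (f e))"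
  by (rule df_app1[where F = lv]) (unfold lv_def, intro dfn)

lemma df_nf [dfn]: "df f \<Longrightarrow> df (\<lambda>e. nf (f e))"
  by (rule df_app1[where F = nf]) (unfold nf_def, intro dfn)

lemma df_upd [dfn]: "df f \<Longrightarrow> df (\<lambda>e. upd (f e))"
  by (rule df_app1[where F = upd]) (unfold upd_def, intro dfn)

lemma df_st [dfn]: "df f \<Longrightarrow> df (\<lambda>e. st (f e))"
  by (rule df_app1[where F = st]) (unfold st_def, intro dfn)

lemma run_0 [simp]: "run S \<zero> = s0"
  unfolding run_def by (rule mrec_0, intro dfn)

lemma run_S: "run S (sc i) = dl (run S i) (ans S (run S i))"
  unfolding run_def by (rule mrec_S, intro dfn)

lemma st_0 [simp]: "st \<zero> = \<zero>"
  unfolding st_def by (rule mrec_0, intro dfn)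

lemma st_S: "st (sc t) = (if halt (st t) then st t else upd (st t))"
  unfolding st_def by (rule mrec_S, intro dfn)

lemma mem_upd: "x \<epsilon> upd S \<longleftrightarrow> x \<epsilon> S \<and> ps (pf x) \<sqsubseteq> lv S \<or> x = nf S"
  unfolding upd_def
proof (rule mem_cs[where b = "S \<oplus> sc (nf S)"])
  show "D (\<lambda>e. e 0 \<epsilon> S \<and> ps (pf (e 0)) \<sqsubseteq> lv S \<or> e 0 = nf S)" by (intro dfn)
next
  fix x assume "x \<epsilon> S \<and> ps (pf x) \<sqsubseteq> lv S \<or> x = nf S"
  then show "x \<sqsubset> S \<oplus> sc (nf S)"
    using A.order_trans[OF A.less_imp_le[OF bit_less] le_add(1)] by auto
qed

lemma cfl_cw: "\<not> halt S \<Longrightarrow> cfl S (cw S)"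
  unfolding cw_def halt_def by (rule lst_ex) (intro dfn, simp)

lemma cw_props:
  assumes "\<not> halt S"
  obtains i j a where "i \<sqsubset> n" "j \<sqsubset> n" "\<not> lf (Q (run S i))" "ans S (run S i) = \<zero>"
     "Q (run S j) = inst (Q (run S i)) a" "(ans S (run S j) \<noteq> \<zero>) = sg (Q (run S i))"
     "ci S = run S i" "lv S = Lb (run S i)" "nf S = pr (pr (Q (run S i)) (lv S)) a" "pf (cw S) = i"
proof -
  obtain i j a where *: "cw S = pr i (pr j a)" and "i \<sqsubset> n" "j \<sqsubset> n" "\<not> lf (Q (run S i))" "ans S (run S i) = \<zero>"
     "Q (run S j) = inst (Q (run S i)) a" "(ans S (run S j) \<noteq> \<zero>) = sg (Q (run S i))"
    using cfl_cw[OF assms] unfolding cfl_def by blast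
  moreover have "ci S = run S i" unfolding ci_def * by simp
  moreover have "nf S = pr (pr (Q (run S i)) (lv S)) a" unfolding nf_def ci_def * by simp
  ultimately show ?thesis using that[of i j a] unfolding lv_def by simp
qed

lemma ans_0: "\<not> lf (Q s) \<Longrightarrow> ans S s = \<zero> \<longleftrightarrow> (\<forall>a. \<not> pr (pr (Q s) (Lb s)) a \<epsilon> S)"
  unfolding ans_def by auto

lemma ans_sc: assumes "\<not> lf (Q s)" "ans S s = sc a" shows "pr (pr (Q s) (Lb s)) a \<epsilon> S"
proof -
  let ?P = "\<lambda>a. pr (pr (Q s) (Lb s)) a \<epsilon> S"
  have "\<exists>a. ?P a" "a = lst ?P"
    using assms unfolding ans_def by (auto split: if_splits)
  moreover have "D (\<lambda>e. ?P (e 0))" by (intro dfn)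
  ultimately show ?thesis using lst_ex[of ?P] by simp
qed

lemma ans_cong:
  assumes "\<And>a. pr (pr (Q s) (Lb s)) a \<epsilon> S \<longleftrightarrow> pr (pr (Q s) (Lb s)) a \<epsilon> S'"
  shows "ans S s = ans S' s"
  unfolding ans_def assms ..

lemma run_cong:
  assumes "\<And>i. i \<sqsubset> k \<Longrightarrow> ans S (run S i) = ans S' (run S i)"
  shows "i \<sqsubseteq> k \<Longrightarrow> run S' i = run S i"
proof -
  have "i \<sqsubseteq> k \<longrightarrow> run S' i = run S i" for i
  proof (induction i rule: ind)
    case (S i)
    then show ?case using assms A.less_imp_le by (auto simp: run_S)
  next
    case D show ?case by (intro dfn)
  qed simp
  then show "i \<sqsubseteq> k \<Longrightarrow> run S' i = run S i" by blast
qed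

lemma cfl_cong:
  assumes "\<And>i. i \<sqsubset> n \<Longrightarrow> ans S (run S i) = ans S' (run S i)"
  shows "cfl S' = cfl S"
proof -
  have "i \<sqsubset> n \<Longrightarrow> run S' i = run S i" for i using run_cong[OF assms, of n i] A.less_imp_le by blast
  then show ?thesis by (simp add: fun_eq_iff cfl_def assms[symmetric] cong: conj_cong)
qed

section \<open>Termination of the corrections\<close>

definition nof :: "'a \<Rightarrow> 'a \<Rightarrow> bool" where
  "nof e S \<longleftrightarrow> (\<forall>x. x \<epsilon> S \<longrightarrow> ps (pf x) \<sqsubset> e)"

lemma D_nof [dfn]: "df f \<Longrightarrow> df g \<Longrightarrow> D (\<lambda>e. nof (f e) (g e))"
  by (rule D_app2[where R = nof]) (unfold nof_def, intro dfn)

text \<open>The statement for the induction on levels. The bound has to be uniform in the stage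
  \<open>t\<close>, because the argument for \<open>e\<close> applies the bound for
  \<open>sc e\<close> at the start of each of a nonstandard number of blocks.\<close>

definition E :: "'a \<Rightarrow> 'a \<Rightarrow> bool" where
  "E e B \<longleftrightarrow> (\<forall>t. nof e (st t) \<longrightarrow> (\<exists>u. t \<sqsubseteq> u \<and> u \<sqsubseteq> t \<oplus> B \<and> (halt (st u) \<or> lv (st u) \<sqsubset> e)))"

lemma D_E [dfn]: "df f \<Longrightarrow> df g \<Longrightarrow> D (\<lambda>e. E (f e) (g e))"
  by (rule D_app2[where R = E]) (unfold E_def, intro dfn)

text \<open>
  \<open>good e t W\<close>: in the window from \<open>t\<close> to \<open>W\<close> only facts of level at least \<open>e\<close> are changed.
  The facts of level \<open>e\<close> added in the window start new blocks, and the answers to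
  the queries of label \<open>e\<close> in a block form a binary word which increases lexicographically.
\<close>

definition good :: "'a \<Rightarrow> 'a \<Rightarrow> 'a \<Rightarrow> bool" where
  "good e t W \<longleftrightarrow> nof e (st t) \<and> (\<forall>u. t \<sqsubseteq> u \<and> u \<sqsubseteq> W \<longrightarrow> \<not> halt (st u) \<and> e \<sqsubseteq> lv (st u))"

definition bs :: "'a \<Rightarrow> 'a \<Rightarrow> 'a \<Rightarrow> bool" where
  "bs e t u \<longleftrightarrow> u = t \<or> (\<exists>u'. u = sc u' \<and> t \<sqsubseteq> u' \<and> lv (st u') = e)"

definition dg :: "'a \<Rightarrow> 'a \<Rightarrow> 'a \<Rightarrow> bool" where
  "dg e u x \<longleftrightarrow> (\<exists>j i. x = j \<otimes> n \<oplus> i \<and> i \<sqsubset> n \<and> Lb (run (st (u \<oplus> j)) i) = e \<and>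
     \<not> lf (Q (run (st (u \<oplus> j)) i)) \<and> ans (st (u \<oplus> j)) (run (st (u \<oplus> j)) i) \<noteq> \<zero>)"

lemma D_good [dfn]: "df f \<Longrightarrow> df g \<Longrightarrow> df h \<Longrightarrow> D (\<lambda>e. good (f e) (g e) (h e))"
  by (rule D_app3[where R = good]) (unfold good_def, intro dfn)

lemma D_bs [dfn]: "df f \<Longrightarrow> df g \<Longrightarrow> df h \<Longrightarrow> D (\<lambda>e. bs (f e) (g e) (h e))"
  by (rule D_app3[where R = bs]) (unfold bs_def, intro dfn)

lemma D_dg [dfn]: "df f \<Longrightarrow> df g \<Longrightarrow> df h \<Longrightarrow> D (\<lambda>e. dg (f e) (g e) (h e))"
  by (rule D_app3[where R = dg]) (unfold dg_def, intro dfn)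

lemma dg_iff:
  assumes "i \<sqsubset> n"
  shows "dg e u (j \<otimes> n \<oplus> i) \<longleftrightarrow> Lb (run (st (u \<oplus> j)) i) = e \<and>
     \<not> lf (Q (run (st (u \<oplus> j)) i)) \<and> ans (st (u \<oplus> j)) (run (st (u \<oplus> j)) i) \<noteq> \<zero>"
proof -
  have "j \<otimes> n \<oplus> i = j' \<otimes> n \<oplus> i' \<and> i' \<sqsubset> n \<longleftrightarrow> j' = j \<and> i' = i" for j' i'
    using division_unique[of j n i j' i'] assms by auto
  then show ?thesis unfolding dg_def by (metis (no_types, lifting))
qed

definition nxt :: "'a \<Rightarrow> 'a \<Rightarrow> 'a \<Rightarrow> 'a \<Rightarrow> bool" where
  "nxt e t u v \<longleftrightarrow> t \<sqsubseteq> u \<and> bs e t u \<and> u \<sqsubseteq> v \<and> lv (st v) = e \<and> (\<forall>w. u \<sqsubseteq> w \<and> w \<sqsubset> v \<longrightarrow> lv (st w) \<noteq> e)"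

text \<open>A correction at level \<open>e\<close> deletes all facts above \<open>e\<close>, so a
  block starts without them.\<close>

lemma nof_bs:
  assumes "good e t W" "bs e t u" "t \<sqsubseteq> u" "u \<sqsubseteq> sc W"
  shows "nof (sc e) (st u)"
  using assms(2) unfolding bs_def
proof
  assume "u = t"
  then show ?thesis using assms(1) unfolding good_def nof_def by (auto intro: A.less_imp_le)
next
  assume "\<exists>u'. u = sc u' \<and> t \<sqsubseteq> u' \<and> lv (st u') = e"
  then obtain u' where u: "u = sc u'" "t \<sqsubseteq> u'" "lv (st u') = e" by blast
  then have h: "\<not> halt (st u')" using assms(1,4) unfolding good_def by auto
  then obtain i a where "nf (st u') = pr (pr (Q (run (st u') i)) e) a"
    using cw_props[OF h] u(3) by metis
  then show ?thesis unfolding nof_def u(1) st_S using h by (auto simp: mem_upd u(3))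
qed

text \<open>The new block starts with the facts of the old one and a single further fact. It
  imitates the old block until the node of this fact is first queried with label \<open>e\<close>;
  there the digit changes from 0 to 1.\<close>

lemma lexi:
  assumes g: "good e t W" and nx: "nxt e t u v" and vW: "v \<sqsubseteq> W" and N: "v \<sqsubseteq> u \<oplus> B"
  shows "\<exists>x. x \<sqsubset> sc B \<otimes> n \<and> (\<forall>y. y \<sqsubset> x \<longrightarrow> dg e u y = dg e (sc v) y) \<and> \<not> dg e u x \<and> dg e (sc v) x"
proof -
  have u: "t \<sqsubseteq> u" "bs e t u" "u \<sqsubseteq> v" "lv (st v) = e" "\<And>w. u \<sqsubseteq> w \<Longrightarrow> w \<sqsubset> v \<Longrightarrow> lv (st w) \<noteq> e"
    using nx unfolding nxt_def by blast+
  have gd: "\<not> halt (st w)" "e \<sqsubseteq> lv (st w)" if "u \<sqsubseteq> w" "w \<sqsubseteq> v" for w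
    using g that u(1) vW unfolding good_def by (meson A.order_trans)+
  have "u \<sqsubseteq> sc W" using u(3) vW by (metis A.le_less A.order_trans less_S)
  then have nu: "nof (sc e) (st u)" using nof_bs[OF g u(2,1)] by blast
  obtain iv jv a where iv: "iv \<sqsubset> n" "\<not> lf (Q (run (st v) iv))" "ans (st v) (run (st v) iv) = \<zero>"
    "e = Lb (run (st v) iv)" "nf (st v) = pr (pr (Q (run (st v) iv)) e) a"
    using cw_props[OF gd(1)[OF u(3) A.order_refl]] u(4) by metis
  define p where "p = Q (run (st v) iv)"
  define f where "f = nf (st v)"
  have f: "f = pr (pr p e) a" using iv(5) by (simp add: f_def p_def)
  \<comment> \<open>Inside the block only levels above \<open>e\<close> are corrected, so the facts
    up to level \<open>e\<close> remain those of its start.\<close>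
  have low: "\<forall>x. x \<epsilon> st (u \<oplus> k) \<and> ps (pf x) \<sqsubseteq> e \<longleftrightarrow> x \<epsilon> st u" if "u \<oplus> k \<sqsubseteq> v" for k
  proof -
    have "u \<oplus> k \<sqsubseteq> v \<longrightarrow> (\<forall>x. x \<epsilon> st (u \<oplus> k) \<and> ps (pf x) \<sqsubseteq> e \<longleftrightarrow> x \<epsilon> st u)"
    proof (induction k rule: ind)
      case Z
      show ?case using nu unfolding nof_def by auto
    next
      case (S k)
      show ?case
      proof (intro impI)
        assume k: "u \<oplus> sc k \<sqsubseteq> v"
        then have k': "u \<oplus> k \<sqsubset> v" by simp
        note h = gd[OF le_add(1) A.less_imp_le[OF k']]
        have "e \<sqsubset> lv (st (u \<oplus> k))" using h(2) u(5)[OF le_add(1) k'] by (auto simp: A.le_less)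
        moreover obtain i' b where "nf (st (u \<oplus> k)) = pr (pr (Q (run (st (u \<oplus> k)) i')) (lv (st (u \<oplus> k)))) b"
          using cw_props[OF h(1)] by metis
        moreover have "\<forall>x. x \<epsilon> st (u \<oplus> k) \<and> ps (pf x) \<sqsubseteq> e \<longleftrightarrow> x \<epsilon> st u"
          using S k' A.less_imp_le by blast
        ultimately show "\<forall>x. x \<epsilon> st (u \<oplus> sc k) \<and> ps (pf x) \<sqsubseteq> e \<longleftrightarrow> x \<epsilon> st u"
          using h(1) A.order_trans[OF _ A.less_imp_le, of _ e "lv (st (u \<oplus> k))"]
          by (auto simp: st_S mem_upd)
      qed
    next
      case D show ?case by (intro dfn)
    qed
    then show ?thesis using that by blast
  qed
  obtain kv where kv: "v = u \<oplus> kv" using u(3) by (auto simp: le_def)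
  then have kvB: "kv \<sqsubseteq> B" using N by simp
  \<comment> \<open>The correction at \<open>v\<close> found this query answered false, and facts of
    level \<open>e\<close> do not change inside the block; so no witness was recorded for it at any
    stage of the block.\<close>
  have fnew: "\<not> pr (pr p e) b \<epsilon> st (u \<oplus> k)" if "u \<oplus> k \<sqsubseteq> v" for b k
  proof -
    have "\<not> pr (pr p e) b \<epsilon> st v"
      using iv(3) ans_0[OF iv(2)] iv(4) unfolding p_def by metis
    then have "\<not> pr (pr p e) b \<epsilon> st u" using low[of kv] kv by (metis A.order_refl)
    then show ?thesis using low[OF that] by (metis A.order_refl pf_pr ps_pr)
  qed
  \<comment> \<open>The positions in the block at which the node to be corrected is queried with its
    label. The correction at \<open>v\<close> itself provides one.\<close>
  define qp where "qp x \<longleftrightarrow> (\<exists>j i. x = j \<otimes> n \<oplus> i \<and> i \<sqsubset> n \<and> u \<oplus> j \<sqsubseteq> v \<and>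
      Q (run (st (u \<oplus> j)) i) = p \<and> Lb (run (st (u \<oplus> j)) i) = e)" for x
  have "qp (kv \<otimes> n \<oplus> iv)" unfolding qp_def
    by (rule exI[of _ kv], rule exI[of _ iv]) (use kv iv(1,4) p_def in auto)
  moreover have "D (\<lambda>e. qp (e 0))" unfolding qp_def by (intro dfn)
  ultimately obtain x where x: "qp x" "\<And>y. qp y \<Longrightarrow> x \<sqsubseteq> y" using least[of qp] by blast
  then obtain j i where ji: "x = j \<otimes> n \<oplus> i" "i \<sqsubset> n" "u \<oplus> j \<sqsubseteq> v"
    "Q (run (st (u \<oplus> j)) i) = p" "Lb (run (st (u \<oplus> j)) i) = e" unfolding qp_def by blast
  have noq: "\<not> (Q (run (st (u \<oplus> j')) i') = p \<and> Lb (run (st (u \<oplus> j')) i') = e)"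
    if "i' \<sqsubset> n" "j' \<otimes> n \<oplus> i' \<sqsubset> x" "u \<oplus> j' \<sqsubseteq> v" for i' j'
    using x(2)[of "j' \<otimes> n \<oplus> i'"] that unfolding qp_def A.not_le[symmetric] by blast
  have same: "ans S' s = ans S s" if "\<And>y. y \<epsilon> S' \<longleftrightarrow> y \<epsilon> S \<or> y = f" "\<not> (Q s = p \<and> Lb s = e)" for S S' s
    using that by (intro ans_cong) (auto simp: f)
  \<comment> \<open>Up to the stage of the first such query the two blocks perform the same
    corrections: the additional fact has not influenced any answer, so the runs, the conflicts, and
    the least conflict coincide.\<close>
  have jle: "j' \<sqsubseteq> j \<longrightarrow> (\<forall>y. y \<epsilon> st (sc v \<oplus> j') \<longleftrightarrow> y \<epsilon> st (u \<oplus> j') \<or> y = f)" for j'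
  proof (induction j' rule: ind)
    case Z
    have "y \<epsilon> st (sc v) \<longleftrightarrow> y \<epsilon> st u \<or> y = f" for y
      using gd(1)[OF u(3) A.order_refl] low[of kv] kv u(4) by (simp add: st_S mem_upd f_def) 
    then show ?case by simp
  next
    case (S j')
    show ?case
    proof (intro impI)
      assume j': "sc j' \<sqsubseteq> j"
      let ?S = "st (u \<oplus> j')" and ?S' = "st (sc v \<oplus> j')"
      have mem: "\<And>y. y \<epsilon> ?S' \<longleftrightarrow> y \<epsilon> ?S \<or> y = f" using S j' by (simp add: A.less_imp_le)
      have uv: "u \<oplus> j' \<sqsubset> v" using j' ji(3) by (meson A.add_left_mono A.add_strict_left_mono A.less_le_trans S_le)
      have "j' \<otimes> n \<oplus> i' \<sqsubset> x" if "i' \<sqsubset> n" for i'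
        unfolding ji(1) using j' that by (intro division_less) auto
      then have "ans ?S (run ?S i') = ans ?S' (run ?S i')" if "i' \<sqsubset> n" for i'
        using same[OF mem noq] that uv by (metis A.less_imp_le)
      then have c: "cfl ?S' = cfl ?S" and r: "i' \<sqsubset> n \<Longrightarrow> run ?S' i' = run ?S i'" for i'
        using cfl_cong[of ?S ?S'] run_cong[of n ?S ?S' i'] A.less_imp_le by blast+
      have h: "\<not> halt ?S" using gd(1)[OF le_add(1) A.less_imp_le[OF uv]] .
      then have h': "\<not> halt ?S'" unfolding halt_def c .
      have cw: "cw ?S' = cw ?S" unfolding cw_def c ..
      have "pf (cw ?S) \<sqsubset> n" using cw_props[OF h] by metis
      then have "ci ?S' = ci ?S" unfolding ci_def cw using r by blast
      then have lvn: "lv ?S' = lv ?S" "nf ?S' = nf ?S" unfolding lv_def nf_def cw by simp_all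
      have "e \<sqsubseteq> lv ?S" using gd(2)[OF le_add(1) A.less_imp_le[OF uv]] .
      then have "\<forall>y. y \<epsilon> upd ?S' \<longleftrightarrow> y \<epsilon> upd ?S \<or> y = f"
        unfolding mem_upd lvn using mem by (auto simp: f)
      moreover have "st (sc v \<oplus> sc j') = upd ?S'" "st (u \<oplus> sc j') = upd ?S"
        using h h' by (simp_all only: add_S st_S if_False)
      ultimately show "\<forall>y. y \<epsilon> st (sc v \<oplus> sc j') \<longleftrightarrow> y \<epsilon> st (u \<oplus> sc j') \<or> y = f" by simp
    qed
  next
    case D show ?case by (intro dfn)
  qed
  have ag: "run (st (sc v \<oplus> j')) i' = run (st (u \<oplus> j')) i' \<and>
     (j' \<otimes> n \<oplus> i' \<sqsubset> x \<longrightarrow>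
      ans (st (sc v \<oplus> j')) (run (st (u \<oplus> j')) i') = ans (st (u \<oplus> j')) (run (st (u \<oplus> j')) i'))"
    if le: "j' \<otimes> n \<oplus> i' \<sqsubseteq> x" and i': "i' \<sqsubset> n" for j' i'
  proof -
    have j': "j' \<sqsubseteq> j" using division_less[OF _ ji(2), of j j' i'] le unfolding ji(1) by (meson A.not_le)
    then have mem: "\<And>y. y \<epsilon> st (sc v \<oplus> j') \<longleftrightarrow> y \<epsilon> st (u \<oplus> j') \<or> y = f" using jle by blast
    have uv: "u \<oplus> j' \<sqsubseteq> v" using j' ji(3) by (meson A.add_left_mono A.order_trans)
    have q: "ans (st (sc v \<oplus> j')) (run (st (u \<oplus> j')) k) = ans (st (u \<oplus> j')) (run (st (u \<oplus> j')) k)"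
      if "k \<sqsubset> n" "j' \<otimes> n \<oplus> k \<sqsubset> x" for k
      using same[OF mem noq[OF that uv]] .
    have "run (st (sc v \<oplus> j')) i' = run (st (u \<oplus> j')) i'"
    proof (rule run_cong[of i'])
      fix k assume k: "k \<sqsubset> i'"
      then have "j' \<otimes> n \<oplus> k \<sqsubset> x" using le by (meson A.add_strict_left_mono A.less_le_trans)
      then show "ans (st (u \<oplus> j')) (run (st (u \<oplus> j')) k) = ans (st (sc v \<oplus> j')) (run (st (u \<oplus> j')) k)"
        using q[OF A.less_trans[OF k i']] by simp
    qed simp
    then show ?thesis using q i' by blast
  qed
  have "dg e u y = dg e (sc v) y" if y: "y \<sqsubset> x" for y
  proof -
    have "n \<noteq> \<zero>" using ji(2) by auto
    then obtain j' i' where y': "y = j' \<otimes> n \<oplus> i'" "i' \<sqsubset> n" using division by blast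
    show ?thesis unfolding y'(1) dg_iff[OF y'(2)]
      using ag[of j' i'] y' y A.less_imp_le by metis
  qed
  moreover have "\<not> dg e u x"
    unfolding ji(1) dg_iff[OF ji(2)] using fnew[OF ji(3)] ans_0 ji(4,5) by metis
  moreover have "dg e (sc v) x"
  proof -
    have r: "run (st (sc v \<oplus> j)) i = run (st (u \<oplus> j)) i" using ag[of j i] ji by auto
    have l: "\<not> lf (Q (run (st (u \<oplus> j)) i))" using iv(2) ji(4) p_def by metis
    have "f \<epsilon> st (sc v \<oplus> j)" using jle[of j] by blast
    then have "ans (st (sc v \<oplus> j)) (run (st (u \<oplus> j)) i) \<noteq> \<zero>" using ans_0[OF l] ji(4,5) f by metis
    then show ?thesis unfolding ji(1) dg_iff[OF ji(2)] r using l ji(5) by blast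
  qed
  moreover have "x \<sqsubset> sc B \<otimes> n"
  proof -
    have "j \<sqsubseteq> kv" using ji(3) kv by simp
    then have "j \<sqsubset> sc B" using kvB A.order_trans by simp
    from division_less[OF this ji(2), of \<zero>] show ?thesis unfolding ji(1) by simp
  qed
  ultimately show ?thesis by blast
qed

text \<open>A binary word that only increases lexicographically changes boundedly often. The
  induction is on the number \<open>r\<close> of digits not known to be constant: while the digits
  before \<open>m\<close> are fixed, digit \<open>m\<close> changes at most once, so an additional
  free digit doubles the bound, up to the length of one block.\<close>

lemma lex_bound:
  assumes "m \<oplus> r = sc B \<otimes> n" and EB: "E (sc e) B"
  shows "\<exists>K. \<forall>t W u v. good e t W \<and> t \<sqsubseteq> u \<and> u \<sqsubseteq> v \<and> v \<sqsubseteq> sc W \<and> bs e t u \<and> bs e t v \<and>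
    (\<forall>z y. u \<sqsubseteq> z \<and> z \<sqsubseteq> v \<and> bs e t z \<and> y \<sqsubset> m \<longrightarrow> dg e z y = dg e u y) \<longrightarrow> v \<sqsubseteq> u \<oplus> K"
proof -
  \<comment> \<open>At a block start the bound for level \<open>sc e\<close> applies, and it forces
    the next correction of level \<open>e\<close> within \<open>B\<close> steps.\<close>
  have nxt_ex: "\<exists>z. nxt e t u z \<and> sc z \<sqsubseteq> v \<and> z \<sqsubseteq> u \<oplus> B"
    if g: "good e t W" and H: "t \<sqsubseteq> u" "u \<sqsubset> v" "v \<sqsubseteq> sc W" "bs e t u" "bs e t v" for t W u v
  proof -
    obtain v' where v': "v = sc v'" "u \<sqsubseteq> v'" "lv (st v') = e"
      using H(1,2,5) unfolding bs_def by (metis A.not_less less_S)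
    have "D (\<lambda>d. u \<sqsubseteq> d 0 \<and> lv (st (d 0)) = e)" by (intro dfn)
    from least[OF this] obtain z where z: "u \<sqsubseteq> z" "lv (st z) = e"
      "\<And>y. u \<sqsubseteq> y \<Longrightarrow> lv (st y) = e \<Longrightarrow> z \<sqsubseteq> y" using v' by blast
    have zv: "z \<sqsubseteq> v'" using z(3) v' by blast
    have "u \<sqsubseteq> sc W" using H(2,3) by (meson A.less_imp_le A.order_trans)
    then have "nof (sc e) (st u)" using nof_bs[OF g H(4) H(1)] by blast
    then obtain w where w: "u \<sqsubseteq> w" "w \<sqsubseteq> u \<oplus> B" "halt (st w) \<or> lv (st w) \<sqsubset> sc e"
      using EB unfolding E_def by blast
    have "z \<sqsubseteq> w"
    proof (cases "w \<sqsubseteq> W")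
      case True
      then have "\<not> halt (st w)" "e \<sqsubseteq> lv (st w)" using g w(1) H(1) A.order_trans unfolding good_def by blast+
      then have "lv (st w) = e" using w(3) le_antisym by auto
      then show ?thesis using z(3) w(1) by blast
    next
      case False
      then show ?thesis using zv v'(1) H(3) by (simp add: A.not_le)
    qed
    then have "z \<sqsubseteq> u \<oplus> B" using w(2) A.order_trans by blast
    moreover have "nxt e t u z" unfolding nxt_def using z H(1,4) by (metis A.not_le)
    ultimately show ?thesis using zv v'(1) by auto
  qed
  have bsz: "nxt e t u z \<Longrightarrow> bs e t (sc z)" for t u z
    unfolding bs_def nxt_def by (metis A.order_trans)
  have "\<forall>m. m \<oplus> r = sc B \<otimes> n \<longrightarrow> (\<exists>K. \<forall>t W u v. good e t W \<and> t \<sqsubseteq> u \<and> u \<sqsubseteq> v \<and> v \<sqsubseteq> sc W \<and> bs e t u \<and> bs e t v \<and>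
    (\<forall>z y. u \<sqsubseteq> z \<and> z \<sqsubseteq> v \<and> bs e t z \<and> y \<sqsubset> m \<longrightarrow> dg e z y = dg e u y) \<longrightarrow> v \<sqsubseteq> u \<oplus> K)" (is "?P r")
  proof (induction r rule: ind)
    case Z
    show ?case
    proof (intro allI impI, rule exI[of _ \<zero>], intro allI impI, elim conjE)
      fix m t W u v
      assume m: "m \<oplus> \<zero> = sc B \<otimes> n" and *: "good e t W" "t \<sqsubseteq> u" "u \<sqsubseteq> v" "v \<sqsubseteq> sc W" "bs e t u" "bs e t v"
        and ag: "\<forall>z y. u \<sqsubseteq> z \<and> z \<sqsubseteq> v \<and> bs e t z \<and> y \<sqsubset> m \<longrightarrow> dg e z y = dg e u y"
      have "\<not> u \<sqsubset> v"
      proof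
        assume "u \<sqsubset> v"
        then obtain z where z: "nxt e t u z" "sc z \<sqsubseteq> v" "z \<sqsubseteq> u \<oplus> B" using nxt_ex * by blast
        then have "z \<sqsubseteq> W" using *(4) by (metis A.le_less_trans S_le less_S A.less_le_trans)
        from lexi[OF *(1) z(1) this z(3)] obtain x where "x \<sqsubset> m" "\<not> dg e u x" "dg e (sc z) x" using m by auto
        moreover have "u \<sqsubseteq> sc z" using z(1) unfolding nxt_def by (meson A.less_imp_le less_S)
        ultimately show False using ag z(2) bsz[OF z(1)] by blast
      qed
      then show "v \<sqsubseteq> u \<oplus> \<zero>" by (simp add: A.not_less)
    qed
  next
    case (S r)
    show ?case
    proof (intro allI impI)
      fix m assume m: "m \<oplus> sc r = sc B \<otimes> n"
      then have "sc m \<oplus> r = sc B \<otimes> n" by simp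
      with S obtain K where K0: "\<forall>t W u v. good e t W \<and> t \<sqsubseteq> u \<and> u \<sqsubseteq> v \<and> v \<sqsubseteq> sc W \<and> bs e t u \<and> bs e t v \<and>
        (\<forall>z y. u \<sqsubseteq> z \<and> z \<sqsubseteq> v \<and> bs e t z \<and> y \<sqsubset> sc m \<longrightarrow> dg e z y = dg e u y) \<longrightarrow> v \<sqsubseteq> u \<oplus> K" by meson
      have K: "good e t W \<Longrightarrow> t \<sqsubseteq> u \<Longrightarrow> u \<sqsubseteq> v \<Longrightarrow> v \<sqsubseteq> sc W \<Longrightarrow> bs e t u \<Longrightarrow> bs e t v \<Longrightarrow>
        (\<And>z y. u \<sqsubseteq> z \<Longrightarrow> z \<sqsubseteq> v \<Longrightarrow> bs e t z \<Longrightarrow> y \<sqsubset> sc m \<Longrightarrow> dg e z y = dg e u y) \<Longrightarrow> v \<sqsubseteq> u \<oplus> K" for t W u v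
        by (rule K0[THEN spec, THEN spec, THEN spec, THEN spec, THEN mp]) (intro conjI allI impI; blast)
      show "\<exists>K. \<forall>t W u v. good e t W \<and> t \<sqsubseteq> u \<and> u \<sqsubseteq> v \<and> v \<sqsubseteq> sc W \<and> bs e t u \<and> bs e t v \<and>
        (\<forall>z y. u \<sqsubseteq> z \<and> z \<sqsubseteq> v \<and> bs e t z \<and> y \<sqsubset> m \<longrightarrow> dg e z y = dg e u y) \<longrightarrow> v \<sqsubseteq> u \<oplus> K"
      \<comment> \<open>Two periods in which digit \<open>m\<close> is constant, separated by one
        block of length at most \<open>sc B\<close>.\<close>
      proof (rule exI[of _ "K \<oplus> sc B \<oplus> K"], intro allI impI, elim conjE)
        fix t W u v
        assume *: "good e t W" "t \<sqsubseteq> u" "u \<sqsubseteq> v" "v \<sqsubseteq> sc W" "bs e t u" "bs e t v"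
          and ag0: "\<forall>z y. u \<sqsubseteq> z \<and> z \<sqsubseteq> v \<and> bs e t z \<and> y \<sqsubset> m \<longrightarrow> dg e z y = dg e u y"
        then have ag: "\<And>z y. u \<sqsubseteq> z \<Longrightarrow> z \<sqsubseteq> v \<Longrightarrow> bs e t z \<Longrightarrow> y \<sqsubset> m \<Longrightarrow> dg e z y = dg e u y" by blast
        \<comment> \<open>The first digit that changes is not below \<open>m\<close>, where the
          words agree, and it is not \<open>m\<close>, which is set already; so it lies beyond
          \<open>m\<close>.\<close>
        have step: "dg e z m \<Longrightarrow> dg e (sc z') m" if T: "u \<sqsubseteq> z" "nxt e t z z'" "sc z' \<sqsubseteq> v" for z z'
        proof -
          have zz: "z \<sqsubseteq> sc z'" "bs e t z" using T(2) unfolding nxt_def by (auto intro: A.less_imp_le)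
          have "z \<sqsubset> sc z'" using T(2) unfolding nxt_def by simp
          moreover have "t \<sqsubseteq> z" using T(1) *(2) A.order_trans by blast
          moreover have scW: "sc z' \<sqsubseteq> sc W" using T(3) *(4) A.order_trans by blast
          ultimately obtain z2 where z2: "nxt e t z z2" "z2 \<sqsubseteq> z \<oplus> B" using nxt_ex[OF *(1)] zz(2) bsz[OF T(2)] by blast
          have "z2 = z'" using z2(1) T(2) unfolding nxt_def by (metis A.neq_iff)
          then have "z' \<sqsubseteq> z \<oplus> B" "z' \<sqsubseteq> W" using z2(2) scW by auto
          from lexi[OF *(1) T(2) this(2,1)] obtain x where
            x: "\<forall>y. y \<sqsubset> x \<longrightarrow> dg e z y = dg e (sc z') y" "\<not> dg e z x" "dg e (sc z') x" by blast
          have "\<not> x \<sqsubset> m"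
            using ag[of z x] ag[of "sc z'" x] x T(1,3) zz bsz[OF T(2)] A.order_trans by blast
          then show "dg e z m \<Longrightarrow> dg e (sc z') m" using x A.neq_iff by metis
        qed
        have mono: "z1 \<sqsubseteq> z2 \<and> z2 \<sqsubseteq> v \<and> bs e t z2 \<longrightarrow> dg e z2 m" if z1: "u \<sqsubseteq> z1" "bs e t z1" "dg e z1 m" for z1 z2
        proof (induction z2 rule: less_ind)
          case (L z2)
          show ?case
          proof (intro impI, elim conjE)
            assume z2: "z1 \<sqsubseteq> z2" "z2 \<sqsubseteq> v" "bs e t z2"
            show "dg e z2 m"
            proof (cases "z1 = z2")
              case False
              then have lt: "z1 \<sqsubset> z2" using z2(1) A.le_less by blast
              have "D (\<lambda>d. z1 \<sqsubseteq> d 0 \<and> d 0 \<sqsubset> z2 \<and> bs e t (d 0))" by (intro dfn)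
              from bounded_max[OF this, of z1 z2] obtain z where
                z: "z1 \<sqsubseteq> z" "z \<sqsubset> z2" "bs e t z" "\<And>y. z1 \<sqsubseteq> y \<Longrightarrow> y \<sqsubset> z2 \<Longrightarrow> bs e t y \<Longrightarrow> y \<sqsubseteq> z"
                using lt z1 A.less_imp_le by blast
              have uz: "u \<sqsubseteq> z" using z1(1) z(1) A.order_trans by blast
              obtain z' where z': "nxt e t z z'" "sc z' \<sqsubseteq> z2"
                using nxt_ex[OF *(1) _ z(2) _ z(3) z2(3)] uz *(2,4) z2(2) A.order_trans by blast
              have "sc z' = z2"
              proof (rule ccontr)
                assume "sc z' \<noteq> z2"
                then have "sc z' \<sqsubset> z2" using z'(2) A.le_less by blast
                moreover have "z \<sqsubset> sc z'" using z'(1) unfolding nxt_def by simp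
                moreover have "z1 \<sqsubseteq> sc z'" using z(1) \<open>z \<sqsubset> sc z'\<close> by (meson A.less_imp_le A.order_trans)
                ultimately show False using z(4)[of "sc z'"] bsz[OF z'(1)] by (meson A.not_le)
              qed
              moreover have "dg e z m" using L[OF z(2)] z z2(2) by (meson A.less_imp_le A.order_trans)
              ultimately show ?thesis using step[OF uz z'(1)] z2(2) by blast
            qed (use z1 in simp)
          qed
        next
          case D show ?case by (intro dfn)
        qed
        show "v \<sqsubseteq> u \<oplus> (K \<oplus> sc B \<oplus> K)"
        proof (cases "\<exists>z. u \<sqsubseteq> z \<and> z \<sqsubseteq> v \<and> bs e t z \<and> dg e z m \<noteq> dg e u m")
          case False
          have "v \<sqsubseteq> u \<oplus> K"
          proof (rule K[OF *])
            show "dg e z y = dg e u y" if "u \<sqsubseteq> z" "z \<sqsubseteq> v" "bs e t z" "y \<sqsubset> sc m" for z y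
              using that ag[of z y] False by (auto simp: A.le_less)
          qed
          then show ?thesis by (simp add: add_assoc) (meson A.add_left_mono A.less_imp_le A.order_trans le_add(1) less_S)
        next
          case True
          have um: "\<not> dg e u m" using True mono[OF A.order_refl *(5)] by blast
          \<comment> \<open>Below, \<open>z\<close> is the first block start with digit
            \<open>m\<close> set, and \<open>w\<close> is the block start before it. The digits up
            to \<open>m\<close> are constant from \<open>u\<close> to \<open>w\<close> and again
            from \<open>z\<close> to \<open>v\<close>.\<close>
          have "D (\<lambda>d. u \<sqsubseteq> d 0 \<and> d 0 \<sqsubseteq> v \<and> bs e t (d 0) \<and> dg e (d 0) m)" by (intro dfn)
          from least[OF this] obtain z where z: "u \<sqsubseteq> z" "z \<sqsubseteq> v" "bs e t z" "dg e z m"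
            "\<And>y. u \<sqsubseteq> y \<Longrightarrow> y \<sqsubseteq> v \<Longrightarrow> bs e t y \<Longrightarrow> dg e y m \<Longrightarrow> z \<sqsubseteq> y" using True um by blast
          have uz: "u \<sqsubset> z" using z(1,4) um A.le_less by metis
          have "D (\<lambda>d. u \<sqsubseteq> d 0 \<and> d 0 \<sqsubset> z \<and> bs e t (d 0))" by (intro dfn)
          from bounded_max[OF this, of u z] obtain w where
            w: "u \<sqsubseteq> w" "w \<sqsubset> z" "bs e t w" "\<And>y. u \<sqsubseteq> y \<Longrightarrow> y \<sqsubset> z \<Longrightarrow> bs e t y \<Longrightarrow> y \<sqsubseteq> w"
            using uz *(5) A.less_imp_le by blast
          have wv: "w \<sqsubseteq> v" using w(2) z(2) by (meson A.less_imp_le A.order_trans)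
          have uw: "w \<sqsubseteq> u \<oplus> K"
          proof (rule K[OF *(1,2) w(1) _ *(5) w(3)])
            show "w \<sqsubseteq> sc W" using wv *(4) A.order_trans by blast
            show "dg e x y = dg e u y" if x: "u \<sqsubseteq> x" "x \<sqsubseteq> w" "bs e t x" "y \<sqsubset> sc m" for x y
            proof -
              have "x \<sqsubset> z" using x(2) w(2) A.le_less_trans by blast
              then have "\<not> dg e x m" using z(5)[OF x(1) _ x(3)] z(2) A.not_le A.less_imp_le A.order_trans by blast
              moreover have "x \<sqsubseteq> v" using x(2) wv A.order_trans by blast
              ultimately show ?thesis using x ag[of x y] um by (auto simp: A.le_less)
            qed
          qed
          obtain z' where z': "nxt e t w z'" "sc z' \<sqsubseteq> z" "z' \<sqsubseteq> w \<oplus> B"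
            using nxt_ex[OF *(1) _ w(2) _ w(3) z(3)] w(1) *(2,4) z(2) A.order_trans by blast
          have "sc z' = z"
          proof (rule ccontr)
            assume "sc z' \<noteq> z"
            then have "sc z' \<sqsubset> z" using z'(2) A.le_less by blast
            moreover have "w \<sqsubset> sc z'" using z'(1) unfolding nxt_def by simp
            moreover have "u \<sqsubseteq> sc z'" using w(1) \<open>w \<sqsubset> sc z'\<close> by (meson A.less_imp_le A.order_trans)
            ultimately show False using w(4)[of "sc z'"] bsz[OF z'(1)] by (meson A.not_le)
          qed
          then have wz: "z \<sqsubseteq> w \<oplus> sc B" using z'(3) by auto
          have zv: "v \<sqsubseteq> z \<oplus> K"
          proof (rule K[OF *(1) _ z(2) *(4) z(3) *(6)])
            show "t \<sqsubseteq> z" using *(2) z(1) A.order_trans by blast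
            show "dg e x y = dg e z y" if x: "z \<sqsubseteq> x" "x \<sqsubseteq> v" "bs e t x" "y \<sqsubset> sc m" for x y
            proof -
              have ux: "u \<sqsubseteq> x" using z(1) x(1) A.order_trans by blast
              show ?thesis
                using mono[OF z(1,3,4)] x z(4) ag[OF ux x(2,3), of y] ag[OF z(1,2,3), of y] by (auto simp: A.le_less)
            qed
          qed
          have "z \<sqsubseteq> u \<oplus> K \<oplus> sc B" using A.order_trans[OF wz A.add_right_mono[OF uw]] .
          from A.order_trans[OF zv A.add_right_mono[OF this]] show ?thesis unfolding add_assoc .
        qed
      qed
    qed
  next
    case D show ?case by (intro dfn)
  qed
  then show ?thesis using assms(1) by blast
qed

text \<open>If levels below \<open>e\<close> were avoided too long, the last block start of the
  window would come at most \<open>K\<close> steps after \<open>t\<close>, and at most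
  \<open>B\<close> steps later a correction of level \<open>e\<close> would start yet another
  block.\<close>

lemma E_step:
  assumes EB: "E (sc e) B"
  shows "\<exists>B'. E e B'"
proof -
  have "\<zero> \<oplus> (sc B \<otimes> n) = sc B \<otimes> n" by simp
  from lex_bound[OF this EB] obtain K where "\<forall>t W u v. good e t W \<and> t \<sqsubseteq> u \<and> u \<sqsubseteq> v \<and> v \<sqsubseteq> sc W \<and>
      bs e t u \<and> bs e t v \<longrightarrow> v \<sqsubseteq> u \<oplus> K" by auto
  then have K: "good e t W \<Longrightarrow> t \<sqsubseteq> u \<Longrightarrow> u \<sqsubseteq> v \<Longrightarrow> v \<sqsubseteq> sc W \<Longrightarrow>
      bs e t u \<Longrightarrow> bs e t v \<Longrightarrow> v \<sqsubseteq> u \<oplus> K" for t W u v by blast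
  have "E e (K \<oplus> sc B)"
    unfolding E_def
  proof (intro allI impI, rule ccontr)
    fix t assume t: "nof e (st t)"
    define W where "W = t \<oplus> (K \<oplus> sc B)"
    assume "\<nexists>u. t \<sqsubseteq> u \<and> u \<sqsubseteq> t \<oplus> (K \<oplus> sc B) \<and> (halt (st u) \<or> lv (st u) \<sqsubset> e)"
    then have g: "good e t W" using t unfolding good_def W_def A.not_less[symmetric] by blast
    have "D (\<lambda>d. t \<sqsubseteq> d 0 \<and> d 0 \<sqsubseteq> W \<and> bs e t (d 0))" by (intro dfn)
    moreover have b0: "bs e t t" "t \<sqsubseteq> W" unfolding bs_def W_def using le_add(1) by blast+
    ultimately obtain v where v: "t \<sqsubseteq> v" "v \<sqsubseteq> W" "bs e t v"
      "\<And>y. t \<sqsubseteq> y \<Longrightarrow> y \<sqsubseteq> W \<Longrightarrow> bs e t y \<Longrightarrow> y \<sqsubseteq> v"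
      using bounded_max[of "\<lambda>x. t \<sqsubseteq> x \<and> x \<sqsubseteq> W \<and> bs e t x" t W] by blast
    have vW: "v \<sqsubseteq> sc W" using v(2) A.less_imp_le less_S by blast
    have "v \<sqsubseteq> t \<oplus> K" by (rule K[OF g A.order_refl v(1) vW _ v(3)]) (simp add: bs_def)
    obtain w where w: "v \<sqsubseteq> w" "w \<sqsubseteq> v \<oplus> B" "halt (st w) \<or> lv (st w) \<sqsubset> sc e"
      using EB nof_bs[OF g v(3,1) vW] unfolding E_def by blast
    have "w \<sqsubseteq> t \<oplus> K \<oplus> B" using w(2) \<open>v \<sqsubseteq> t \<oplus> K\<close> A.add_right_mono A.order_trans by blast
    then have wW: "sc w \<sqsubseteq> W" unfolding W_def by (simp add: add_assoc)
    have tw: "t \<sqsubseteq> w" using v(1) w(1) A.order_trans by blast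
    have "w \<sqsubseteq> W" using wW by (simp add: A.less_imp_le)
    then have "lv (st w) = e" using g w(3) tw unfolding good_def by (simp add: le_antisym)
    then have "bs e t (sc w)" using tw unfolding bs_def by blast
    moreover have "t \<sqsubseteq> sc w" using tw by (meson A.less_imp_le less_S)
    ultimately have "sc w \<sqsubseteq> v" using v(4) wW by blast
    then show False using w(1) by (simp add: A.not_le)
  qed
  then show ?thesis by blast
qed

text \<open>Downward induction on the level, from the bound \<open>L\<close> of all labels to level
  zero, below which no correction is possible.\<close>

lemma terminates:
  assumes P0: "\<And>S i. i \<sqsubset> n \<Longrightarrow> Lb (run S i) \<sqsubset> L"
  shows "\<exists>t. halt (st t)"
proof -
  have "\<forall>e. e \<oplus> r = L \<longrightarrow> (\<exists>B. E e B)" for r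
  proof (induction r rule: ind)
    case Z
    have "E L \<zero>"
      unfolding E_def
    proof (intro allI impI)
      fix t
      have "halt (st t) \<or> lv (st t) \<sqsubset> L" using cw_props[of "st t"] P0 by metis
      then show "\<exists>u. t \<sqsubseteq> u \<and> u \<sqsubseteq> t \<oplus> \<zero> \<and> (halt (st u) \<or> lv (st u) \<sqsubset> L)" by auto
    qed
    then show ?case by auto
  next
    case (S r)
    show ?case
    proof (intro allI impI)
      fix e assume "e \<oplus> sc r = L"
      then have "sc e \<oplus> r = L" by simp
      then show "\<exists>B. E e B" using S E_step by blast
    qed
  next
    case D show ?case by (intro dfn)
  qed
  from this[of L] obtain B where "E \<zero> B" by auto
  moreover have "nof \<zero> (st \<zero>)" unfolding nof_def by (auto dest: bit_less)
  ultimately show ?thesis unfolding E_def by (meson not_less_zero)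
qed

lemma nf_level: "\<not> halt S \<Longrightarrow> ps (pf (nf S)) = lv S"
  unfolding nf_def by simp

text \<open>A fact survives only corrections on its own level or above, and these leave all facts
  with smaller labels alone. So the smaller facts are still those present when it was added.\<close>

lemma origin:
  "\<forall>x. x \<epsilon> st t \<longrightarrow> (\<exists>u. \<not> halt (st u) \<and> nf (st u) = x \<and>
     (\<forall>y. ps (pf y) \<sqsubset> ps (pf x) \<longrightarrow> (y \<epsilon> st u) = (y \<epsilon> st t)))"
proof (induction t rule: ind)
  case Z
  show ?case by (auto dest: bit_less)
next
  case (S t)
  show ?case
  proof (cases "halt (st t)")
    case True
    then show ?thesis using S by (simp add: st_S)
  next
    case h: False
    show ?thesis
    proof (intro allI impI)
      fix x assume "x \<epsilon> st (sc t)"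
      then have "x \<epsilon> st t \<and> ps (pf x) \<sqsubseteq> lv (st t) \<or> x = nf (st t)" using h by (simp add: st_S mem_upd)
      then show "\<exists>u. \<not> halt (st u) \<and> nf (st u) = x \<and>
         (\<forall>y. ps (pf y) \<sqsubset> ps (pf x) \<longrightarrow> (y \<epsilon> st u) = (y \<epsilon> st (sc t)))"
      proof
        assume *: "x \<epsilon> st t \<and> ps (pf x) \<sqsubseteq> lv (st t)"
        then have "y \<epsilon> st t \<longleftrightarrow> y \<epsilon> st (sc t)" if "ps (pf y) \<sqsubset> ps (pf x)" for y
        proof -
          have "ps (pf y) \<sqsubset> lv (st t)" using that * A.less_le_trans by blast
          then show ?thesis using h nf_level[OF h] by (auto simp: st_S mem_upd A.less_imp_le)
        qed
        then show ?thesis using S * by metis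
      next
        assume x: "x = nf (st t)"
        have "ps (pf x) = lv (st t)" using x nf_level[OF h] by simp
        then have "y \<epsilon> st t \<longleftrightarrow> y \<epsilon> st (sc t)" if "ps (pf y) \<sqsubset> ps (pf x)" for y
          using that h x A.less_imp_le by (auto simp: st_S mem_upd)
        then show ?thesis using x h by metis
      qed
    qed
  qed
next
  case D show ?case by (intro dfn)
qed

lemma ans_key: "Q s = Q s' \<Longrightarrow> Lb s = Lb s' \<Longrightarrow> ans S s = ans S s'"
  unfolding ans_def by simp

text \<open>At a halting stage no false answer is refuted by a queried instance. A true answer was
  justified when its witness was recorded; the facts with smaller labels have not changed since, and
  by \<open>P2\<close> the instance has the same label in both runs, so it still has the same
  answer.\<close>

theorem consistent_run:
  assumes P0: "\<And>S i. i \<sqsubset> n \<Longrightarrow> Lb (run S i) \<sqsubset> L"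
    and P1: "\<And>S i j. i \<sqsubset> n \<Longrightarrow> j \<sqsubset> n \<Longrightarrow> Q (run S i) = Q (run S j) \<Longrightarrow> Lb (run S i) = Lb (run S j)"
      "\<And>S i j a. i \<sqsubset> n \<Longrightarrow> j \<sqsubset> n \<Longrightarrow> \<not> lf (Q (run S i)) \<Longrightarrow> Q (run S j) = inst (Q (run S i)) a \<Longrightarrow>
        Lb (run S j) \<sqsubset> Lb (run S i)"
    and P2: "\<And>S S' i j i' j' a. i \<sqsubset> n \<Longrightarrow> j \<sqsubset> n \<Longrightarrow> i' \<sqsubset> n \<Longrightarrow> j' \<sqsubset> n \<Longrightarrow> \<not> lf (Q (run S i)) \<Longrightarrow>
        Q (run S' i') = Q (run S i) \<Longrightarrow> Lb (run S' i') = Lb (run S i) \<Longrightarrow>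
        Q (run S j) = inst (Q (run S i)) a \<Longrightarrow> Q (run S' j') = inst (Q (run S i)) a \<Longrightarrow>
        (\<And>x. ps (pf x) \<sqsubset> Lb (run S i) \<Longrightarrow> (x \<epsilon> S) = (x \<epsilon> S')) \<Longrightarrow> Lb (run S j) = Lb (run S' j')"
  shows "\<exists>S. okR (\<lambda>p b. \<exists>i. i \<sqsubset> n \<and> p = Q (run S i) \<and> b = ans S (run S i))"
proof -
  obtain t where t: "halt (st t)" using terminates P0 by blast
  let ?S = "st t"
  let ?R = "\<lambda>p b. \<exists>i. i \<sqsubset> n \<and> p = Q (run ?S i) \<and> b = ans ?S (run ?S i)"
  have "okR ?R"
    unfolding okR_def
  proof (intro conjI allI impI; elim conjE exE)
    fix p a b i j
    assume *: "i \<sqsubset> n" "j \<sqsubset> n" "p = Q (run ?S i)" "p = Q (run ?S j)"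
      and a: "a = ans ?S (run ?S i)" "b = ans ?S (run ?S j)"
    have "Lb (run ?S i) = Lb (run ?S j)" using P1(1) * by metis
    then show "a = b" using ans_key[of "run ?S i" "run ?S j" ?S] *(3,4) a by simp
  next
    fix p a i
    assume "lf p" "p = Q (run ?S i)" "a = ans ?S (run ?S i)"
    then show "(a \<noteq> \<zero>) = At p" unfolding ans_def by simp
  next
    fix p a b i j
    assume l: "\<not> lf p" and *: "i \<sqsubset> n" "j \<sqsubset> n" "p = Q (run ?S i)" "inst p a = Q (run ?S j)"
      and a: "sc a = ans ?S (run ?S i)" and b: "b = ans ?S (run ?S j)"
    let ?x = "pr (pr p (Lb (run ?S i))) a"
    have "?x \<epsilon> ?S" using ans_sc[of "run ?S i" ?S a] l *(3) a by simp
    then obtain u where u: "\<not> halt (st u)" "nf (st u) = ?x"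
      "\<And>y. ps (pf y) \<sqsubset> Lb (run ?S i) \<Longrightarrow> (y \<epsilon> st u) = (y \<epsilon> ?S)" using origin[of t] by fastforce
    obtain i' j' where i': "i' \<sqsubset> n" "j' \<sqsubset> n" "Q (run (st u) j') = inst p a" "Q (run (st u) i') = p"
      "Lb (run (st u) i') = Lb (run ?S i)" "(ans (st u) (run (st u) j') \<noteq> \<zero>) = sg p"
      by (rule cw_props[OF u(1)]) (use u(2) in auto)
    have lab: "Lb (run ?S j) = Lb (run (st u) j')"
      using P2[of i j i' j' ?S "st u" a] * i' l u(3) by simp
    moreover have "Lb (run ?S j) \<sqsubset> Lb (run ?S i)" using P1(2)[OF *(1,2), of ?S a] l *(3) *(4)[symmetric] by simp
    ultimately have "ans ?S (run ?S j) = ans (st u) (run ?S j)"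
      by (intro ans_cong) (simp add: u(3))
    also have "... = ans (st u) (run (st u) j')" by (rule ans_key) (use lab i' *(4) in simp_all)
    finally show "(b \<noteq> \<zero>) = sg p" using b i'(6) by simp
  next
    fix p a b i j
    assume "\<not> lf p" "i \<sqsubset> n" "j \<sqsubset> n" "p = Q (run ?S i)" "inst p a = Q (run ?S j)"
      "\<zero> = ans ?S (run ?S i)" "b = ans ?S (run ?S j)"
    moreover have "\<not> cfl ?S (pr i (pr j a))" using t unfolding halt_def by blast
    ultimately show "(b \<noteq> \<zero>) \<noteq> sg p" unfolding cfl_def by force
  qed
  then show ?thesis by blast
qed

end

section \<open>Counting the elements of definable sets\<close>

context pa
begin

definition cnt :: "('a \<Rightarrow> bool) \<Rightarrow> 'a \<Rightarrow> 'a" where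
  "cnt P v = mrec \<zero> (\<lambda>u k. if P u then sc k else k) v"

lemma df_cnt [dfn]:
  assumes P: "D (\<lambda>e. P (\<lambda>n. e (Suc n)) (e 0))" and v: "df v"
  shows "df (\<lambda>e. cnt (P e) (v e))"
proof -
  have "inj (\<lambda>n. Suc n)" by simp
  from D_inj[OF P this] have "D (\<lambda>e. P (\<lambda>n. e (Suc (Suc n))) (e (Suc 0)))" by simp
  then show ?thesis unfolding cnt_def by (intro dfn v) (simp add: numeral_eq_Suc)
qed

lemma cnt_simps:
  assumes P: "D (\<lambda>e. P (e 0))"
  shows "cnt P \<zero> = \<zero>" "cnt P (sc v) = (if P v then sc (cnt P v) else cnt P v)"
proof -
  have DP: "D (\<lambda>e. P (e i))" for i by (rule D_at[OF P])
  have "df (\<lambda>e. (\<lambda>u k. if P u then sc k else k) (e 1) (e 0))" by (intro dfn DP)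
  from mrec_0[OF this] mrec_S[OF this]
  show "cnt P \<zero> = \<zero>" "cnt P (sc v) = (if P v then sc (cnt P v) else cnt P v)"
    unfolding cnt_def by simp_all
qed

lemma cnt_mono:
  assumes P: "D (\<lambda>e. P (e 0))" and R: "D (\<lambda>e. R (e 0))" and "\<And>u. P u \<Longrightarrow> R u"
  shows "cnt P v \<sqsubseteq> cnt R v"
proof (induction v rule: ind)
  case (S v)
  then show ?case using assms(3)[of v] by (simp add: cnt_simps P R le_SI)
next
  case D
  have "D (\<lambda>e. P (e i))" "D (\<lambda>e. R (e i))" for i by (rule D_at[OF P] D_at[OF R])+
  then show ?case by (intro dfn)
qed (simp add: cnt_simps P R)

lemma cnt_mono_less:
  assumes P: "D (\<lambda>e. P (e 0))" and R: "D (\<lambda>e. R (e 0))" and le: "\<And>u. P u \<Longrightarrow> R u"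
    and w: "R w" "\<not> P w"
  shows "w \<sqsubset> v \<Longrightarrow> cnt P v \<sqsubset> cnt R v"
proof -
  have "w \<sqsubset> v \<longrightarrow> cnt P v \<sqsubset> cnt R v"
  proof (induction v rule: ind)
    case (S v)
    show ?case
    proof
      assume "w \<sqsubset> sc v"
      then consider "w = v" | "w \<sqsubset> v" by (auto simp: A.le_less)
      then show "cnt P (sc v) \<sqsubset> cnt R (sc v)"
      proof cases
        case 1
        then show ?thesis using w cnt_mono[OF P R le, of v] by (simp add: cnt_simps P R)
      next
        case 2
        then show ?thesis using S le[of v] by (auto simp: cnt_simps P R A.less_imp_le)
      qed
    qed
  next
    case D
    have "D (\<lambda>e. P (e i))" "D (\<lambda>e. R (e i))" for i by (rule D_at[OF P] D_at[OF R])+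
    then show ?case by (intro dfn)
  qed simp
  then show "w \<sqsubset> v \<Longrightarrow> cnt P v \<sqsubset> cnt R v" by blast
qed

lemma cnt_less:
  assumes P: "D (\<lambda>e. P (e 0))" and "P v"
  shows "v \<sqsubset> w \<Longrightarrow> cnt P v \<sqsubset> cnt P w"
proof -
  have "v \<sqsubset> w \<longrightarrow> cnt P v \<sqsubset> cnt P w"
  proof (induction w rule: ind)
    case (S w)
    then show ?case using assms(2) by (auto simp: cnt_simps P A.le_less)
  next
    case D
    have "D (\<lambda>e. P (e i))" for i by (rule D_at[OF P])
    then show ?case by (intro dfn)
  qed simp
  then show "v \<sqsubset> w \<Longrightarrow> cnt P v \<sqsubset> cnt P w" by blast
qed

lemma cnt_un:
  assumes P: "D (\<lambda>e. P (e 0))" and R: "D (\<lambda>e. R (e 0))"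
  shows "cnt (\<lambda>u. P u \<or> R u) v \<sqsubseteq> cnt P v \<oplus> cnt R v"
proof -
  have DP: "D (\<lambda>e. P (e i))" "D (\<lambda>e. R (e i))" for i by (rule D_at[OF P] D_at[OF R])+
  have PR: "D (\<lambda>e. P (e 0) \<or> R (e 0))" by (intro dfn DP)
  show ?thesis
  proof (induction v rule: ind)
    case (S v)
    show ?case using S by (simp add: cnt_simps(2)[of "\<lambda>u. P u \<or> R u", OF PR] cnt_simps P R le_SI)
  next
    case D show ?case by (intro dfn DP)
  qed (simp add: cnt_simps(1)[of "\<lambda>u. P u \<or> R u", OF PR] cnt_simps P R)
qed

lemma cnt_one: "cnt (\<lambda>u. u = y) v \<sqsubseteq> sc \<zero>"
proof -
  have d: "D (\<lambda>e. e 0 = y)" by (intro dfn)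
  have "cnt (\<lambda>u. u = y) v \<sqsubseteq> sc \<zero> \<and> (v \<sqsubseteq> y \<longrightarrow> cnt (\<lambda>u. u = y) v = \<zero>)"
  proof (induction v rule: ind)
    case (S v)
    then show ?case by (auto simp: cnt_simps(2)[of "\<lambda>u. u = y", OF d] A.less_imp_le)
  next
    case D show ?case by (intro dfn)
  qed (simp add: cnt_simps(1)[of "\<lambda>u. u = y", OF d])
  then show ?thesis by blast
qed

text \<open>Induction on \<open>b\<close>: each further argument contributes at most one
  value.\<close>

lemma cnt_image:
  assumes P: "D (\<lambda>e. P (e 0))" and f: "df (\<lambda>e. f (e 0))"
  shows "cnt (\<lambda>v. \<exists>u. u \<sqsubset> b \<and> P u \<and> v = f u) w \<sqsubseteq> cnt P b"
proof (induction b rule: ind)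
  have DP: "D (\<lambda>e. P (e i))" and fi: "df (\<lambda>e. f (e i))" for i by (rule D_at[OF P] df_at[OF f])+
  case Z
  have "D (\<lambda>e. False)" by (intro dfn)
  then have "cnt (\<lambda>v. False) w = \<zero>"
    by (induction w rule: ind) (simp_all add: cnt_simps, intro dfn)
  then show ?case by simp
next
  have DP: "D (\<lambda>e. P (e i))" and fi: "df (\<lambda>e. f (e i))" for i by (rule D_at[OF P] df_at[OF f])+
  case (S b)
  have d: "D (\<lambda>e. \<exists>u. u \<sqsubset> b \<and> P u \<and> e 0 = f u)" "D (\<lambda>e. e 0 = f b)"
    by (intro dfn DP fi)+
  show ?case
  proof (cases "P b")
    case True
    have "(\<lambda>v. \<exists>u. u \<sqsubset> sc b \<and> P u \<and> v = f u) = (\<lambda>v. (\<exists>u. u \<sqsubset> b \<and> P u \<and> v = f u) \<or> v = f b)"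
      using True by (auto simp: A.le_less fun_eq_iff)
    then have "cnt (\<lambda>v. \<exists>u. u \<sqsubset> sc b \<and> P u \<and> v = f u) w \<sqsubseteq>
        cnt (\<lambda>v. \<exists>u. u \<sqsubset> b \<and> P u \<and> v = f u) w \<oplus> cnt (\<lambda>v. v = f b) w"
      using cnt_un[OF d] by simp
    also have "... \<sqsubseteq> cnt P b \<oplus> sc \<zero>" using S cnt_one by (rule A.add_mono)
    finally show ?thesis using True by (simp add: cnt_simps P)
  next
    case False
    have "(\<lambda>v. \<exists>u. u \<sqsubset> sc b \<and> P u \<and> v = f u) = (\<lambda>v. \<exists>u. u \<sqsubset> b \<and> P u \<and> v = f u)"
      using False by (auto simp: A.le_less fun_eq_iff)
    then show ?thesis using False S by (simp add: cnt_simps P)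
  qed
next
  have DP: "D (\<lambda>e. P (e i))" and fi: "df (\<lambda>e. f (e i))" for i by (rule D_at[OF P] df_at[OF f])+
  case D show ?case by (intro dfn DP fi)
qed

end

section \<open>Labels assigned during the run\<close>

locale layer = game M inst sg lf At for M :: "'a lpa" and inst sg lf At +
  fixes s0 :: 'a and Q :: "'a \<Rightarrow> 'a" and dl :: "'a \<Rightarrow> 'a \<Rightarrow> 'a" and n :: 'a and tm tl tr :: "'a \<Rightarrow> 'a"
  assumes Q_df: "df (\<lambda>e. Q (e 0))" and dl_df: "df (\<lambda>e. dl (e 1) (e 0))"
    and tm_df: "df (\<lambda>e. tm (e 0))" and tl_df: "df (\<lambda>e. tl (e 0))" and tr_df: "df (\<lambda>e. tr (e 0))"
    and edge: "\<not> lf p \<Longrightarrow> tm (inst p a) \<sqsubset> tm p" "\<not> lf p \<Longrightarrow> tm (inst p a) = tl (tm p) \<or> tm (inst p a) = tr (tm p)"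
begin

lemma df_layer [dfn]:
  "df f \<Longrightarrow> df (\<lambda>e. Q (f e))" "df f \<Longrightarrow> df g \<Longrightarrow> df (\<lambda>e. dl (f e) (g e))"
  "df f \<Longrightarrow> df (\<lambda>e. tm (f e))" "df f \<Longrightarrow> df (\<lambda>e. tl (f e))" "df f \<Longrightarrow> df (\<lambda>e. tr (f e))"
  by (erule df_comp[OF Q_df], rule df2[OF dl_df], assumption+, (erule df_comp[OF tm_df] df_comp[OF tl_df] df_comp[OF tr_df])+)

definition grow :: "'a \<Rightarrow> 'a" where
  "grow Y = cs (\<lambda>v. v \<epsilon> Y \<or> (\<exists>u. u \<epsilon> Y \<and> (v = tl u \<or> v = tr u)))"
definition bl :: "'a \<Rightarrow> 'a \<Rightarrow> 'a" where "bl X j = mrec X (\<lambda>_. grow) j"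
text \<open>Powers of three: one growth step adds at most two components per element, so
  \<open>kap h\<close> bounds the size of a ball of radius \<open>h\<close> around a single
  template.\<close>

definition kap :: "'a \<Rightarrow> 'a" where "kap h = mrec (sc \<zero>) (\<lambda>_ k. k \<oplus> k \<oplus> k) h"
text \<open>With one more query left, the labelled ball must contain the next smaller radius and,
  for the pigeonhole principle, one layer more than a ball of that radius has elements.\<close>

definition eta :: "'a \<Rightarrow> 'a" where "eta r = mrec \<zero> (\<lambda>_ h. h \<oplus> sc (kap h)) r"
text \<open>Labels given before query \<open>i\<close> lie below \<open>base i\<close>; the
  increment makes room for the ranks of the elements of the new ball.\<close>

definition base :: "'a \<Rightarrow> 'a" where "base i = mrec \<zero> (\<lambda>i b. b \<oplus> sc (kap (eta (n \<ominus> sc i)))) i"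

lemma df_grow [dfn]: "df f \<Longrightarrow> df (\<lambda>e. grow (f e))"
  by (rule df_app1[where F = grow]) (unfold grow_def, intro dfn)

lemma df_bl [dfn]: "df f \<Longrightarrow> df g \<Longrightarrow> df (\<lambda>e. bl (f e) (g e))"
  by (rule df_app2[where F = bl]) (unfold bl_def, intro dfn)

lemma df_kap [dfn]: "df f \<Longrightarrow> df (\<lambda>e. kap (f e))"
  by (rule df_app1[where F = kap]) (unfold kap_def, intro dfn)

lemma df_eta [dfn]: "df f \<Longrightarrow> df (\<lambda>e. eta (f e))"
  by (rule df_app1[where F = eta]) (unfold eta_def, intro dfn)

lemma df_base [dfn]: "df f \<Longrightarrow> df (\<lambda>e. base (f e))"
  by (rule df_app1[where F = base]) (unfold base_def, intro dfn)

lemma kap_simps: "kap \<zero> = sc \<zero>" "kap (sc h) = kap h \<oplus> kap h \<oplus> kap h"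
  unfolding kap_def by (rule mrec_0 mrec_S, intro dfn)+

lemma eta_simps: "eta \<zero> = \<zero>" "eta (sc r) = eta r \<oplus> sc (kap (eta r))"
  unfolding eta_def by (rule mrec_0 mrec_S, intro dfn)+

lemma base_simps: "base \<zero> = \<zero>" "base (sc i) = base i \<oplus> sc (kap (eta (n \<ominus> sc i)))"
  unfolding base_def by (rule mrec_0 mrec_S, intro dfn)+

lemma bl_0: "bl X \<zero> = X" and bl_S: "bl X (sc j) = grow (bl X j)"
  unfolding bl_def by (rule mrec_0 mrec_S, intro dfn)+

lemma mem_grow: "v \<epsilon> grow Y \<longleftrightarrow> v \<epsilon> Y \<or> (\<exists>u. u \<epsilon> Y \<and> (v = tl u \<or> v = tr u))"
proof -
  have "D (\<lambda>e. e 1 = tl (e 0))" "D (\<lambda>e. e 1 = tr (e 0))" by (intro dfn)+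
  from collection[OF this(1), of Y] collection[OF this(2), of Y]
  obtain b b' where b: "\<And>u. u \<sqsubset> Y \<Longrightarrow> tl u \<sqsubset> b" "\<And>u. u \<sqsubset> Y \<Longrightarrow> tr u \<sqsubset> b'" by auto
  show ?thesis unfolding grow_def
  proof (rule mem_cs[where b = "Y \<oplus> b \<oplus> b'"])
    show "D (\<lambda>e. e 0 \<epsilon> Y \<or> (\<exists>u. u \<epsilon> Y \<and> (e 0 = tl u \<or> e 0 = tr u)))" by (intro dfn)
  next
    fix v assume "v \<epsilon> Y \<or> (\<exists>u. u \<epsilon> Y \<and> (v = tl u \<or> v = tr u))"
    then have "v \<sqsubset> Y \<or> v \<sqsubset> b \<or> v \<sqsubset> b'" using b bit_less by blast
    moreover have "Y \<sqsubseteq> Y \<oplus> b \<oplus> b'" "b \<sqsubseteq> Y \<oplus> b \<oplus> b'" "b' \<sqsubseteq> Y \<oplus> b \<oplus> b'"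
      using le_add add_assoc add_left_commute by metis+
    ultimately show "v \<sqsubset> Y \<oplus> b \<oplus> b'" using A.less_le_trans by blast
  qed
qed

lemma bl_mono: assumes "v \<epsilon> bl X j" "j \<sqsubseteq> k" shows "v \<epsilon> bl X k"
proof -
  obtain d where d: "k = j \<oplus> d" using assms(2) by (auto simp: le_def)
  have "v \<epsilon> bl X (j \<oplus> d)"
  proof (induction d rule: ind)
    case D show ?case by (intro dfn)
  qed (use assms(1) in \<open>auto simp: bl_S mem_grow\<close>)
  then show ?thesis unfolding d .
qed

lemma bl_un: "(\<And>v. v \<epsilon> Z \<longleftrightarrow> v \<epsilon> X \<or> v \<epsilon> Y) \<Longrightarrow> v \<epsilon> bl Z j \<longleftrightarrow> v \<epsilon> bl X j \<or> v \<epsilon> bl Y j"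
proof -
  assume a: "\<And>v. v \<epsilon> Z \<longleftrightarrow> v \<epsilon> X \<or> v \<epsilon> Y"
  have "\<forall>v. v \<epsilon> bl Z j \<longleftrightarrow> v \<epsilon> bl X j \<or> v \<epsilon> bl Y j"
  proof (induction j rule: ind)
    case D show ?case by (intro dfn)
  qed (use a in \<open>auto simp: bl_0 bl_S mem_grow\<close>)
  then show ?thesis by blast
qed

definition sing :: "'a \<Rightarrow> 'a" where "sing t = cs (\<lambda>v. v = t)"

lemma df_sing [dfn]: "df f \<Longrightarrow> df (\<lambda>e. sing (f e))"
  by (rule df_app1[where F = sing]) (unfold sing_def, intro dfn)

lemma mem_sing: "v \<epsilon> sing t \<longleftrightarrow> v = t"
  unfolding sing_def by (rule mem_cs[where b = "sc t"]) (intro dfn, simp)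

lemma card_bl: "cnt (\<lambda>v. v \<epsilon> bl (sing t) h) w \<sqsubseteq> kap h"
proof -
  have "\<forall>w. cnt (\<lambda>v. v \<epsilon> bl (sing t) h) w \<sqsubseteq> kap h"
  proof (induction h rule: ind)
    case Z
    show ?case using cnt_one by (simp add: bl_0 mem_sing kap_simps)
  next
    case (S h)
    let ?Y = "bl (sing t) h"
    have d: "D (\<lambda>e. e 0 \<epsilon> ?Y)" "df (\<lambda>e. tl (e 0))" "df (\<lambda>e. tr (e 0))" by (intro dfn)+
    have d': "D (\<lambda>e. \<exists>u. u \<sqsubset> ?Y \<and> u \<epsilon> ?Y \<and> e 0 = tl u)" "D (\<lambda>e. \<exists>u. u \<sqsubset> ?Y \<and> u \<epsilon> ?Y \<and> e 0 = tr u)"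
      "D (\<lambda>e. e 0 \<epsilon> ?Y \<or> (\<exists>u. u \<sqsubset> ?Y \<and> u \<epsilon> ?Y \<and> e 0 = tl u))" by (intro dfn)+
    show ?case
    proof
      fix w
      have "(\<lambda>v. v \<epsilon> bl (sing t) (sc h)) = (\<lambda>v. (v \<epsilon> ?Y \<or> (\<exists>u. u \<sqsubset> ?Y \<and> u \<epsilon> ?Y \<and> v = tl u)) \<or>
          (\<exists>u. u \<sqsubset> ?Y \<and> u \<epsilon> ?Y \<and> v = tr u))"
        using bit_less by (auto simp: fun_eq_iff bl_S mem_grow; blast)
      then have "cnt (\<lambda>v. v \<epsilon> bl (sing t) (sc h)) w \<sqsubseteq>
          cnt (\<lambda>v. v \<epsilon> ?Y \<or> (\<exists>u. u \<sqsubset> ?Y \<and> u \<epsilon> ?Y \<and> v = tl u)) w \<oplus>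
          cnt (\<lambda>v. \<exists>u. u \<sqsubset> ?Y \<and> u \<epsilon> ?Y \<and> v = tr u) w" using cnt_un[OF d'(3,2)] by simp
      also have "... \<sqsubseteq> (kap h \<oplus> kap h) \<oplus> kap h"
      proof (rule A.add_mono)
        have "cnt (\<lambda>v. v \<epsilon> ?Y \<or> (\<exists>u. u \<sqsubset> ?Y \<and> u \<epsilon> ?Y \<and> v = tl u)) w \<sqsubseteq>
            cnt (\<lambda>v. v \<epsilon> ?Y) w \<oplus> cnt (\<lambda>v. \<exists>u. u \<sqsubset> ?Y \<and> u \<epsilon> ?Y \<and> v = tl u) w"
          by (rule cnt_un[OF d(1) d'(1)])
        also have "... \<sqsubseteq> kap h \<oplus> kap h"
          using S A.order_trans[OF cnt_image[OF d(1,2)]] by (intro A.add_mono) blast+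
        finally show "cnt (\<lambda>v. v \<epsilon> ?Y \<or> (\<exists>u. u \<sqsubset> ?Y \<and> u \<epsilon> ?Y \<and> v = tl u)) w \<sqsubseteq> kap h \<oplus> kap h" .
        show "cnt (\<lambda>v. \<exists>u. u \<sqsubset> ?Y \<and> u \<epsilon> ?Y \<and> v = tr u) w \<sqsubseteq> kap h"
          using S A.order_trans[OF cnt_image[OF d(1,3)]] by blast
      qed
      finally show "cnt (\<lambda>v. v \<epsilon> bl (sing t) (sc h)) w \<sqsubseteq> kap (sc h)" by (simp add: kap_simps)
    qed
  next
    case D show ?case by (intro dfn)
  qed
  then show ?thesis by blast
qed

text \<open>Pigeonhole principle: if the ball around \<open>t\<close> had an element in each of the
  \<open>sc (kap h')\<close> layers around \<open>A\<close>, it would have more than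
  \<open>kap h'\<close> elements.\<close>

lemma free_layer:
  "\<exists>j. h \<sqsubseteq> j \<and> j \<sqsubset> h \<oplus> sc (kap h') \<and> (\<forall>v. v \<epsilon> bl (sing t) h' \<and> v \<epsilon> bl A (sc j) \<longrightarrow> v \<epsilon> bl A j)"
proof (rule ccontr)
  assume neg: "\<not> ?thesis"
  let ?X = "bl (sing t) h'"
  have "i \<sqsubseteq> sc (kap h') \<longrightarrow> i \<sqsubseteq> cnt (\<lambda>v. v \<epsilon> ?X \<and> v \<epsilon> bl A (h \<oplus> i)) ?X" for i
  proof (induction i rule: ind)
    case (S i)
    show ?case
    proof
      assume "sc i \<sqsubseteq> sc (kap h')"
      then have i: "i \<sqsubset> sc (kap h')" by simp
      then have "\<exists>v. v \<epsilon> ?X \<and> v \<epsilon> bl A (sc (h \<oplus> i)) \<and> \<not> v \<epsilon> bl A (h \<oplus> i)"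
        using neg le_add(1) A.add_strict_left_mono by blast
      then obtain v where v: "v \<epsilon> ?X" "v \<epsilon> bl A (sc (h \<oplus> i))" "\<not> v \<epsilon> bl A (h \<oplus> i)" by blast
      have d: "D (\<lambda>e. e 0 \<epsilon> ?X \<and> e 0 \<epsilon> bl A (h \<oplus> i))" "D (\<lambda>e. e 0 \<epsilon> ?X \<and> e 0 \<epsilon> bl A (h \<oplus> sc i))" by (intro dfn)+
      have "cnt (\<lambda>v. v \<epsilon> ?X \<and> v \<epsilon> bl A (h \<oplus> i)) ?X \<sqsubset> cnt (\<lambda>v. v \<epsilon> ?X \<and> v \<epsilon> bl A (h \<oplus> sc i)) ?X"
        by (rule cnt_mono_less[OF d, of v]) (use v in \<open>auto simp: bl_S mem_grow intro: bit_less\<close>)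
      moreover have "i \<sqsubseteq> cnt (\<lambda>v. v \<epsilon> ?X \<and> v \<epsilon> bl A (h \<oplus> i)) ?X" using S i A.less_imp_le by blast
      ultimately show "sc i \<sqsubseteq> cnt (\<lambda>v. v \<epsilon> ?X \<and> v \<epsilon> bl A (h \<oplus> sc i)) ?X"
        unfolding S_le by (rule A.le_less_trans[rotated])
    qed
  next
    case D show ?case by (intro dfn)
  qed simp
  from this[of "sc (kap h')"] have "sc (kap h') \<sqsubseteq> cnt (\<lambda>v. v \<epsilon> ?X \<and> v \<epsilon> bl A (h \<oplus> sc (kap h'))) ?X" by simp
  also have "... \<sqsubseteq> cnt (\<lambda>v. v \<epsilon> ?X) ?X" by (rule cnt_mono) (intro dfn, intro dfn, blast)
  also have "... \<sqsubseteq> kap h'" by (rule card_bl)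
  finally show False by simp
qed

end

context layer
begin

text \<open>
  States of the augmented automaton are \<open>pr s (pr i (pr Z A))\<close>: the \<open>i\<close>-th query is asked next,
  \<open>A\<close> is the set of templates asked so far and \<open>Z\<close> labels a set of templates
  containing the ball of radius \<open>eta (n \<ominus> i)\<close> around \<open>A\<close>, decreasingly along components.
  When a new template is asked, a layer around \<open>A\<close> avoiding the new ball is chosen; labels inside
  that layer are kept and the rest of the new ball gets larger labels.
\<close>

definition fi where "fi s = pf (ps s)"
definition fZ where "fZ s = pf (ps (ps s))"
definition fA where "fA s = ps (ps (ps s))"
definition tau where "tau s = tm (Q (pf s))"
definition hh where "hh s = eta (n \<ominus> sc (fi s))"
definition X where "X s = bl (sing (tau s)) (hh s)"
definition jj where
  "jj s = lst (\<lambda>j. hh s \<sqsubseteq> j \<and> (\<forall>v. v \<epsilon> X s \<and> v \<epsilon> bl (fA s) (sc j) \<longrightarrow> v \<epsilon> bl (fA s) j))"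
definition K where "K s = bl (fA s) (jj s)"
text \<open>The value of \<open>cnt\<close> is the rank of \<open>v\<close> in the new ball.
  Components have smaller codes than the whole, so they get smaller labels.\<close>

definition nZ where
  "nZ s = cs (\<lambda>x. x \<epsilon> fZ s \<and> pf x \<epsilon> K s \<or>
     (\<exists>v. v \<epsilon> X s \<and> \<not> v \<epsilon> K s \<and> x = pr v (base (fi s) \<oplus> cnt (\<lambda>u. u \<epsilon> X s) v)))"
definition nA where "nA s = cs (\<lambda>v. v \<epsilon> fA s \<or> v = tau s)"
definition Lb where "Lb s = lst (\<lambda>l. pr (tau s) l \<epsilon> nZ s)"
definition dl' where "dl' s a = pr (dl (pf s) a) (pr (sc (fi s)) (pr (nZ s) (nA s)))"

lemma df_aug [dfn]:
  assumes "df f"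
  shows "df (\<lambda>e. fi (f e))" "df (\<lambda>e. fZ (f e))" "df (\<lambda>e. fA (f e))" "df (\<lambda>e. tau (f e))" "df (\<lambda>e. hh (f e))"
    "df (\<lambda>e. X (f e))"
  unfolding fi_def fZ_def fA_def tau_def hh_def X_def by (intro dfn assms)+

lemma df_jj [dfn]: "df f \<Longrightarrow> df (\<lambda>e. jj (f e))"
  by (rule df_app1[where F = jj]) (unfold jj_def, intro dfn)

lemma df_K [dfn]: "df f \<Longrightarrow> df (\<lambda>e. K (f e))"
  unfolding K_def by (intro dfn)

lemma df_nZ [dfn]: "df f \<Longrightarrow> df (\<lambda>e. nZ (f e))"
  by (rule df_app1[where F = nZ]) (unfold nZ_def, intro dfn)

lemma df_nA [dfn]: "df f \<Longrightarrow> df (\<lambda>e. nA (f e))"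
  by (rule df_app1[where F = nA]) (unfold nA_def, intro dfn)

lemma df_aLb [dfn]: "df f \<Longrightarrow> df (\<lambda>e. Lb (f e))"
  by (rule df_app1[where F = Lb]) (unfold Lb_def, intro dfn)

lemma df_dl' [dfn]: "df f \<Longrightarrow> df g \<Longrightarrow> df (\<lambda>e. dl' (f e) (g e))"
  by (rule df_app2[where F = dl']) (unfold dl'_def, intro dfn)

sublocale L: lgame M inst sg lf At "pr s0 (pr \<zero> (pr \<zero> \<zero>))" "\<lambda>s. Q (pf s)" Lb dl' n "base n"
  by unfold_locales (intro dfn)+

lemma mem_nA: "v \<epsilon> nA s \<longleftrightarrow> v \<epsilon> fA s \<or> v = tau s"
  unfolding nA_def
proof (rule mem_cs[where b = "sc (fA s \<oplus> tau s)"])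
  show "D (\<lambda>e. e 0 \<epsilon> fA s \<or> e 0 = tau s)" by (intro dfn)
next
  fix v assume "v \<epsilon> fA s \<or> v = tau s"
  then show "v \<sqsubset> sc (fA s \<oplus> tau s)"
    using A.order_trans[OF A.less_imp_le[OF bit_less] le_add(1)] by auto
qed

lemma mem_nZ: "x \<epsilon> nZ s \<longleftrightarrow> x \<epsilon> fZ s \<and> pf x \<epsilon> K s \<or>
     (\<exists>v. v \<epsilon> X s \<and> \<not> v \<epsilon> K s \<and> x = pr v (base (fi s) \<oplus> cnt (\<lambda>u. u \<epsilon> X s) v))"
proof -
  have "D (\<lambda>e. e 1 = pr (e 0) (base (fi s) \<oplus> cnt (\<lambda>u. u \<epsilon> X s) (e 0)))" by (intro dfn)
  from collection[OF this, of "X s"] obtain b where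
    b: "\<And>v. v \<sqsubset> X s \<Longrightarrow> pr v (base (fi s) \<oplus> cnt (\<lambda>u. u \<epsilon> X s) v) \<sqsubset> b" by auto
  show ?thesis unfolding nZ_def
  proof (rule mem_cs[where b = "fZ s \<oplus> b"])
    show "D (\<lambda>e. e 0 \<epsilon> fZ s \<and> pf (e 0) \<epsilon> K s \<or>
       (\<exists>v. v \<epsilon> X s \<and> \<not> v \<epsilon> K s \<and> e 0 = pr v (base (fi s) \<oplus> cnt (\<lambda>u. u \<epsilon> X s) v)))" by (intro dfn)
  next
    fix x assume "x \<epsilon> fZ s \<and> pf x \<epsilon> K s \<or>
       (\<exists>v. v \<epsilon> X s \<and> \<not> v \<epsilon> K s \<and> x = pr v (base (fi s) \<oplus> cnt (\<lambda>u. u \<epsilon> X s) v))"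
    then show "x \<sqsubset> fZ s \<oplus> b"
      using A.less_le_trans[OF bit_less le_add(1)] A.less_le_trans[OF b[OF bit_less] le_add(2)] by blast
  qed
qed

lemma mem_nZ_pr: "pr v l \<epsilon> nZ s \<longleftrightarrow> pr v l \<epsilon> fZ s \<and> v \<epsilon> K s \<or>
     v \<epsilon> X s \<and> \<not> v \<epsilon> K s \<and> l = base (fi s) \<oplus> cnt (\<lambda>u. u \<epsilon> X s) v"
  unfolding mem_nZ by auto

definition inv :: "'a \<Rightarrow> bool" where
  "inv s \<longleftrightarrow> (\<forall>v. v \<epsilon> bl (fA s) (eta (n \<ominus> fi s)) \<longrightarrow> (\<exists>l. pr v l \<epsilon> fZ s)) \<and>
     (\<forall>v l l'. pr v l \<epsilon> fZ s \<and> pr v l' \<epsilon> fZ s \<longrightarrow> l = l') \<and>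
     (\<forall>u v l m. pr u l \<epsilon> fZ s \<and> pr v m \<epsilon> fZ s \<and> (v = tl u \<or> v = tr u) \<and> v \<sqsubset> u \<longrightarrow> m \<sqsubset> l) \<and>
     (\<forall>v l. pr v l \<epsilon> fZ s \<longrightarrow> l \<sqsubset> base (fi s))"

lemma inv_unique: "inv s \<Longrightarrow> pr v l \<epsilon> fZ s \<Longrightarrow> pr v l' \<epsilon> fZ s \<Longrightarrow> l = l'"
  and inv_edge: "inv s \<Longrightarrow> pr u l \<epsilon> fZ s \<Longrightarrow> pr v m \<epsilon> fZ s \<Longrightarrow> v = tl u \<or> v = tr u \<Longrightarrow> v \<sqsubset> u \<Longrightarrow> m \<sqsubset> l"
  unfolding inv_def by blast+

lemma D_inv [dfn]: "df f \<Longrightarrow> D (\<lambda>e. inv (f e))"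
  by (rule D_app1[where R = inv]) (unfold inv_def, intro dfn)

text \<open>The ball labelled before this query contains all layers among which
  \<open>free_layer\<close> chooses, by the recursion for \<open>eta\<close>. Hence everything kept
  in \<open>K s\<close> has a label.\<close>

lemma jj:
  assumes "n = fi s \<oplus> sc r"
  shows "hh s = eta r" "hh s \<sqsubseteq> jj s" "jj s \<sqsubseteq> eta (n \<ominus> fi s)"
    "v \<epsilon> X s \<Longrightarrow> v \<epsilon> bl (fA s) (sc (jj s)) \<Longrightarrow> v \<epsilon> K s"
proof -
  have "n = sc (fi s) \<oplus> r" using assms by simp
  then have r: "n \<ominus> sc (fi s) = r" "n \<ominus> fi s = sc r" using assms mns_add by metis+
  show h: "hh s = eta r" unfolding hh_def r ..
  have d: "D (\<lambda>e. hh s \<sqsubseteq> e 0 \<and> (\<forall>v. v \<epsilon> X s \<and> v \<epsilon> bl (fA s) (sc (e 0)) \<longrightarrow> v \<epsilon> bl (fA s) (e 0)))"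
    by (intro dfn)
  obtain j where j: "hh s \<sqsubseteq> j" "j \<sqsubset> hh s \<oplus> sc (kap (hh s))"
    "\<forall>v. v \<epsilon> X s \<and> v \<epsilon> bl (fA s) (sc j) \<longrightarrow> v \<epsilon> bl (fA s) j"
    using free_layer[of "hh s" "hh s" "tau s" "fA s"] unfolding X_def by blast
  then have p: "hh s \<sqsubseteq> j \<and> (\<forall>v. v \<epsilon> X s \<and> v \<epsilon> bl (fA s) (sc j) \<longrightarrow> v \<epsilon> bl (fA s) j)" by blast
  show "hh s \<sqsubseteq> jj s" "v \<epsilon> X s \<Longrightarrow> v \<epsilon> bl (fA s) (sc (jj s)) \<Longrightarrow> v \<epsilon> K s"
    using lst_ex[OF d, OF exI, OF p] unfolding jj_def[symmetric] K_def by blast+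
  have "jj s \<sqsubseteq> j" using lst_le[OF d, OF p] unfolding jj_def[symmetric] .
  then show "jj s \<sqsubseteq> eta (n \<ominus> fi s)" using j(2) unfolding r eta_simps h
    by (meson A.le_less_trans A.less_imp_le)
qed

lemma A_K: "v \<epsilon> fA s \<Longrightarrow> v \<epsilon> K s"
  unfolding K_def using bl_mono[of v "fA s" \<zero>] by (simp add: bl_0)

text \<open>A component of a kept template that is newly labelled would lie in the chosen layer,
  which the new ball avoids. From new to kept templates labels decrease because old labels are below
  \<open>base (fi s)\<close>, and inside the new part they decrease by rank.\<close>

lemma inv_step:
  assumes inv: "inv s" and n: "n = fi s \<oplus> sc r"
    and Z: "fZ s' = nZ s" "fA s' = nA s" "fi s' = sc (fi s)"
  shows "inv s'"
proof -
  note jj = jj[OF n]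
  have i1: "v \<epsilon> bl (fA s) (eta (n \<ominus> fi s)) \<Longrightarrow> \<exists>l. pr v l \<epsilon> fZ s"
    and i2: "pr v l \<epsilon> fZ s \<Longrightarrow> pr v l' \<epsilon> fZ s \<Longrightarrow> l = l'"
    and i3: "pr u l \<epsilon> fZ s \<Longrightarrow> pr v m \<epsilon> fZ s \<Longrightarrow> v = tl u \<or> v = tr u \<Longrightarrow> v \<sqsubset> u \<Longrightarrow> m \<sqsubset> l"
    and i4: "pr v l \<epsilon> fZ s \<Longrightarrow> l \<sqsubset> base (fi s)" for u v l m l'
    using inv unfolding inv_def by blast+
  have "n = sc (fi s) \<oplus> r" using n by simp
  then have r: "n \<ominus> sc (fi s) = r" using mns_add by metis
  have DX: "D (\<lambda>e. e 0 \<epsilon> X s)" by (intro dfn)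
  have bs: "base (sc (fi s)) = base (fi s) \<oplus> sc (kap (eta r))" by (simp add: base_simps r)
  show ?thesis
    unfolding inv_def Z
  proof (intro conjI allI impI; (elim conjE)?)
    fix v assume v: "v \<epsilon> bl (nA s) (eta (n \<ominus> sc (fi s)))"
    have "v \<epsilon> bl (fA s) (hh s) \<or> v \<epsilon> X s"
      using v bl_un[of "nA s" "fA s" "sing (tau s)" v "hh s"] unfolding r jj(1) X_def mem_nA mem_sing by blast
    then have "v \<epsilon> K s \<or> v \<epsilon> X s" unfolding K_def using bl_mono jj(2) by blast
    moreover have "v \<epsilon> K s \<Longrightarrow> \<exists>l. pr v l \<epsilon> fZ s" using i1 bl_mono[OF _ jj(3)] unfolding K_def by blast
    ultimately show "\<exists>l. pr v l \<epsilon> nZ s" unfolding mem_nZ_pr by blast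
  next
    fix v l l' assume "pr v l \<epsilon> nZ s" "pr v l' \<epsilon> nZ s"
    then show "l = l'" unfolding mem_nZ_pr using i2 by blast
  next
    fix u v l m
    assume *: "pr u l \<epsilon> nZ s" "pr v m \<epsilon> nZ s" "v = tl u \<or> v = tr u" "v \<sqsubset> u"
    have new: "x \<epsilon> X s \<and> \<not> x \<epsilon> K s \<and> k = base (fi s) \<oplus> cnt (\<lambda>u. u \<epsilon> X s) x"
      if "pr x k \<epsilon> nZ s" "\<not> (pr x k \<epsilon> fZ s \<and> x \<epsilon> K s)" for x k
      using that unfolding mem_nZ_pr by blast
    show "m \<sqsubset> l"
    proof (cases "pr u l \<epsilon> fZ s \<and> u \<epsilon> K s"; cases "pr v m \<epsilon> fZ s \<and> v \<epsilon> K s")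
      assume "pr u l \<epsilon> fZ s \<and> u \<epsilon> K s" "\<not> (pr v m \<epsilon> fZ s \<and> v \<epsilon> K s)"
      then have "v \<epsilon> bl (fA s) (sc (jj s))" "v \<epsilon> X s" "\<not> v \<epsilon> K s"
        using new[OF *(2)] *(3) unfolding bl_S mem_grow K_def by blast+
      then show ?thesis using jj(4) by blast
    next
      assume u: "\<not> (pr u l \<epsilon> fZ s \<and> u \<epsilon> K s)" and v: "pr v m \<epsilon> fZ s \<and> v \<epsilon> K s"
      show ?thesis using new[OF *(1) u] i4 v A.less_le_trans[OF _ le_add(1)] by blast
    next
      assume u: "\<not> (pr u l \<epsilon> fZ s \<and> u \<epsilon> K s)" and v: "\<not> (pr v m \<epsilon> fZ s \<and> v \<epsilon> K s)"
      show ?thesis using new[OF *(1) u] new[OF *(2) v] cnt_less[OF DX _ *(4)] by simp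
    qed (use i3 * in blast)
  next
    fix v l assume "pr v l \<epsilon> nZ s"
    then consider "pr v l \<epsilon> fZ s" | "v \<epsilon> X s" "l = base (fi s) \<oplus> cnt (\<lambda>u. u \<epsilon> X s) v"
      unfolding mem_nZ_pr by blast
    then show "l \<sqsubset> base (sc (fi s))"
    proof cases
      case 1
      then show ?thesis unfolding bs using i4 A.less_le_trans[OF _ le_add(1)] by blast
    next
      case 2
      have "cnt (\<lambda>u. u \<epsilon> X s) v \<sqsubseteq> kap (eta r)" using card_bl unfolding X_def jj(1) by blast
      then show ?thesis unfolding bs 2(2) by simp
    qed
  qed
qed

lemma run_parts:
  "pf (L.run S \<zero>) = s0" "fi (L.run S \<zero>) = \<zero>" "fZ (L.run S \<zero>) = \<zero>" "fA (L.run S \<zero>) = \<zero>"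
  "pf (L.run S (sc i)) = dl (pf (L.run S i)) (L.ans S (L.run S i))"
  "fi (L.run S (sc i)) = sc (fi (L.run S i))"
  "fZ (L.run S (sc i)) = nZ (L.run S i)" "fA (L.run S (sc i)) = nA (L.run S i)"
  by (simp_all add: L.run_S dl'_def fi_def fZ_def fA_def)

lemma fi_run: "fi (L.run S i) = i"
proof (induction i rule: ind)
  case D show ?case by (intro dfn)
qed (simp_all add: run_parts del: L.run_0)

lemma no_mem_zero: "\<not> v \<epsilon> \<zero>"
  using bit_less not_less_zero by blast

lemma inv_run: "i \<sqsubseteq> n \<longrightarrow> inv (L.run S i)"
proof (induction i rule: ind)
  case Z
  have "\<not> v \<epsilon> bl \<zero> j" for v j
  proof (induction j rule: ind)
    case Z then show ?case by (simp add: bl_0 no_mem_zero)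
  next
    case (S j)
    have "\<forall>v. \<not> v \<epsilon> bl \<zero> j"
    proof (induction j rule: ind)
      case D show ?case by (intro dfn)
    qed (simp_all add: bl_0 bl_S mem_grow no_mem_zero)
    then show ?case by (simp add: bl_S mem_grow)
  next
    case D show ?case by (intro dfn)
  qed
  then show ?case unfolding inv_def by (simp add: run_parts no_mem_zero del: L.run_0)
next
  case (S i)
  show ?case
  proof
    assume i: "sc i \<sqsubseteq> n"
    then obtain r where r: "n = i \<oplus> sc r" by (auto simp: less_def)
    have r': "n = fi (L.run S i) \<oplus> sc r" by (subst fi_run) (rule r)
    have "inv (L.run S i)" using S i A.less_imp_le[of i n] by simp
    then show "inv (L.run S (sc i))" by (rule inv_step[OF _ r']) (rule run_parts)+
  qed
next
  case D show ?case by (intro dfn)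
qed

lemma Lb_mem: "\<exists>l. pr (tau s) l \<epsilon> nZ s \<Longrightarrow> pr (tau s) (Lb s) \<epsilon> nZ s"
  unfolding Lb_def by (rule lst_ex[where P = "\<lambda>l. pr (tau s) l \<epsilon> nZ s"]) (intro dfn)

lemma label:
  assumes "i \<sqsubset> n" shows "pr (tau (L.run S i)) (Lb (L.run S i)) \<epsilon> nZ (L.run S i)"
proof -
  let ?s = "L.run S i"
  have i: "inv (L.run S (sc i))" using inv_run[of "sc i" S] assms by simp
  have "tau ?s \<epsilon> nA ?s" by (simp add: mem_nA)
  then have "tau ?s \<epsilon> bl (nA ?s) (eta (n \<ominus> sc i))" using bl_mono[of "tau ?s" "nA ?s" \<zero>] by (simp add: bl_0)
  then have "\<exists>l. pr (tau ?s) l \<epsilon> nZ ?s" using i unfolding inv_def run_parts fi_run by blast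
  then show ?thesis by (rule Lb_mem)
qed

text \<open>Templates that have been queried belong to each later kept set, so their labels never
  change.\<close>

lemma persist:
  assumes "i \<sqsubset> n"
  shows "sc i \<sqsubseteq> m \<and> m \<sqsubseteq> n \<longrightarrow> pr (tau (L.run S i)) (Lb (L.run S i)) \<epsilon> fZ (L.run S m) \<and> tau (L.run S i) \<epsilon> fA (L.run S m)"
proof (induction m rule: ind)
  case (S m)
  show ?case
  proof (cases "m = i")
    case True
    then show ?thesis using label[OF assms] by (simp add: run_parts mem_nA)
  next
    case False
    show ?thesis
    proof
      assume "sc i \<sqsubseteq> sc m \<and> sc m \<sqsubseteq> n"
      then have "sc i \<sqsubseteq> m \<and> m \<sqsubseteq> n" using False A.less_imp_le[of m n] A.le_neq_trans[of i m] by auto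
      then show "pr (tau (L.run S i)) (Lb (L.run S i)) \<epsilon> fZ (L.run S (sc m)) \<and> tau (L.run S i) \<epsilon> fA (L.run S (sc m))"
        using S A_K by (simp add: run_parts mem_nA mem_nZ_pr)
    qed
  qed
next
  case D show ?case by (intro dfn)
qed simp

lemma label_n:
  assumes "i \<sqsubset> n" shows "pr (tau (L.run S i)) (Lb (L.run S i)) \<epsilon> fZ (L.run S n)"
  using persist[OF assms, of n S] assms by simp

lemma inv_n: "inv (L.run S n)"
  using inv_run by blast

lemma base_mono: "i \<sqsubseteq> j \<Longrightarrow> base i \<sqsubseteq> base j"
proof -
  assume "i \<sqsubseteq> j"
  then obtain d where j: "j = i \<oplus> d" by (auto simp: le_def)
  have "base i \<sqsubseteq> base (i \<oplus> d)"
  proof (induction d rule: ind)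
    case (S d)
    have "base (i \<oplus> d) \<sqsubseteq> base (sc (i \<oplus> d))" unfolding base_simps by (rule le_add)
    then show ?case unfolding add_S by (rule A.order_trans[OF S])
  next
    case D show ?case by (intro dfn)
  qed simp
  then show ?thesis unfolding j .
qed

text \<open>A component that received its label after its parent would lie in a later ball and in
  the layer next to the set kept then, which the choice of that layer excludes.\<close>

lemma label_stable:
  assumes b: "b \<sqsubset> n" and l: "l \<sqsubset> base (sc b)" and v: "v = tl u \<or> v = tr u"
  shows "sc b \<oplus> d \<sqsubseteq> n \<Longrightarrow> pr u l \<epsilon> fZ (L.run S (sc b \<oplus> d)) \<Longrightarrow> pr v k \<epsilon> fZ (L.run S (sc b \<oplus> d)) \<Longrightarrow>
    pr v k \<epsilon> fZ (L.run S (sc b))"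
proof -
  have "sc b \<oplus> d \<sqsubseteq> n \<and> pr u l \<epsilon> fZ (L.run S (sc b \<oplus> d)) \<and> pr v k \<epsilon> fZ (L.run S (sc b \<oplus> d)) \<longrightarrow>
    pr v k \<epsilon> fZ (L.run S (sc b))"
  proof (induction d rule: ind)
    case (S d)
    show ?case
    proof (intro impI, elim conjE)
      let ?s = "L.run S (sc b \<oplus> d)"
      assume n: "sc b \<oplus> sc d \<sqsubseteq> n" and "pr u l \<epsilon> fZ (L.run S (sc b \<oplus> sc d))" "pr v k \<epsilon> fZ (L.run S (sc b \<oplus> sc d))"
      then have uv: "pr u l \<epsilon> nZ ?s" "pr v k \<epsilon> nZ ?s" by (simp_all only: add_S run_parts)
      have bd: "sc b \<oplus> d \<sqsubset> n" using n unfolding add_S S_le .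
      then obtain r where r0: "n = (sc b \<oplus> d) \<oplus> sc r" unfolding less_def by blast
      have r: "n = fi ?s \<oplus> sc r" by (subst fi_run) (rule r0)
      have "l \<sqsubset> base (fi ?s)" using l base_mono[of "sc b" "sc b \<oplus> d"] unfolding fi_run
        using A.less_le_trans le_add(1) by blast
      then have "\<not> l = base (fi ?s) \<oplus> cnt (\<lambda>u. u \<epsilon> X ?s) u" using le_add(1) A.not_le by blast
      then have u: "pr u l \<epsilon> fZ ?s" "u \<epsilon> K ?s" using uv(1) unfolding mem_nZ_pr by blast+
      have "v \<epsilon> bl (fA ?s) (sc (jj ?s))" using v u(2) unfolding bl_S mem_grow K_def by blast
      then have "pr v k \<epsilon> fZ ?s" using uv(2) jj(4)[OF r] unfolding mem_nZ_pr by blast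
      then show "pr v k \<epsilon> fZ (L.run S (sc b))" using S u(1) A.less_imp_le[OF bd] by blast
    qed
  next
    case D show ?case by (intro dfn)
  qed simp
  then show "sc b \<oplus> d \<sqsubseteq> n \<Longrightarrow> pr u l \<epsilon> fZ (L.run S (sc b \<oplus> d)) \<Longrightarrow> pr v k \<epsilon> fZ (L.run S (sc b \<oplus> d)) \<Longrightarrow>
    pr v k \<epsilon> fZ (L.run S (sc b))" by blast
qed

lemma label_less:
  assumes "i \<sqsubset> n" shows "Lb (L.run S i) \<sqsubset> base (sc i)"
  using label[OF assms, of S] inv_run[of "sc i" S] assms unfolding inv_def run_parts fi_run by auto

text \<open>The crucial premise of \<open>consistent_run\<close> is the stability of labels. The
  label of an instance is settled when that of its parent is, and the run up to this moment has used
  only facts with smaller labels.\<close>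

theorem consistent_play:
  "\<exists>sq an. df (\<lambda>e. sq (e 0)) \<and> df (\<lambda>e. an (e 0)) \<and> sq \<zero> = s0 \<and> (\<forall>i. sq (sc i) = dl (sq i) (an i)) \<and>
     okR (\<lambda>p b. \<exists>i. i \<sqsubset> n \<and> p = Q (sq i) \<and> b = an i)"
proof -
  have "\<exists>S. okR (\<lambda>p b. \<exists>i. i \<sqsubset> n \<and> p = Q (pf (L.run S i)) \<and> b = L.ans S (L.run S i))"
  proof (rule L.consistent_run)
    fix S i assume "i \<sqsubset> n"
    then show "Lb (L.run S i) \<sqsubset> base n" using A.less_le_trans[OF label_less base_mono[of "sc i" n]] by simp
  next
    fix S i j assume "i \<sqsubset> n" "j \<sqsubset> n" "Q (pf (L.run S i)) = Q (pf (L.run S j))"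
    then show "Lb (L.run S i) = Lb (L.run S j)"
      using inv_unique[OF inv_n label_n[of i S], of "Lb (L.run S j)"] label_n[of j S] by (simp add: tau_def)
  next
    fix S i j a assume n: "i \<sqsubset> n" "j \<sqsubset> n" and p: "\<not> lf (Q (pf (L.run S i)))" "Q (pf (L.run S j)) = inst (Q (pf (L.run S i))) a"
    have "tau (L.run S j) = tl (tau (L.run S i)) \<or> tau (L.run S j) = tr (tau (L.run S i))"
      "tau (L.run S j) \<sqsubset> tau (L.run S i)"
      unfolding tau_def p(2) using edge[OF p(1)] by blast+
    then show "Lb (L.run S j) \<sqsubset> Lb (L.run S i)"
      by (rule inv_edge[OF inv_n label_n[OF n(1)] label_n[OF n(2)]])
  next
    fix S S' i j i' j' a
    assume n: "i \<sqsubset> n" "j \<sqsubset> n" "i' \<sqsubset> n" "j' \<sqsubset> n" and lf: "\<not> lf (Q (pf (L.run S i)))"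
      and p: "Q (pf (L.run S' i')) = Q (pf (L.run S i))" "Lb (L.run S' i') = Lb (L.run S i)"
      and q: "Q (pf (L.run S j)) = inst (Q (pf (L.run S i))) a" "Q (pf (L.run S' j')) = inst (Q (pf (L.run S i))) a"
      and same: "\<And>x. ps (pf x) \<sqsubset> Lb (L.run S i) \<Longrightarrow> (x \<epsilon> S) = (x \<epsilon> S')"
    define l where "l = Lb (L.run S i)"
    \<comment> \<open>This yields the query \<open>b\<close> whose range of new labels contains
      \<open>l\<close>: \<open>base b\<close> is at most \<open>l\<close>, and \<open>l\<close> is
      below \<open>base (sc b)\<close>.\<close>
    have "D (\<lambda>e. l \<sqsubset> base (e 0))" by (intro dfn)
    moreover have "l \<sqsubset> base n" unfolding l_def using A.less_le_trans[OF label_less[OF n(1)] base_mono[of "sc i" n]] n(1) by simp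
    ultimately obtain b' where b': "l \<sqsubset> base b'" "\<And>y. l \<sqsubset> base y \<Longrightarrow> b' \<sqsubseteq> y"
      using least[where P = "\<lambda>x. l \<sqsubset> base x"] by blast
    have "b' \<noteq> \<zero>" using b'(1) base_simps(1) by auto
    then obtain b where b: "b' = sc b" using cases0 by blast
    have bn: "b \<sqsubset> n" using b'(2)[OF \<open>l \<sqsubset> base n\<close>] unfolding b by simp
    have lb: "l \<sqsubset> base (sc b)" using b'(1) b by simp
    have bl: "base b \<sqsubseteq> l" 
    proof (rule ccontr)
      assume "\<not> base b \<sqsubseteq> l"
      then have "sc b \<sqsubseteq> b" using b'(2)[of b] unfolding b by (simp add: A.not_le del: S_le)
      then show False by simp
    qed
    \<comment> \<open>Queries before \<open>b\<close> have labels below \<open>l\<close>, where the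
      two sets of facts agree; so both runs reach the same state and then choose the same
      labelling.\<close>
    have "m \<sqsubseteq> b \<longrightarrow> L.run S m = L.run S' m" for m
    proof (induction m rule: ind)
      case (S m)
      show ?case
      proof
        assume m: "sc m \<sqsubseteq> b"
        then have eq: "L.run S' m = L.run S m" using S by (simp add: A.less_imp_le)
        have "m \<sqsubset> n" using m bn A.less_trans by simp
        then have "Lb (L.run S m) \<sqsubset> l" using label_less[of m S] base_mono[OF m] bl A.less_le_trans by blast
        then have "L.ans S (L.run S m) = L.ans S' (L.run S m)"
          by (intro L.ans_cong) (simp add: same[folded l_def])
        then show "L.run S (sc m) = L.run S' (sc m)" unfolding L.run_S eq by simp
      qed
    next
      case D show ?case by (intro dfn)
    qed simp
    then have "fZ (L.run S (sc b)) = fZ (L.run S' (sc b))" by (simp add: run_parts)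
    moreover have "pr (tau (L.run S j)) (Lb (L.run S j)) \<epsilon> fZ (L.run S (sc b))" 
      "pr (tau (L.run S' j')) (Lb (L.run S' j')) \<epsilon> fZ (L.run S' (sc b))"
    proof -
      obtain d where d: "n = sc b \<oplus> d" using bn by (metis S_le le_def)
      have t: "tau (L.run S' i') = tau (L.run S i)" using p by (simp add: tau_def)
      have v: "tau (L.run S j) = tl (tau (L.run S i)) \<or> tau (L.run S j) = tr (tau (L.run S i))"
        "tau (L.run S' j') = tl (tau (L.run S i)) \<or> tau (L.run S' j') = tr (tau (L.run S i))"
        using edge(2)[OF lf] q by (simp_all add: tau_def)
      show "pr (tau (L.run S j)) (Lb (L.run S j)) \<epsilon> fZ (L.run S (sc b))"
        by (rule label_stable[OF bn lb v(1), of d])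
          (use label_n[OF n(1), of S] label_n[OF n(2), of S] d l_def in simp_all)
      show "pr (tau (L.run S' j')) (Lb (L.run S' j')) \<epsilon> fZ (L.run S' (sc b))"
        by (rule label_stable[OF bn lb v(2), of d])
          (use label_n[OF n(3), of S'] label_n[OF n(4), of S'] d l_def p t in simp_all)
    qed
    moreover have "tau (L.run S j) = tau (L.run S' j')" using q by (simp add: tau_def)
    moreover have "inv (L.run S (sc b))" using inv_run bn by simp
    ultimately show "Lb (L.run S j) = Lb (L.run S' j')" using inv_unique by simp
  qed
  then obtain S where S: "okR (\<lambda>p b. \<exists>i. i \<sqsubset> n \<and> p = Q (pf (L.run S i)) \<and> b = L.ans S (L.run S i))" by blast
  show ?thesis
  proof (intro exI conjI)
    show "df (\<lambda>e. pf (L.run S (e 0)))" "df (\<lambda>e. L.ans S (L.run S (e 0)))" by (intro dfn)+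
  qed (use S in \<open>simp_all add: run_parts del: L.run_0\<close>)
qed

end

section \<open>Extending finite plays\<close>

locale sgame = game M inst sg lf At for M :: "'a lpa" and inst sg lf At +
  fixes tm tl tr :: "'a \<Rightarrow> 'a" and Q :: "'a \<Rightarrow> 'a" and dl :: "'a \<Rightarrow> 'a \<Rightarrow> 'a" and C :: 'a
  assumes Q_df: "df (\<lambda>e. Q (e 0))" and dl_df: "df (\<lambda>e. dl (e 1) (e 0))"
    and tm_df: "df (\<lambda>e. tm (e 0))" and tl_df: "df (\<lambda>e. tl (e 0))" and tr_df: "df (\<lambda>e. tr (e 0))"
    and edge: "\<not> lf p \<Longrightarrow> tm (inst p a) \<sqsubset> tm p" "\<not> lf p \<Longrightarrow> tm (inst p a) = tl (tm p) \<or> tm (inst p a) = tr (tm p)"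
begin

lemma df_Qdl [dfn]: "df f \<Longrightarrow> df (\<lambda>e. Q (f e))" "df f \<Longrightarrow> df g \<Longrightarrow> df (\<lambda>e. dl (f e) (g e))"
  by (rule df_comp[OF Q_df], assumption) (rule df2[OF dl_df])

definition sqz :: "'a \<Rightarrow> 'a \<Rightarrow> 'a \<Rightarrow> 'a" where
  "sqz z s i = mrec s (\<lambda>i x. dl x (bval (pf z) (ps z) i)) i"

definition play :: "'a \<Rightarrow> 'a \<Rightarrow> bool" where
  "play H s \<longleftrightarrow> (\<exists>z. \<forall>i. i \<sqsubset> C \<longrightarrow> pr (Q (sqz z s i)) (bval (pf z) (ps z) i) \<epsilon> H)"

definition ext :: "'a \<Rightarrow> 'a \<Rightarrow> 'a \<Rightarrow> bool" where
  "ext H s H' \<longleftrightarrow> (\<forall>x. x \<epsilon> H \<longrightarrow> x \<epsilon> H') \<and> play H' s"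

definition OK :: "'a \<Rightarrow> bool" where "OK H \<longleftrightarrow> okR (\<lambda>p b. pr p b \<epsilon> H)"

text \<open>The recursion is on a standard number, so each \<open>con k\<close> is definable in M,
  although the plays it quantifies over have the possibly nonstandard length
  \<open>C\<close>.\<close>

primrec con :: "nat \<Rightarrow> 'a \<Rightarrow> bool" where
  "con 0 H = OK H"
| "con (Suc k) H = (\<forall>s. \<exists>H'. ext H s H' \<and> con k H')"

lemma df_sqz [dfn]: "df f \<Longrightarrow> df g \<Longrightarrow> df h \<Longrightarrow> df (\<lambda>e. sqz (f e) (g e) (h e))"
  by (rule df_app3[where F = sqz]) (unfold sqz_def, intro dfn)

lemma D_ext [dfn]: "df f \<Longrightarrow> df g \<Longrightarrow> df h \<Longrightarrow> D (\<lambda>e. ext (f e) (g e) (h e))"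
  by (rule D_app3[where R = ext]) (unfold ext_def play_def, intro dfn)

lemma D_OK [dfn]: "df f \<Longrightarrow> D (\<lambda>e. OK (f e))"
  by (rule D_app1[where R = OK]) (unfold OK_def okR_def, intro dfn)

lemma D_con [dfn]: "df f \<Longrightarrow> D (\<lambda>e. con k (f e))"
proof (induction k arbitrary: f)
  case (Suc k)
  show ?case
  proof (rule D_app1[where R = "con (Suc k)", OF _ Suc.prems])
    show "D (\<lambda>e. con (Suc k) (e i))" for i
      unfolding con.simps by (intro dfn Suc.IH)
  qed
qed (simp add: D_OK)

lemma sqz_simps: "sqz z s \<zero> = s" "sqz z s (sc i) = dl (sqz z s i) (bval (pf z) (ps z) i)"
proof -
  have d: "df (\<lambda>e. dl (e 0) (bval (pf z) (ps z) (e 1)))" by (intro dfn)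
  show "sqz z s \<zero> = s" "sqz z s (sc i) = dl (sqz z s i) (bval (pf z) (ps z) i)"
    unfolding sqz_def using mrec_0[OF d] mrec_S[OF d] by simp_all
qed

lemma okR_mono: "okR R \<Longrightarrow> (\<And>p b. R' p b \<Longrightarrow> R p b) \<Longrightarrow> okR R'"
  unfolding okR_def by meson

lemma automaton_play:
  assumes "df (\<lambda>e. R (e 0))" "df (\<lambda>e. f (e 1) (e 0))"
  shows "\<exists>sq an. df (\<lambda>e. sq (e 0)) \<and> df (\<lambda>e. an (e 0)) \<and> sq \<zero> = s \<and> (\<forall>i. sq (sc i) = f (sq i) (an i)) \<and>
     okR (\<lambda>p b. \<exists>i. i \<sqsubset> n \<and> p = R (sq i) \<and> b = an i)"
proof -
  interpret layer M inst sg lf At s R f n tm tl tr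
    using assms edge by unfold_locales (intro tm_df tl_df tr_df | blast)+
  show ?thesis by (rule consistent_play)
qed

definition recorded :: "('a \<Rightarrow> 'a) \<Rightarrow> ('a \<Rightarrow> 'a) \<Rightarrow> ('a \<Rightarrow> 'a) \<Rightarrow> 'a \<Rightarrow> 'a \<Rightarrow> bool" where
  "recorded R sq an n F \<longleftrightarrow> (\<forall>x. x \<epsilon> F \<longleftrightarrow> (\<exists>i. i \<sqsubset> n \<and> x = pr (R (sq i)) (an i)))"

text \<open>All automata are treated at once, because the induction step passes to a longer one. It
  imitates \<open>R\<close> and \<open>f\<close> for \<open>n\<close> queries and records the
  answers, computes from the record the least state without a good extension, and plays
  \<open>C\<close> rounds from there. Its own record, good by induction hypothesis, is the extension
  said not to exist.\<close>

lemma con_run: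
  assumes "df (\<lambda>e. R (e 0))" "df (\<lambda>e. f (e 1) (e 0))"
  shows "\<exists>sq an. df (\<lambda>e. sq (e 0)) \<and> df (\<lambda>e. an (e 0)) \<and> sq \<zero> = s \<and>
    (\<forall>i. i \<sqsubset> n \<longrightarrow> sq (sc i) = f (sq i) (an i)) \<and> (\<forall>F. recorded R sq an n F \<longrightarrow> con k F)"
  using assms
proof (induction k arbitrary: R f s n)
  case 0
  obtain sq an where *: "df (\<lambda>e. sq (e 0))" "df (\<lambda>e. an (e 0))" "sq \<zero> = s" "\<forall>i. sq (sc i) = f (sq i) (an i)"
     "okR (\<lambda>p b. \<exists>i. i \<sqsubset> n \<and> p = R (sq i) \<and> b = an i)"
    using automaton_play[OF 0, of s n] by blast
  have "con 0 F" if "recorded R sq an n F" for F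
    using *(5) that unfolding recorded_def by (simp add: OK_def)
  then show ?case using * by blast
next
  case (Suc k)
  note [dfn] = df_comp[OF Suc.prems(1)] df2[OF Suc.prems(2)]
  show ?case
  proof (rule ccontr)
    assume contr: "\<not> ?case"
    define sbad where "sbad F = lst (\<lambda>s. \<forall>H'. ext F s H' \<longrightarrow> \<not> con k H')" for F
    have df_sbad [dfn]: "df g \<Longrightarrow> df (\<lambda>e. sbad (g e))" for g
      by (rule df_app1[where F = sbad]) (unfold sbad_def, intro dfn)
    define gF where "gF s = pf (ps s)" for s
    define gx where "gx s = ps (ps s)" for s
    \<comment> \<open>At step \<open>n\<close> the state is replaced by the bad state computed from
      the record; afterwards it is the state of the play from there.\<close>
    define eff where "eff s = (if pf s = n then sbad (gF s) else gx s)" for s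
    define R' where "R' s = (if pf s \<sqsubset> n then R (gx s) else Q (eff s))" for s
    define rec where "rec s a = cs (\<lambda>y. y \<epsilon> gF s \<or> y = pr (R (gx s)) a)" for s a
    define f' where "f' s a = pr (sc (pf s)) (pr (if pf s \<sqsubset> n then rec s a else gF s)
      (if pf s \<sqsubset> n then f (gx s) a else dl (eff s) a))" for s a
    have [dfn]: "df g \<Longrightarrow> df (\<lambda>e. gF (g e))" "df g \<Longrightarrow> df (\<lambda>e. gx (g e))" "df g \<Longrightarrow> df (\<lambda>e. eff (g e))" for g
      unfolding gF_def gx_def eff_def by (intro dfn; assumption)+
    have df_R' [dfn]: "df g \<Longrightarrow> df (\<lambda>e. R' (g e))" for g
      unfolding R'_def by (intro dfn)
    have [dfn]: "df g \<Longrightarrow> df h \<Longrightarrow> df (\<lambda>e. rec (g e) (h e))" for g h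
      by (rule df_app2[where F = rec]) (unfold rec_def, intro dfn)
    have df_f': "df (\<lambda>e. f' (e 1) (e 0))" unfolding f'_def by (intro dfn)
    obtain sq an where d: "df (\<lambda>e. sq (e 0))" "df (\<lambda>e. an (e 0))" and sq0: "sq \<zero> = pr \<zero> (pr \<zero> s)"
      and sqS: "\<And>i. i \<sqsubset> n \<oplus> C \<Longrightarrow> sq (sc i) = f' (sq i) (an i)"
      and rec: "\<And>F. recorded R' sq an (n \<oplus> C) F \<Longrightarrow> con k F"
      using Suc.IH[OF df_R'[OF df_proj] df_f', of "pr \<zero> (pr \<zero> s)" "n \<oplus> C"] by metis
    note [dfn] = df_comp[OF d(1)] df_comp[OF d(2)]
    have lt: "i \<sqsubset> n \<Longrightarrow> i \<sqsubset> n \<oplus> C" for i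
      using A.less_le_trans[OF _ le_add(1)] .
    have idx: "i \<sqsubseteq> n \<oplus> C \<longrightarrow> pf (sq i) = i" for i
    proof (induction i rule: ind)
      case Z show ?case by (simp add: sq0)
    next
      case (S i) show ?case
      proof
        assume i: "sc i \<sqsubseteq> n \<oplus> C"
        then have "pf (sq i) = i" using S A.less_imp_le[of i "n \<oplus> C"] by simp
        then show "pf (sq (sc i)) = sc i" using i by (simp add: sqS f'_def)
      qed
    next
      case D show ?case by (intro dfn)
    qed
    have idx': "i \<sqsubset> n \<Longrightarrow> pf (sq i) = i" "i \<sqsubset> n \<oplus> C \<Longrightarrow> pf (sq i) = i" for i
      using idx[of i] A.less_imp_le[OF lt] A.less_imp_le[of i "n \<oplus> C"] by blast+
    have mem_rec: "y \<epsilon> rec t a \<longleftrightarrow> y \<epsilon> gF t \<or> y = pr (R (gx t)) a" for y t a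
      unfolding rec_def
    proof (rule mem_cs[where b = "sc (gF t \<oplus> pr (R (gx t)) a)"])
      show "D (\<lambda>e. e 0 \<epsilon> gF t \<or> e 0 = pr (R (gx t)) a)" by (intro dfn)
    next
      fix v assume "v \<epsilon> gF t \<or> v = pr (R (gx t)) a"
      then show "v \<sqsubset> sc (gF t \<oplus> pr (R (gx t)) a)"
        using A.order_trans[OF A.less_imp_le[OF bit_less] le_add(1)] by auto
    qed
    have F: "i \<sqsubseteq> n \<longrightarrow> (\<forall>y. y \<epsilon> gF (sq i) \<longleftrightarrow> (\<exists>j. j \<sqsubset> i \<and> y = pr (R (gx (sq j))) (an j)))" for i
    proof (induction i rule: ind)
      case Z
      have "\<not> y \<epsilon> \<zero>" for y using bit_less not_less_zero by blast
      then show ?case by (simp add: sq0 gF_def)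
    next
      case (S i) show ?case
      proof (intro impI allI)
        fix y assume "sc i \<sqsubseteq> n"
        then have i: "i \<sqsubset> n" by simp
        have "gF (sq (sc i)) = rec (sq i) (an i)"
          unfolding sqS[OF lt[OF i]] f'_def gF_def using idx' i by simp
        then show "y \<epsilon> gF (sq (sc i)) \<longleftrightarrow> (\<exists>j. j \<sqsubset> sc i \<and> y = pr (R (gx (sq j))) (an j))"
          using S A.less_imp_le[OF i] by (auto simp: mem_rec A.le_less)
      qed
    next
      case D show ?case by (intro dfn)
    qed
    define F where "F = gF (sq n)"
    have recF: "recorded R (\<lambda>i. gx (sq i)) an n F"
      unfolding recorded_def F_def using F[of n] by simp
    have "\<not> con (Suc k) F"
    proof
      assume "con (Suc k) F"
      \<comment> \<open>A record is determined only up to having the same members, and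
        \<open>con (Suc k)\<close> depends only on the members.\<close>
      have F1: "con (Suc k) F'" if "recorded R (\<lambda>i. gx (sq i)) an n F'" for F' :: 'a
      proof -
        have "(\<forall>x. x \<epsilon> F' \<longleftrightarrow> x \<epsilon> F)" using recF that unfolding recorded_def by simp
        then have "ext F' = ext F" unfolding ext_def by (simp add: fun_eq_iff)
        then show ?thesis using \<open>con (Suc k) F\<close> by simp
      qed
      have "df (\<lambda>e. gx (sq (e 0)))" by (intro dfn)
      moreover have "gx (sq \<zero>) = s" by (simp add: sq0 gx_def)
      moreover have "i \<sqsubset> n \<Longrightarrow> gx (sq (sc i)) = f (gx (sq i)) (an i)" for i
        unfolding sqS[OF lt] f'_def using idx' by (simp add: gx_def)
      ultimately have "df (\<lambda>e. gx (sq (e 0))) \<and> df (\<lambda>e. an (e 0)) \<and> gx (sq \<zero>) = s \<and>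
        (\<forall>i. i \<sqsubset> n \<longrightarrow> gx (sq (sc i)) = f (gx (sq i)) (an i)) \<and>
        (\<forall>F. recorded R (\<lambda>i. gx (sq i)) an n F \<longrightarrow> con (Suc k) F)"
        using F1 d(2) by blast
      then have ?case by - (rule exI[where x = "\<lambda>i. gx (sq i)"], rule exI[where x = an])
      then show False using contr by blast
    qed
    then have ex: "\<exists>s. \<forall>H'. ext F s H' \<longrightarrow> \<not> con k H'" by auto
    have "D (\<lambda>e. \<forall>H'. ext F (e 0) H' \<longrightarrow> \<not> con k H')" by (intro dfn)
    from lst_ex[where P = "\<lambda>s. \<forall>H'. ext F s H' \<longrightarrow> \<not> con k H'", OF this ex]
    have bad: "ext F (sbad F) H' \<Longrightarrow> \<not> con k H'" for H'
      unfolding sbad_def by blast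
    have "D (\<lambda>e. e 1 = pr (R' (sq (e 0))) (an (e 0)))" by (intro dfn)
    from collection[OF this, of "n \<oplus> C"] obtain b where
      b: "\<And>i. i \<sqsubset> n \<oplus> C \<Longrightarrow> pr (R' (sq i)) (an i) \<sqsubset> b" by auto
    define H where "H = cs (\<lambda>x. \<exists>i. i \<sqsubset> n \<oplus> C \<and> x = pr (R' (sq i)) (an i))"
    have mem_H: "x \<epsilon> H \<longleftrightarrow> (\<exists>i. i \<sqsubset> n \<oplus> C \<and> x = pr (R' (sq i)) (an i))" for x
      unfolding H_def
    proof (rule mem_cs[where b = b])
      show "D (\<lambda>e. \<exists>i. i \<sqsubset> n \<oplus> C \<and> e 0 = pr (R' (sq i)) (an i))" by (intro dfn)
    qed (use b in blast)
    have conH: "con k H" by (rule rec) (simp add: recorded_def mem_H)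
    have "x \<epsilon> H" if xF: "x \<epsilon> F" for x
    proof -
      obtain j where j: "j \<sqsubset> n" "x = pr (R (gx (sq j))) (an j)" using recF[unfolded recorded_def, THEN spec, THEN iffD1, OF xF] by blast
      then have "x = pr (R' (sq j)) (an j)" using idx' by (simp add: R'_def)
      then show ?thesis unfolding mem_H using lt[OF j(1)] by blast
    qed
    moreover have "play H (sbad F)"
    proof -
      have "df (\<lambda>e. an (n \<oplus> e 0))" by (intro dfn)
      \<comment> \<open>The answers of the last \<open>C\<close> queries are coded again, starting
        from index zero, as \<open>play\<close> wants them.\<close>
      from beta_lemma[OF this] obtain a b where ab: "\<And>i. i \<sqsubset> C \<Longrightarrow> bval a b i = an (n \<oplus> i)"
        unfolding bval[symmetric] by (metis bval)
      have lt2: "i \<sqsubset> C \<Longrightarrow> n \<oplus> i \<sqsubset> n \<oplus> C" for i by (simp add: A.add_less_cancel_left)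
      have q: "i \<sqsubseteq> C \<longrightarrow> sqz (pr a b) (sbad F) i = eff (sq (n \<oplus> i))" for i
      proof (induction i rule: ind)
        case Z then show ?case using idx[of n] by (simp add: sqz_simps eff_def F_def)
      next
        case (S i) show ?case
        proof
          assume "sc i \<sqsubseteq> C"
          then have i: "i \<sqsubset> C" by simp
          have g: "\<not> n \<oplus> i \<sqsubset> n" by (simp add: A.not_less)
          have "sc (n \<oplus> i) \<noteq> n" using less_add_S[of n i] unfolding add_S by (metis A.less_irrefl)
          moreover have "pf (sq (sc (n \<oplus> i))) = sc (n \<oplus> i)" using idx lt2[OF i] by simp
          ultimately have "eff (sq (sc (n \<oplus> i))) = gx (sq (sc (n \<oplus> i)))" by (simp add: eff_def)
          also have "\<dots> = dl (eff (sq (n \<oplus> i))) (an (n \<oplus> i))"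
            unfolding sqS[OF lt2[OF i]] using idx'(2)[OF lt2[OF i]] g by (simp add: f'_def gx_def)
          finally show "sqz (pr a b) (sbad F) (sc i) = eff (sq (n \<oplus> sc i))"
            using S i A.less_imp_le[OF i] by (simp add: sqz_simps ab)
        qed
      next
        case D show ?case by (intro dfn)
      qed
      have "pr (Q (sqz (pr a b) (sbad F) i)) (bval (pf (pr a b)) (ps (pr a b)) i) \<epsilon> H" if i: "i \<sqsubset> C" for i
      proof -
        have g: "\<not> n \<oplus> i \<sqsubset> n" by (simp add: A.not_less)
        have "R' (sq (n \<oplus> i)) = Q (eff (sq (n \<oplus> i)))" unfolding R'_def using g idx'(2)[OF lt2[OF i]] by simp
        then show ?thesis using q[of i] A.less_imp_le[OF i] lt2[OF i] unfolding mem_H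
          by (intro exI[where x = "n \<oplus> i"]) (simp add: ab i)
      qed
      then show ?thesis unfolding play_def by blast
    qed
    ultimately have "ext F (sbad F) H" unfolding ext_def by blast
    with bad conH show False by blast
  qed
qed

text \<open>Run for zero steps, an automaton records the empty set.\<close>

lemma con_empty: "con k \<zero>"
proof -
  have "df (\<lambda>e. Q (e 0))" "df (\<lambda>e. dl (e 1) (e 0))" by (intro dfn)+
  from con_run[OF this, of \<zero> \<zero>] obtain sq an where "\<forall>F. recorded Q sq an \<zero> F \<longrightarrow> con k F" by blast
  moreover have "\<not> y \<epsilon> \<zero>" for y using bit_less not_less_zero by blast
  ultimately show ?thesis unfolding recorded_def by simp
qed

text \<open>For rank zero, consistency passes from an extension to the given set because all clauses
  of \<open>okR\<close> are universal.\<close>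

lemma con_mono: "con (Suc k) H \<Longrightarrow> con k H"
proof (induction k arbitrary: H)
  case 0
  then obtain H' where "ext H \<zero> H'" "OK H'" by auto
  then show ?case unfolding con.simps OK_def ext_def by (auto elim: okR_mono)
next
  case (Suc k)
  then show ?case unfolding con.simps(2)[of "Suc k"] con.simps(2)[of k] by meson
qed

lemma con_le: "j \<le> k \<Longrightarrow> con k H \<Longrightarrow> con j H"
  by (induction rule: dec_induct) (auto dest: con_mono simp del: con.simps)

end

section \<open>Recursive types\<close>

abbreviation R1 where "R1 F \<equiv> recursive_fun 1 (\<lambda>xs. F (xs ! 0))"
abbreviation R2 where "R2 F \<equiv> recursive_fun 2 (\<lambda>xs. F (xs ! 0) (xs ! 1))"
abbreviation R3 where "R3 F \<equiv> recursive_fun 3 (\<lambda>xs. F (xs ! 0) (xs ! 1) (xs ! 2))"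

named_theorems rf

lemma rf_proj [rf]: "i < n \<Longrightarrow> recursive_fun n (\<lambda>xs. xs ! i)"
  by (rule recursive_fun.proj)

lemma rf_comp1: "R1 F \<Longrightarrow> recursive_fun n f \<Longrightarrow> recursive_fun n (\<lambda>xs. F (f xs))"
  using recursive_fun.comp[of "[f]" "\<lambda>xs. F (xs ! 0)" n] by simp

lemma rf_comp2: "R2 F \<Longrightarrow> recursive_fun n f \<Longrightarrow> recursive_fun n g \<Longrightarrow> recursive_fun n (\<lambda>xs. F (f xs) (g xs))"
  using recursive_fun.comp[of "[f, g]" "\<lambda>xs. F (xs ! 0) (xs ! 1)" n] by (simp add: numeral_2_eq_2)

lemma rf_Suc [rf]: "recursive_fun n f \<Longrightarrow> recursive_fun n (\<lambda>xs. Suc (f xs))"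
proof (rule rf_comp1[of Suc])
  show "R1 Suc"
    by (rule recursive_fun.ext[OF recursive_fun.succ]) (auto simp: length_Suc_conv)
qed

lemma rf_const [rf]: "recursive_fun n (\<lambda>xs. c)"
  by (induction c) (auto intro: recursive_fun.zero rf_Suc)

lemma R1_rec: assumes "R2 g" shows "R1 (\<lambda>k. rec_nat a g k)"
proof (rule recursive_fun.ext)
  show "recursive_fun 1 (\<lambda>xs. rec_nat a (\<lambda>k r. g ((k # r # tl xs) ! 0) ((k # r # tl xs) ! 1)) (hd xs))"
    using recursive_fun.prim_rec[of 0 "\<lambda>_. a", OF rf_const, of "\<lambda>xs. g (xs ! 0) (xs ! 1)"] assms
    by (simp add: numeral_2_eq_2)
qed (auto simp: length_Suc_conv)

lemma R2_rec: assumes "R1 f" "R3 g" shows "R2 (\<lambda>k x. rec_nat (f x) (\<lambda>k r. g k r x) k)"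
proof (rule recursive_fun.ext)
  show "recursive_fun 2 (\<lambda>xs. rec_nat (f (tl xs ! 0)) (\<lambda>k r. g ((k # r # tl xs) ! 0) ((k # r # tl xs) ! 1)
     ((k # r # tl xs) ! 2)) (hd xs))"
    using recursive_fun.prim_rec[of 1 "\<lambda>xs. f (xs ! 0)" "\<lambda>xs. g (xs ! 0) (xs ! 1) (xs ! 2)"] assms
    by (simp add: numeral_2_eq_2 numeral_3_eq_3)
qed (auto simp: length_Suc_conv numeral_2_eq_2)

lemma rf_add [rf]: "recursive_fun n f \<Longrightarrow> recursive_fun n g \<Longrightarrow> recursive_fun n (\<lambda>xs. f xs + g xs)"
proof (rule rf_comp2[of "(+)"])
  have "rec_nat x (\<lambda>k r. Suc r) k = k + x" for k x :: nat by (induction k) auto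
  then show "R2 (+)" using R2_rec[of "\<lambda>x. x" "\<lambda>k r x. Suc r"] by (simp add: rf)
qed

lemma rf_mult [rf]: "recursive_fun n f \<Longrightarrow> recursive_fun n g \<Longrightarrow> recursive_fun n (\<lambda>xs. f xs * g xs)"
proof (rule rf_comp2[of "(*)"])
  have "rec_nat 0 (\<lambda>k r. r + x) k = k * x" for k x :: nat by (induction k) auto
  then show "R2 (*)" using R2_rec[of "\<lambda>x. 0" "\<lambda>k r x. r + x"] by (simp add: rf)
qed

lemma rf_diff [rf]:
  assumes "recursive_fun n f" "recursive_fun n g" shows "recursive_fun n (\<lambda>xs. f xs - g xs)"
proof -
  have "rec_nat 0 (\<lambda>k r. k) k = k - 1" for k :: nat by (cases k) auto
  then have p: "R1 (\<lambda>k. k - 1)" using R1_rec[of "\<lambda>k r. k" 0] by (simp add: rf)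
  have "R3 (\<lambda>k r x. r - 1)" by (rule rf_comp1[OF p]) (simp add: rf)
  moreover have "rec_nat x (\<lambda>k r. r - 1) k = x - k" for k x :: nat by (induction k) auto
  ultimately have "R2 (\<lambda>k x. x - k)" using R2_rec[of "\<lambda>x. x" "\<lambda>k r x. r - 1"] by (simp add: rf)
  from rf_comp2[OF this assms(2,1)] show ?thesis .
qed

lemma rf_if_eq [rf]:
  assumes "recursive_fun n f" "recursive_fun n g" "recursive_fun n h" "recursive_fun n k"
  shows "recursive_fun n (\<lambda>xs. if f xs = g xs then h xs else k xs)"
proof -
  have "rec_nat 1 (\<lambda>k r. 0) k = (if k = 0 then 1 else 0 :: nat)" for k :: nat by (cases k) auto
  then have z: "R1 (\<lambda>k. if k = 0 then 1 else 0)" using R1_rec[of "\<lambda>k r. 0" 1] by (simp add: rf del: One_nat_def)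
  have "recursive_fun n (\<lambda>xs. if (f xs - g xs) + (g xs - f xs) = 0 then 1 else 0)"
    by (rule rf_comp1[OF z]) (intro rf assms)
  then have c: "recursive_fun n (\<lambda>xs. if f xs = g xs then 1 else 0)"
    by (rule recursive_fun.ext) auto
  have "recursive_fun n (\<lambda>xs. (if f xs = g xs then 1 else 0) * h xs + (1 - (if f xs = g xs then 1 else 0)) * k xs)"
    by (intro rf_add rf_mult rf_diff rf_const c assms)
  then show ?thesis by (rule recursive_fun.ext) auto
qed

text \<open>Strict growth bounds the search: if \<open>x\<close> is the iterate with number
  \<open>j\<close>, then \<open>j\<close> is at most \<open>x\<close>.\<close>

lemma recursive_range:
  assumes g: "R1 g" and inc: "\<And>k. (g ^^ k) a < (g ^^ Suc k) a"
  shows "recursive_set (range (\<lambda>k. (g ^^ k) a))"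
proof -
  have it: "rec_nat a (\<lambda>k r. g r) k = (g ^^ k) a" for k by (induction k) auto
  have "R2 (\<lambda>k r. g r)" by (rule rf_comp1[OF g]) (simp add: rf)
  then have i: "R1 (\<lambda>k. (g ^^ k) a)" using R1_rec[of "\<lambda>k r. g r" a] by (simp add: it)
  have "R3 (\<lambda>k r x. if (g ^^ k) a = x then 1 else r)"
    by (intro rf_if_eq rf rf_comp1[OF i]) auto
  then have 1: "R2 (\<lambda>k x. rec_nat 0 (\<lambda>k r. if (g ^^ k) a = x then 1 else r) k)"
    using R2_rec[of "\<lambda>x. 0" "\<lambda>k r x. if (g ^^ k) a = x then 1 else r"] by (simp add: rf del: One_nat_def)
  have 2: "rec_nat 0 (\<lambda>k r. if (g ^^ k) a = x then 1 else r) k = (if \<exists>j<k. (g ^^ j) a = x then 1 else (0::nat))" for k x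
    by (induction k) (auto simp: less_Suc_eq)
  have le: "k \<le> (g ^^ k) a" for k
    by (induction k) (use inc le_less_trans in \<open>fastforce simp del: funpow.simps\<close>)+
  have "(\<exists>j<Suc x. (g ^^ j) a = x) \<longleftrightarrow> x \<in> range (\<lambda>k. (g ^^ k) a)" for x
    using le by (auto simp: image_iff less_Suc_eq_le)
  moreover have "R1 (\<lambda>x. rec_nat 0 (\<lambda>k r. if (g ^^ k) a = x then 1 else r) (Suc x))"
    using rf_comp2[OF 1, of 1 "\<lambda>xs. Suc (xs ! 0)" "\<lambda>xs. xs ! 0"] by (simp add: rf)
  ultimately have "R1 (\<lambda>x. if x \<in> range (\<lambda>k. (g ^^ k) a) then 1 else 0)" unfolding 2 by simp
  then show ?thesis unfolding recursive_set_def
    by (rule recursive_fun.ext) (auto simp: length_Suc_conv)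
qed

section \<open>Types obtained by iterating a formula context\<close>

inductive ctx :: "(fm \<Rightarrow> fm) \<Rightarrow> bool" where
  const: "ctx (\<lambda>p. q)"
| hole: "ctx (\<lambda>p. p)"
| Neg: "ctx h \<Longrightarrow> ctx (\<lambda>p. Neg (h p))"
| Dsj: "ctx h \<Longrightarrow> ctx h' \<Longrightarrow> ctx (\<lambda>p. Dsj (h p) (h' p))"
| Exi: "ctx h \<Longrightarrow> ctx (\<lambda>p. Exi k (h p))"

lemma nat_lpa_simps [simp]: "zer nat_lpa = 0" "suc nat_lpa = Suc" "pls nat_lpa = (+)" "tms nat_lpa = (*)"
  by (simp_all add: nat_lpa_def)

lemma pair_nat: "pair nat_lpa x y = (x + y) * (x + y) + x"
  by (simp add: pair_def)

lemma ctx_gn: "ctx h \<Longrightarrow> \<exists>g. R1 g \<and> (\<forall>p. gn (h p) = g (gn p))"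
proof (induction rule: ctx.induct)
  case (const q)
  show ?case by (rule exI[where x = "\<lambda>_. gn q"]) (simp add: rf)
next
  case hole
  show ?case by (rule exI[where x = "\<lambda>x. x"]) (simp add: rf)
next
  case (Neg h)
  then obtain g where g: "R1 g" "\<forall>p. gn (h p) = g (gn p)" by blast
  have "R1 (\<lambda>x. c_neg nat_lpa (g x))"
    unfolding c_neg_def tagged_def pair_nat by (intro rf g)
  then show ?case using g(2) by (intro exI[where x = "\<lambda>x. c_neg nat_lpa (g x)"]) simp
next
  case (Dsj h h')
  then obtain g g' where g: "R1 g" "\<forall>p. gn (h p) = g (gn p)" "R1 g'" "\<forall>p. gn (h' p) = g' (gn p)" by blast
  have "R1 (\<lambda>x. c_dsj nat_lpa (g x) (g' x))"
    unfolding c_dsj_def tagged_def pair_nat by (intro rf g)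
  then show ?case using g(2,4) by (intro exI[where x = "\<lambda>x. c_dsj nat_lpa (g x) (g' x)"]) simp
next
  case (Exi h k)
  then obtain g where g: "R1 g" "\<forall>p. gn (h p) = g (gn p)" by blast
  have "R1 (\<lambda>x. c_exi nat_lpa k (g x))"
    unfolding c_exi_def tagged_def pair_nat by (intro rf g)
  then show ?case using g(2) by (intro exI[where x = "\<lambda>x. c_exi nat_lpa k (g x)"]) simp
qed

lemma ctx_vars: "ctx h \<Longrightarrow> \<exists>V. finite V \<and> (\<forall>p. fm_vars (h p) \<subseteq> V \<union> fm_vars p)"
proof (induction rule: ctx.induct)
  case (const q)
  then show ?case using finite_fm_vars by (intro exI[where x = "fm_vars q"]) auto
next
  case (Dsj h h')
  then obtain V V' where "finite V \<and> (\<forall>p. fm_vars (h p) \<subseteq> V \<union> fm_vars p)"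
    "finite V' \<and> (\<forall>p. fm_vars (h' p) \<subseteq> V' \<union> fm_vars p)" by blast
  then show ?case by (intro exI[where x = "V \<union> V'"]) (simp add: le_supI2 subset_iff, blast)
next
  case (Exi h k)
  then show ?case by (metis Diff_subset fm_vars.simps(4) subset_trans)
qed (auto intro: exI[where x = "{}"])

lemma pair_nat_less: "0 < x \<Longrightarrow> y < pair nat_lpa x y" "y \<le> pair nat_lpa x y" "x \<le> pair nat_lpa x y"
proof -
  have "x + y \<le> (x + y) * (x + y)" by (cases "x + y") auto
  then show "0 < x \<Longrightarrow> y < pair nat_lpa x y" "y \<le> pair nat_lpa x y" "x \<le> pair nat_lpa x y"
    unfolding pair_nat by linarith+
qed

lemma gn_less: "gn p < gn (Neg p)" "gn p < gn (Dsj p q)" "gn q < gn (Dsj p q)" "gn p < gn (Exi k p)"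
  unfolding gn.simps c_neg_def c_dsj_def c_exi_def tagged_def
  by (rule pair_nat_less(1) le_less_trans[OF pair_nat_less(2) pair_nat_less(1)]
      le_less_trans[OF pair_nat_less(3) pair_nat_less(1)], simp)+

text \<open>A context acts on Goedel numbers by a recursive function that increases them, so the
  orbit of \<open>p\<close> is a recursive set; and all iterates share finitely many
  variables.\<close>

lemma saturated_iterate:
  assumes M: "recursively_saturated M" and e: "range e \<subseteq> univ M" and h: "ctx h" "\<And>p. gn p < gn (h p)"
    and fin: "\<And>k. \<exists>x\<in>univ M. \<forall>j\<le>k. sat M (e(0 := x)) ((h ^^ j) p)"
  shows "\<exists>x\<in>univ M. \<forall>k. sat M (e(0 := x)) ((h ^^ k) p)"
proof -
  let ?G = "range (\<lambda>k. (h ^^ k) p)"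
  obtain g where g: "R1 g" "\<And>p. gn (h p) = g (gn p)" using ctx_gn[OF h(1)] by blast
  have gk: "(g ^^ k) (gn p) = gn ((h ^^ k) p)" for k by (induction k) (auto simp: g(2))
  have "gn ` ?G = range (\<lambda>k. (g ^^ k) (gn p))" by (auto simp: gk)
  moreover have "(g ^^ k) (gn p) < (g ^^ Suc k) (gn p)" for k using h(2)[of "(h ^^ k) p"] unfolding gk by simp
  ultimately have r: "recursive_set (gn ` ?G)" using recursive_range[OF g(1)] by simp
  obtain V where V: "finite V" "\<And>p. fm_vars (h p) \<subseteq> V \<union> fm_vars p" using ctx_vars[OF h(1)] by blast
  have Vk: "fm_vars ((h ^^ k) p) \<subseteq> V \<union> fm_vars p" for k
  proof (induction k)
    case (Suc k) then show ?case using V(2)[of "(h ^^ k) p"] by auto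
  qed simp
  obtain n where n: "V \<union> fm_vars p \<subseteq> {..n}"
    using finite_nat_iff_bounded_le[of "V \<union> fm_vars p"] V(1) finite_fm_vars by auto
  have "\<exists>x\<in>univ M. \<forall>q\<in>D. sat M (e(0 := x)) q" if D: "finite D" "D \<subseteq> ?G" for D
  proof -
    obtain K where K: "finite K" "D = (\<lambda>k. (h ^^ k) p) ` K" using finite_subset_image[OF D] by blast
    then obtain k where "K \<subseteq> {..k}" using finite_nat_iff_bounded_le by blast
    then show ?thesis using fin[of k] K(2) by blast
  qed
  moreover have "\<forall>q\<in>?G. fm_vars q \<subseteq> {..n}" using Vk n by blast
  ultimately have "\<exists>x\<in>univ M. \<forall>q\<in>?G. sat M (e(0 := x)) q"
    using r e by (intro M[unfolded recursively_saturated_def, THEN spec[where x = ?G], THEN spec[where x = n],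
      THEN spec[where x = e], THEN mp] conjI allI impI; (elim conjE)?)
  then show ?thesis by auto
qed

abbreviation Cnj where "Cnj p q \<equiv> Neg (Dsj (Neg p) (Neg q))"

section \<open>Games of standard length and saturation\<close>

primrec pl :: "('a \<Rightarrow> bool) \<Rightarrow> ('a \<Rightarrow> 'a \<Rightarrow> bool) \<Rightarrow> ('a \<Rightarrow> 'a \<Rightarrow> 'a \<Rightarrow> bool) \<Rightarrow> nat \<Rightarrow> 'a \<Rightarrow> bool" where
  "pl A V R 0 w = A w"
| "pl A V R (Suc k) w = (A w \<and> (\<forall>u. V w u \<longrightarrow> (\<exists>w'. R w u w' \<and> pl A V R k w')))"

lemma pl_le: "j \<le> k \<Longrightarrow> pl A V R k w \<Longrightarrow> pl A V R j w"
proof -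
  have "pl A V R (Suc k) w \<Longrightarrow> pl A V R k w" for k w
    by (induction k arbitrary: w) (auto, blast)
  note * = this
  show "j \<le> k \<Longrightarrow> pl A V R k w \<Longrightarrow> pl A V R j w"
  proof (induction rule: dec_induct)
    case (step n) show ?case using step.IH *[OF step.prems] .
  qed
qed

text \<open>That a response wins \<open>k\<close> further rounds is expressed by the
  \<open>k\<close>-th iterate of one context. Winning more rounds implies winning fewer, so the type
  of a response that wins all of them is finitely satisfiable.\<close>

lemma (in pa) saturated_game:
  assumes sat: "recursively_saturated M"
    and D: "D (\<lambda>e. A (e 0))" "D (\<lambda>e. V (e 0) (e 1))" "D (\<lambda>e. R (e 0) (e 1) (e 2))"
    and z: "\<And>k. pl A V R k z" "V z u"
  shows "\<exists>w. R z u w \<and> (\<forall>k. pl A V R k w)"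
proof -
  have [dfn]: "D (\<lambda>e. A (e i))" "D (\<lambda>e. V (e i) (e j))" "D (\<lambda>e. R (e i) (e j) (e k))" for i j k
  proof -
    show "D (\<lambda>e. A (e i))" by (rule D_at[OF D(1)])
    show "D (\<lambda>e. V (e i) (e j))" by (rule D_at2[OF D(2)])
    show "D (\<lambda>e. R (e i) (e j) (e k))" using D_at3[OF D(3)] .
  qed
  have "D (\<lambda>e. R (e 2) (e 1) (e 0) \<and> A (e 0))" "D (\<lambda>e. V (e 2) (e 1))" by (intro dfn)+
  from D_merge[OF this] obtain r v c where r: "\<And>e. (R (e 2) (e 1) (e 0) \<and> A (e 0)) = sat M (mix e c) r"
    and v: "\<And>e. V (e 2) (e 1) = sat M (mix e c) v" by blast
  \<comment> \<open>The three variables of a move are reused in every round: variable 4 takes over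
    the position from variable 0, variable 2 is the challenge, and variable 0 becomes the
    response.\<close>
  define h where "h p = Cnj r (Exi 4 (Cnj (Eq (Var 4) (Var 0)) (Neg (Exi 2 (Cnj v (Neg (Exi 0 p)))))))" for p
  have ch: "ctx h" unfolding h_def by (intro ctx.intros)
  have gh: "gn p < gn (h p)" for p
    unfolding h_def by (rule less_trans[OF _ gn_less(1)] less_trans[OF _ gn_less(3)] less_trans[OF _ gn_less(4)] gn_less(1) gn_less(4))+
  have upd: "(mix e c)(0 := x) = mix (e(0 := x)) c" "(mix e c)(2 := x) = mix (e(1 := x)) c"
    "(mix e c)(4 := x) = mix (e(2 := x)) c" for e x
    by (auto simp: mix_def fun_eq_iff elim!: evenE)
  have sem: "sat M (mix e c) ((h ^^ k) r) \<longleftrightarrow> R (e 2) (e 1) (e 0) \<and> pl A V R k (e 0)" for e k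
  proof (induction k arbitrary: e)
    case 0 show ?case by (simp add: r[symmetric])
  next
    case (Suc k)
    have "sat M (mix e c) (h q) \<longleftrightarrow> (R (e 2) (e 1) (e 0) \<and> A (e 0)) \<and>
        (\<forall>s. V (e 0) s \<longrightarrow> (\<exists>x. sat M (mix (e(2 := e 0, 1 := s, 0 := x)) c) q))" for q
      unfolding h_def using mix_simps(1)[of _ c 0] mix_simps(1)[of _ c 1] mix_simps(1)[of _ c 2]
      by (auto simp: r[symmetric] v[symmetric] UN upd)
    then show ?case by (auto simp: Suc)
  qed
  let ?e = "mix (\<lambda>n. if n = 2 then z else u) c"
  have 1: "sat M (?e(0 := x)) ((h ^^ k) r) \<longleftrightarrow> R z u x \<and> pl A V R k x" for x k
    unfolding upd sem by simp
  have "\<exists>x\<in>univ M. \<forall>k. sat M (?e(0 := x)) ((h ^^ k) r)"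
  proof (rule saturated_iterate[OF sat _ ch gh])
    fix k
    obtain x where x: "R z u x" "pl A V R k x" using z(1)[of "Suc k"] z(2) by auto
    have "pl A V R j x" if "j \<le> k" for j by (rule pl_le[OF that x(2)])
    then show "\<exists>x\<in>univ M. \<forall>j\<le>k. sat M (?e(0 := x)) ((h ^^ j) r)"
      unfolding 1 UN using x(1) by (intro bexI[where x = x]) simp_all
  qed (simp add: UN)
  then obtain w where "\<forall>k. R z u w \<and> pl A V R k w" unfolding 1 by (elim bexE)
  then show ?thesis by (intro exI[where x = w]) simp
qed

context sgame
begin

text \<open>Each state is served at one step of a countable chain. The union inherits
  \<open>okR\<close>, since every clause mentions at most two answers and these lie in a common
  member of the chain.\<close>

theorem saturated_play:
  assumes sat: "recursively_saturated M" and count: "countable (UNIV :: 'a set)"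
  obtains G where "okR G"
    "\<And>s. \<exists>sq an. df (\<lambda>e. sq (e 0)) \<and> df (\<lambda>e. an (e 0)) \<and> sq \<zero> = s \<and>
      (\<forall>i. sq (sc i) = dl (sq i) (an i)) \<and> (\<forall>i. i \<sqsubset> C \<longrightarrow> G (Q (sq i)) (an i))"
proof -
  let ?pl = "pl OK (\<lambda>_ _. True) ext"
  have con0: "con k H \<Longrightarrow> OK H" for k H using con_le[of 0 k H] by simp
  have con_pl: "con k H \<Longrightarrow> ?pl k H" for k H
  proof (induction k arbitrary: H)
    case (Suc k)
    have "OK H" by (rule con0[OF Suc.prems])
    moreover have "\<exists>H'. ext H s H' \<and> ?pl k H'" for s using Suc.prems Suc.IH by (simp, meson)
    ultimately show ?case by simp
  qed simp
  have step: "\<exists>H'. ext H s H' \<and> (\<forall>k. ?pl k H')" if "\<forall>k. ?pl k H" for H s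
    by (rule saturated_game[OF sat]) (use that in \<open>(intro dfn | simp)+\<close>)
  obtain f :: "nat \<Rightarrow> 'a" where f: "range f = UNIV"
    using range_from_nat_into[OF UNIV_not_empty count] by blast
  obtain F where F0: "F 0 = \<zero>" and F: "\<And>j. ext (F j) (f j) (F (Suc j)) \<and> (\<forall>k. ?pl k (F j))"
  proof -
    have "\<exists>F. F 0 = \<zero> \<and> (\<forall>j. (\<forall>k. ?pl k (F j)) \<and> ext (F j) (f j) (F (Suc j)))"
      using dependent_nat_choice[of "\<lambda>j H. (\<forall>k. ?pl k H) \<and> (j = 0 \<longrightarrow> H = \<zero>)" "\<lambda>j H H'. ext H (f j) H'"]
        con_pl[OF con_empty] step by (metis nat.distinct(1))
    then show ?thesis using that by blast
  qed
  define G where "G p b \<longleftrightarrow> (\<exists>j. pr p b \<epsilon> F j)" for p b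
  have mono: "i \<le> j \<Longrightarrow> x \<epsilon> F i \<Longrightarrow> x \<epsilon> F j" for i j x
    by (induction rule: dec_induct) (use F in \<open>auto simp: ext_def\<close>)
  have ok: "okR (\<lambda>p b. pr p b \<epsilon> F j)" for j using F[of j] pl.simps(1)[of OK] unfolding OK_def by blast
  have two: "\<exists>j. pr p b \<epsilon> F j \<and> pr q b' \<epsilon> F j" if G: "G p b" "G q b'" for p b q b'
  proof -
    obtain i j where ij: "pr p b \<epsilon> F i" "pr q b' \<epsilon> F j" using G unfolding G_def by blast
    then have "pr p b \<epsilon> F (max i j)" "pr q b' \<epsilon> F (max i j)" using mono max.cobounded1 max.cobounded2 by blast+
    then show ?thesis by blast
  qed
  have "okR G" unfolding okR_def
  proof (intro conjI allI impI; (elim conjE)?)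
    fix p a b assume "G p a" "G p b"
    from two[OF this] show "a = b" using ok unfolding okR_def by blast
  next
    fix p a assume "G p a" "lf p"
    then show "(a \<noteq> \<zero>) = At p" using ok unfolding okR_def G_def by blast
  next
    fix p a b assume *: "\<not> lf p" and "G p (sc a)" "G (inst p a) b"
    from two[OF this(2,3)] obtain j where j: "pr p (sc a) \<epsilon> F j" "pr (inst p a) b \<epsilon> F j" by blast
    with * show "(b \<noteq> \<zero>) = sg p" using ok[of j] unfolding okR_def by blast
  next
    fix p a b assume *: "\<not> lf p" and "G p \<zero>" "G (inst p a) b"
    from two[OF this(2,3)] obtain j where j: "pr p \<zero> \<epsilon> F j" "pr (inst p a) b \<epsilon> F j" by blast
    with * show "(b \<noteq> \<zero>) \<noteq> sg p" using ok[of j] unfolding okR_def by blast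
  qed
  moreover have "\<exists>sq an. df (\<lambda>e. sq (e 0)) \<and> df (\<lambda>e. an (e 0)) \<and> sq \<zero> = s \<and>
      (\<forall>i. sq (sc i) = dl (sq i) (an i)) \<and> (\<forall>i. i \<sqsubset> C \<longrightarrow> G (Q (sq i)) (an i))" for s
  proof -
    obtain j where "s = f j" using f by (metis rangeE UNIV_I)
    then have "play (F (Suc j)) s" using F[of j] unfolding ext_def by blast
    then obtain z where z: "\<And>i. i \<sqsubset> C \<Longrightarrow> G (Q (sqz z s i)) (bval (pf z) (ps z) i)"
      unfolding play_def G_def by blast
    have "df (\<lambda>e. sqz z s (e 0))" "df (\<lambda>e. bval (pf z) (ps z) (e 0))" by (intro dfn)+
    then show ?thesis using z sqz_simps
      by - (rule exI[where x = "sqz z s"], rule exI[where x = "\<lambda>i. bval (pf z) (ps z) i"], blast)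
  qed
  ultimately show ?thesis using that by blast
qed

end

context pa
begin

section \<open>Arithmetized syntax\<close>

lemmas c_defs = c_var_def c_zero_def c_suc_def c_add_def c_mul_def c_eq_def c_neg_def c_dsj_def c_exi_def

lemma num_inj [simp]: "(sc ^^ m) \<zero> = (sc ^^ n) \<zero> \<longleftrightarrow> m = n"
proof (induction m arbitrary: n)
  case 0 show ?case by (cases n) auto
next
  case (Suc m) then show ?case by (cases n) auto
qed

lemma tagged_inj [simp]: "tagged M m x = tagged M n y \<longleftrightarrow> m = n \<and> x = y"
  by (simp add: tagged_def)

lemma c_inj [simp]:
  "c_var M k = c_var M l \<longleftrightarrow> k = l" "c_suc M x = c_suc M y \<longleftrightarrow> x = y"
  "c_add M x y = c_add M u v \<longleftrightarrow> x = u \<and> y = v" "c_mul M x y = c_mul M u v \<longleftrightarrow> x = u \<and> y = v"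
  "c_eq M x y = c_eq M u v \<longleftrightarrow> x = u \<and> y = v" "c_neg M x = c_neg M y \<longleftrightarrow> x = y"
  "c_dsj M x y = c_dsj M u v \<longleftrightarrow> x = u \<and> y = v" "c_exi M x y = c_exi M u v \<longleftrightarrow> x = u \<and> y = v"
  by (simp_all add: c_defs)

lemma c_dist [simp]:
  "c_var M k \<noteq> c_zero M" "c_var M k \<noteq> c_suc M x" "c_var M k \<noteq> c_add M x y" "c_var M k \<noteq> c_mul M x y"
  "c_zero M \<noteq> c_var M k" "c_zero M \<noteq> c_suc M x" "c_zero M \<noteq> c_add M x y" "c_zero M \<noteq> c_mul M x y"
  "c_suc M u \<noteq> c_var M k" "c_suc M u \<noteq> c_zero M" "c_suc M u \<noteq> c_add M x y" "c_suc M u \<noteq> c_mul M x y"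
  "c_add M u v \<noteq> c_var M k" "c_add M u v \<noteq> c_zero M" "c_add M u v \<noteq> c_suc M x" "c_add M u v \<noteq> c_mul M x y"
  "c_mul M u v \<noteq> c_var M k" "c_mul M u v \<noteq> c_zero M" "c_mul M u v \<noteq> c_suc M x" "c_mul M u v \<noteq> c_add M x y"
  "c_eq M u v \<noteq> c_neg M x" "c_eq M u v \<noteq> c_dsj M x y" "c_eq M u v \<noteq> c_exi M x y"
  "c_neg M u \<noteq> c_eq M x y" "c_neg M u \<noteq> c_dsj M x y" "c_neg M u \<noteq> c_exi M x y"
  "c_dsj M u v \<noteq> c_eq M x y" "c_dsj M u v \<noteq> c_neg M x" "c_dsj M u v \<noteq> c_exi M x y"
  "c_exi M u v \<noteq> c_eq M x y" "c_exi M u v \<noteq> c_neg M x" "c_exi M u v \<noteq> c_dsj M x y"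
  by (simp_all add: c_defs)

lemma less_tagged: "x \<sqsubset> tagged M (Suc n) x"
proof -
  let ?t = "(sc ^^ Suc n) \<zero>"
  have "x \<sqsubset> ?t \<oplus> x" by (simp add: add_commute)
  also have "\<dots> \<sqsubseteq> (?t \<oplus> x) \<otimes> (?t \<oplus> x)" by (rule le_sq)
  also have "\<dots> \<sqsubseteq> (?t \<oplus> x) \<otimes> (?t \<oplus> x) \<oplus> ?t" by (rule le_add)
  finally show ?thesis unfolding tagged_def pair_def .
qed

lemma c_less [simp]:
  "x \<sqsubset> c_suc M x" "x \<sqsubset> c_add M x y" "y \<sqsubset> c_add M x y" "x \<sqsubset> c_mul M x y" "y \<sqsubset> c_mul M x y"
  "x \<sqsubset> c_neg M x" "x \<sqsubset> c_dsj M x y" "y \<sqsubset> c_dsj M x y" "y \<sqsubset> c_exi M x y"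
proof -
  have 1: "x \<sqsubset> tagged M n x" if "n > 0" for n x using less_tagged[of x "n - 1"] that by simp
  show "x \<sqsubset> c_suc M x" "x \<sqsubset> c_neg M x" unfolding c_defs by (rule 1, simp)+
  show "x \<sqsubset> c_add M x y" "y \<sqsubset> c_add M x y" "x \<sqsubset> c_mul M x y" "y \<sqsubset> c_mul M x y"
    "x \<sqsubset> c_dsj M x y" "y \<sqsubset> c_dsj M x y" "y \<sqsubset> c_exi M x y"
    unfolding c_defs by (rule A.le_less_trans[OF pr_ge(1) 1] A.le_less_trans[OF pr_ge(2) 1], simp)+
qed

lemma df_tagged [dfn]: "df f \<Longrightarrow> df (\<lambda>e. tagged M n (f e))"
  unfolding tagged_def by (intro dfn)

lemma df_c [dfn]:
  "df f \<Longrightarrow> df (\<lambda>e. c_var M (f e))" "df (\<lambda>e. c_zero M)" "df f \<Longrightarrow> df (\<lambda>e. c_suc M (f e))"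
  "df f \<Longrightarrow> df g \<Longrightarrow> df (\<lambda>e. c_add M (f e) (g e))" "df f \<Longrightarrow> df g \<Longrightarrow> df (\<lambda>e. c_mul M (f e) (g e))"
  "df f \<Longrightarrow> df g \<Longrightarrow> df (\<lambda>e. c_eq M (f e) (g e))" "df f \<Longrightarrow> df (\<lambda>e. c_neg M (f e))"
  "df f \<Longrightarrow> df g \<Longrightarrow> df (\<lambda>e. c_dsj M (f e) (g e))" "df f \<Longrightarrow> df g \<Longrightarrow> df (\<lambda>e. c_exi M (f e) (g e))"
  unfolding c_defs by (intro dfn; assumption)+

section \<open>Certificates and the recursion equations of the syntax\<close>

definition Cert :: "(('a \<Rightarrow> bool) \<Rightarrow> 'a \<Rightarrow> bool) \<Rightarrow> 'a \<Rightarrow> bool" where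
  "Cert \<Phi> x \<longleftrightarrow> (\<exists>c. x \<epsilon> c \<and> (\<forall>y. y \<epsilon> c \<longrightarrow> \<Phi> (\<lambda>z. z \<epsilon> c) y))"

lemma coded_un: "\<exists>c. \<forall>z. z \<epsilon> c \<longleftrightarrow> z \<epsilon> a \<or> z \<epsilon> b \<or> z = x"
proof -
  have "D (\<lambda>e. e 0 \<epsilon> a \<or> e 0 \<epsilon> b \<or> e 0 = x)" by (intro dfn)
  from comprehension[OF this, of "sc (a \<oplus> b \<oplus> x)"] obtain c where
    c: "\<forall>z. z \<epsilon> c \<longleftrightarrow> z \<sqsubset> sc (a \<oplus> b \<oplus> x) \<and> (z \<epsilon> a \<or> z \<epsilon> b \<or> z = x)" by blast
  have "a \<sqsubseteq> a \<oplus> b \<oplus> x" "b \<sqsubseteq> a \<oplus> b \<oplus> x"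
    by (rule A.order_trans[OF le_add(1) le_add(1)] A.order_trans[OF le_add(2) le_add(1)])+
  then have "z \<epsilon> a \<or> z \<epsilon> b \<or> z = x \<Longrightarrow> z \<sqsubseteq> a \<oplus> b \<oplus> x" for z
    using A.order_trans[OF A.less_imp_le[OF bit_less]] by auto
  then show ?thesis using c by auto
qed

lemma not_mem_zero [simp]: "\<not> x \<epsilon> \<zero>"
  using bit_less not_less_zero by blast

text \<open>One proof of the recursion equation for all notions given by certificates. A new
  certificate joins those of the premises; by \<open>fin\<close> at most two are needed, so the
  union is again coded.\<close>

lemma Cert_iff:
  assumes mono: "\<And>P Q y. \<Phi> P y \<Longrightarrow> (\<And>z. P z \<Longrightarrow> Q z) \<Longrightarrow> \<Phi> Q y"
    and fin: "\<And>P y. \<Phi> P y \<Longrightarrow> \<Phi> (\<lambda>_. False) y \<or> (\<exists>z w. P z \<and> P w \<and> \<Phi> (\<lambda>v. v = z \<or> v = w) y)"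
  shows "Cert \<Phi> x \<longleftrightarrow> \<Phi> (Cert \<Phi>) x"
proof
  assume "Cert \<Phi> x"
  then obtain c where c: "x \<epsilon> c" "\<forall>y. y \<epsilon> c \<longrightarrow> \<Phi> (\<lambda>z. z \<epsilon> c) y" unfolding Cert_def by (elim exE conjE)
  show "\<Phi> (Cert \<Phi>) x"
  proof (rule mono[OF c(2)[rule_format, OF c(1)]])
    fix z assume "z \<epsilon> c"
    then show "Cert \<Phi> z" unfolding Cert_def using c(2) by (intro exI[where x = c] conjI)
  qed
next
  have ins: "Cert \<Phi> x" if A: "\<And>y. y \<epsilon> a \<Longrightarrow> \<Phi> (\<lambda>z. z \<epsilon> a) y" and B: "\<And>y. y \<epsilon> b \<Longrightarrow> \<Phi> (\<lambda>z. z \<epsilon> b) y"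
    and X: "\<Phi> (\<lambda>v. v \<epsilon> a \<or> v \<epsilon> b) x" for a b
  proof -
    obtain c where c: "\<And>z. z \<epsilon> c \<longleftrightarrow> z \<epsilon> a \<or> z \<epsilon> b \<or> z = x" using coded_un[of a b x] by blast
    have st: "\<Phi> (\<lambda>z. z \<epsilon> c) y" if y: "y \<epsilon> c" for y
    proof -
      from y consider "y \<epsilon> a" | "y \<epsilon> b" | "y = x" unfolding c by blast
      then show ?thesis
      proof cases
        case 1 show ?thesis by (rule mono[OF A[OF 1]]) (simp add: c)
      next
        case 2 show ?thesis by (rule mono[OF B[OF 2]]) (simp add: c)
      next
        case 3 show ?thesis unfolding 3 by (rule mono[OF X]) (auto simp: c)
      qed
    qed
    show ?thesis unfolding Cert_def
    proof (intro exI conjI allI impI)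
      show "x \<epsilon> c" by (simp add: c)
    qed (rule st)
  qed
  assume "\<Phi> (Cert \<Phi>) x"
  from fin[OF this] show "Cert \<Phi> x"
  proof (elim disjE exE conjE)
    assume 1: "\<Phi> (\<lambda>_. False) x"
    show ?thesis by (rule ins[of \<zero> \<zero>]) (use 1 in simp_all)
  next
    fix z w assume zw: "Cert \<Phi> z" "Cert \<Phi> w" and 2: "\<Phi> (\<lambda>v. v = z \<or> v = w) x"
    obtain a where a: "z \<epsilon> a" "\<forall>y. y \<epsilon> a \<longrightarrow> \<Phi> (\<lambda>z. z \<epsilon> a) y" using zw(1) unfolding Cert_def by (elim exE conjE)
    obtain b where b: "w \<epsilon> b" "\<forall>y. y \<epsilon> b \<longrightarrow> \<Phi> (\<lambda>z. z \<epsilon> b) y" using zw(2) unfolding Cert_def by (elim exE conjE)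
    show ?thesis
    proof (rule ins[OF a(2)[rule_format] b(2)[rule_format]])
      show "\<Phi> (\<lambda>v. v \<epsilon> a \<or> v \<epsilon> b) x" by (rule mono[OF 2]) (use a(1) b(1) in auto)
    qed
  qed
qed

lemma is_term_iff: "is_term M x \<longleftrightarrow> (\<exists>k. x = c_var M k) \<or> x = c_zero M \<or>
    (\<exists>r. is_term M r \<and> x = c_suc M r) \<or>
    (\<exists>r s. is_term M r \<and> is_term M s \<and> (x = c_add M r s \<or> x = c_mul M r s))"
proof -
  let ?\<Phi> = "\<lambda>P y. (\<exists>k. y = c_var M k) \<or> y = c_zero M \<or> (\<exists>r. P r \<and> y = c_suc M r) \<or>
    (\<exists>r s. P r \<and> P s \<and> (y = c_add M r s \<or> y = c_mul M r s))"
  have *: "is_term M t \<longleftrightarrow> Cert ?\<Phi> t" for t by (simp add: is_term_def Cert_def UN)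
  show ?thesis unfolding * by (rule Cert_iff; elim disjE exE conjE; simp; blast)
qed

lemma occurs_iff: "occurs M v x \<longleftrightarrow> x = c_var M v \<or> (\<exists>r. occurs M v r \<and> x = c_suc M r) \<or>
    (\<exists>r s. (occurs M v r \<or> occurs M v s) \<and> (x = c_add M r s \<or> x = c_mul M r s))"
proof -
  let ?\<Phi> = "\<lambda>P y. y = c_var M v \<or> (\<exists>r. P r \<and> y = c_suc M r) \<or>
    (\<exists>r s. (P r \<or> P s) \<and> (y = c_add M r s \<or> y = c_mul M r s))"
  have *: "occurs M v t \<longleftrightarrow> Cert ?\<Phi> t" for t by (simp add: occurs_def Cert_def UN)
  show ?thesis unfolding * by (rule Cert_iff; elim disjE exE conjE; simp; blast)
qed

lemma is_form_iff: "is_form M x \<longleftrightarrow> (\<exists>s t. is_term M s \<and> is_term M t \<and> x = c_eq M s t) \<or>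
      (\<exists>z. is_form M z \<and> x = c_neg M z) \<or> (\<exists>z w. is_form M z \<and> is_form M w \<and> x = c_dsj M z w) \<or>
      (\<exists>k z. is_form M z \<and> x = c_exi M k z)"
proof -
  let ?\<Phi> = "\<lambda>P y. (\<exists>s t. is_term M s \<and> is_term M t \<and> y = c_eq M s t) \<or>
      (\<exists>z. P z \<and> y = c_neg M z) \<or> (\<exists>z w. P z \<and> P w \<and> y = c_dsj M z w) \<or>
      (\<exists>k z. P z \<and> y = c_exi M k z)"
  have *: "is_form M t \<longleftrightarrow> Cert ?\<Phi> t" for t by (simp add: is_form_def Cert_def UN)
  show ?thesis unfolding * by (rule Cert_iff; elim disjE exE conjE; simp; blast)
qed

lemma free_in_iff: "free_in M v x \<longleftrightarrow> (\<exists>s t. (occurs M v s \<or> occurs M v t) \<and> x = c_eq M s t) \<or>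
      (\<exists>z. free_in M v z \<and> x = c_neg M z) \<or> (\<exists>z w. (free_in M v z \<or> free_in M v w) \<and> x = c_dsj M z w) \<or>
      (\<exists>k z. k \<noteq> v \<and> free_in M v z \<and> x = c_exi M k z)"
proof -
  let ?\<Phi> = "\<lambda>P y. (\<exists>s t. (occurs M v s \<or> occurs M v t) \<and> y = c_eq M s t) \<or>
      (\<exists>z. P z \<and> y = c_neg M z) \<or> (\<exists>z w. (P z \<or> P w) \<and> y = c_dsj M z w) \<or>
      (\<exists>k z. k \<noteq> v \<and> P z \<and> y = c_exi M k z)"
  have *: "free_in M v t \<longleftrightarrow> Cert ?\<Phi> t" for t by (simp add: free_in_def Cert_def UN)
  show ?thesis unfolding * by (rule Cert_iff; elim disjE exE conjE; simp; blast)
qed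

lemma free_for_iff: "free_for M t v x \<longleftrightarrow> (\<exists>r s. x = c_eq M r s) \<or>
      (\<exists>z. free_for M t v z \<and> x = c_neg M z) \<or> (\<exists>z w. free_for M t v z \<and> free_for M t v w \<and> x = c_dsj M z w) \<or>
      (\<exists>k z. x = c_exi M k z \<and> (\<not> free_in M v x \<or> free_for M t v z \<and> \<not> occurs M k t))"
proof -
  let ?\<Phi> = "\<lambda>P y. (\<exists>r s. y = c_eq M r s) \<or>
      (\<exists>z. P z \<and> y = c_neg M z) \<or> (\<exists>z w. P z \<and> P w \<and> y = c_dsj M z w) \<or>
      (\<exists>k z. y = c_exi M k z \<and> (\<not> free_in M v y \<or> P z \<and> \<not> occurs M k t))"
  have *: "free_for M t v y \<longleftrightarrow> Cert ?\<Phi> y" for y by (simp add: free_for_def Cert_def UN)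
  show ?thesis unfolding * by (rule Cert_iff; elim disjE exE conjE; simp; blast)
qed

lemma value_of_iff: "value_of M t a \<longleftrightarrow> t = c_zero M \<and> a = \<zero> \<or>
      (\<exists>r x. value_of M r x \<and> t = c_suc M r \<and> a = sc x) \<or>
      (\<exists>r x s y. value_of M r x \<and> value_of M s y \<and>
         (t = c_add M r s \<and> a = x \<oplus> y \<or> t = c_mul M r s \<and> a = x \<otimes> y))"
proof -
  let ?\<Phi> = "\<lambda>P p. p = pr (c_zero M) \<zero> \<or> (\<exists>r x. P (pr r x) \<and> p = pr (c_suc M r) (sc x)) \<or>
      (\<exists>r x s y. P (pr r x) \<and> P (pr s y) \<and>
         (p = pr (c_add M r s) (x \<oplus> y) \<or> p = pr (c_mul M r s) (x \<otimes> y)))"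
  have *: "value_of M t a \<longleftrightarrow> Cert ?\<Phi> (pr t a)" for t a by (simp add: value_of_def Cert_def UN del: pr_inj)
  have "Cert ?\<Phi> (pr t a) \<longleftrightarrow> ?\<Phi> (Cert ?\<Phi>) (pr t a)" by (rule Cert_iff; elim disjE exE conjE; simp; blast)
  then show ?thesis unfolding *[symmetric] by simp
qed

lemma numeral_of_iff: "numeral_of M x t \<longleftrightarrow> x = \<zero> \<and> t = c_zero M \<or>
    (\<exists>y s. numeral_of M y s \<and> x = sc y \<and> t = c_suc M s)"
proof -
  let ?\<Phi> = "\<lambda>P p. p = pr \<zero> (c_zero M) \<or> (\<exists>y s. P (pr y s) \<and> p = pr (sc y) (c_suc M s))"
  have *: "numeral_of M x t \<longleftrightarrow> Cert ?\<Phi> (pr x t)" for x t by (simp add: numeral_of_def Cert_def UN del: pr_inj)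
  have "Cert ?\<Phi> (pr x t) \<longleftrightarrow> ?\<Phi> (Cert ?\<Phi>) (pr x t)" by (rule Cert_iff; elim disjE exE conjE; simp; blast)
  then show ?thesis unfolding *[symmetric] by simp
qed

lemma tm_subst_iff: "tm_subst M d t t' \<longleftrightarrow>
      (\<exists>k. pr k t' \<epsilon> d \<and> t = c_var M k) \<or> (\<exists>k. (\<forall>s. \<not> pr k s \<epsilon> d) \<and> t = c_var M k \<and> t' = c_var M k) \<or>
      t = c_zero M \<and> t' = c_zero M \<or> (\<exists>r r'. tm_subst M d r r' \<and> t = c_suc M r \<and> t' = c_suc M r') \<or>
      (\<exists>r r' s s'. tm_subst M d r r' \<and> tm_subst M d s s' \<and>
         (t = c_add M r s \<and> t' = c_add M r' s' \<or> t = c_mul M r s \<and> t' = c_mul M r' s'))"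
proof -
  let ?\<Phi> = "\<lambda>P p. (\<exists>k s. pr k s \<epsilon> d \<and> p = pr (c_var M k) s) \<or>
      (\<exists>k. (\<forall>s. \<not> pr k s \<epsilon> d) \<and> p = pr (c_var M k) (c_var M k)) \<or>
      p = pr (c_zero M) (c_zero M) \<or> (\<exists>r r'. P (pr r r') \<and> p = pr (c_suc M r) (c_suc M r')) \<or>
      (\<exists>r r' s s'. P (pr r r') \<and> P (pr s s') \<and>
         (p = pr (c_add M r s) (c_add M r' s') \<or> p = pr (c_mul M r s) (c_mul M r' s')))"
  have *: "tm_subst M d t t' \<longleftrightarrow> Cert ?\<Phi> (pr t t')" for t t'
    by (simp add: tm_subst_def Cert_def UN del: pr_inj)
  have "Cert ?\<Phi> (pr t t') \<longleftrightarrow> ?\<Phi> (Cert ?\<Phi>) (pr t t')" by (rule Cert_iff; elim disjE exE conjE; simp; blast)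
  then show ?thesis unfolding *[symmetric] by simp
qed

lemma fm_subst_iff: "fm_subst M d x x' \<longleftrightarrow>
      (\<exists>s s' t t'. tm_subst M d s s' \<and> tm_subst M d t t' \<and> x = c_eq M s t \<and> x' = c_eq M s' t') \<or>
      (\<exists>y y'. fm_subst M d y y' \<and> x = c_neg M y \<and> x' = c_neg M y') \<or>
      (\<exists>y y' z z'. fm_subst M d y y' \<and> fm_subst M d z z' \<and> x = c_dsj M y z \<and> x' = c_dsj M y' z') \<or>
      (\<exists>k y y' d'. drop_var M k d d' \<and> fm_subst M d' y y' \<and> x = c_exi M k y \<and> x' = c_exi M k y')"
proof -
  \<comment> \<open>The substitution changes below a quantifier, so it is a component of the
    certified facts instead of a parameter.\<close>
  let ?\<Phi> = "\<lambda>P p. (\<exists>d s s' t t'. tm_subst M d s s' \<and> tm_subst M d t t' \<and>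
         p = pr d (pr (c_eq M s t) (c_eq M s' t'))) \<or>
      (\<exists>d y y'. P (pr d (pr y y')) \<and> p = pr d (pr (c_neg M y) (c_neg M y'))) \<or>
      (\<exists>d y y' z z'. P (pr d (pr y y')) \<and> P (pr d (pr z z')) \<and> p = pr d (pr (c_dsj M y z) (c_dsj M y' z'))) \<or>
      (\<exists>d k y y' d'. drop_var M k d d' \<and> P (pr d' (pr y y')) \<and> p = pr d (pr (c_exi M k y) (c_exi M k y')))"
  have *: "fm_subst M d x x' \<longleftrightarrow> Cert ?\<Phi> (pr d (pr x x'))" for d x x'
    by (simp add: fm_subst_def Cert_def UN ex_disj_distrib del: pr_inj)
  have "Cert ?\<Phi> (pr d (pr x x')) \<longleftrightarrow> ?\<Phi> (Cert ?\<Phi>) (pr d (pr x x'))"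
    by (rule Cert_iff; elim disjE exE conjE; simp; blast)
  then show ?thesis unfolding *[symmetric] by (simp; blast)
qed

lemma is_term_simps [simp]: "is_term M (c_var M k)" "is_term M (c_zero M)" "is_term M (c_suc M r) \<longleftrightarrow> is_term M r"
  "is_term M (c_add M r s) \<longleftrightarrow> is_term M r \<and> is_term M s" "is_term M (c_mul M r s) \<longleftrightarrow> is_term M r \<and> is_term M s"
  by ((subst is_term_iff, auto); fail)+

lemma occurs_simps [simp]: "occurs M v (c_var M k) \<longleftrightarrow> k = v" "\<not> occurs M v (c_zero M)"
  "occurs M v (c_suc M r) \<longleftrightarrow> occurs M v r" "occurs M v (c_add M r s) \<longleftrightarrow> occurs M v r \<or> occurs M v s"
  "occurs M v (c_mul M r s) \<longleftrightarrow> occurs M v r \<or> occurs M v s"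
  by ((subst occurs_iff, auto); fail)+

lemma is_form_simps [simp]: "is_form M (c_eq M s t) \<longleftrightarrow> is_term M s \<and> is_term M t"
  "is_form M (c_neg M x) \<longleftrightarrow> is_form M x" "is_form M (c_dsj M x y) \<longleftrightarrow> is_form M x \<and> is_form M y"
  "is_form M (c_exi M k x) \<longleftrightarrow> is_form M x"
  by ((subst is_form_iff, auto); fail)+

lemma free_in_simps [simp]: "free_in M v (c_eq M s t) \<longleftrightarrow> occurs M v s \<or> occurs M v t"
  "free_in M v (c_neg M x) \<longleftrightarrow> free_in M v x" "free_in M v (c_dsj M x y) \<longleftrightarrow> free_in M v x \<or> free_in M v y"
  "free_in M v (c_exi M k x) \<longleftrightarrow> k \<noteq> v \<and> free_in M v x"
  by ((subst free_in_iff, auto); fail)+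

lemma free_for_simps [simp]: "free_for M t v (c_eq M r s)" "free_for M t v (c_neg M x) \<longleftrightarrow> free_for M t v x"
  "free_for M t v (c_dsj M x y) \<longleftrightarrow> free_for M t v x \<and> free_for M t v y"
  "free_for M t v (c_exi M k x) \<longleftrightarrow> \<not> free_in M v (c_exi M k x) \<or> free_for M t v x \<and> \<not> occurs M k t"
  by ((subst free_for_iff, auto); fail)+

lemma tm_subst_simps [simp]:
  "tm_subst M d (c_var M k) t' \<longleftrightarrow> pr k t' \<epsilon> d \<or> (\<forall>s. \<not> pr k s \<epsilon> d) \<and> t' = c_var M k"
  "tm_subst M d (c_zero M) t' \<longleftrightarrow> t' = c_zero M"
  "tm_subst M d (c_suc M r) t' \<longleftrightarrow> (\<exists>r'. tm_subst M d r r' \<and> t' = c_suc M r')"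
  "tm_subst M d (c_add M r s) t' \<longleftrightarrow> (\<exists>r' s'. tm_subst M d r r' \<and> tm_subst M d s s' \<and> t' = c_add M r' s')"
  "tm_subst M d (c_mul M r s) t' \<longleftrightarrow> (\<exists>r' s'. tm_subst M d r r' \<and> tm_subst M d s s' \<and> t' = c_mul M r' s')"
  by ((subst tm_subst_iff, auto); fail)+

lemma fm_subst_simps [simp]:
  "fm_subst M d (c_eq M s t) x' \<longleftrightarrow> (\<exists>s' t'. tm_subst M d s s' \<and> tm_subst M d t t' \<and> x' = c_eq M s' t')"
  "fm_subst M d (c_neg M y) x' \<longleftrightarrow> (\<exists>y'. fm_subst M d y y' \<and> x' = c_neg M y')"
  "fm_subst M d (c_dsj M y z) x' \<longleftrightarrow> (\<exists>y' z'. fm_subst M d y y' \<and> fm_subst M d z z' \<and> x' = c_dsj M y' z')"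
  "fm_subst M d (c_exi M k y) x' \<longleftrightarrow> (\<exists>y' d'. drop_var M k d d' \<and> fm_subst M d' y y' \<and> x' = c_exi M k y')"
  by ((subst fm_subst_iff, auto); fail)+

lemma D_is_term [dfn]: "df f \<Longrightarrow> D (\<lambda>e. is_term M (f e))"
  by (rule D_app1[where R = "is_term M"]) (unfold is_term_def, intro dfn)

lemma D_syntax [dfn]:
  "df f \<Longrightarrow> D (\<lambda>e. is_form M (f e))"
  "df f \<Longrightarrow> df g \<Longrightarrow> D (\<lambda>e. occurs M (f e) (g e))" "df f \<Longrightarrow> df g \<Longrightarrow> D (\<lambda>e. value_of M (f e) (g e))"
  "df f \<Longrightarrow> df g \<Longrightarrow> D (\<lambda>e. numeral_of M (f e) (g e))"
  "df f \<Longrightarrow> df g \<Longrightarrow> df h \<Longrightarrow> D (\<lambda>e. tm_subst M (f e) (g e) (h e))"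
  "df f \<Longrightarrow> df g \<Longrightarrow> df h \<Longrightarrow> D (\<lambda>e. drop_var M (f e) (g e) (h e))"
proof -
  show "df f \<Longrightarrow> D (\<lambda>e. is_form M (f e))"
    by (rule D_app1[where R = "is_form M"]) (unfold is_form_def, intro dfn)
  show "df f \<Longrightarrow> df g \<Longrightarrow> D (\<lambda>e. occurs M (f e) (g e))"
    by (rule D_app2[where R = "occurs M"]) (unfold occurs_def, intro dfn)
  show "df f \<Longrightarrow> df g \<Longrightarrow> D (\<lambda>e. value_of M (f e) (g e))"
    by (rule D_app2[where R = "value_of M"]) (unfold value_of_def, intro dfn)
  show "df f \<Longrightarrow> df g \<Longrightarrow> D (\<lambda>e. numeral_of M (f e) (g e))"
    by (rule D_app2[where R = "numeral_of M"]) (unfold numeral_of_def, intro dfn)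
  show "df f \<Longrightarrow> df g \<Longrightarrow> df h \<Longrightarrow> D (\<lambda>e. tm_subst M (f e) (g e) (h e))"
    by (rule D_app3[where R = "tm_subst M"]) (unfold tm_subst_def, intro dfn)
  show "df f \<Longrightarrow> df g \<Longrightarrow> df h \<Longrightarrow> D (\<lambda>e. drop_var M (f e) (g e) (h e))"
    by (rule D_app3[where R = "drop_var M"]) (unfold drop_var_def, intro dfn)
qed

lemma D_syntax' [dfn]:
  "df f \<Longrightarrow> df g \<Longrightarrow> D (\<lambda>e. free_in M (f e) (g e))"
  "df f \<Longrightarrow> df g \<Longrightarrow> df h \<Longrightarrow> D (\<lambda>e. fm_subst M (f e) (g e) (h e))"
proof -
  show "df f \<Longrightarrow> df g \<Longrightarrow> D (\<lambda>e. free_in M (f e) (g e))"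
    by (rule D_app2[where R = "free_in M"]) (unfold free_in_def, intro dfn)
  show "df f \<Longrightarrow> df g \<Longrightarrow> df h \<Longrightarrow> D (\<lambda>e. fm_subst M (f e) (g e) (h e))"
    by (rule D_app3[where R = "fm_subst M"]) (unfold fm_subst_def, intro dfn)
qed

lemma D_free_for [dfn]: "df f \<Longrightarrow> df g \<Longrightarrow> df h \<Longrightarrow> D (\<lambda>e. free_for M (f e) (g e) (h e))"
  by (rule D_app3[where R = "free_for M"]) (unfold free_for_def, intro dfn)

end

section \<open>Formulae under assignments, up to bisimilarity\<close>

locale tsys = pa M for M :: "'a lpa" +
  fixes f :: "'a \<Rightarrow> 'a \<Rightarrow> 'a" and ob :: "'a \<Rightarrow> 'a"
  assumes f_df: "df (\<lambda>e. f (e 1) (e 0))" and ob_df: "df (\<lambda>e. ob (e 0))"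
begin

definition wlk where "wlk z x k = mrec x (\<lambda>i y. f y (bval (pf z) (ps z) i)) k"
text \<open>For a deterministic system, equal observations along all paths amount to bisimilarity.
  As paths are beta-coded elements, the relation is definable and a least representative can be
  chosen.\<close>

definition bsm where "bsm x y \<longleftrightarrow> (\<forall>z k. ob (wlk z x k) = ob (wlk z y k))"
definition nd where "nd x = lst (\<lambda>y. bsm x y)"

lemma df_fob [dfn]: "df g \<Longrightarrow> df h \<Longrightarrow> df (\<lambda>e. f (g e) (h e))" "df g \<Longrightarrow> df (\<lambda>e. ob (g e))"
  by (rule df2[OF f_df], assumption+) (rule df_comp[OF ob_df])

lemma df_wlk [dfn]: "df g \<Longrightarrow> df h \<Longrightarrow> df k \<Longrightarrow> df (\<lambda>e. wlk (g e) (h e) (k e))"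
  by (rule df_app3[where F = wlk]) (unfold wlk_def, intro dfn)

lemma D_bsm [dfn]: "df g \<Longrightarrow> df h \<Longrightarrow> D (\<lambda>e. bsm (g e) (h e))"
  by (rule D_app2[where R = bsm]) (unfold bsm_def, intro dfn)

lemma df_nd [dfn]: "df g \<Longrightarrow> df (\<lambda>e. nd (g e))"
  by (rule df_app1[where F = nd]) (unfold nd_def, intro dfn)

lemma wlk_simps: "wlk z x \<zero> = x" "wlk z x (sc k) = f (wlk z x k) (bval (pf z) (ps z) k)"
proof -
  have d: "df (\<lambda>e. f (e 0) (bval (pf z) (ps z) (e 1)))" by (intro dfn)
  show "wlk z x \<zero> = x" "wlk z x (sc k) = f (wlk z x k) (bval (pf z) (ps z) k)"
    unfolding wlk_def using mrec_0[OF d] mrec_S[OF d] by simp_all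
qed

lemma bsm_refl [simp]: "bsm x x" and bsm_sym: "bsm x y \<Longrightarrow> bsm y x"
  and bsm_trans: "bsm x y \<Longrightarrow> bsm y z \<Longrightarrow> bsm x z"
  unfolding bsm_def by simp_all

lemma bsm_ob: "bsm x y \<Longrightarrow> ob x = ob y"
  unfolding bsm_def using wlk_simps(1) by metis

lemma bsm_step: assumes "bsm x y" shows "bsm (f x a) (f y a)"
  unfolding bsm_def
proof (intro allI)
  fix z k
  \<comment> \<open>The path that first takes \<open>a\<close> and then follows \<open>z\<close>
    needs a code of its own, up to length \<open>sc k\<close>.\<close>
  have "df (\<lambda>e. if e 0 = \<zero> then a else bval (pf z) (ps z) (e 0 \<ominus> sc \<zero>))" by (intro dfn)
  from beta_lemma[OF this, of "sc k"] obtain b c where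
    "\<forall>i. i \<sqsubset> sc k \<longrightarrow> beta M b c i (if i = \<zero> then a else bval (pf z) (ps z) (i \<ominus> sc \<zero>))" by blast
  then have bc: "i \<sqsubseteq> k \<Longrightarrow> bval b c i = (if i = \<zero> then a else bval (pf z) (ps z) (i \<ominus> sc \<zero>))" for i
    unfolding bval by simp
  have 0: "sc i \<ominus> sc \<zero> = i" for i using mns_add[of "sc \<zero>" i] by simp
  have "i \<sqsubseteq> k \<longrightarrow> wlk (pr b c) x (sc i) = wlk z (f x a) i" for i x
  proof (induction i rule: ind)
    case Z then show ?case using bc[of \<zero>] by (simp add: wlk_simps)
  next
    case (S i) then show ?case using bc[of "sc i"] by (auto simp: wlk_simps 0 A.less_imp_le)
  next
    case D show ?case by (intro dfn)
  qed
  then have "wlk (pr b c) x (sc k) = wlk z (f x a) k" for x by simp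
  then show "ob (wlk z (f x a) k) = ob (wlk z (f y a) k)"
    using assms unfolding bsm_def by metis
qed

lemma bsm_coind:
  assumes D: "D (\<lambda>e. R (e 0) (e 1))" and R: "R x y"
    and st: "\<And>x y. R x y \<Longrightarrow> ob x = ob y" "\<And>x y a. R x y \<Longrightarrow> R (f x a) (f y a)"
  shows "bsm x y"
proof -
  have [dfn]: "df g \<Longrightarrow> df h \<Longrightarrow> D (\<lambda>e. R (g e) (h e))" for g h
    by (rule D_app2[where R = R, OF D_at2[OF D]])
  have "R (wlk z x k) (wlk z y k)" for z k
  proof (induction k rule: ind)
    case D show ?case by (intro dfn)
  qed (simp_all add: wlk_simps R st(2))
  then show ?thesis unfolding bsm_def using st(1) by blast
qed

lemma bsm_nd: "bsm x (nd x)"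
proof -
  have "D (\<lambda>e. bsm x (e 0))" by (intro dfn)
  from lst_ex[where P = "bsm x", OF this] show ?thesis unfolding nd_def using bsm_refl by blast
qed

lemma nd_le: "nd x \<sqsubseteq> x"
proof -
  have "D (\<lambda>e. bsm x (e 0))" by (intro dfn)
  from lst_le[where P = "bsm x", OF this] show ?thesis unfolding nd_def using bsm_refl by blast
qed

lemma nd_cong: assumes "bsm x y" shows "nd x = nd y"
proof -
  have "bsm x = bsm y" using assms bsm_sym bsm_trans by blast
  then show ?thesis unfolding nd_def by simp
qed

end

section \<open>Assignments, values of terms, and substitution\<close>

context pa
begin

text \<open>Assignments are total: a variable without an entry has the value zero. Thus
  \<open>\<zero>\<close> can serve as the assignment for sentences.\<close>

definition av :: "'a \<Rightarrow> 'a \<Rightarrow> 'a" where "av e k = lst (\<lambda>a. pr k a \<epsilon> e)"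
definition upd :: "'a \<Rightarrow> 'a \<Rightarrow> 'a \<Rightarrow> 'a" where "upd e k a = cs (\<lambda>x. x \<epsilon> e \<and> pf x \<noteq> k \<or> x = pr k a)"

lemma df_av [dfn]: "df f \<Longrightarrow> df g \<Longrightarrow> df (\<lambda>e. av (f e) (g e))"
  by (rule df_app2[where F = av]) (unfold av_def, intro dfn)

lemma df_upd [dfn]: "df f \<Longrightarrow> df g \<Longrightarrow> df h \<Longrightarrow> df (\<lambda>e. upd (f e) (g e) (h e))"
  by (rule df_app3[where F = upd]) (unfold upd_def, intro dfn)

lemma mem_upd: "x \<epsilon> upd e k a \<longleftrightarrow> x \<epsilon> e \<and> pf x \<noteq> k \<or> x = pr k a"
proof -
  have "D (\<lambda>z. z 0 \<epsilon> e \<and> pf (z 0) \<noteq> k \<or> z 0 = pr k a)" by (intro dfn)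
  then show ?thesis unfolding upd_def
  proof (rule mem_cs[where b = "sc (e \<oplus> pr k a)"])
    fix x assume "x \<epsilon> e \<and> pf x \<noteq> k \<or> x = pr k a"
    then show "x \<sqsubset> sc (e \<oplus> pr k a)" using A.order_trans[OF A.less_imp_le[OF bit_less] le_add(1)] by auto
  qed
qed

lemma av_upd: "av (upd e k a) j = (if j = k then a else av e j)"
proof (cases "j = k")
  case True
  then show ?thesis unfolding av_def by (auto simp: mem_upd intro!: lst_eq)
next
  case False
  then show ?thesis unfolding av_def by (simp add: mem_upd)
qed

definition TV :: "'a \<Rightarrow> 'a \<Rightarrow> 'a \<Rightarrow> bool" where
  "TV e t a \<longleftrightarrow> Cert (\<lambda>P p. (\<exists>k. p = pr (c_var M k) (av e k)) \<or> p = pr (c_zero M) \<zero> \<or>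
      (\<exists>r x. P (pr r x) \<and> p = pr (c_suc M r) (sc x)) \<or>
      (\<exists>r x s y. P (pr r x) \<and> P (pr s y) \<and>
         (p = pr (c_add M r s) (x \<oplus> y) \<or> p = pr (c_mul M r s) (x \<otimes> y)))) (pr t a)"

lemma D_TV [dfn]: "df f \<Longrightarrow> df g \<Longrightarrow> df h \<Longrightarrow> D (\<lambda>e. TV (f e) (g e) (h e))"
  by (rule D_app3[where R = TV]) (unfold TV_def Cert_def, intro dfn)

lemma TV_iff: "TV e t a \<longleftrightarrow> (\<exists>k. t = c_var M k \<and> a = av e k) \<or> t = c_zero M \<and> a = \<zero> \<or>
      (\<exists>r x. TV e r x \<and> t = c_suc M r \<and> a = sc x) \<or>
      (\<exists>r x s y. TV e r x \<and> TV e s y \<and>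
         (t = c_add M r s \<and> a = x \<oplus> y \<or> t = c_mul M r s \<and> a = x \<otimes> y))"
proof -
  let ?\<Phi> = "\<lambda>P p. (\<exists>k. p = pr (c_var M k) (av e k)) \<or> p = pr (c_zero M) \<zero> \<or>
      (\<exists>r x. P (pr r x) \<and> p = pr (c_suc M r) (sc x)) \<or>
      (\<exists>r x s y. P (pr r x) \<and> P (pr s y) \<and>
         (p = pr (c_add M r s) (x \<oplus> y) \<or> p = pr (c_mul M r s) (x \<otimes> y)))"
  have "Cert ?\<Phi> (pr t a) \<longleftrightarrow> ?\<Phi> (Cert ?\<Phi>) (pr t a)"
    by (rule Cert_iff; elim disjE exE conjE; simp; blast)
  then show ?thesis unfolding TV_def by simp
qed

lemma TV_simps [simp]: "TV e (c_var M k) a \<longleftrightarrow> a = av e k" "TV e (c_zero M) a \<longleftrightarrow> a = \<zero>"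
  "TV e (c_suc M r) a \<longleftrightarrow> (\<exists>x. TV e r x \<and> a = sc x)"
  "TV e (c_add M r s) a \<longleftrightarrow> (\<exists>x y. TV e r x \<and> TV e s y \<and> a = x \<oplus> y)"
  "TV e (c_mul M r s) a \<longleftrightarrow> (\<exists>x y. TV e r x \<and> TV e s y \<and> a = x \<otimes> y)"
  by ((subst TV_iff, auto); fail)+

lemma value_of_simps [simp]: "\<not> value_of M (c_var M k) a" "value_of M (c_zero M) a \<longleftrightarrow> a = \<zero>"
  "value_of M (c_suc M r) a \<longleftrightarrow> (\<exists>x. value_of M r x \<and> a = sc x)"
  "value_of M (c_add M r s) a \<longleftrightarrow> (\<exists>x y. value_of M r x \<and> value_of M s y \<and> a = x \<oplus> y)"
  "value_of M (c_mul M r s) a \<longleftrightarrow> (\<exists>x y. value_of M r x \<and> value_of M s y \<and> a = x \<otimes> y)"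
  by ((subst value_of_iff, auto); fail)+

lemma term_induct [consumes 1, case_names D var zero suc add mul]:
  assumes "is_term M t" and D: "D (\<lambda>e. P (e 0))" and "\<And>k. P (c_var M k)" "P (c_zero M)"
    "\<And>r. is_term M r \<Longrightarrow> P r \<Longrightarrow> P (c_suc M r)"
    "\<And>r s. is_term M r \<Longrightarrow> is_term M s \<Longrightarrow> P r \<Longrightarrow> P s \<Longrightarrow> P (c_add M r s)"
    "\<And>r s. is_term M r \<Longrightarrow> is_term M s \<Longrightarrow> P r \<Longrightarrow> P s \<Longrightarrow> P (c_mul M r s)"
  shows "P t"
proof -
  have "is_term M t \<longrightarrow> P t"
  proof (induction t rule: less_ind)
    case (L t)
    show ?case
    proof
      assume "is_term M t"
      from this[unfolded is_term_iff[of t]] show "P t"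
        by (elim disjE exE conjE) (use assms(3-) L in simp_all)
    qed
  next
    case D show ?case by (intro dfn assms)
  qed
  then show ?thesis using assms(1) by blast
qed

lemma form_induct [consumes 1, case_names D eq neg dsj exi]:
  assumes "is_form M x" and D: "D (\<lambda>e. P (e 0))"
    and "\<And>s t. is_term M s \<Longrightarrow> is_term M t \<Longrightarrow> P (c_eq M s t)"
    "\<And>x. is_form M x \<Longrightarrow> P x \<Longrightarrow> P (c_neg M x)"
    "\<And>x y. is_form M x \<Longrightarrow> is_form M y \<Longrightarrow> P x \<Longrightarrow> P y \<Longrightarrow> P (c_dsj M x y)"
    "\<And>k x. is_form M x \<Longrightarrow> P x \<Longrightarrow> P (c_exi M k x)"
  shows "P x"
proof -
  have "is_form M x \<longrightarrow> P x"
  proof (induction x rule: less_ind)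
    case (L x)
    show ?case
    proof
      assume "is_form M x"
      from this[unfolded is_form_iff[of x]] show "P x"
        by (elim disjE exE conjE) (use assms(3-) L in simp_all)
    qed
  next
    case D show ?case by (intro dfn assms)
  qed
  then show ?thesis using assms(1) by blast
qed

lemma TV_ex: "is_term M t \<Longrightarrow> \<exists>a. TV e t a"
proof (induction t rule: term_induct)
  case D show ?case by (intro dfn)
qed (simp; blast?)+

lemma TV_fun: "is_term M t \<Longrightarrow> TV e t a \<Longrightarrow> TV e t b \<Longrightarrow> a = b"
proof -
  have "is_term M t \<Longrightarrow> \<forall>a b. TV e t a \<longrightarrow> TV e t b \<longrightarrow> a = b"
  proof (induction t rule: term_induct)
    case D show ?case by (intro dfn)
  qed (simp; blast)+
  then show "is_term M t \<Longrightarrow> TV e t a \<Longrightarrow> TV e t b \<Longrightarrow> a = b" by blast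
qed

text \<open>\<open>d\<close> is the substitution of \<open>t\<close> for \<open>v\<close> or empty.
  The empty case arises below quantifiers that bind \<open>v\<close>; it also shows that the value
  depends only on the variables that occur.\<close>

lemma TV_subst:
  assumes t: "is_term M t" and d: "\<And>q. q \<epsilon> d \<Longrightarrow> q = pr v t"
  shows "is_term M s \<Longrightarrow> \<forall>s' a. tm_subst M d s s' \<longrightarrow>
    (\<forall>q. \<not> q \<epsilon> d) \<or> \<not> occurs M v s \<or> TV e' t (av e v) \<longrightarrow>
    (\<forall>u. occurs M u s \<and> (u \<noteq> v \<or> (\<forall>q. \<not> q \<epsilon> d)) \<longrightarrow> av e u = av e' u) \<longrightarrow>
    TV e' s' a = TV e s a"
proof (induction s rule: term_induct)
  case D show ?case by (intro dfn)
next
  case (var k)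
  show ?case
  proof (intro allI impI)
    fix s' a
    assume s': "tm_subst M d (c_var M k) s'" and
      1: "(\<forall>q. \<not> q \<epsilon> d) \<or> \<not> occurs M v (c_var M k) \<or> TV e' t (av e v)" and
      2: "\<forall>u. occurs M u (c_var M k) \<and> (u \<noteq> v \<or> (\<forall>q. \<not> q \<epsilon> d)) \<longrightarrow> av e u = av e' u"
    show "TV e' s' a = TV e (c_var M k) a"
    proof (cases "pr k s' \<epsilon> d")
      case True
      then have "k = v" "s' = t" using d by force+
      then show ?thesis using 1 True TV_fun[OF t] by auto
    next
      case False
      then have s: "s' = c_var M k" "\<And>s. \<not> pr k s \<epsilon> d" using s' by simp_all
      have "k \<noteq> v \<or> (\<forall>q. \<not> q \<epsilon> d)" using s(2) d by blast
      then show ?thesis using 2 s(1) by simp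
    qed
  qed
next
  case (suc r)
  show ?case
  proof (intro allI impI)
    fix s' a
    assume s': "tm_subst M d (c_suc M r) s'" and
      1: "(\<forall>q. \<not> q \<epsilon> d) \<or> \<not> occurs M v (c_suc M r) \<or> TV e' t (av e v)" and
      2: "\<forall>u. occurs M u (c_suc M r) \<and> (u \<noteq> v \<or> (\<forall>q. \<not> q \<epsilon> d)) \<longrightarrow> av e u = av e' u"
    obtain r' where *: "tm_subst M d r r'" "s' = c_suc M r'" using s' by auto
    have "TV e' r' a = TV e r a" for a using suc(2) * 1 2 by simp
    then show "TV e' s' a = TV e (c_suc M r) a" by (simp add: *(2))
  qed
next
  case (add r s)
  show ?case
  proof (intro allI impI)
    fix s' a
    assume s': "tm_subst M d (c_add M r s) s'" and
      1: "(\<forall>q. \<not> q \<epsilon> d) \<or> \<not> occurs M v (c_add M r s) \<or> TV e' t (av e v)" and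
      2: "\<forall>u. occurs M u (c_add M r s) \<and> (u \<noteq> v \<or> (\<forall>q. \<not> q \<epsilon> d)) \<longrightarrow> av e u = av e' u"
    obtain r' w' where *: "tm_subst M d r r'" "tm_subst M d s w'" "s' = c_add M r' w'" using s' by auto
    have "TV e' r' a = TV e r a" "TV e' w' a = TV e s a" for a
      using add(3)[rule_format, OF *(1)] add(4)[rule_format, OF *(2)] 1 2 by (simp_all, blast+)
    then show "TV e' s' a = TV e (c_add M r s) a" by (simp add: *(3))
  qed
next
  case (mul r s)
  show ?case
  proof (intro allI impI)
    fix s' a
    assume s': "tm_subst M d (c_mul M r s) s'" and
      1: "(\<forall>q. \<not> q \<epsilon> d) \<or> \<not> occurs M v (c_mul M r s) \<or> TV e' t (av e v)" and
      2: "\<forall>u. occurs M u (c_mul M r s) \<and> (u \<noteq> v \<or> (\<forall>q. \<not> q \<epsilon> d)) \<longrightarrow> av e u = av e' u"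
    obtain r' w' where *: "tm_subst M d r r'" "tm_subst M d s w'" "s' = c_mul M r' w'" using s' by auto
    have "TV e' r' a = TV e r a" "TV e' w' a = TV e s a" for a
      using mul(3)[rule_format, OF *(1)] mul(4)[rule_format, OF *(2)] 1 2 by (simp_all, blast+)
    then show "TV e' s' a = TV e (c_mul M r s) a" by (simp add: *(3))
  qed
qed simp

lemma tm_subst_zero: "is_term M t \<Longrightarrow> tm_subst M \<zero> t t"
proof (induction t rule: term_induct)
  case D show ?case by (intro dfn)
qed simp_all

lemma TV_agree: "is_term M t \<Longrightarrow> (\<And>u. occurs M u t \<Longrightarrow> av e u = av e' u) \<Longrightarrow> TV e t a = TV e' t a"
  using TV_subst[of t \<zero> \<zero> t e' e] tm_subst_zero[of t] by simp

lemma value_TV: "is_term M t \<Longrightarrow> value_of M t a \<Longrightarrow> TV e t a"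
proof -
  have "is_term M t \<Longrightarrow> \<forall>a. value_of M t a \<longrightarrow> TV e t a"
  proof (induction t rule: term_induct)
    case D show ?case by (intro dfn)
  qed (simp; blast?)+
  then show "is_term M t \<Longrightarrow> value_of M t a \<Longrightarrow> TV e t a" by blast
qed

lemma value_ex: "is_term M t \<Longrightarrow> (\<And>v. \<not> occurs M v t) \<Longrightarrow> \<exists>a. value_of M t a"
proof -
  have "is_term M t \<Longrightarrow> (\<forall>v. \<not> occurs M v t) \<longrightarrow> (\<exists>a. value_of M t a)"
  proof (induction t rule: term_induct)
    case D show ?case by (intro dfn)
  qed (simp; blast?)+
  then show "is_term M t \<Longrightarrow> (\<And>v. \<not> occurs M v t) \<Longrightarrow> \<exists>a. value_of M t a" by blast
qed

lemma numeral_ex: "\<exists>n. numeral_of M a n"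
proof (induction a rule: ind)
  case D show ?case by (intro dfn)
qed (subst numeral_of_iff, simp)+

lemma numeral: "numeral_of M a n \<Longrightarrow> is_term M n" "numeral_of M a n \<Longrightarrow> \<not> occurs M v n"
  "numeral_of M a n \<Longrightarrow> TV e n a"
proof -
  have "\<forall>n. numeral_of M a n \<longrightarrow> is_term M n \<and> \<not> occurs M v n \<and> TV e n a"
  proof (induction a rule: ind)
    case Z show ?case by (subst numeral_of_iff) simp
  next
    case (S a) then show ?case by (subst numeral_of_iff) auto
  next
    case D show ?case by (intro dfn)
  qed
  then show "numeral_of M a n \<Longrightarrow> is_term M n" "numeral_of M a n \<Longrightarrow> \<not> occurs M v n"
    "numeral_of M a n \<Longrightarrow> TV e n a" by blast+
qed

lemma tm_subst_ex:
  assumes t: "is_term M t" "\<And>u. \<not> occurs M u t" and d: "\<And>q. q \<epsilon> d \<Longrightarrow> q = pr v t"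
  shows "is_term M s \<Longrightarrow> \<exists>s'. tm_subst M d s s' \<and> is_term M s' \<and>
    (\<forall>u. occurs M u s' \<longrightarrow> occurs M u s \<and> (u = v \<longrightarrow> (\<forall>q. \<not> q \<epsilon> d)))"
proof (induction s rule: term_induct)
  case D show ?case by (intro dfn)
next
  case (var k)
  show ?case
  proof (cases "\<exists>r. pr k r \<epsilon> d")
    case True
    then obtain r where r: "pr k r \<epsilon> d" by blast
    then have "r = t" using d by force
    then show ?thesis using r t by auto
  next
    case False
    moreover have "k = v \<Longrightarrow> \<forall>q. \<not> q \<epsilon> d" using False d by blast
    ultimately show ?thesis by auto
  qed
next
  case (suc r)
  then obtain r' where "tm_subst M d r r'" "is_term M r'"
    "\<forall>u. occurs M u r' \<longrightarrow> occurs M u r \<and> (u = v \<longrightarrow> (\<forall>q. \<not> q \<epsilon> d))" by blast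
  then show ?case by (intro exI[where x = "c_suc M r'"]) simp
next
  case (add r s)
  then obtain r' s' where "tm_subst M d r r'" "is_term M r'"
    "\<forall>u. occurs M u r' \<longrightarrow> occurs M u r \<and> (u = v \<longrightarrow> (\<forall>q. \<not> q \<epsilon> d))"
    "tm_subst M d s s'" "is_term M s'"
    "\<forall>u. occurs M u s' \<longrightarrow> occurs M u s \<and> (u = v \<longrightarrow> (\<forall>q. \<not> q \<epsilon> d))" by metis
  then show ?case by (intro exI[where x = "c_add M r' s'"]) auto
next
  case (mul r s)
  then obtain r' s' where "tm_subst M d r r'" "is_term M r'"
    "\<forall>u. occurs M u r' \<longrightarrow> occurs M u r \<and> (u = v \<longrightarrow> (\<forall>q. \<not> q \<epsilon> d))"
    "tm_subst M d s s'" "is_term M s'"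
    "\<forall>u. occurs M u s' \<longrightarrow> occurs M u s \<and> (u = v \<longrightarrow> (\<forall>q. \<not> q \<epsilon> d))" by metis
  then show ?case by (intro exI[where x = "c_mul M r' s'"]) auto
qed simp

lemma drop_var_ex: "\<exists>d'. drop_var M k d d'"
proof -
  have "D (\<lambda>e. e 0 \<epsilon> d \<and> \<not> (\<exists>s. e 0 = pr k s))" by (intro dfn)
  from comprehension[OF this, of d] show ?thesis unfolding drop_var_def UN using bit_less by auto
qed

text \<open>The substitution is quantified inside the induction because it changes below a
  quantifier: nothing is left of it when the bound variable is \<open>v\<close>.\<close>

lemma fm_subst_ex:
  assumes t: "is_term M t" "\<And>u. \<not> occurs M u t"
  shows "is_form M x \<Longrightarrow> \<forall>d. (\<forall>q. q \<epsilon> d \<longrightarrow> q = pr v t) \<longrightarrow> (\<exists>x'. fm_subst M d x x' \<and> is_form M x' \<and>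
    (\<forall>u. free_in M u x' \<longrightarrow> free_in M u x \<and> (u = v \<longrightarrow> (\<forall>q. \<not> q \<epsilon> d))))"
proof (induction x rule: form_induct)
  case D show ?case by (intro dfn)
next
  case (eq r s)
  show ?case
  proof (intro allI impI)
    fix d assume d: "\<forall>q. q \<epsilon> d \<longrightarrow> q = pr v t"
    obtain r' where "tm_subst M d r r'" "is_term M r'"
      "\<forall>u. occurs M u r' \<longrightarrow> occurs M u r \<and> (u = v \<longrightarrow> (\<forall>q. \<not> q \<epsilon> d))"
      using tm_subst_ex[OF t, of d v r] d eq by blast
    moreover obtain s' where "tm_subst M d s s'" "is_term M s'"
      "\<forall>u. occurs M u s' \<longrightarrow> occurs M u s \<and> (u = v \<longrightarrow> (\<forall>q. \<not> q \<epsilon> d))"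
      using tm_subst_ex[OF t, of d v s] d eq by blast
    ultimately show "\<exists>x'. fm_subst M d (c_eq M r s) x' \<and> is_form M x' \<and>
      (\<forall>u. free_in M u x' \<longrightarrow> free_in M u (c_eq M r s) \<and> (u = v \<longrightarrow> (\<forall>q. \<not> q \<epsilon> d)))"
      by (intro exI[where x = "c_eq M r' s'"]) auto
  qed
next
  case (neg x)
  show ?case
  proof (intro allI impI)
    fix d assume "\<forall>q. q \<epsilon> d \<longrightarrow> q = pr v t"
    then obtain x' where "fm_subst M d x x' \<and> is_form M x' \<and>
      (\<forall>u. free_in M u x' \<longrightarrow> free_in M u x \<and> (u = v \<longrightarrow> (\<forall>q. \<not> q \<epsilon> d)))" using neg by blast
    then show "\<exists>x'. fm_subst M d (c_neg M x) x' \<and> is_form M x' \<and>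
      (\<forall>u. free_in M u x' \<longrightarrow> free_in M u (c_neg M x) \<and> (u = v \<longrightarrow> (\<forall>q. \<not> q \<epsilon> d)))"
      by (intro exI[where x = "c_neg M x'"]) auto
  qed
next
  case (dsj x y)
  show ?case
  proof (intro allI impI)
    fix d assume d: "\<forall>q. q \<epsilon> d \<longrightarrow> q = pr v t"
    obtain x' where "fm_subst M d x x' \<and> is_form M x' \<and>
      (\<forall>u. free_in M u x' \<longrightarrow> free_in M u x \<and> (u = v \<longrightarrow> (\<forall>q. \<not> q \<epsilon> d)))" using dsj(3) d by blast
    moreover obtain y' where "fm_subst M d y y' \<and> is_form M y' \<and>
      (\<forall>u. free_in M u y' \<longrightarrow> free_in M u y \<and> (u = v \<longrightarrow> (\<forall>q. \<not> q \<epsilon> d)))" using dsj(4) d by blast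
    ultimately show "\<exists>x'. fm_subst M d (c_dsj M x y) x' \<and> is_form M x' \<and>
      (\<forall>u. free_in M u x' \<longrightarrow> free_in M u (c_dsj M x y) \<and> (u = v \<longrightarrow> (\<forall>q. \<not> q \<epsilon> d)))"
      by (intro exI[where x = "c_dsj M x' y'"]) auto
  qed
next
  case (exi k x)
  show ?case
  proof (intro allI impI)
    fix d assume d: "\<forall>q. q \<epsilon> d \<longrightarrow> q = pr v t"
    obtain d' where d': "drop_var M k d d'" using drop_var_ex by blast
    then have "\<forall>q. q \<epsilon> d' \<longrightarrow> q = pr v t" using d unfolding drop_var_def UN by blast
    then obtain x' where x': "fm_subst M d' x x' \<and> is_form M x' \<and>
      (\<forall>u. free_in M u x' \<longrightarrow> free_in M u x \<and> (u = v \<longrightarrow> (\<forall>q. \<not> q \<epsilon> d')))" using exi by blast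
    have "\<not> q \<epsilon> d" if "\<forall>q. \<not> q \<epsilon> d'" "k \<noteq> v" for q
    proof
      assume q: "q \<epsilon> d"
      then have "q = pr v t" using d by blast
      then have "q \<epsilon> d'" using q d' that(2) unfolding drop_var_def UN by simp
      then show False using that(1) by blast
    qed
    then show "\<exists>x'. fm_subst M d (c_exi M k x) x' \<and> is_form M x' \<and>
      (\<forall>u. free_in M u x' \<longrightarrow> free_in M u (c_exi M k x) \<and> (u = v \<longrightarrow> (\<forall>q. \<not> q \<epsilon> d)))"
      using x' d' by (intro exI[where x = "c_exi M k x'"]) auto
  qed
qed

lemma free_for_closed: "is_form M x \<Longrightarrow> (\<And>u. \<not> occurs M u t) \<Longrightarrow> free_for M t v x"
proof -
  assume t: "\<And>u. \<not> occurs M u t"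
  show "is_form M x \<Longrightarrow> free_for M t v x"
  proof (induction x rule: form_induct)
    case D show ?case by (intro dfn)
  qed (use t in simp_all)
qed

lemma fm_subst_zero: "is_form M x \<Longrightarrow> fm_subst M \<zero> x x"
proof (induction x rule: form_induct)
  case D show ?case by (intro dfn)
next
  case (exi k x)
  have "drop_var M k \<zero> \<zero>" by (simp add: drop_var_def)
  then show ?case using exi by auto
qed (simp_all add: tm_subst_zero)

section \<open>Nodes: formulae with assignments\<close>

definition tg :: "nat \<Rightarrow> 'a" where "tg n = (sc ^^ n) \<zero>"
text \<open>Zero marks a leaf. Leaves are the equations, and also all elements whose first
  projection is none of the three tags.\<close>

definition kd :: "'a \<Rightarrow> 'a" where
  "kd y = (if pf y = tg 7 \<or> pf y = tg 8 \<or> pf y = tg 9 then pf y else \<zero>)"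
text \<open>Leaves are their own children, so that paths are total. At a disjunction each nonzero
  choice selects the second disjunct.\<close>

definition child :: "'a \<Rightarrow> 'a \<Rightarrow> 'a" where
  "child y a = (if pf y = tg 7 then ps y else if pf y = tg 8 then if a = \<zero> then pf (ps y) else ps (ps y)
     else if pf y = tg 9 then ps (ps y) else y)"
definition rinst :: "'a \<Rightarrow> 'a \<Rightarrow> 'a" where
  "rinst x a = pr (child (pf x) a) (if pf (pf x) = tg 9 then upd (ps x) (pf (ps (pf x))) a else ps x)"
definition lfn :: "'a \<Rightarrow> bool" where "lfn x \<longleftrightarrow> kd (pf x) = \<zero>"
definition sgn :: "'a \<Rightarrow> bool" where "sgn x \<longleftrightarrow> kd (pf x) \<noteq> tg 7"
definition Atn :: "'a \<Rightarrow> bool" where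
  "Atn x \<longleftrightarrow> (\<exists>s t a. pf x = c_eq M s t \<and> TV (ps x) s a \<and> TV (ps x) t a)"
definition obs :: "'a \<Rightarrow> 'a" where "obs x = pr (kd (pf x)) (if Atn x then sc \<zero> else \<zero>)"

lemma df_node [dfn]:
  "df f \<Longrightarrow> df (\<lambda>e. kd (f e))" "df f \<Longrightarrow> df g \<Longrightarrow> df (\<lambda>e. child (f e) (g e))"
  unfolding kd_def child_def by (intro dfn; assumption)+

lemma D_node [dfn]:
  "df f \<Longrightarrow> D (\<lambda>e. lfn (f e))" "df f \<Longrightarrow> D (\<lambda>e. sgn (f e))" "df f \<Longrightarrow> D (\<lambda>e. Atn (f e))"
proof -
  show "df f \<Longrightarrow> D (\<lambda>e. Atn (f e))" by (rule D_app1[where R = Atn]) (unfold Atn_def, intro dfn)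
qed (unfold lfn_def sgn_def, (intro dfn; assumption)+)

lemma df_rinst [dfn]: "df f \<Longrightarrow> df g \<Longrightarrow> df (\<lambda>e. rinst (f e) (g e))" "df f \<Longrightarrow> df (\<lambda>e. obs (f e))"
  unfolding rinst_def obs_def by (intro dfn; assumption)+

lemma tg_inj [simp]: "tg m = tg n \<longleftrightarrow> m = n" "tg m = \<zero> \<longleftrightarrow> m = 0" "\<zero> = tg m \<longleftrightarrow> m = 0"
  using num_inj[of m 0] num_inj[of 0 m] by (simp_all add: tg_def)

lemma pf_c [simp]: "pf (c_eq M x y) = tg 6" "pf (c_neg M x) = tg 7" "pf (c_dsj M x y) = tg 8" "pf (c_exi M x y) = tg 9"
  by (simp_all only: c_defs tagged_def tg_def pf_pr)

lemma ps_c [simp]: "ps (c_neg M x) = x" "ps (c_dsj M x y) = pr x y" "ps (c_exi M x y) = pr x y"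
  by (simp_all only: c_defs tagged_def ps_pr)

lemma kd_c [simp]: "kd (c_eq M x y) = \<zero>" "kd (c_neg M x) = tg 7" "kd (c_dsj M x y) = tg 8" "kd (c_exi M x y) = tg 9"
  by (simp_all add: kd_def)

lemma rinst_c [simp]: "rinst (pr (c_eq M s t) e) a = pr (c_eq M s t) e" "rinst (pr (c_neg M x) e) a = pr x e"
  "rinst (pr (c_dsj M x y) e) a = pr (if a = \<zero> then x else y) e" "rinst (pr (c_exi M k x) e) a = pr x (upd e k a)"
  by (simp_all add: rinst_def child_def)

lemma Atn_c [simp]: "Atn (pr (c_eq M s t) e) \<longleftrightarrow> (\<exists>a. TV e s a \<and> TV e t a)" "\<not> Atn (pr (c_neg M x) e)"
  "\<not> Atn (pr (c_dsj M x y) e)" "\<not> Atn (pr (c_exi M k x) e)"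
  by (simp_all add: Atn_def)

end

text \<open>\<open>S\<close> compares formulae by shape alone and supplies the templates that carry
  labels; \<open>N\<close> also takes assignments and the truth of equations into account and
  supplies the nodes.\<close>

sublocale pa \<subseteq> S: tsys M child kd
  by unfold_locales (intro dfn)+

sublocale pa \<subseteq> N: tsys M rinst obs
  by unfold_locales (intro dfn)+

section \<open>The substitution lemma as a bisimulation\<close>

context pa
begin

text \<open>A bisimulation between substituting and assigning. Freeness for \<open>t\<close> is
  required only while \<open>v\<close> is free and \<open>d\<close> is nonempty, so the relation
  persists below a quantifier that binds \<open>v\<close>.\<close>

definition subst_rel :: "'a \<Rightarrow> 'a \<Rightarrow> 'a \<Rightarrow> 'a \<Rightarrow> bool" where
  "subst_rel v t p q \<longleftrightarrow> (\<exists>x x' e e' d. p = pr x' e' \<and> q = pr x e \<and> is_form M x \<and> fm_subst M d x x' \<and>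
     (\<forall>q. q \<epsilon> d \<longrightarrow> q = pr v t) \<and>
     ((\<forall>q. \<not> q \<epsilon> d) \<or> \<not> free_in M v x \<or> free_for M t v x \<and> TV e' t (av e v)) \<and>
     (\<forall>u. free_in M u x \<and> (u \<noteq> v \<or> (\<forall>q. \<not> q \<epsilon> d)) \<longrightarrow> av e u = av e' u))"

lemma subst_relI:
  assumes "is_form M x" "fm_subst M d x x'" "\<And>q. q \<epsilon> d \<Longrightarrow> q = pr v t"
    "(\<forall>q. \<not> q \<epsilon> d) \<or> \<not> free_in M v x \<or> free_for M t v x \<and> TV e' t (av e v)"
    "\<And>u. free_in M u x \<Longrightarrow> u \<noteq> v \<or> (\<forall>q. \<not> q \<epsilon> d) \<Longrightarrow> av e u = av e' u"
  shows "subst_rel v t (pr x' e') (pr x e)"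
  unfolding subst_rel_def
  by (rule exI[where x = x], rule exI[where x = x'], rule exI[where x = e], rule exI[where x = e'],
      rule exI[where x = d]) (use assms in simp)

lemma subst_bsm:
  assumes t: "is_term M t" and R: "subst_rel v t p q"
  shows "N.bsm p q"
proof (rule N.bsm_coind[where R = "subst_rel v t", OF _ R])
  show "D (\<lambda>e. subst_rel v t (e 0) (e 1))" unfolding subst_rel_def by (intro dfn)
next
  fix p q assume "subst_rel v t p q"
  then obtain x x' e e' d where p: "p = pr x' e'" "q = pr x e" and x: "is_form M x" "fm_subst M d x x'" and
     d: "\<And>q. q \<epsilon> d \<Longrightarrow> q = pr v t" and
     f: "(\<forall>q. \<not> q \<epsilon> d) \<or> \<not> free_in M v x \<or> free_for M t v x \<and> TV e' t (av e v)" and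
     ag: "\<And>u. free_in M u x \<Longrightarrow> u \<noteq> v \<or> (\<forall>q. \<not> q \<epsilon> d) \<Longrightarrow> av e u = av e' u"
    unfolding subst_rel_def by blast
  from x(1)[unfolded is_form_iff[of x]] show "obs p = obs q"
  proof (elim disjE exE conjE)
    fix r s assume rs: "is_term M r" "is_term M s" "x = c_eq M r s"
    then obtain r' s' where *: "tm_subst M d r r'" "tm_subst M d s s'" "x' = c_eq M r' s'" using x(2) by auto
    have c: "(\<forall>q. \<not> q \<epsilon> d) \<or> \<not> occurs M v w \<or> TV e' t (av e v)"
      "\<forall>u. occurs M u w \<and> (u \<noteq> v \<or> (\<forall>q. \<not> q \<epsilon> d)) \<longrightarrow> av e u = av e' u" if w: "w = r \<or> w = s" for w
    proof -
      have "free_in M u x" if "occurs M u w" for u using that w rs(3) by auto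
      then show "(\<forall>q. \<not> q \<epsilon> d) \<or> \<not> occurs M v w \<or> TV e' t (av e v)"
        "\<forall>u. occurs M u w \<and> (u \<noteq> v \<or> (\<forall>q. \<not> q \<epsilon> d)) \<longrightarrow> av e u = av e' u" using f ag by blast+
    qed
    have "TV e' r' a = TV e r a" for a
      by (rule TV_subst[where v = v and t = t and d = d, OF t _ rs(1), rule_format, OF _ *(1)]) (use d c[of r] in \<open>blast+\<close>)
    moreover have "TV e' s' a = TV e s a" for a
      by (rule TV_subst[where v = v and t = t and d = d, OF t _ rs(2), rule_format, OF _ *(2)]) (use d c[of s] in \<open>blast+\<close>)
    ultimately show ?thesis by (simp add: p obs_def rs(3) *(3))
  qed (use x(2) in \<open>auto simp: p obs_def\<close>)
  fix a
  from x(1)[unfolded is_form_iff[of x]] show "subst_rel v t (rinst p a) (rinst q a)"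
  proof (elim disjE exE conjE)
    fix r s assume rs: "is_term M r" "is_term M s" "x = c_eq M r s"
    then obtain r' s' where "x' = c_eq M r' s'" using x(2) by auto
    then have "rinst p a = p" "rinst q a = q" by (simp_all add: p rs(3))
    then show ?thesis using \<open>subst_rel v t p q\<close> by simp
  next
    fix y assume y: "is_form M y" "x = c_neg M y"
    then obtain y' where y': "fm_subst M d y y'" "x' = c_neg M y'" using x(2) by auto
    show ?thesis unfolding p y(2) y'(2) rinst_c
      by (rule subst_relI[where d = d]) (use y y' d f ag in simp_all)
  next
    fix y z assume y: "is_form M y" "is_form M z" "x = c_dsj M y z"
    then obtain y' z' where y': "fm_subst M d y y'" "fm_subst M d z z'" "x' = c_dsj M y' z'" using x(2) by auto
    have "subst_rel v t (pr y' e') (pr y e)"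
      by (rule subst_relI[where d = d]) (use y y' d f ag in auto)
    moreover have "subst_rel v t (pr z' e') (pr z e)"
      by (rule subst_relI[where d = d]) (use y y' d f ag in auto)
    ultimately show ?thesis by (simp add: p y(3) y'(3))
  next
    fix k y assume y: "is_form M y" "x = c_exi M k y"
    then obtain y' d' where y': "fm_subst M d' y y'" "drop_var M k d d'" "x' = c_exi M k y'" using x(2) by auto
    have d': "q \<epsilon> d' \<longleftrightarrow> q \<epsilon> d \<and> \<not> (\<exists>s. q = pr k s)" for q using y'(2) unfolding drop_var_def UN by simp
    have kv: "(\<forall>q. \<not> q \<epsilon> d') \<longleftrightarrow> (\<forall>q. \<not> q \<epsilon> d) \<or> k = v" 
    proof -
      have "q \<epsilon> d'" if "q \<epsilon> d" "k \<noteq> v" for q using d[OF that(1)] that unfolding d' by simp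
      moreover have "\<not> q \<epsilon> d'" if "k = v" for q using d[of q] that unfolding d' by blast
      moreover have "q \<epsilon> d' \<Longrightarrow> q \<epsilon> d" for q unfolding d' by blast
      ultimately show ?thesis by blast
    qed
    \<comment> \<open>Where the substitution still acts, \<open>k\<close> does not occur in
      \<open>t\<close>, so the update at \<open>k\<close> leaves the value of \<open>t\<close>
      alone.\<close>
    have 1: "(\<forall>q. \<not> q \<epsilon> d') \<or> \<not> free_in M v y \<or> free_for M t v y \<and> TV (upd e' k a) t (av (upd e k a) v)"
    proof (rule ccontr)
      assume n: "\<not> ?thesis"
      then have "k \<noteq> v" "free_in M v x" "\<not> (\<forall>q. \<not> q \<epsilon> d)" unfolding kv by (auto simp: y(2))
      then have "free_for M t v y" "\<not> occurs M k t" "TV e' t (av e v)" using f by (auto simp: y(2))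
      moreover have "TV (upd e' k a) t (av e v) = TV e' t (av e v)"
        using \<open>\<not> occurs M k t\<close> by (intro TV_agree[OF t]) (auto simp: av_upd)
      ultimately show False using n \<open>k \<noteq> v\<close> by (auto simp: av_upd)
    qed
    have 2: "av (upd e k a) u = av (upd e' k a) u" if "free_in M u y" "u \<noteq> v \<or> (\<forall>q. \<not> q \<epsilon> d')" for u
      using that ag[of u] unfolding kv by (auto simp: av_upd y(2))
    show ?thesis unfolding p y(2) y'(3) rinst_c
      by (rule subst_relI[where d = d']) (use y y' d d' 1 2 in auto)
  qed
qed

text \<open>The case of the empty substitution, in which only the two assignments differ.\<close>

lemma node_agree:
  assumes "is_form M x" "\<And>u. free_in M u x \<Longrightarrow> av e u = av e' u"
  shows "N.bsm (pr x e) (pr x e')"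
proof (rule N.bsm_sym, rule subst_bsm[of "c_zero M"])
  show "subst_rel \<zero> (c_zero M) (pr x e') (pr x e)"
    by (rule subst_relI[where d = \<zero>]) (use assms fm_subst_zero[OF assms(1)] in simp_all)
qed simp

lemma node_subst:
  assumes x: "is_form M x" and t: "is_term M t" and s: "subst1 M v t x x'" "free_for M t v x" and a: "TV e t a"
  shows "N.bsm (pr x' e) (pr x (upd e v a))"
proof (rule subst_bsm[OF t])
  obtain d where "\<forall>q. q \<epsilon> d \<longleftrightarrow> q = pr v t" "fm_subst M d x x'" using s(1) unfolding subst1_def UN by auto
  then show "subst_rel v t (pr x' e) (pr x (upd e v a))"
    by (intro subst_relI[where d = d]) (use x s(2) a in \<open>auto simp: av_upd\<close>)
qed

end

sublocale pa \<subseteq> W: game M "\<lambda>p a. N.nd (rinst p a)" sgn lfn Atn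
  by unfold_locales (intro dfn)+

context pa
begin

lemma pr_cases: obtains x y where "z = pr x y" | "pf z = \<zero>" "ps z = \<zero>"
  by (cases "\<exists>x y. z = pr x y") (auto simp: pf_def ps_def lst_def)

lemma pf_le: "pf z \<sqsubseteq> z" "ps z \<sqsubseteq> z"
  by (cases z rule: pr_cases; simp add: pr_ge)+

lemma child_less: assumes "kd t \<noteq> \<zero>" shows "child t a \<sqsubset> t"
proof -
  obtain n where n: "pf t = tg n" "n > 0" using assms unfolding kd_def by (auto split: if_splits)
  then obtain y where "t = pr (tg n) y" by (cases t rule: pr_cases) auto
  then have "ps t \<sqsubset> t" using less_tagged[of y "n - 1"] n(2) by (simp add: tagged_def tg_def)
  then show ?thesis using assms A.le_less_trans[OF pf_le(1), of "ps t" t] A.le_less_trans[OF pf_le(2), of "ps t" t]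
    unfolding kd_def child_def by (auto split: if_splits)
qed

lemma pf_rinst: "pf (rinst x a) = child (pf x) a"
  by (simp add: rinst_def)

text \<open>Makes the template of a node independent of its representative.\<close>

lemma node_shape: assumes "N.bsm x y" shows "S.bsm (pf x) (pf y)"
proof -
  have "pf (N.wlk z x k) = S.wlk z (pf x) k" for z x k
  proof (induction k rule: ind)
    case D show ?case by (intro dfn)
  qed (simp_all add: N.wlk_simps S.wlk_simps pf_rinst)
  then show ?thesis using assms unfolding N.bsm_def S.bsm_def obs_def by (metis pr_inj)
qed

lemma node_props:
  assumes "N.bsm x y" shows "lfn x = lfn y" "sgn x = sgn y" "Atn x = Atn y"
  using N.bsm_ob[OF assms] unfolding obs_def lfn_def sgn_def by (auto split: if_splits)

section \<open>The automaton for disjunctions and proofs\<close>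

definition ln :: "'a \<Rightarrow> 'a \<Rightarrow> 'a" where "ln s i = lst (\<lambda>A. pr i A \<epsilon> s)"

text \<open>The rules with one premise for which a false conclusion has a false premise under the
  same assignment; existential introduction is the one that needs a witness.\<close>

definition rule0 :: "'a \<Rightarrow> 'a \<Rightarrow> bool" where
  "rule0 B A \<longleftrightarrow> (\<exists>x\<in>Form M. A = c_dsj M x B) \<or> B = c_dsj M A A \<or>
     (\<exists>x\<in>Form M. \<exists>y\<in>Form M. \<exists>z\<in>Form M. B = c_dsj M x (c_dsj M y z) \<and> A = c_dsj M (c_dsj M x y) z)"

text \<open>
  The automaton has three kinds of runs. State \<open>pr (tg 0) p\<close> asks the node \<open>p\<close>. A state
  \<open>pr (tg 1) (pr c (pr h (pr i (pr j y))))\<close> walks down the certificate \<open>c\<close> of a disjunction, following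
  the witnesses if \<open>h = \<zero>\<close>, and towards the entry \<open>h - 1\<close> otherwise. States tagged 2 and 3 walk from a
  false line \<open>i\<close> of a proof \<open>s\<close>, under an assignment \<open>e\<close>, to a false earlier line; tag 3
  asks for the witness, or for the truth value of the cut formula, that determines this line.
\<close>

definition split :: "'a \<Rightarrow> 'a \<Rightarrow> 'a \<Rightarrow> 'a \<Rightarrow> 'a \<Rightarrow> bool" where
  "split c i j y = (\<lambda>k. i \<sqsubset> k \<and> k \<sqsubset> j \<and>
     (\<exists>z w. y = c_dsj M z w \<and> pr i (pr k z) \<epsilon> c \<and> pr k (pr j w) \<epsilon> c))"

text \<open>An answer \<open>sc \<zero>\<close> names the first disjunct as the true one and any
  larger answer the second, in accordance with \<open>child\<close>.\<close>

definition dstep :: "'a \<Rightarrow> 'a \<Rightarrow> 'a \<Rightarrow> 'a \<Rightarrow> 'a \<Rightarrow> 'a \<Rightarrow> 'a" where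
  "dstep c h i j y a = (let k = lst (split c i j y) in
     if h = \<zero> \<and> a = sc \<zero> \<or> h \<noteq> \<zero> \<and> h \<sqsubseteq> k then pr i (pr k (pf (ps y))) else pr k (pr j (ps (ps y))))"

definition just0 where "just0 s i j \<longleftrightarrow> j \<sqsubset> i \<and> rule0 (ln s j) (ln s i)"
definition just1 where "just1 s i j \<longleftrightarrow> j \<sqsubset> i \<and> rule1 M (ln s j) (ln s i)"
definition just2 where
  "just2 s i w \<longleftrightarrow> (\<exists>j k. w = pr j k \<and> j \<sqsubset> i \<and> k \<sqsubset> i \<and> rule2 M (ln s j) (ln s k) (ln s i))"

text \<open>For an implication \<open>A\<close>, the term \<open>ps (pf (ps A))\<close> is the
  formula under the negation, here the existential one. For the first premise \<open>B\<close> of a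
  cut, \<open>pf (ps B)\<close> is the cut formula.\<close>

definition decide :: "'a \<Rightarrow> 'a \<Rightarrow> 'a" where
  "decide s i = (if \<exists>j. just1 s i j then ps (pf (ps (ln s i))) else pf (ps (ln s (pf (lst (just2 s i))))))"

text \<open>If the conclusion of a cut is false, the first premise is false when the cut formula is,
  and the second one otherwise. The answer to a true existential formula is the successor of a
  witness, hence the subtraction of one.\<close>

definition pstep :: "'a \<Rightarrow> 'a \<Rightarrow> 'a \<Rightarrow> 'a \<Rightarrow> 'a" where
  "pstep s i e a = (if \<exists>j. just0 s i j then pr (lst (just0 s i)) e
     else if \<exists>j. just1 s i j then pr (lst (just1 s i)) (upd e (pf (ps (ps (pf (ps (ln s i)))))) (a \<ominus> sc \<zero>))
     else if a = \<zero> then pr (pf (lst (just2 s i))) e else pr (ps (lst (just2 s i))) e)"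

definition qry :: "'a \<Rightarrow> 'a" where
  "qry st = N.nd (let r = ps st in
     if pf st = tg 0 then r
     else if pf st = tg 1 then pr (ps (ps (ps (ps r)))) \<zero>
     else if pf st = tg 2 then pr (ln (pf r) (pf (ps r))) (ps (ps r))
     else pr (decide (pf r) (pf (ps r))) (ps (ps r)))"

definition nxt :: "'a \<Rightarrow> 'a \<Rightarrow> 'a" where
  "nxt st a = (let r = ps st in
     if pf st = tg 1 then pr (tg 1) (pr (pf r) (pr (pf (ps r))
       (dstep (pf r) (pf (ps r)) (pf (ps (ps r))) (pf (ps (ps (ps r)))) (ps (ps (ps (ps r)))) a)))
     else if pf st = tg 2 then pr (tg 3) r
     else if pf st = tg 3 then pr (tg 2) (pr (pf r) (pstep (pf r) (pf (ps r)) (ps (ps r)) a))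
     else st)"

lemma df_ln [dfn]: "df f \<Longrightarrow> df g \<Longrightarrow> df (\<lambda>e. ln (f e) (g e))"
  by (rule df_app2[where F = ln]) (unfold ln_def, intro dfn)

lemma D_rules [dfn]: "df f \<Longrightarrow> df g \<Longrightarrow> D (\<lambda>e. rule0 (f e) (g e))" "df f \<Longrightarrow> df g \<Longrightarrow> D (\<lambda>e. rule1 M (f e) (g e))"
  "df f \<Longrightarrow> df g \<Longrightarrow> df h \<Longrightarrow> D (\<lambda>e. rule2 M (f e) (g e) (h e))"
proof -
  have F: "x \<in> Form M \<longleftrightarrow> is_form M x" "x \<in> univ M \<longleftrightarrow> True" for x by (simp_all add: Form_def UN)
  show "df f \<Longrightarrow> df g \<Longrightarrow> D (\<lambda>e. rule0 (f e) (g e))"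
    by (rule D_app2[where R = rule0]) (unfold rule0_def Bex_def F, intro dfn)
  show "df f \<Longrightarrow> df g \<Longrightarrow> D (\<lambda>e. rule1 M (f e) (g e))"
    by (rule D_app2[where R = "rule1 M"]) (unfold rule1_def Bex_def F c_imp_def, intro dfn)
  show "df f \<Longrightarrow> df g \<Longrightarrow> df h \<Longrightarrow> D (\<lambda>e. rule2 M (f e) (g e) (h e))"
    by (rule D_app3[where R = "rule2 M"]) (unfold rule2_def Bex_def F, intro dfn)
qed

lemma D_just [dfn]: "df f \<Longrightarrow> df g \<Longrightarrow> df h \<Longrightarrow> D (\<lambda>e. just0 (f e) (g e) (h e))"
  "df f \<Longrightarrow> df g \<Longrightarrow> df h \<Longrightarrow> D (\<lambda>e. just1 (f e) (g e) (h e))"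
  "df f \<Longrightarrow> df g \<Longrightarrow> df h \<Longrightarrow> D (\<lambda>e. just2 (f e) (g e) (h e))"
proof -
  show "df f \<Longrightarrow> df g \<Longrightarrow> df h \<Longrightarrow> D (\<lambda>e. just2 (f e) (g e) (h e))"
    by (rule D_app3[where R = just2]) (unfold just2_def, intro dfn)
qed (unfold just0_def just1_def, (intro dfn; assumption)+)

lemma df_decide [dfn]: "df f \<Longrightarrow> df g \<Longrightarrow> df (\<lambda>e. decide (f e) (g e))"
  by (rule df_app2[where F = decide]) (unfold decide_def, intro dfn)

lemma df_nxt: "df (\<lambda>e. nxt (e 1) (e 0))"
  unfolding nxt_def Let_def dstep_def split_def pstep_def by (intro dfn)

lemma df_qry: "df (\<lambda>e. qry (e 0))"
  unfolding qry_def Let_def by (intro dfn)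

text \<open>A quantifier has an instance for each element, but all of them have the same shape. So a
  template has at most two components, as the counting of balls requires.\<close>

lemma node_edge:
  assumes "\<not> lfn p"
  shows "S.nd (pf (N.nd (rinst p a))) \<sqsubset> S.nd (pf p)"
    "S.nd (pf (N.nd (rinst p a))) = S.nd (child (S.nd (pf p)) \<zero>) \<or>
     S.nd (pf (N.nd (rinst p a))) = S.nd (child (S.nd (pf p)) (sc \<zero>))"
proof -
  let ?t = "S.nd (pf p)"
  have 1: "S.nd (pf (N.nd (rinst p a))) = S.nd (child ?t a)"
    using S.nd_cong[OF node_shape[OF N.bsm_nd[of "rinst p a"]]]
      S.nd_cong[OF S.bsm_step[OF S.bsm_nd[of "pf p"], of a]] by (simp add: pf_rinst)
  have "kd ?t \<noteq> \<zero>" using assms S.bsm_ob[OF S.bsm_nd[of "pf p"]] by (simp add: lfn_def)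
  from A.le_less_trans[OF S.nd_le child_less[OF this]]
  show "S.nd (pf (N.nd (rinst p a))) \<sqsubset> ?t" unfolding 1 .
  have "child ?t a = child ?t \<zero> \<or> child ?t a = child ?t (sc \<zero>)" by (simp add: child_def)
  then show "S.nd (pf (N.nd (rinst p a))) = S.nd (child ?t \<zero>) \<or>
     S.nd (pf (N.nd (rinst p a))) = S.nd (child ?t (sc \<zero>))" unfolding 1 by auto
qed

lemma walk_game: "sgame M (\<lambda>p a. N.nd (rinst p a)) sgn lfn Atn (\<lambda>p. S.nd (pf p)) (\<lambda>t. S.nd (child t \<zero>))
    (\<lambda>t. S.nd (child t (sc \<zero>))) qry nxt"
  by unfold_locales ((intro dfn df_qry df_nxt; fail) | (rule node_edge; assumption))+

end

section \<open>The truth class of a consistent set of answers\<close>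

locale truth = pa M for M :: "'a lpa" +
  fixes G :: "'a \<Rightarrow> 'a \<Rightarrow> bool" and B :: 'a
  assumes ok: "W.okR G"
    and plays: "\<And>s. \<exists>sq an. df (\<lambda>e. sq (e 0)) \<and> df (\<lambda>e. an (e 0)) \<and> sq \<zero> = s \<and>
      (\<forall>i. sq (sc i) = nxt (sq i) (an i)) \<and> (\<forall>i. i \<sqsubset> sc (sc (B \<oplus> B)) \<longrightarrow> G (qry (sq i)) (an i))"
begin

text \<open>The first query of the play that starts in the idle state \<open>pr (tg 0) x\<close> is
  the node of \<open>x\<close>.\<close>

lemma total: "\<exists>b. G (N.nd x) b"
proof -
  obtain sq an where "sq \<zero> = pr (tg 0) x" "G (qry (sq \<zero>)) (an \<zero>)"
    using plays[of "pr (tg 0) x"] by (metis less_S zero_le)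
  then show ?thesis by (auto simp: qry_def)
qed

lemma unique: "G p a \<Longrightarrow> G p b \<Longrightarrow> a = b"
  using ok unfolding W.okR_def by blast

definition tr :: "'a \<Rightarrow> bool" where "tr x \<longleftrightarrow> (\<exists>b. b \<noteq> \<zero> \<and> G (N.nd x) b)"

lemma tr_iff: "G (N.nd x) b \<Longrightarrow> tr x \<longleftrightarrow> b \<noteq> \<zero>"
  unfolding tr_def using unique by blast

lemma tr_cong: "N.bsm x y \<Longrightarrow> tr x = tr y"
  unfolding tr_def using N.nd_cong by simp

lemma tr_leaf: assumes "lfn x" shows "tr x \<longleftrightarrow> Atn x"
proof -
  obtain b where b: "G (N.nd x) b" using total by blast
  note p = node_props[OF N.bsm_nd[of x]]
  have "(b \<noteq> \<zero>) = Atn (N.nd x)" using ok b assms p(1) unfolding W.okR_def by blast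
  then show ?thesis using tr_iff[OF b] p(3) by simp
qed

lemma tr_inst:
  assumes "\<not> lfn x"
  shows "G (N.nd x) (sc a) \<Longrightarrow> tr (rinst x a) = sgn x" "\<not> tr x \<Longrightarrow> tr (rinst x a) \<noteq> sgn x"
proof -
  note p = node_props[OF N.bsm_nd[of x]]
  obtain b where b: "G (N.nd (rinst x a)) b" using total by blast
  have r: "N.nd (rinst (N.nd x) a) = N.nd (rinst x a)"
    using N.nd_cong[OF N.bsm_step[OF N.bsm_nd[of x], of a]] by simp
  have lf: "\<not> lfn (N.nd x)" using assms p(1) by simp
  show "G (N.nd x) (sc a) \<Longrightarrow> tr (rinst x a) = sgn x"
    using ok lf b unfolding W.okR_def tr_iff[OF b] p(2) r[symmetric] by blast
  obtain b' where b': "G (N.nd x) b'" using total by blast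
  show "\<not> tr x \<Longrightarrow> tr (rinst x a) \<noteq> sgn x"
    using ok lf b b' unfolding W.okR_def tr_iff[OF b] tr_iff[OF b'] p(2) r[symmetric] by blast
qed

lemma tr_ex: assumes "\<not> lfn x" shows "tr x \<longleftrightarrow> (\<exists>a. tr (rinst x a) = sgn x)"
proof
  assume "tr x"
  then obtain b where "b \<noteq> \<zero>" "G (N.nd x) b" unfolding tr_def by blast
  then obtain a where "G (N.nd x) (sc a)" using cases0 by metis
  then show "\<exists>a. tr (rinst x a) = sgn x" using tr_inst(1)[OF assms] by blast
qed (use tr_inst(2)[OF assms] in blast)

definition TR :: "'a \<Rightarrow> 'a \<Rightarrow> bool" where "TR x e \<longleftrightarrow> tr (pr x e)"

lemma TR_simps [simp]:
  "TR (c_eq M s t) e \<longleftrightarrow> (\<exists>a. TV e s a \<and> TV e t a)" "TR (c_neg M x) e \<longleftrightarrow> \<not> TR x e"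
  "TR (c_dsj M x y) e \<longleftrightarrow> TR x e \<or> TR y e" "TR (c_exi M k x) e \<longleftrightarrow> (\<exists>a. TR x (upd e k a))"
proof -
  show "TR (c_eq M s t) e \<longleftrightarrow> (\<exists>a. TV e s a \<and> TV e t a)"
    unfolding TR_def by (subst tr_leaf) (simp_all add: lfn_def)
  show "TR (c_neg M x) e \<longleftrightarrow> \<not> TR x e" "TR (c_exi M k x) e \<longleftrightarrow> (\<exists>a. TR x (upd e k a))"
    unfolding TR_def by (subst tr_ex; simp add: lfn_def sgn_def)+
  have "(\<exists>a. tr (pr (if a = \<zero> then x else y) e)) \<longleftrightarrow> tr (pr x e) \<or> tr (pr y e)"
    using sc_neq(1)[of \<zero>] by (metis (full_types))
  then show "TR (c_dsj M x y) e \<longleftrightarrow> TR x e \<or> TR y e"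
    unfolding TR_def by (subst tr_ex) (simp_all add: lfn_def sgn_def)
qed

lemma TR_agree: "is_form M x \<Longrightarrow> (\<And>u. free_in M u x \<Longrightarrow> av e u = av e' u) \<Longrightarrow> TR x e = TR x e'"
  unfolding TR_def by (intro tr_cong node_agree)

text \<open>\<open>TR\<close> need not be definable, so induction on formulae is not at hand.
  Instead both sides belong to the same node and hence to the same answer.\<close>

lemma TR_subst: "is_form M x \<Longrightarrow> is_term M t \<Longrightarrow> subst1 M v t x x' \<Longrightarrow> free_for M t v x \<Longrightarrow> TV e t a \<Longrightarrow>
    TR x' e = TR x (upd e v a)"
  unfolding TR_def by (intro tr_cong node_subst)

lemma axiom_true: assumes "logical_axiom M A" shows "TR A e"
proof -
  have sub: "TR x' e \<Longrightarrow> \<exists>a. TR x (upd e v a)"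
    if *: "is_form M x" "is_term M t" "free_for M t v x" "subst1 M v t x x'" for x v t x'
  proof -
    obtain a where "TV e t a" using TV_ex[OF *(2)] by blast
    from TR_subst[OF *(1,2,4,3) this] show "TR x' e \<Longrightarrow> \<exists>a. TR x (upd e v a)" by blast
  qed
  show ?thesis using assms unfolding logical_axiom_def Form_def UN
    by (elim disjE bexE conjE) (auto simp: sub c_imp_def c_eqv_def)
qed

lemma rule0_sound: "rule0 Y A \<Longrightarrow> TR Y e \<Longrightarrow> TR A e"
  unfolding rule0_def by auto

lemma rule2_sound: "rule2 M Y C A \<Longrightarrow> TR Y e \<Longrightarrow> \<not> TR (pf (ps Y)) e \<Longrightarrow> TR A e"
  "rule2 M Y C A \<Longrightarrow> TR C e \<Longrightarrow> TR (pf (ps Y)) e \<Longrightarrow> TR A e"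
  unfolding rule2_def by auto

text \<open>If the conclusion is false, its existential antecedent is true and the answer supplies a
  witness. Assigning the witness to \<open>v\<close> makes \<open>x\<close> true, while
  \<open>y\<close>, in which \<open>v\<close> is not free, stays false.\<close>

lemma rule1_sound:
  assumes "rule1 M Y A" "\<not> rule0 Y A" "\<not> TR A e" "G (N.nd (pr (ps (pf (ps A))) e)) a"
  shows "\<not> TR Y (upd e (pf (ps (ps (pf (ps A))))) (a \<ominus> sc \<zero>))"
proof -
  obtain x y v where x: "is_form M x" "is_form M y" "\<not> free_in M v y" "Y = c_imp M x y" "A = c_imp M (c_exi M v x) y"
    using assms(1,2) unfolding rule1_def rule0_def Form_def UN by blast
  have A: "ps (pf (ps A)) = c_exi M v x" "pf (ps (ps (pf (ps A)))) = v" unfolding x c_imp_def by simp_all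
  have ex: "TR (c_exi M v x) e" "\<not> TR y e" using assms(3) by (auto simp: x c_imp_def)
  then have "a \<noteq> \<zero>" using assms(4) unfolding A TR_def using tr_iff by blast
  then obtain b where b: "a = sc b" using cases0 by blast
  have "a \<ominus> sc \<zero> = b" using mns_add[of "sc \<zero>" b] unfolding b by simp
  moreover have "TR x (upd e v b)"
    using tr_inst(1)[of "pr (c_exi M v x) e" b] assms(4) unfolding A b by (simp add: lfn_def sgn_def TR_def)
  moreover have "TR y (upd e v b) = TR y e" using x(3) by (intro TR_agree x) (auto simp: av_upd)
  ultimately show ?thesis using ex(2) unfolding A by (simp add: x c_imp_def)
qed

definition T :: "'a set" where "T = {x \<in> Sent M. TR x \<zero>}"

lemma Sent_simps: "x \<in> Sent M \<longleftrightarrow> is_form M x \<and> (\<forall>v. \<not> free_in M v x)"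
  by (simp add: Sent_def Form_def UN)

text \<open>The quantifier clause speaks of numerals, that of \<open>TR\<close> of updated
  assignments. \<open>TR_subst\<close> connects them, since a numeral is closed and denotes its
  number under every assignment.\<close>

lemma T_full: "full_truth_class M T"
  unfolding full_truth_class_def
proof (intro conjI ballI impI)
  show "T \<subseteq> Sent M" by (auto simp: T_def)
next
  fix s t assume st: "s \<in> ClTerm M" "t \<in> ClTerm M"
  then have c: "is_term M s" "is_term M t" "\<not> occurs M v s" "\<not> occurs M v t" for v
    by (auto simp: ClTerm_def is_closed_term_def UN)
  have "(\<exists>a. TV \<zero> s a \<and> TV \<zero> t a) \<longleftrightarrow> (\<exists>a. value_of M s a \<and> value_of M t a)"
  proof
    assume "\<exists>a. TV \<zero> s a \<and> TV \<zero> t a"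
    then obtain a where a: "TV \<zero> s a" "TV \<zero> t a" by blast
    obtain x y where xy: "value_of M s x" "value_of M t y" using value_ex c by metis
    have "x = a" "y = a" using TV_fun a value_TV[OF _ xy(1)] value_TV[OF _ xy(2)] c by blast+
    then show "\<exists>a. value_of M s a \<and> value_of M t a" using xy by blast
  qed (use value_TV c in blast)
  then show "c_eq M s t \<in> T \<longleftrightarrow> (\<exists>a\<in>univ M. value_of M s a \<and> value_of M t a)"
    using c by (auto simp: T_def Sent_simps UN)
next
  fix x assume "x \<in> Sent M"
  then show "c_neg M x \<in> T \<longleftrightarrow> x \<notin> T" by (auto simp: T_def Sent_simps)
next
  fix x y assume "x \<in> Sent M" "y \<in> Sent M"
  then show "c_dsj M x y \<in> T \<longleftrightarrow> x \<in> T \<or> y \<in> T" by (auto simp: T_def Sent_simps)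
next
  fix v x assume x: "x \<in> Form M" and fr: "\<forall>u\<in>univ M. free_in M u x \<longrightarrow> u = v"
  have f: "is_form M x" using x by (simp add: Form_def)
  have sub: "TR x' \<zero> = TR x (upd \<zero> v a)" if "numeral_of M a n" "subst1 M v n x x'" for a n x'
    using numeral[OF that(1)] that(2) f by (intro TR_subst free_for_closed)
  have "c_exi M v x \<in> T \<longleftrightarrow> (\<exists>a. TR x (upd \<zero> v a))"
    using f fr by (auto simp: T_def Sent_simps UN)
  also have "\<dots> \<longleftrightarrow> (\<exists>a n x'. numeral_of M a n \<and> subst1 M v n x x' \<and> x' \<in> T)"
  proof
    assume "\<exists>a. TR x (upd \<zero> v a)"
    then obtain a where a: "TR x (upd \<zero> v a)" by blast
    obtain n where n: "numeral_of M a n" using numeral_ex by blast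
    have "D (\<lambda>e. e 0 = pr v n)" by (intro dfn)
    from comprehension[OF this, of "sc (pr v n)"] obtain d where d: "\<forall>q. q \<epsilon> d \<longleftrightarrow> q = pr v n" by auto
    then obtain x' where x': "fm_subst M d x x'" "is_form M x'"
      "\<forall>u. free_in M u x' \<longrightarrow> free_in M u x \<and> (u = v \<longrightarrow> (\<forall>q. \<not> q \<epsilon> d))"
      using fm_subst_ex[OF numeral(1)[OF n] numeral(2)[OF n] f, of v] by blast
    have "subst1 M v n x x'" unfolding subst1_def UN using d x'(1) by auto
    moreover have "x' \<in> Sent M" unfolding Sent_simps using x'(2,3) d fr UN by blast
    ultimately show "\<exists>a n x'. numeral_of M a n \<and> subst1 M v n x x' \<and> x' \<in> T"
      using n sub[OF n] a unfolding T_def by blast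
  qed (use sub in \<open>auto simp: T_def\<close>)
  finally show "c_exi M v x \<in> T \<longleftrightarrow>
      (\<exists>a\<in>univ M. \<exists>n\<in>univ M. \<exists>x'\<in>univ M. numeral_of M a n \<and> subst1 M v n x x' \<and> x' \<in> T)" by (simp add: UN)
qed

end

section \<open>Disjunctive correctness\<close>

context truth
begin

lemma qry_states:
  "qry (pr (tg 1) (pr c (pr h (pr i (pr j y))))) = N.nd (pr y \<zero>)"
  "qry (pr (tg 2) (pr s (pr i e))) = N.nd (pr (ln s i) e)"
  "qry (pr (tg 3) (pr s (pr i e))) = N.nd (pr (decide s i) e)"
  by (simp_all add: qry_def)

lemma nxt_states:
  "nxt (pr (tg 1) (pr c (pr h (pr i (pr j y))))) a = pr (tg 1) (pr c (pr h (dstep c h i j y a)))"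
  "nxt (pr (tg 2) (pr s (pr i e))) a = pr (tg 3) (pr s (pr i e))"
  "nxt (pr (tg 3) (pr s (pr i e))) a = pr (tg 2) (pr s (pstep s i e a))"
  by (simp_all add: nxt_def)

text \<open>Truth is handed down to the disjunct that the witness names, and falsity to both
  disjuncts, so in the latter case the walk is free to approach a given entry.\<close>

lemma dstep_sound:
  assumes k: "split c i j y k" and fl: "h = \<zero> \<longrightarrow> a \<noteq> \<zero>" "h \<noteq> \<zero> \<longrightarrow> a = \<zero> \<and> i \<sqsubset> h \<and> h \<sqsubseteq> j"
    and a: "G (N.nd (pr y \<zero>)) a"
  shows "\<exists>i' j' y'. dstep c h i j y a = pr i' (pr j' y') \<and> pr i' (pr j' y') \<epsilon> c \<and> j' \<sqsubseteq> j \<and>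
    (i' = i \<and> j' \<sqsubset> j \<or> i \<sqsubset> i' \<and> j' = j) \<and> (h = \<zero> \<longrightarrow> TR y' \<zero>) \<and> (h \<noteq> \<zero> \<longrightarrow> \<not> TR y' \<zero> \<and> i' \<sqsubset> h \<and> h \<sqsubseteq> j')"
proof -
  define l where "l = lst (split c i j y)"
  have "D (\<lambda>e. split c i j y (e 0))" unfolding split_def by (intro dfn)
  from lst_ex[where P = "split c i j y", OF this] k have "split c i j y l" unfolding l_def by blast
  then obtain z w where l: "i \<sqsubset> l" "l \<sqsubset> j" "y = c_dsj M z w" "pr i (pr l z) \<epsilon> c" "pr l (pr j w) \<epsilon> c"
    unfolding split_def by blast
  have y: "TR y \<zero> \<longleftrightarrow> TR z \<zero> \<or> TR w \<zero>" by (simp add: l(3))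
  have ta: "TR y \<zero> \<longleftrightarrow> a \<noteq> \<zero>" unfolding TR_def by (rule tr_iff[OF a])
  show ?thesis
  proof (cases "h = \<zero> \<and> a = sc \<zero> \<or> h \<noteq> \<zero> \<and> h \<sqsubseteq> l")
    case True
    then have "dstep c h i j y a = pr i (pr l z)" unfolding dstep_def l_def[symmetric] Let_def by (simp add: l(3))
    moreover have "TR z \<zero>" if h: "h = \<zero>"
    proof -
      have "G (N.nd (pr y \<zero>)) (sc \<zero>)" using True h a by simp
      from tr_inst(1)[OF _ this] show ?thesis by (simp add: l(3) lfn_def sgn_def TR_def)
    qed
    moreover have "\<not> TR z \<zero> \<and> i \<sqsubset> h \<and> h \<sqsubseteq> l" if "h \<noteq> \<zero>" using that fl(2) True ta y by simp
    ultimately show ?thesis using l A.less_imp_le[OF l(2)]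
      by - (rule exI[of _ i], rule exI[of _ l], rule exI[of _ z], simp)
  next
    case False
    then have "dstep c h i j y a = pr l (pr j w)" unfolding dstep_def l_def[symmetric] Let_def by (auto simp: l(3))
    moreover have "TR w \<zero>" if h: "h = \<zero>"
    proof -
      obtain b where b: "a = sc b" using fl(1) h cases0 by blast
      then have "b \<noteq> \<zero>" "G (N.nd (pr y \<zero>)) (sc b)" using False h a by auto
      then show ?thesis using tr_inst(1)[of "pr y \<zero>" b] by (simp add: l(3) lfn_def sgn_def TR_def)
    qed
    moreover have "\<not> TR w \<zero> \<and> l \<sqsubset> h \<and> h \<sqsubseteq> j" if "h \<noteq> \<zero>" using that fl(2) False ta y by (simp add: A.not_le)
    ultimately show ?thesis using l
      by - (rule exI[of _ l], rule exI[of _ j], rule exI[of _ w], simp)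
  qed
qed

text \<open>Each step shortens the interval from \<open>i\<close> to \<open>j\<close>, which is
  impossible \<open>m\<close> times. The case \<open>h = \<zero>\<close> refutes a true disjunction
  without true entries, and \<open>h = sc i\<close> a false one whose entry \<open>i\<close> is
  true; indices are shifted by one to keep zero for the first case.\<close>

lemma disjunction_walk:
  assumes c: "\<forall>p. p \<epsilon> c \<longrightarrow> (\<exists>i y. pr i y \<epsilon> s \<and> p = pr i (pr (sc i) y)) \<or>
      (\<exists>i k j y z. i \<sqsubset> k \<and> k \<sqsubset> j \<and> pr i (pr k y) \<epsilon> c \<and> pr k (pr j z) \<epsilon> c \<and> p = pr i (pr j (c_dsj M y z)))"
    and start: "pr \<zero> (pr m d) \<epsilon> c" "m \<sqsubseteq> B"
    and E: "\<And>i y. i \<sqsubset> m \<Longrightarrow> pr i y \<epsilon> s \<Longrightarrow> (h = \<zero> \<longrightarrow> \<not> TR y \<zero>) \<and> (h = sc i \<longrightarrow> TR y \<zero>)"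
    and flag: "h = \<zero> \<longrightarrow> TR d \<zero>" "h \<noteq> \<zero> \<longrightarrow> \<not> TR d \<zero> \<and> h \<sqsubseteq> m"
  shows False
proof -
  obtain sq an where dsq: "df (\<lambda>e. sq (e 0))" "df (\<lambda>e. an (e 0))"
    and sq0: "sq \<zero> = pr (tg 1) (pr c (pr h (pr \<zero> (pr m d))))"
    and sqS: "\<And>i. sq (sc i) = nxt (sq i) (an i)" and G: "\<And>i. i \<sqsubset> sc (sc (B \<oplus> B)) \<Longrightarrow> G (qry (sq i)) (an i)"
    using plays by blast
  note [dfn] = df_comp[OF dsq(1)] df_comp[OF dsq(2)]
  have G': "G (qry (sq i)) (an i)" if "i \<sqsubseteq> m" for i
    using that start(2) A.order_trans[OF A.order_trans[OF that start(2)] le_add(1)[of B B]] by (intro G) (simp add: A.less_imp_le le_SI)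
  have ij: "i \<sqsubset> j" if "pr i (pr j y) \<epsilon> c" for i j y
    using c[rule_format, OF that] A.less_trans by auto
  \<comment> \<open>The length \<open>j - i\<close> is at most \<open>m - k\<close>, written without
    subtraction.\<close>
  have "k \<sqsubseteq> m \<longrightarrow> (\<exists>i j y. sq k = pr (tg 1) (pr c (pr h (pr i (pr j y)))) \<and> pr i (pr j y) \<epsilon> c \<and> j \<sqsubseteq> m \<and>
    j \<oplus> k \<sqsubseteq> i \<oplus> m \<and> (h = \<zero> \<longrightarrow> an k \<noteq> \<zero>) \<and> (h \<noteq> \<zero> \<longrightarrow> an k = \<zero> \<and> i \<sqsubset> h \<and> h \<sqsubseteq> j))" for k
  proof (induction k rule: ind)
    case Z
    have "TR d \<zero> \<longleftrightarrow> an \<zero> \<noteq> \<zero>" using tr_iff G'[of \<zero>] unfolding sq0 qry_states TR_def by simp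
    then show ?case using start flag by - (rule impI, rule exI[of _ \<zero>], rule exI[of _ m], rule exI[of _ d], simp add: sq0 pos_S)
  next
    case (S k)
    show ?case
    proof
      assume k: "sc k \<sqsubseteq> m"
      then have k': "k \<sqsubseteq> m" by (simp add: A.less_imp_le)
      obtain i j y where st: "sq k = pr (tg 1) (pr c (pr h (pr i (pr j y))))" "pr i (pr j y) \<epsilon> c" "j \<sqsubseteq> m"
        "j \<oplus> k \<sqsubseteq> i \<oplus> m" "h = \<zero> \<longrightarrow> an k \<noteq> \<zero>" "h \<noteq> \<zero> \<longrightarrow> an k = \<zero> \<and> i \<sqsubset> h \<and> h \<sqsubseteq> j"
        using S k' by blast
      have Gk: "G (N.nd (pr y \<zero>)) (an k)" using G'[OF k'] unfolding st(1) qry_states .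
      then have y: "TR y \<zero> \<longleftrightarrow> an k \<noteq> \<zero>" unfolding TR_def by (rule tr_iff)
      \<comment> \<open>The walk cannot stand at a single entry, whose truth value would contradict
        \<open>E\<close>; so the certificate splits the current disjunction.\<close>
      have "\<not> (pr i y \<epsilon> s \<and> j = sc i)"
      proof
        assume e: "pr i y \<epsilon> s \<and> j = sc i"
        then have "i \<sqsubset> m" using st(3) by simp
        moreover have "h \<noteq> \<zero> \<Longrightarrow> h = sc i" using st(6) e by (auto intro: A.order.antisym)
        ultimately show False using E[of i y] e st(5,6) y by blast
      qed
      then obtain l where "split c i j y l" using c[rule_format, OF st(2)] unfolding split_def by auto
      from dstep_sound[OF this st(5,6) Gk] obtain i' j' y' where
        n: "dstep c h i j y (an k) = pr i' (pr j' y')" "pr i' (pr j' y') \<epsilon> c" "j' \<sqsubseteq> j"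
          "i' = i \<and> j' \<sqsubset> j \<or> i \<sqsubset> i' \<and> j' = j" "h = \<zero> \<longrightarrow> TR y' \<zero>"
          "h \<noteq> \<zero> \<longrightarrow> \<not> TR y' \<zero> \<and> i' \<sqsubset> h \<and> h \<sqsubseteq> j'" by blast
      have sq': "sq (sc k) = pr (tg 1) (pr c (pr h (pr i' (pr j' y'))))" unfolding sqS st(1) nxt_states n(1) ..
      have "TR y' \<zero> \<longleftrightarrow> an (sc k) \<noteq> \<zero>" using tr_iff G'[OF k] unfolding sq' qry_states TR_def by simp
      moreover have "j' \<oplus> sc k \<sqsubseteq> i' \<oplus> m"
        using n(4)
      proof (elim disjE conjE)
        assume "i' = i" "j' \<sqsubset> j"
        then have "j' \<oplus> k \<sqsubset> i' \<oplus> m" using A.less_le_trans[OF A.add_strict_right_mono[of j' j k] st(4)] by simp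
        then show ?thesis by simp
      next
        assume "i \<sqsubset> i'" "j' = j"
        then have "j' \<oplus> k \<sqsubset> i' \<oplus> m" using A.le_less_trans[OF st(4) A.add_strict_right_mono[of i i' m]] by simp
        then show ?thesis by simp
      qed
      ultimately show "\<exists>i j y. sq (sc k) = pr (tg 1) (pr c (pr h (pr i (pr j y)))) \<and> pr i (pr j y) \<epsilon> c \<and> j \<sqsubseteq> m \<and>
        j \<oplus> sc k \<sqsubseteq> i \<oplus> m \<and> (h = \<zero> \<longrightarrow> an (sc k) \<noteq> \<zero>) \<and> (h \<noteq> \<zero> \<longrightarrow> an (sc k) = \<zero> \<and> i \<sqsubset> h \<and> h \<sqsubseteq> j)"
        using n sq' A.order_trans[OF n(3) st(3)]
        by - (rule exI[of _ i'], rule exI[of _ j'], rule exI[of _ y'], simp)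
    qed
  next
    case D show ?case by (intro dfn)
  qed
  from this[of m] obtain i j y where "pr i (pr j y) \<epsilon> c" "j \<oplus> m \<sqsubseteq> i \<oplus> m" by auto
  then show False using ij[of i j y] by (simp add: A.not_le[symmetric])
qed

lemma T_disj: assumes "\<And>m. m \<in> I \<Longrightarrow> m \<sqsubseteq> B" shows "disj_correct M I T"
  unfolding disj_correct_def UN
proof (intro ballI impI, elim conjE)
  fix m s d
  assume m: "m \<in> I" and d: "d \<in> Sent M" and s: "is_seq M m s" and
    sent: "\<forall>i\<in>UNIV. i \<sqsubset> m \<longrightarrow> (\<forall>x\<in>UNIV. pr i x \<epsilon> s \<longrightarrow> x \<in> Sent M)" and dis: "is_disjunction M m s d"
  obtain c where c0: "pr \<zero> (pr m d) \<epsilon> c" and c: "\<forall>p. p \<epsilon> c \<longrightarrow> (\<exists>i y. pr i y \<epsilon> s \<and> p = pr i (pr (sc i) y)) \<or>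
      (\<exists>i k j y z. i \<sqsubset> k \<and> k \<sqsubset> j \<and> pr i (pr k y) \<epsilon> c \<and> pr k (pr j z) \<epsilon> c \<and> p = pr i (pr j (c_dsj M y z)))"
    using dis unfolding is_disjunction_def UN bex_UNIV ball_UNIV by blast
  show "d \<in> T \<longleftrightarrow> (\<exists>i\<in>UNIV. i \<sqsubset> m \<and> (\<exists>x\<in>UNIV. pr i x \<epsilon> s \<and> x \<in> T))"
  proof
    assume "d \<in> T"
    show "\<exists>i\<in>UNIV. i \<sqsubset> m \<and> (\<exists>x\<in>UNIV. pr i x \<epsilon> s \<and> x \<in> T)"
    proof (rule ccontr)
      assume n: "\<not> ?thesis"
      have "\<not> TR y \<zero>" if "i \<sqsubset> m" "pr i y \<epsilon> s" for i y using n that sent unfolding T_def by blast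
      then show False
        by (intro disjunction_walk[OF c c0 assms[OF m], of \<zero>]) (use \<open>d \<in> T\<close> in \<open>auto simp: T_def\<close>)
    qed
  next
    assume "\<exists>i\<in>UNIV. i \<sqsubset> m \<and> (\<exists>x\<in>UNIV. pr i x \<epsilon> s \<and> x \<in> T)"
    then obtain i x where x: "i \<sqsubset> m" "pr i x \<epsilon> s" "TR x \<zero>" unfolding T_def by auto
    show "d \<in> T"
    proof (rule ccontr)
      assume "d \<notin> T"
      then have nd: "\<not> TR d \<zero>" using d by (simp add: T_def)
      have "TR y \<zero>" if "pr i y \<epsilon> s" for y
        using s x that unfolding is_seq_def UN by auto
      then show False
        by (intro disjunction_walk[OF c c0 assms[OF m], of "sc i"]) (use nd x in auto)
    qed
  qed
qed

section \<open>Deductive correctness\<close>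

lemma pstep_sound:
  assumes j: "(\<exists>j. just1 s i j) \<or> (\<exists>w. just2 s i w)" and F: "\<not> TR (ln s i) e"
    and a: "G (N.nd (pr (decide s i) e)) a"
  shows "\<exists>j e'. pstep s i e a = pr j e' \<and> j \<sqsubset> i \<and> \<not> TR (ln s j) e'"
proof -
  have D: "D (\<lambda>e. just0 s i (e 0))" "D (\<lambda>e. just1 s i (e 0))" "D (\<lambda>e. just2 s i (e 0))" by (intro dfn)+
  consider "\<exists>j. just0 s i j" | "\<not> (\<exists>j. just0 s i j)" "\<exists>j. just1 s i j"
    | "\<not> (\<exists>j. just0 s i j)" "\<not> (\<exists>j. just1 s i j)" "\<exists>w. just2 s i w" using j by blast
  then show ?thesis
  proof cases
    case 1
    have "just0 s i (lst (just0 s i))" by (rule lst_ex[where P = "just0 s i", OF D(1) 1])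
    then show ?thesis using 1 F rule0_sound unfolding just0_def[of s i "lst (just0 s i)"] pstep_def by auto
  next
    case 2
    have *: "just1 s i (lst (just1 s i))" by (rule lst_ex[where P = "just1 s i", OF D(2) 2(2)])
    then have "\<not> rule0 (ln s (lst (just1 s i))) (ln s i)" using 2(1) unfolding just1_def[of s i "lst (just1 s i)"] just0_def by blast
    moreover have "G (N.nd (pr (ps (pf (ps (ln s i)))) e)) a" using a 2(2) unfolding decide_def by simp
    moreover have "pstep s i e a = pr (lst (just1 s i)) (upd e (pf (ps (ps (pf (ps (ln s i)))))) (a \<ominus> sc \<zero>))"
      using 2 unfolding pstep_def by auto
    ultimately show ?thesis using * F rule1_sound unfolding just1_def[of s i "lst (just1 s i)"] by simp
  next
    case 3
    have "just2 s i (lst (just2 s i))" by (rule lst_ex[where P = "just2 s i", OF D(3) 3(3)])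
    then obtain j k where w: "lst (just2 s i) = pr j k" "j \<sqsubset> i" "k \<sqsubset> i" "rule2 M (ln s j) (ln s k) (ln s i)"
      unfolding just2_def[of s i "lst (just2 s i)"] by blast
    have "G (N.nd (pr (pf (ps (ln s j))) e)) a" using a 3(2) w(1) unfolding decide_def by simp
    then have "TR (pf (ps (ln s j))) e \<longleftrightarrow> a \<noteq> \<zero>" unfolding TR_def by (rule tr_iff)
    then show ?thesis using 3 w F rule2_sound[OF w(4)] unfolding pstep_def by auto
  qed
qed

text \<open>From a false last line, each round leads to a false line strictly before, which is
  impossible \<open>n\<close> times. The assignment changes on the way; axioms are true under all
  assignments, and so are the members of \<open>h\<close>, since they are true sentences.\<close>

lemma proof_sound:
  assumes p: "is_proof M h p n x" and n: "n \<sqsubseteq> B" and h: "coded_set M h \<subseteq> T" and x: "x \<in> Sent M"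
  shows "x \<in> T"
proof (rule ccontr)
  assume "x \<notin> T"
  then have nx: "\<not> TR x \<zero>" using x by (simp add: T_def)
  obtain s l where s: "is_seq M n s" and l: "n = sc l" "pr l x \<epsilon> s" and
    st: "\<And>i A. i \<sqsubset> n \<Longrightarrow> pr i A \<epsilon> s \<Longrightarrow> logical_axiom M A \<or> A \<epsilon> h \<or>
         (\<exists>j B. j \<sqsubset> i \<and> pr j B \<epsilon> s \<and> rule1 M B A) \<or>
         (\<exists>j k B C. j \<sqsubset> i \<and> k \<sqsubset> i \<and> pr j B \<epsilon> s \<and> pr k C \<epsilon> s \<and> rule2 M B C A)"
    using p unfolding is_proof_def UN bex_UNIV ball_UNIV by blast
  have ln: "pr i A \<epsilon> s \<longleftrightarrow> A = ln s i" if "i \<sqsubset> n" for i A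
  proof -
    have "\<exists>!x. pr i x \<epsilon> s" using s that unfolding is_seq_def UN by simp
    then obtain A' where "pr i A' \<epsilon> s" "\<forall>A. pr i A \<epsilon> s \<longrightarrow> A = A'" by (elim ex1E)
    then have A': "\<And>A. pr i A \<epsilon> s \<longleftrightarrow> A = A'" by blast
    then have "ln s i = A'" unfolding ln_def by (intro lst_eq) auto
    then show ?thesis using A' by simp
  qed
  have just: "(\<exists>j. just1 s i j) \<or> (\<exists>w. just2 s i w)" if i: "i \<sqsubset> n" and F: "\<not> TR (ln s i) e" for i e
  proof -
    have A: "pr i (ln s i) \<epsilon> s" using ln[OF i] by blast
    have "\<not> logical_axiom M (ln s i)" using axiom_true F by blast
    moreover have "\<not> ln s i \<epsilon> h"
    proof
      assume "ln s i \<epsilon> h"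
      then have "ln s i \<in> T" using h by (auto simp: coded_set_def UN)
      then have "TR (ln s i) \<zero>" "is_form M (ln s i)" "\<And>u. \<not> free_in M u (ln s i)" by (auto simp: T_def Sent_simps)
      then show False using F TR_agree[of "ln s i" e \<zero>] by blast
    qed
    ultimately have *: "(\<exists>j Y. j \<sqsubset> i \<and> pr j Y \<epsilon> s \<and> rule1 M Y (ln s i)) \<or>
      (\<exists>j k Y Z. j \<sqsubset> i \<and> k \<sqsubset> i \<and> pr j Y \<epsilon> s \<and> pr k Z \<epsilon> s \<and> rule2 M Y Z (ln s i))"
      using st[OF i A] by blast
    have lt: "j \<sqsubset> n" if "j \<sqsubset> i" for j using A.less_trans[OF that i] .
    from * show ?thesis
    proof (elim disjE exE conjE)
      fix j Y assume j: "j \<sqsubset> i" "pr j Y \<epsilon> s" "rule1 M Y (ln s i)"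
      have "Y = ln s j" using j(2) ln[OF lt[OF j(1)]] by simp
      then have "just1 s i j" using j unfolding just1_def by simp
      then show ?thesis by blast
    next
      fix j k Y Z assume j: "j \<sqsubset> i" "k \<sqsubset> i" "pr j Y \<epsilon> s" "pr k Z \<epsilon> s" "rule2 M Y Z (ln s i)"
      have "Y = ln s j" "Z = ln s k" using j(3,4) ln[OF lt[OF j(1)]] ln[OF lt[OF j(2)]] by simp_all
      then have "just2 s i (pr j k)" using j unfolding just2_def by simp
      then show ?thesis by blast
    qed
  qed
  obtain sq an where dsq: "df (\<lambda>e. sq (e 0))" "df (\<lambda>e. an (e 0))"
    and sq0: "sq \<zero> = pr (tg 2) (pr s (pr l \<zero>))"
    and sqS: "\<And>i. sq (sc i) = nxt (sq i) (an i)" and G: "\<And>i. i \<sqsubset> sc (sc (B \<oplus> B)) \<Longrightarrow> G (qry (sq i)) (an i)"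
    using plays by blast
  note [dfn] = df_comp[OF dsq(1)] df_comp[OF dsq(2)]
  \<comment> \<open>Each line costs two queries, at the times 2k and 2k + 1 with \<open>k\<close> at
    most \<open>B\<close>. This is the origin of the length \<open>sc (sc (B \<oplus> B))\<close> of
    the plays.\<close>
  have G': "G (qry (sq (k \<oplus> k))) (an (k \<oplus> k))" if "k \<sqsubseteq> n" for k
    using A.add_mono[OF A.order_trans[OF that n] A.order_trans[OF that n]] by (intro G) (simp add: le_SI)
  have G'': "G (qry (sq (sc (k \<oplus> k)))) (an (sc (k \<oplus> k)))" if "k \<sqsubseteq> n" for k
    using A.add_mono[OF A.order_trans[OF that n] A.order_trans[OF that n]] by (intro G) simp
  have "k \<sqsubseteq> n \<longrightarrow> (\<exists>i e. sq (k \<oplus> k) = pr (tg 2) (pr s (pr i e)) \<and> i \<oplus> k \<sqsubset> n \<and> an (k \<oplus> k) = \<zero>)" for k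
  proof (induction k rule: ind)
    case Z
    have "x = ln s l" using ln[of l x] l by simp
    then have "\<not> tr (pr (ln s l) \<zero>)" using nx unfolding TR_def by simp
    then have "an \<zero> = \<zero>" using tr_iff G'[of \<zero>] by (simp add: sq0 qry_states)
    then show ?case using l(1) by (simp add: sq0)
  next
    case (S k)
    show ?case
    proof
      assume k: "sc k \<sqsubseteq> n"
      then have k': "k \<sqsubseteq> n" by (simp add: A.less_imp_le)
      then obtain i e where i: "sq (k \<oplus> k) = pr (tg 2) (pr s (pr i e))" "i \<oplus> k \<sqsubset> n" "an (k \<oplus> k) = \<zero>"
        using S by blast
      have F: "\<not> TR (ln s i) e" using tr_iff G'[OF k'] i(3) unfolding i(1) qry_states TR_def by simp
      have sq1: "sq (sc (k \<oplus> k)) = pr (tg 3) (pr s (pr i e))" unfolding sqS i(1) nxt_states ..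
      have Ga: "G (N.nd (pr (decide s i) e)) (an (sc (k \<oplus> k)))" using G''[OF k'] unfolding sq1 qry_states .
      have "i \<sqsubset> n" using A.le_less_trans[OF le_add(1) i(2)] .
      from pstep_sound[OF just[OF this F] F Ga] obtain j e' where
        j: "pstep s i e (an (sc (k \<oplus> k))) = pr j e'" "j \<sqsubset> i" "\<not> TR (ln s j) e'" by blast
      have sq2: "sq (sc k \<oplus> sc k) = pr (tg 2) (pr s (pr j e'))"
        using j(1) sqS[of "sc (k \<oplus> k)"] unfolding sq1 nxt_states by simp
      have "an (sc k \<oplus> sc k) = \<zero>" using tr_iff G'[OF k] j(3) unfolding sq2 qry_states TR_def by blast
      moreover have "j \<oplus> sc k \<sqsubset> n"
        using A.le_less_trans[OF _ i(2), of "sc (j \<oplus> k)"] A.add_strict_right_mono[OF j(2), of k] by simp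
      ultimately show "\<exists>i e. sq (sc k \<oplus> sc k) = pr (tg 2) (pr s (pr i e)) \<and> i \<oplus> sc k \<sqsubset> n \<and> an (sc k \<oplus> sc k) = \<zero>"
        using sq2 by blast
    qed
  next
    case D show ?case by (intro dfn)
  qed
  from this[of n] obtain i where "i \<oplus> n \<sqsubset> n" by auto
  then show False using A.less_le_trans[OF _ le_add(2)[of n i]] by blast
qed

lemma T_deductive: assumes "\<And>m. m \<in> I \<Longrightarrow> m \<sqsubseteq> B" shows "strongly_deductively_correct M I T"
  unfolding strongly_deductively_correct_def using proof_sound assms by blast

end

context pa
begin

text \<open>The length of the plays is fixed before the truth class is built, so correctness is
  obtained for all sets of elements up to \<open>B\<close> together.\<close>

theorem truth_class_ex:
  assumes "recursively_saturated M" "countable (UNIV :: 'a set)"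
  shows "\<exists>T. full_truth_class M T \<and> (\<forall>I. (\<forall>m\<in>I. m \<sqsubseteq> B) \<longrightarrow>
    disj_correct M I T \<and> strongly_deductively_correct M I T)"
proof -
  interpret P: sgame M "\<lambda>p a. N.nd (rinst p a)" sgn lfn Atn "\<lambda>p. S.nd (pf p)" "\<lambda>t. S.nd (child t \<zero>)"
    "\<lambda>t. S.nd (child t (sc \<zero>))" qry nxt "sc (sc (B \<oplus> B))"
    by (rule walk_game)
  obtain G where "W.okR G" "\<And>s. \<exists>sq an. df (\<lambda>e. sq (e 0)) \<and> df (\<lambda>e. an (e 0)) \<and> sq \<zero> = s \<and>
      (\<forall>i. sq (sc i) = nxt (sq i) (an i)) \<and> (\<forall>i. i \<sqsubset> sc (sc (B \<oplus> B)) \<longrightarrow> G (qry (sq i)) (an i))"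
    by (rule P.saturated_play[OF assms]) blast
  then interpret truth M G B by unfold_locales
  show ?thesis by (rule exI[where x = T]) (simp add: T_full T_disj T_deductive)
qed

lemma cut_bounded:
  assumes "proper_cut M I" obtains B where "\<And>m. m \<in> I \<Longrightarrow> m \<sqsubseteq> B"
proof -
  obtain B where B: "B \<notin> I" using assms unfolding proper_cut_def UN by blast
  have "m \<sqsubseteq> B" if m: "m \<in> I" for m
  proof (rule ccontr)
    assume "\<not> m \<sqsubseteq> B"
    then have "B \<sqsubset> m" by (simp add: A.not_le)
    then show False using assms m B unfolding proper_cut_def cut_def UN by blast
  qed
  then show ?thesis using that by blast
qed

end

section \<open>Isomorphic elementary cuts\<close>

context pa
begin

definition agr :: "'a \<Rightarrow> 'a \<Rightarrow> 'a \<Rightarrow> bool" where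
  "agr i s s' \<longleftrightarrow> (\<forall>j k l. j \<sqsubset> i \<and> k \<sqsubset> i \<and> l \<sqsubset> i \<longrightarrow> (av s j = av s k \<longleftrightarrow> av s' j = av s' k) \<and>
     (av s j = \<zero> \<longleftrightarrow> av s' j = \<zero>) \<and> (av s k = sc (av s j) \<longleftrightarrow> av s' k = sc (av s' j)) \<and>
     (av s l = av s j \<oplus> av s k \<longleftrightarrow> av s' l = av s' j \<oplus> av s' k) \<and>
     (av s l = av s j \<otimes> av s k \<longleftrightarrow> av s' l = av s' j \<otimes> av s' k))"

text \<open>The atomic diagram of the entries below \<open>i\<close>: \<open>m\<close> numbers the
  five kinds of atomic relations, and indices that a relation does not mention are
  arbitrary.\<close>

definition atm :: "'a \<Rightarrow> 'a \<Rightarrow> 'a \<Rightarrow> bool" where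
  "atm i s x \<longleftrightarrow> (\<exists>m j k l. x = pr m (pr j (pr k l)) \<and> j \<sqsubset> i \<and> k \<sqsubset> i \<and> l \<sqsubset> i \<and>
     (m = tg 0 \<and> av s j = av s k \<or> m = tg 1 \<and> av s j = \<zero> \<or> m = tg 2 \<and> av s k = sc (av s j) \<or>
      m = tg 3 \<and> av s l = av s j \<oplus> av s k \<or> m = tg 4 \<and> av s l = av s j \<otimes> av s k))"

text \<open>
  \<open>tau k i s\<close> is the type of rank \<open>k\<close> of the entries of the sequence \<open>s\<close> with index below \<open>i\<close>.
\<close>

primrec tau :: "nat \<Rightarrow> 'a \<Rightarrow> 'a \<Rightarrow> 'a" where
  "tau 0 i s = cs (atm i s)"
| "tau (Suc k) i s = pr (cs (atm i s)) (cs (\<lambda>t. \<exists>a. t = tau k (sc i) (upd s i a)))"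

lemma D_agr [dfn]: "df f \<Longrightarrow> df g \<Longrightarrow> df h \<Longrightarrow> D (\<lambda>e. agr (f e) (g e) (h e))"
  by (rule D_app3[where R = agr]) (unfold agr_def, intro dfn)

lemma D_atm [dfn]: "df f \<Longrightarrow> df g \<Longrightarrow> df h \<Longrightarrow> D (\<lambda>e. atm (f e) (g e) (h e))"
  by (rule D_app3[where R = atm]) (unfold atm_def, intro dfn)

lemma df_tau [dfn]: "df f \<Longrightarrow> df g \<Longrightarrow> df (\<lambda>e. tau k (f e) (g e))"
proof (induction k arbitrary: f g)
  case 0
  show ?case by (rule df_app2[where F = "tau 0", OF _ 0]) (unfold tau.simps, intro dfn)
next
  case (Suc k)
  show ?case by (rule df_app2[where F = "tau (Suc k)", OF _ Suc.prems]) (unfold tau.simps, intro dfn Suc.IH)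
qed

text \<open>The construction of the code is repeated to control its size; this makes the types of
  the next rank bounded.\<close>

lemma cs_bound:
  assumes D: "D (\<lambda>e. P (e 0))" and b: "\<And>x. P x \<Longrightarrow> x \<sqsubset> b"
  shows "cs P \<sqsubset> p2 b"
proof -
  note [dfn] = D_at[OF D]
  have "\<exists>c. c \<sqsubset> p2 b \<and> (\<forall>x. x \<epsilon> c \<longleftrightarrow> x \<sqsubset> b \<and> P x)"
  proof (induction b rule: ind)
    case Z show ?case by (intro exI[where x = \<zero>]) simp
  next
    case (S b)
    then obtain c where c: "c \<sqsubset> p2 b" "\<And>x. x \<epsilon> c \<longleftrightarrow> x \<sqsubset> b \<and> P x" by blast
    show ?case
    proof (cases "P b")
      case True
      have "c \<oplus> p2 b \<sqsubset> p2 (sc b)" unfolding p2_S by (rule A.add_strict_right_mono[OF c(1)])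
      moreover have "x \<epsilon> c \<oplus> p2 b \<longleftrightarrow> x \<sqsubset> sc b \<and> P x" for x
        using bit_add_p2[OF c(1)] c(2) True by (auto simp: A.le_less)
      ultimately show ?thesis by blast
    next
      case False
      have "c \<sqsubset> p2 (sc b)" using A.less_le_trans[OF c(1) p2_mono[of b "sc b"]] by (simp add: A.less_imp_le)
      moreover have "x \<epsilon> c \<longleftrightarrow> x \<sqsubset> sc b \<and> P x" for x using c(2) False by (auto simp: A.le_less)
      ultimately show ?thesis by blast
    qed
  next
    case D show ?case by (intro dfn)
  qed
  then obtain c where c: "c \<sqsubset> p2 b" "\<forall>x. x \<epsilon> c \<longleftrightarrow> P x" using b by blast
  have "D (\<lambda>e. \<forall>x. x \<epsilon> e 0 \<longleftrightarrow> P x)" by (intro dfn)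
  from lst_le[where P = "\<lambda>c. \<forall>x. x \<epsilon> c \<longleftrightarrow> P x", OF this c(2)] show ?thesis
    unfolding cs_def using c(1) A.le_less_trans by blast
qed

lemma pr_mono: "a \<sqsubseteq> a' \<Longrightarrow> b \<sqsubseteq> b' \<Longrightarrow> pr a b \<sqsubseteq> pr a' b'"
  unfolding pair_def by (intro A.add_mono A.mult_mono) auto

lemma tg_le: "m \<le> n \<Longrightarrow> tg m \<sqsubseteq> tg n"
  by (induction rule: dec_induct) (simp_all add: tg_def A.less_imp_le le_SI)

lemma atm_bound: "atm i s x \<Longrightarrow> x \<sqsubset> sc (pr (tg 4) (pr i (pr i i)))"
proof -
  assume "atm i s x"
  then obtain m j k l where "x = pr m (pr j (pr k l))" "j \<sqsubseteq> i" "k \<sqsubseteq> i" "l \<sqsubseteq> i" "m \<sqsubseteq> tg 4"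
    unfolding atm_def using tg_le[of _ 4] A.less_imp_le by fastforce
  then show ?thesis by (simp add: pr_mono)
qed

text \<open>Types of rank \<open>k\<close> are coded sets in a hierarchy of standard height over
  boundedly many atomic facts.\<close>

lemma tau_bound: "\<exists>B. \<forall>s. tau k i s \<sqsubset> B"
proof (induction k arbitrary: i)
  case 0
  have "cs (atm i s) \<sqsubset> p2 (sc (pr (tg 4) (pr i (pr i i))))" for s
    by (rule cs_bound[where P = "atm i s", OF _ atm_bound]) (intro dfn)
  then show ?case unfolding tau.simps by (intro exI allI)
next
  case (Suc k)
  then obtain B where B: "\<And>s. tau k (sc i) s \<sqsubset> B" by blast
  have 0: "cs (atm i s) \<sqsubset> p2 (sc (pr (tg 4) (pr i (pr i i))))" for s
    by (rule cs_bound[where P = "atm i s", OF _ atm_bound]) (intro dfn)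
  have "cs (\<lambda>t. \<exists>a. t = tau k (sc i) (upd s i a)) \<sqsubset> p2 B" for s
    by (rule cs_bound[where P = "\<lambda>t. \<exists>a. t = tau k (sc i) (upd s i a)"]) (intro dfn, use B in auto)
  then have "tau (Suc k) i s \<sqsubseteq> pr (p2 (sc (pr (tg 4) (pr i (pr i i))))) (p2 B)" for s
    unfolding tau.simps by (intro pr_mono A.less_imp_le 0)
  then show ?case by (intro exI[where x = "sc (pr (p2 (sc (pr (tg 4) (pr i (pr i i))))) (p2 B))"]) simp
qed

lemma tau_agr: assumes "tau k i s = tau k i s'" shows "agr i s s'"
proof -
  have m: "x \<epsilon> cs (atm i s) \<longleftrightarrow> atm i s x" for x s
    by (rule mem_cs[where P = "atm i s", OF _ atm_bound]) (intro dfn)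
  have eq: "cs (atm i s) = cs (atm i s')" using assms by (cases k) simp_all
  have *: "atm i s x = atm i s' x" for x using m[of x s] m[of x s'] unfolding eq by blast
  show ?thesis unfolding agr_def
  proof (intro allI impI, elim conjE)
    fix j k l assume "j \<sqsubset> i" "k \<sqsubset> i" "l \<sqsubset> i"
    then show "(av s j = av s k \<longleftrightarrow> av s' j = av s' k) \<and>
     (av s j = \<zero> \<longleftrightarrow> av s' j = \<zero>) \<and> (av s k = sc (av s j) \<longleftrightarrow> av s' k = sc (av s' j)) \<and>
     (av s l = av s j \<oplus> av s k \<longleftrightarrow> av s' l = av s' j \<oplus> av s' k) \<and>
     (av s l = av s j \<otimes> av s k \<longleftrightarrow> av s' l = av s' j \<otimes> av s' k)"
      using *[of "pr (tg 0) (pr j (pr k l))"] *[of "pr (tg 1) (pr j (pr k l))"] *[of "pr (tg 2) (pr j (pr k l))"]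
        *[of "pr (tg 3) (pr j (pr k l))"] *[of "pr (tg 4) (pr j (pr k l))"] unfolding atm_def by simp
  qed
qed

lemma tau_ext:
  assumes "tau (Suc k) i s = tau (Suc k) i s'"
  shows "\<exists>a'. tau k (sc i) (upd s i a) = tau k (sc i) (upd s' i a')"
proof -
  obtain B where B: "\<And>s. tau k (sc i) s \<sqsubset> B" using tau_bound by blast
  have m: "t \<epsilon> cs (\<lambda>t. \<exists>a. t = tau k (sc i) (upd s i a)) \<longleftrightarrow> (\<exists>a. t = tau k (sc i) (upd s i a))" for t s
    by (rule mem_cs[where P = "\<lambda>t. \<exists>a. t = tau k (sc i) (upd s i a)" and b = B]) (intro dfn, use B in auto)
  have "cs (\<lambda>t. \<exists>a. t = tau k (sc i) (upd s i a)) = cs (\<lambda>t. \<exists>a. t = tau k (sc i) (upd s' i a))"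
    using assms by simp
  then have "(\<exists>b. tau k (sc i) (upd s i a) = tau k (sc i) (upd s i b)) \<longleftrightarrow>
      (\<exists>b. tau k (sc i) (upd s i a) = tau k (sc i) (upd s' i b))"
    using m[of "tau k (sc i) (upd s i a)" s] m[of "tau k (sc i) (upd s i a)" s'] by metis
  then show ?thesis by blast
qed

text \<open>There are only M-finitely many pairs of a sequence up to \<open>x\<close> and a type
  below \<open>B\<close>, so collection bounds witnesses for all of them.\<close>

lemma tau_witness_bound:
  "\<exists>u. \<forall>s y. s \<sqsubseteq> x \<longrightarrow> (\<exists>a. a \<sqsubseteq> u \<and> tau k (sc i) (upd s i y) = tau k (sc i) (upd s i a))"
proof -
  obtain B where B: "\<And>s. tau k (sc i) s \<sqsubset> B" using tau_bound by blast
  \<comment> \<open>The premise makes the relation hold trivially for types that are not realised,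
    as collection asks for a value at every argument.\<close>
  let ?R = "\<lambda>p a. (\<exists>y. ps p = tau k (sc i) (upd (pf p) i y)) \<longrightarrow> ps p = tau k (sc i) (upd (pf p) i a)"
  have "D (\<lambda>e. ?R (e 0) (e 1))" by (intro dfn)
  from collection[where R = ?R, OF this, of "sc (pr x B)"] obtain u where
    u: "\<forall>p. p \<sqsubset> sc (pr x B) \<longrightarrow> (\<exists>a. a \<sqsubset> u \<and> ?R p a)" by blast
  have "\<exists>a. a \<sqsubseteq> u \<and> tau k (sc i) (upd s i y) = tau k (sc i) (upd s i a)" if "s \<sqsubseteq> x" for s y
  proof -
    have "pr s (tau k (sc i) (upd s i y)) \<sqsubset> sc (pr x B)" using that B by (simp add: pr_mono A.less_imp_le)
    with u obtain a where "a \<sqsubset> u" "?R (pr s (tau k (sc i) (upd s i y))) a" by blast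
    then show ?thesis using A.less_imp_le by auto
  qed
  then show ?thesis by blast
qed

lemma upd_bound: "\<exists>v. \<forall>s a. s \<sqsubseteq> x \<longrightarrow> a \<sqsubseteq> u \<longrightarrow> upd s i a \<sqsubseteq> v"
proof -
  have "D (\<lambda>e. e 1 = upd (pf (e 0)) i (ps (e 0)))" by (intro dfn)
  from collection[where R = "\<lambda>p v. v = upd (pf p) i (ps p)", OF this, of "sc (pr x u)"] obtain v where
    v: "\<forall>p. p \<sqsubset> sc (pr x u) \<longrightarrow> upd (pf p) i (ps p) \<sqsubset> v" by auto
  have "upd s i a \<sqsubseteq> v" if "s \<sqsubseteq> x" "a \<sqsubseteq> u" for s a
    using v[rule_format, of "pr s a"] pr_mono[OF that] A.less_imp_le by simp
  then show ?thesis by blast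
qed

lemma av_le: "av s j \<sqsubseteq> s"
proof (cases "\<exists>a. pr j a \<epsilon> s")
  case True
  have "D (\<lambda>e. pr j (e 0) \<epsilon> s)" by (intro dfn)
  from lst_ex[where P = "\<lambda>a. pr j a \<epsilon> s", OF this True] have "pr j (av s j) \<epsilon> s" unfolding av_def .
  then show ?thesis using A.order_trans[OF pr_ge(2) A.less_imp_le[OF bit_less]] by blast
next
  case False
  then show ?thesis by (simp add: av_def lst_def)
qed

text \<open>
  States of the back-and-forth game are \<open>st b m i s s'\<close>: two sequences with entries at the indices below
  \<open>i\<close>. In mode \<open>tg 1\<close> the entries of \<open>s'\<close> are picked below \<open>b\<close>; a move \<open>tg 1\<close>
  continues this mode with an element bounded by an entry of \<open>s'\<close>, while a move \<open>tg 2\<close> picks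
  an arbitrary element and passes to the usual game, mode \<open>tg 0\<close>. In mode \<open>tg 2\<close> the bound has
  to be chosen.
\<close>

abbreviation "st b m i s s' \<equiv> pr b (pr m (pr i (pr s s')))"

definition pA :: "'a \<Rightarrow> bool" where
  "pA z \<longleftrightarrow> (\<forall>b m i s s'. z = st b m i s s' \<longrightarrow> m = tg 2 \<or> agr i s s')"

definition pV :: "'a \<Rightarrow> 'a \<Rightarrow> bool" where
  "pV z u \<longleftrightarrow> (\<exists>b m i s s'. z = st b m i s s' \<and> (m = tg 2 \<or> (\<exists>a. u = pr (tg 0) a) \<or>
     (\<exists>a. u = pr (tg 1) a \<and> (\<exists>j. j \<sqsubset> i \<and> a \<sqsubseteq> av s' j)) \<or> (\<exists>a. u = pr (tg 2) a)))"

definition pR :: "'a \<Rightarrow> 'a \<Rightarrow> 'a \<Rightarrow> bool" where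
  "pR z u w \<longleftrightarrow> (\<exists>b m i s s'. z = st b m i s s' \<and>
     (m = tg 2 \<and> (\<exists>b'. s \<sqsubset> b' \<and> w = st b' (tg 1) (sc \<zero>) (upd \<zero> \<zero> s) (upd \<zero> \<zero> s)) \<or>
      m \<noteq> tg 2 \<and> (\<exists>a a'.
       u = pr (tg 0) a \<and> (m = tg 1 \<longrightarrow> a' \<sqsubset> b) \<and> w = st b m (sc i) (upd s i a) (upd s' i a') \<or>
       u = pr (tg 1) a' \<and> w = st b m (sc i) (upd s i a) (upd s' i a') \<or>
       u = pr (tg 2) a' \<and> w = st b (tg 0) (sc i) (upd s i a) (upd s' i a'))))"

lemma D_game: "D (\<lambda>e. pA (e 0))" "D (\<lambda>e. pV (e 0) (e 1))" "D (\<lambda>e. pR (e 0) (e 1) (e 2))"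
proof -
  show "D (\<lambda>e. pA (e 0))" unfolding pA_def by (intro dfn)
  show "D (\<lambda>e. pV (e 0) (e 1))" unfolding pV_def by (intro dfn)
  show "D (\<lambda>e. pR (e 0) (e 1) (e 2))" unfolding pR_def by (intro dfn)
qed

abbreviation "W k b m i s s' \<equiv> pl pA pV pR k (st b m i s s')"

lemma W_0: "m \<noteq> tg 2 \<Longrightarrow> W 0 b m i s s' \<longleftrightarrow> agr i s s'"
  by (simp add: pA_def)

lemma W_Suc:
  assumes m: "m \<noteq> tg 2"
  shows "W (Suc k) b m i s s' \<longleftrightarrow> agr i s s' \<and>
    (\<forall>a. \<exists>a'. (m = tg 1 \<longrightarrow> a' \<sqsubset> b) \<and> W k b m (sc i) (upd s i a) (upd s' i a')) \<and>
    (\<forall>a'. (\<exists>j. j \<sqsubset> i \<and> a' \<sqsubseteq> av s' j) \<longrightarrow> (\<exists>a. W k b m (sc i) (upd s i a) (upd s' i a'))) \<and>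
    (\<forall>a'. \<exists>a. W k b (tg 0) (sc i) (upd s i a) (upd s' i a'))"
proof -
  have A: "pA (st b m i s s') \<longleftrightarrow> agr i s s'" using m by (simp add: pA_def)
  have V: "pV (st b m i s s') u \<longleftrightarrow> (\<exists>a. u = pr (tg 0) a) \<or>
     (\<exists>a. u = pr (tg 1) a \<and> (\<exists>j. j \<sqsubset> i \<and> a \<sqsubseteq> av s' j)) \<or> (\<exists>a. u = pr (tg 2) a)" for u
    using m by (simp add: pV_def)
  have R: "pR (st b m i s s') (pr (tg 0) a) w \<longleftrightarrow> (\<exists>a'. (m = tg 1 \<longrightarrow> a' \<sqsubset> b) \<and> w = st b m (sc i) (upd s i a) (upd s' i a'))"
    "pR (st b m i s s') (pr (tg 1) a') w \<longleftrightarrow> (\<exists>a. w = st b m (sc i) (upd s i a) (upd s' i a'))"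
    "pR (st b m i s s') (pr (tg 2) a') w \<longleftrightarrow> (\<exists>a. w = st b (tg 0) (sc i) (upd s i a) (upd s' i a'))" for a a' w
    using m by (simp_all add: pR_def)
  have V': "(\<forall>u. pV (st b m i s s') u \<longrightarrow> Q u) \<longleftrightarrow> (\<forall>a. Q (pr (tg 0) a)) \<and>
     (\<forall>a'. (\<exists>j. j \<sqsubset> i \<and> a' \<sqsubseteq> av s' j) \<longrightarrow> Q (pr (tg 1) a')) \<and> (\<forall>a'. Q (pr (tg 2) a'))" for Q
  proof (intro iffI conjI allI impI)
    fix u assume *: "(\<forall>a. Q (pr (tg 0) a)) \<and>
     (\<forall>a'. (\<exists>j. j \<sqsubset> i \<and> a' \<sqsubseteq> av s' j) \<longrightarrow> Q (pr (tg 1) a')) \<and> (\<forall>a'. Q (pr (tg 2) a'))" and u: "pV (st b m i s s') u"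
    from u[unfolded V] show "Q u"
    proof (elim disjE exE conjE)
      fix a j assume "u = pr (tg 1) a" "j \<sqsubset> i" "a \<sqsubseteq> av s' j"
      then show ?thesis using *[THEN conjunct2, THEN conjunct1, rule_format, OF exI, of j a] by simp
    qed (use * in simp_all)
  qed (simp_all add: V)
  have ex: "(\<exists>w. (\<exists>a. w = t a) \<and> Q w) = (\<exists>a. Q (t a))"
    "(\<exists>w. (\<exists>a. C a \<and> w = t a) \<and> Q w) = (\<exists>a. C a \<and> Q (t a))" for t :: "'a \<Rightarrow> 'a" and C Q by blast+
  show ?thesis unfolding pl.simps A V' R ex by (rule refl)
qed

text \<open>The direction of the Ehrenfeucht-Fraisse theorem from types to strategies: each response
  restores equality of the types, of one rank less.\<close>

lemma W_equiv: "tau k i s = tau k i s' \<Longrightarrow> W k b (tg 0) i s s'"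
proof (induction k arbitrary: i s s')
  case 0
  show ?case using tau_agr[OF 0] W_0[of "tg 0"] by simp
next
  case (Suc k)
  have 1: "\<exists>a'. tau k (sc i) (upd s i a) = tau k (sc i) (upd s' i a')" for a
    by (rule tau_ext[OF Suc.prems])
  have 2: "\<exists>a. tau k (sc i) (upd s i a) = tau k (sc i) (upd s' i a')" for a'
    using tau_ext[OF Suc.prems[symmetric], of a'] by metis
  have f: "\<exists>a'. W k b (tg 0) (sc i) (upd s i a) (upd s' i a')" for a using 1 Suc.IH by blast
  have g: "\<exists>a. W k b (tg 0) (sc i) (upd s i a) (upd s' i a')" for a' using 2 Suc.IH by blast
  show ?case using W_Suc[of "tg 0" k b i s s'] tau_agr[OF Suc.prems] f g by simp
qed

text \<open>Witnesses for all types over sequences up to \<open>x\<close> lie below some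
  \<open>u\<close>, the sequences extended by them below some \<open>v\<close>, and the induction
  hypothesis for \<open>v\<close> bounds the remaining rounds. The claim is made for every
  \<open>b\<close> from \<open>b0\<close> on, so that these requirements can be met by one
  bound.\<close>

lemma W_room: "\<exists>b0. \<forall>b s s'. b0 \<sqsubseteq> b \<longrightarrow> s' \<sqsubseteq> x \<longrightarrow> tau k i s = tau k i s' \<longrightarrow> W k b (tg 1) i s s'"
proof (induction k arbitrary: i x)
  case 0
  have "W 0 b (tg 1) i s s'" if "tau 0 i s = tau 0 i s'" for b s s'
    using tau_agr[OF that] W_0[of "tg 1"] by simp
  then show ?case by blast
next
  case (Suc k)
  obtain u where u: "\<And>s y. s \<sqsubseteq> x \<Longrightarrow> \<exists>a. a \<sqsubseteq> u \<and> tau k (sc i) (upd s i y) = tau k (sc i) (upd s i a)"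
    using tau_witness_bound[of x k i] by blast
  obtain v where v: "\<And>s a. s \<sqsubseteq> x \<Longrightarrow> a \<sqsubseteq> u \<oplus> x \<Longrightarrow> upd s i a \<sqsubseteq> v" using upd_bound by blast
  obtain b0 where b0: "\<And>b s s'. b0 \<sqsubseteq> b \<Longrightarrow> s' \<sqsubseteq> v \<Longrightarrow> tau k (sc i) s = tau k (sc i) s' \<Longrightarrow> W k b (tg 1) (sc i) s s'"
    using Suc.IH[of v "sc i"] by blast
  have "W (Suc k) b (tg 1) i s s'" if b: "b0 \<oplus> sc u \<sqsubseteq> b" and s': "s' \<sqsubseteq> x" and t: "tau (Suc k) i s = tau (Suc k) i s'" for b s s'
  proof -
    have bb: "b0 \<sqsubseteq> b" "sc u \<sqsubseteq> b" using A.order_trans[OF le_add(1) b] A.order_trans[OF le_add(2) b] .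
    have 1: "\<exists>a'. a' \<sqsubset> b \<and> W k b (tg 1) (sc i) (upd s i a) (upd s' i a')" for a
    proof -
      obtain y where y: "tau k (sc i) (upd s i a) = tau k (sc i) (upd s' i y)" using tau_ext[OF t] by blast
      obtain a' where a': "a' \<sqsubseteq> u" "tau k (sc i) (upd s' i y) = tau k (sc i) (upd s' i a')" using u[OF s'] by blast
      have "a' \<sqsubset> b" using A.le_less_trans[OF a'(1)] bb(2) by simp
      moreover have "W k b (tg 1) (sc i) (upd s i a) (upd s' i a')"
        by (rule b0[OF bb(1) v[OF s' A.order_trans[OF a'(1) le_add(1)]]]) (simp add: y a'(2))
      ultimately show ?thesis by blast
    qed
    have g: "\<exists>a. tau k (sc i) (upd s i a) = tau k (sc i) (upd s' i a')" for a'
      using tau_ext[OF t[symmetric], of a'] by metis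
    \<comment> \<open>An element below an entry of \<open>s'\<close> is below \<open>x\<close>, so
      the extended sequence is still covered by \<open>v\<close>.\<close>
    have 2: "\<exists>a. W k b (tg 1) (sc i) (upd s i a) (upd s' i a')" if "a' \<sqsubseteq> av s' j" for a' j
    proof -
      have a': "a' \<sqsubseteq> u \<oplus> x" using A.order_trans[OF that A.order_trans[OF av_le A.order_trans[OF s' le_add(2)]]] .
      obtain a where "tau k (sc i) (upd s i a) = tau k (sc i) (upd s' i a')" using g by blast
      from b0[OF bb(1) v[OF s' a'] this] show ?thesis by blast
    qed
    have 3: "\<exists>a. W k b (tg 0) (sc i) (upd s i a) (upd s' i a')" for a'
      using g[of a'] W_equiv by blast
    show ?thesis using W_Suc[of "tg 1" k b i s s'] tau_agr[OF t] 1 2 3 by auto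
  qed
  then show ?case by (intro exI[where x = "b0 \<oplus> sc u"]) blast
qed

text \<open>Mode \<open>tg 0\<close> no longer asks for responses below \<open>b\<close>.\<close>

lemma W_drop: "W k b (tg 1) i s s' \<Longrightarrow> W k b (tg 0) i s s'"
proof (induction k arbitrary: i s s')
  case 0 then show ?case using W_0[of "tg 1"] W_0[of "tg 0"] by simp
next
  case (Suc k)
  have "agr i s s'" "\<exists>a'. W k b (tg 1) (sc i) (upd s i a) (upd s' i a')"
    "\<exists>a. W k b (tg 0) (sc i) (upd s i a) (upd s' i a')" for a a'
    using Suc.prems W_Suc[of "tg 1" k b i s s'] by auto
  then show ?case using W_Suc[of "tg 0" k b i s s'] Suc.IH by (simp; blast)
qed

section \<open>Positions that are won for every standard number of rounds\<close>

definition Win :: "'a \<Rightarrow> 'a \<Rightarrow> 'a \<Rightarrow> 'a \<Rightarrow> 'a \<Rightarrow> bool" where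
  "Win b m i s s' \<longleftrightarrow> (\<forall>k. W k b m i s s')"

lemma Win_drop: "Win b (tg 1) i s s' \<Longrightarrow> Win b (tg 0) i s s'"
  unfolding Win_def using W_drop by blast

lemma Win_agr: "Win b m i s s' \<Longrightarrow> m \<noteq> tg 2 \<Longrightarrow> agr i s s'"
  unfolding Win_def using W_0 by blast

lemma Win_moves:
  assumes M: "recursively_saturated M" and W: "Win b m i s s'" and m: "m \<noteq> tg 2"
  shows "\<exists>a'. (m = tg 1 \<longrightarrow> a' \<sqsubset> b) \<and> Win b m (sc i) (upd s i a) (upd s' i a')"
    "j \<sqsubset> i \<Longrightarrow> a' \<sqsubseteq> av s' j \<Longrightarrow> \<exists>a. Win b m (sc i) (upd s i a) (upd s' i a')"
    "\<exists>a. Win b (tg 0) (sc i) (upd s i a) (upd s' i a')"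
proof -
  have g: "\<exists>w. pR (st b m i s s') u w \<and> (\<forall>k. pl pA pV pR k w)" if "pV (st b m i s s') u" for u
    by (rule saturated_game[OF M D_game]) (use W that in \<open>auto simp: Win_def\<close>)
  show "\<exists>a'. (m = tg 1 \<longrightarrow> a' \<sqsubset> b) \<and> Win b m (sc i) (upd s i a) (upd s' i a')"
  proof -
    have "pV (st b m i s s') (pr (tg 0) a)" by (simp add: pV_def)
    from g[OF this] show ?thesis using m unfolding Win_def by (auto simp: pR_def)
  qed
  show "\<exists>a. Win b m (sc i) (upd s i a) (upd s' i a')" if "j \<sqsubset> i" "a' \<sqsubseteq> av s' j"
  proof -
    have "pV (st b m i s s') (pr (tg 1) a')" using that by (auto simp: pV_def)
    from g[OF this] show ?thesis using m unfolding Win_def by (auto simp: pR_def)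
  qed
  show "\<exists>a. Win b (tg 0) (sc i) (upd s i a) (upd s' i a')"
  proof -
    have "pV (st b m i s s') (pr (tg 2) a')" by (simp add: pV_def)
    from g[OF this] show ?thesis using m unfolding Win_def by (auto simp: pR_def)
  qed
qed

text \<open>The bound from \<open>W_room\<close> depends on the number of rounds. Mode
  \<open>tg 2\<close> makes the choice of the bound a move of the game, so saturation yields one
  bound for all numbers of rounds.\<close>

lemma Win_start:
  assumes M: "recursively_saturated M"
  shows "\<exists>b. c \<sqsubset> b \<and> Win b (tg 1) (sc \<zero>) (upd \<zero> \<zero> c) (upd \<zero> \<zero> c)"
proof -
  let ?z = "st \<zero> (tg 2) \<zero> c c"
  have "pl pA pV pR k ?z" for k
  proof (cases k)
    case (Suc n)
    obtain b0 where b0: "\<And>b s s'. b0 \<sqsubseteq> b \<Longrightarrow> s' \<sqsubseteq> upd \<zero> \<zero> c \<Longrightarrow> tau n (sc \<zero>) s = tau n (sc \<zero>) s' \<Longrightarrow> W n b (tg 1) (sc \<zero>) s s'"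
      using W_room[of "upd \<zero> \<zero> c" n "sc \<zero>"] by blast
    have "W n (b0 \<oplus> sc c) (tg 1) (sc \<zero>) (upd \<zero> \<zero> c) (upd \<zero> \<zero> c)" by (rule b0) (simp_all del: add_S)
    moreover have "c \<sqsubset> b0 \<oplus> sc c" using A.less_le_trans[OF _ le_add(2), of c "sc c" b0] by simp
    ultimately have "\<exists>w'. pR ?z u w' \<and> pl pA pV pR n w'" for u
      by (intro exI[where x = "st (b0 \<oplus> sc c) (tg 1) (sc \<zero>) (upd \<zero> \<zero> c) (upd \<zero> \<zero> c)"]) (simp add: pR_def)
    then show ?thesis unfolding Suc by (simp add: pA_def)
  qed (simp add: pA_def)
  moreover have "pV ?z \<zero>" by (simp add: pV_def)
  ultimately have "\<exists>w. pR ?z \<zero> w \<and> (\<forall>k. pl pA pV pR k w)"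
    by (rule saturated_game[OF M D_game])
  then show ?thesis unfolding Win_def by (auto simp: pR_def)
qed

section \<open>From winning positions to elementary maps\<close>

definition extn :: "'a \<Rightarrow> 'a \<Rightarrow> 'a \<Rightarrow> 'a \<Rightarrow> 'a \<Rightarrow> 'a \<Rightarrow> bool" where
  "extn i s s' l t t' \<longleftrightarrow> (\<forall>j. j \<sqsubset> i \<longrightarrow> j \<sqsubset> l \<and> av t j = av s j \<and> av t' j = av s' j)"

lemma extn_refl: "extn i s s' i s s'" and
  extn_trans: "extn i s s' l t t' \<Longrightarrow> extn l t t' n u u' \<Longrightarrow> extn i s s' n u u'" and
  extn_upd: "extn i s s' (sc i) (upd s i a) (upd s' i a')"
  unfolding extn_def by (auto simp: av_upd A.less_imp_le)

lemma Win_new: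
  assumes w: "Win b (tg 0) (sc i) (upd s i a) (upd s' i a')"
  shows "a = \<zero> \<Longrightarrow> a' = \<zero>" "j \<sqsubset> i \<Longrightarrow> a = sc (av s j) \<Longrightarrow> a' = sc (av s' j)"
    "j \<sqsubset> i \<Longrightarrow> k \<sqsubset> i \<Longrightarrow> a = av s j \<oplus> av s k \<Longrightarrow> a' = av s' j \<oplus> av s' k"
    "j \<sqsubset> i \<Longrightarrow> k \<sqsubset> i \<Longrightarrow> a = av s j \<otimes> av s k \<Longrightarrow> a' = av s' j \<otimes> av s' k"
proof -
  have g: "agr (sc i) (upd s i a) (upd s' i a')" using Win_agr[OF w] by simp
  have n: "j \<sqsubset> i \<Longrightarrow> av (upd t i x) j = av t j" for t x j using A.less_irrefl by (auto simp: av_upd)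
  have i: "av (upd t i x) i = x" for t x by (simp add: av_upd)
  have l: "j \<sqsubset> i \<Longrightarrow> j \<sqsubset> sc i" for j by (simp add: A.less_imp_le)
  have ii: "i \<sqsubset> sc i" by simp
  show "a = \<zero> \<Longrightarrow> a' = \<zero>" using g[unfolded agr_def, rule_format, of i i i] ii unfolding i by blast
  show "j \<sqsubset> i \<Longrightarrow> a = sc (av s j) \<Longrightarrow> a' = sc (av s' j)"
    using g[unfolded agr_def, rule_format, of j i i] ii l[of j] n[of j] unfolding i by simp
  show "j \<sqsubset> i \<Longrightarrow> k \<sqsubset> i \<Longrightarrow> a = av s j \<oplus> av s k \<Longrightarrow> a' = av s' j \<oplus> av s' k"
    "j \<sqsubset> i \<Longrightarrow> k \<sqsubset> i \<Longrightarrow> a = av s j \<otimes> av s k \<Longrightarrow> a' = av s' j \<otimes> av s' k"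
    using g[unfolded agr_def, rule_format, of j k i] ii l[of j] n[of j] l[of k] n[of k] unfolding i by simp_all
qed

lemma Win_upd:
  assumes "Win b (tg 0) (sc n) (upd w n x) (upd w' n x')" "extn i s s' n w w'"
  shows "\<exists>l u u' j. Win b (tg 0) l u u' \<and> extn i s s' l u u' \<and> j \<sqsubset> l \<and> av u j = x \<and> av u' j = x'"
  by (rule exI[of _ "sc n"], rule exI[of _ "upd w n x"], rule exI[of _ "upd w' n x'"], rule exI[of _ n])
    (use assms extn_trans[OF assms(2) extn_upd] in \<open>simp add: av_upd\<close>)

text \<open>\<open>agr\<close> compares entries only, so the value of every subterm is appended to
  both sequences by a move of the game.\<close>

lemma Win_term:
  assumes M: "recursively_saturated M"
  shows "Win b (tg 0) i s s' \<Longrightarrow> (\<And>v. v \<in> tm_vars t \<Longrightarrow> \<exists>j. j \<sqsubset> i \<and> e v = av s j \<and> e' v = av s' j) \<Longrightarrow>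
    \<exists>l u u' j. Win b (tg 0) l u u' \<and> extn i s s' l u u' \<and> j \<sqsubset> l \<and> av u j = tm_val M e t \<and> av u' j = tm_val M e' t"
proof (induction t arbitrary: i s s')
  case (Var k)
  obtain j where "j \<sqsubset> i" "e k = av s j" "e' k = av s' j" using Var(2)[of k] by auto
  then show ?case using Var(1)
    by - (rule exI[of _ i], rule exI[of _ s], rule exI[of _ s'], rule exI[of _ j], simp add: extn_refl)
next
  case Zero
  obtain a' where w: "Win b (tg 0) (sc i) (upd s i \<zero>) (upd s' i a')" using Win_moves(1)[OF M Zero(1)] by auto
  have "a' = \<zero>" using Win_new(1)[OF w] by simp
  then show ?case using Win_upd[OF w extn_refl] by simp
next
  case (Sc t)
  obtain l u u' j where *: "Win b (tg 0) l u u'" "extn i s s' l u u'" "j \<sqsubset> l" "av u j = tm_val M e t" "av u' j = tm_val M e' t"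
    using Sc.IH[OF Sc.prems(1)] Sc.prems(2) by auto
  obtain a' where w: "Win b (tg 0) (sc l) (upd u l (sc (av u j))) (upd u' l a')" using Win_moves(1)[OF M *(1)] by auto
  have "a' = sc (av u' j)" using Win_new(2)[OF w *(3)] by simp
  then show ?case using Win_upd[OF w *(2)] *(4,5) by simp
next
  case (Add t t')
  obtain l u u' j where *: "Win b (tg 0) l u u'" "extn i s s' l u u'" "j \<sqsubset> l" "av u j = tm_val M e t" "av u' j = tm_val M e' t"
    using Add.IH(1)[OF Add.prems(1)] Add.prems(2) by auto
  have "\<exists>j. j \<sqsubset> l \<and> e v = av u j \<and> e' v = av u' j" if "v \<in> tm_vars t'" for v
    using Add.prems(2)[of v] that *(2) unfolding extn_def by auto
  from Add.IH(2)[OF *(1) this] obtain n w w' k where **: "Win b (tg 0) n w w'" "extn l u u' n w w'" "k \<sqsubset> n"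
    "av w k = tm_val M e t'" "av w' k = tm_val M e' t'" by blast
  have j: "j \<sqsubset> n" "av w j = tm_val M e t" "av w' j = tm_val M e' t" using **(2) *(3-) unfolding extn_def by auto
  obtain a' where v: "Win b (tg 0) (sc n) (upd w n (av w j \<oplus> av w k)) (upd w' n a')" using Win_moves(1)[OF M **(1)] by auto
  have "a' = av w' j \<oplus> av w' k" using Win_new(3)[OF v j(1) **(3)] by simp
  then show ?case using Win_upd[OF v extn_trans[OF *(2) **(2)]] j(2,3) **(4,5) by simp
next
  case (Mul t t')
  obtain l u u' j where *: "Win b (tg 0) l u u'" "extn i s s' l u u'" "j \<sqsubset> l" "av u j = tm_val M e t" "av u' j = tm_val M e' t"
    using Mul.IH(1)[OF Mul.prems(1)] Mul.prems(2) by auto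
  have "\<exists>j. j \<sqsubset> l \<and> e v = av u j \<and> e' v = av u' j" if "v \<in> tm_vars t'" for v
    using Mul.prems(2)[of v] that *(2) unfolding extn_def by auto
  from Mul.IH(2)[OF *(1) this] obtain n w w' k where **: "Win b (tg 0) n w w'" "extn l u u' n w w'" "k \<sqsubset> n"
    "av w k = tm_val M e t'" "av w' k = tm_val M e' t'" by blast
  have j: "j \<sqsubset> n" "av w j = tm_val M e t" "av w' j = tm_val M e' t" using **(2) *(3-) unfolding extn_def by auto
  obtain a' where v: "Win b (tg 0) (sc n) (upd w n (av w j \<otimes> av w k)) (upd w' n a')" using Win_moves(1)[OF M **(1)] by auto
  have "a' = av w' j \<otimes> av w' k" using Win_new(4)[OF v j(1) **(3)] by simp
  then show ?case using Win_upd[OF v extn_trans[OF *(2) **(2)]] j(2,3) **(4,5) by simp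
qed

text \<open>A quantifier needs free moves on both sides. Mode \<open>tg 0\<close> allows them to be
  repeated, whereas in mode \<open>tg 1\<close> an arbitrary element on the side of
  \<open>s'\<close> ends the mode.\<close>

lemma Win_sat:
  assumes M: "recursively_saturated M"
  shows "Win b (tg 0) i s s' \<Longrightarrow> (\<And>v. v \<in> fm_vars p \<Longrightarrow> \<exists>j. j \<sqsubset> i \<and> e v = av s j \<and> e' v = av s' j) \<Longrightarrow>
    sat M e p \<longleftrightarrow> sat M e' p"
proof (induction p arbitrary: i s s' e e')
  case (Eq t t')
  obtain l u u' j where *: "Win b (tg 0) l u u'" "extn i s s' l u u'" "j \<sqsubset> l" "av u j = tm_val M e t" "av u' j = tm_val M e' t"
    using Win_term[OF M Eq.prems(1), of t e e'] Eq.prems(2) by auto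
  have "\<exists>j. j \<sqsubset> l \<and> e v = av u j \<and> e' v = av u' j" if "v \<in> tm_vars t'" for v
    using Eq.prems(2)[of v] that *(2) unfolding extn_def by auto
  from Win_term[where e = e and e' = e' and t = t', OF M *(1) this] obtain n w w' k where **: "Win b (tg 0) n w w'" "extn l u u' n w w'" "k \<sqsubset> n"
    "av w k = tm_val M e t'" "av w' k = tm_val M e' t'" by blast
  have j: "j \<sqsubset> n" "av w j = tm_val M e t" "av w' j = tm_val M e' t" using **(2) *(3-) unfolding extn_def by auto
  have "(av w j = av w k) = (av w' j = av w' k)"
    using Win_agr[OF **(1), unfolded agr_def, simplified, rule_format, of j k k] j(1) **(3) by auto
  then show ?case by (simp add: j **)
next
  case (Neg p)
  have "sat M e p = sat M e' p" by (rule Neg.IH[OF Neg.prems(1)]) (use Neg.prems(2) in simp)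
  then show ?case by simp
next
  case (Dsj p q)
  have "sat M e p = sat M e' p" by (rule Dsj.IH(1)[OF Dsj.prems(1)]) (use Dsj.prems(2) in simp)
  moreover have "sat M e q = sat M e' q" by (rule Dsj.IH(2)[OF Dsj.prems(1)]) (use Dsj.prems(2) in simp)
  ultimately show ?case by simp
next
  case (Exi k p)
  have *: "sat M (e(k := a)) p = sat M (e'(k := a')) p" if w: "Win b (tg 0) (sc i) (upd s i a) (upd s' i a')" for a a'
  proof (rule Exi.IH[OF w])
    fix v assume v: "v \<in> fm_vars p"
    show "\<exists>j. j \<sqsubset> sc i \<and> (e(k := a)) v = av (upd s i a) j \<and> (e'(k := a')) v = av (upd s' i a') j"
    proof (cases "v = k")
      case True then show ?thesis by (intro exI[of _ i]) (simp add: av_upd)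
    next
      case False
      then obtain j where "j \<sqsubset> i" "e v = av s j" "e' v = av s' j" using Exi.prems(2)[of v] v by auto
      then show ?thesis using False by (intro exI[of _ j]) (auto simp: av_upd A.less_imp_le)
    qed
  qed
  have "\<exists>a'. Win b (tg 0) (sc i) (upd s i a) (upd s' i a')" for a using Win_moves(1)[OF M Exi.prems(1)] by auto
  moreover have "\<exists>a. Win b (tg 0) (sc i) (upd s i a) (upd s' i a')" for a' using Win_moves(3)[OF M Exi.prems(1)] by auto
  ultimately show ?case using * by (simp add: UN; blast)
qed

end

section \<open>Isomorphisms of structures\<close>

definition isom :: "('a \<Rightarrow> 'b) \<Rightarrow> 'a lpa \<Rightarrow> 'b lpa \<Rightarrow> bool" where
  "isom f M N \<longleftrightarrow> bij_betw f (univ M) (univ N) \<and> f (zer M) = zer N \<and>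
     (\<forall>x\<in>univ M. f (suc M x) = suc N (f x)) \<and>
     (\<forall>x\<in>univ M. \<forall>y\<in>univ M. f (pls M x y) = pls N (f x) (f y)) \<and>
     (\<forall>x\<in>univ M. \<forall>y\<in>univ M. f (tms M x y) = tms N (f x) (f y))"

lemma lpa_iso_isom: "lpa_iso M N \<longleftrightarrow> (\<exists>f. isom f M N)"
  unfolding lpa_iso_def isom_def ..

lemma isom_inv:
  assumes f: "isom f M N" and M: "lpa_structure M"
  shows "isom (inv_into (univ M) f) N M"
proof -
  have b: "bij_betw f (univ M) (univ N)" using f by (simp add: isom_def)
  have i: "inv_into (univ M) f (f x) = x" if "x \<in> univ M" for x
    using bij_betw_inv_into_left[OF b that] .
  have N: "univ N = f ` univ M" using b by (simp add: bij_betw_def)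
  have "zer M \<in> univ M" "\<And>x. x \<in> univ M \<Longrightarrow> suc M x \<in> univ M"
    "\<And>x y. x \<in> univ M \<Longrightarrow> y \<in> univ M \<Longrightarrow> pls M x y \<in> univ M \<and> tms M x y \<in> univ M"
    using M unfolding lpa_structure_def by blast+
  moreover have "zer N = f (zer M)" "\<And>x. x \<in> univ M \<Longrightarrow> suc N (f x) = f (suc M x)"
    "\<And>x y. x \<in> univ M \<Longrightarrow> y \<in> univ M \<Longrightarrow> pls N (f x) (f y) = f (pls M x y) \<and> tms N (f x) (f y) = f (tms M x y)"
    using f unfolding isom_def by simp_all
  ultimately show ?thesis unfolding isom_def using bij_betw_inv_into[OF b] by (simp add: N i)
qed

lemma tm_val_isom:
  assumes f: "isom f M N" and M: "lpa_structure M" and e: "range e \<subseteq> univ M"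
  shows "tm_val M e t \<in> univ M \<and> tm_val N (\<lambda>v. f (e v)) t = f (tm_val M e t)"
  using e M f by (induction t) (auto simp: lpa_structure_def isom_def)

lemma sat_isom:
  assumes f: "isom f M N" and M: "lpa_structure M"
  shows "range e \<subseteq> univ M \<Longrightarrow> sat N (\<lambda>v. f (e v)) p \<longleftrightarrow> sat M e p"
proof (induction p arbitrary: e)
  case (Eq s t)
  have "inj_on f (univ M)" using f by (simp add: isom_def bij_betw_def)
  then show ?case using tm_val_isom[OF f M Eq] by (simp add: inj_on_eq_iff)
next
  case (Exi k p)
  have "univ N = f ` univ M" using f by (simp add: isom_def bij_betw_def)
  moreover have "(\<lambda>v. f (e v))(k := f x) = (\<lambda>v. f ((e(k := x)) v))" for x by auto
  moreover have "sat N (\<lambda>v. f ((e(k := x)) v)) p = sat M (e(k := x)) p" if "x \<in> univ M" for x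
    using Exi.prems that by (intro Exi.IH) auto
  ultimately show ?case by (simp del: fun_upd_apply)
qed simp_all

section \<open>Construction of the cut\<close>

context pa
begin

text \<open>The limit of the positions is a map \<open>h\<close> defined on all of M. Its values
  stay below \<open>b\<close>, and the downward moves make its range an initial segment. Passing to
  mode \<open>tg 0\<close> at each stage shows that \<open>h\<close> is an elementary embedding, so
  its range is elementary and isomorphic to M; the first entry puts \<open>c\<close> into
  it.\<close>

theorem cut_ex:
  assumes M: "recursively_saturated M" and count: "countable (UNIV :: 'a set)"
  shows "\<exists>I. c \<in> I \<and> proper_cut M I \<and> elementary I M \<and> lpa_iso (restr M I) M"
proof -
  obtain b where b: "c \<sqsubset> b" "Win b (tg 1) (sc \<zero>) (upd \<zero> \<zero> c) (upd \<zero> \<zero> c)" using Win_start[OF M] by blast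
  obtain f :: "nat \<Rightarrow> 'a" where f: "range f = UNIV"
    using range_from_nat_into[OF UNIV_not_empty count] by blast
  \<comment> \<open>Each element is listed infinitely often, since it may come to lie below an entry
    of the second sequence only late in the construction.\<close>
  define g where "g n = f (fst (prod_decode n))" for n
  have g: "\<exists>n\<ge>N. g n = x" for N x
  proof -
    obtain m where "f m = x" using f by (metis UNIV_I rangeE)
    then show ?thesis using le_prod_encode_2[of N m] by (intro exI[of _ "prod_encode (m, N)"]) (simp add: g_def)
  qed
  define P where "P x \<longleftrightarrow> Win b (tg 1) (fst x) (fst (snd x)) (snd (snd x)) \<and>
    (\<forall>j. j \<sqsubset> fst x \<longrightarrow> av (snd (snd x)) j \<sqsubset> b)" for x
  define R where "R n x y \<longleftrightarrow> extn (fst x) (fst (snd x)) (snd (snd x)) (fst y) (fst (snd y)) (snd (snd y)) \<and>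
    (\<exists>j. j \<sqsubset> fst y \<and> av (fst (snd y)) j = g n) \<and>
    ((\<exists>j. j \<sqsubset> fst x \<and> g n \<sqsubseteq> av (snd (snd x)) j) \<longrightarrow> (\<exists>j. j \<sqsubset> fst y \<and> av (snd (snd y)) j = g n))" for n x y
  have step: "\<exists>y. P y \<and> R n x y" if "P x" for n x
  proof -
    obtain i s s' where x: "x = (i, s, s')" by (cases x) auto
    have W: "Win b (tg 1) i s s'" and s': "\<And>j. j \<sqsubset> i \<Longrightarrow> av s' j \<sqsubset> b" using that by (auto simp: P_def x)
    obtain a' where a': "a' \<sqsubset> b" "Win b (tg 1) (sc i) (upd s i (g n)) (upd s' i a')" using Win_moves(1)[OF M W] by auto
    have b1: "av (upd s' i a') j \<sqsubset> b" if "j \<sqsubset> sc i" for j using that s'[of j] a'(1) by (auto simp: av_upd A.le_less)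
    show ?thesis
    proof (cases "\<exists>j. j \<sqsubset> i \<and> g n \<sqsubseteq> av s' j")
      case False
      have "P (sc i, upd s i (g n), upd s' i a')" using a' b1 by (simp add: P_def)
      moreover have "R n x (sc i, upd s i (g n), upd s' i a')"
        unfolding R_def x using False extn_upd by (auto simp: av_upd intro!: exI[of _ i])
      ultimately show ?thesis by blast
    next
      case True
      then obtain j where j: "j \<sqsubset> i" "g n \<sqsubseteq> av s' j" by blast
      then have "j \<sqsubset> sc i" "g n \<sqsubseteq> av (upd s' i a') j" by (auto simp: av_upd A.less_imp_le)
      from Win_moves(2)[OF M a'(2) _ this] obtain a where
        a: "Win b (tg 1) (sc (sc i)) (upd (upd s i (g n)) (sc i) a) (upd (upd s' i a') (sc i) (g n))" by auto
      have "g n \<sqsubset> b" using A.le_less_trans[OF j(2) s'[OF j(1)]] .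
      then have "av (upd (upd s' i a') (sc i) (g n)) j \<sqsubset> b" if "j \<sqsubset> sc (sc i)" for j
        using that b1[of j] by (auto simp: av_upd[of _ "sc i"] A.le_less[of j "sc i"])
      then have "P (sc (sc i), upd (upd s i (g n)) (sc i) a, upd (upd s' i a') (sc i) (g n))" using a by (simp add: P_def)
      moreover have "R n x (sc (sc i), upd (upd s i (g n)) (sc i) a, upd (upd s' i a') (sc i) (g n))"
      proof -
        have "i \<noteq> sc i" using less_add_S[of i \<zero>] by (metis A.less_irrefl add_0 add_S)
        moreover have "extn i s s' (sc (sc i)) (upd (upd s i (g n)) (sc i) a) (upd (upd s' i a') (sc i) (g n))"
          by (rule extn_trans[OF extn_upd extn_upd])
        moreover have "i \<sqsubset> sc (sc i)" using A.less_imp_le[of i "sc i"] by simp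
        ultimately show ?thesis unfolding R_def x fst_conv snd_conv
          by (intro conjI impI) (simp, rule exI[of _ i], simp add: av_upd, rule exI[of _ "sc i"], simp add: av_upd)
      qed
      ultimately show ?thesis by blast
    qed
  qed
  have "P (sc \<zero>, upd \<zero> \<zero> c, upd \<zero> \<zero> c)" using b by (simp add: P_def av_upd)
  then obtain F where F0: "F 0 = (sc \<zero>, upd \<zero> \<zero> c, upd \<zero> \<zero> c)" and FP: "\<And>n. P (F n)" and FR: "\<And>n. R n (F n) (F (Suc n))"
    using dependent_nat_choice[of "\<lambda>n x. P x \<and> (n = 0 \<longrightarrow> x = (sc \<zero>, upd \<zero> \<zero> c, upd \<zero> \<zero> c))" R] step
    by (metis nat.distinct(1))
  define i where "i n = fst (F n)" for n
  define s where "s n = fst (snd (F n))" for n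
  define s' where "s' n = snd (snd (F n))" for n
  have W: "Win b (tg 1) (i n) (s n) (s' n)" and bd: "\<And>j. j \<sqsubset> i n \<Longrightarrow> av (s' n) j \<sqsubset> b" for n
    using FP[of n] unfolding P_def i_def s_def s'_def by blast+
  have ext: "extn (i n) (s n) (s' n) (i m) (s m) (s' m)" if "n \<le> m" for n m
    using that
  proof (induction rule: dec_induct)
    case base show ?case by (rule extn_refl)
  next
    case (step m)
    have "extn (i m) (s m) (s' m) (i (Suc m)) (s (Suc m)) (s' (Suc m))"
      using FR[of m] unfolding R_def i_def s_def s'_def by blast
    then show ?case by (rule extn_trans[OF step.IH])
  qed
  define r where "r n x y \<longleftrightarrow> (\<exists>j. j \<sqsubset> i n \<and> av (s n) j = x \<and> av (s' n) j = y)" for n x y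
  have r_mono: "r m x y" if "r n x y" "n \<le> m" for n m x y
    using that(1) ext[OF that(2)] unfolding r_def extn_def by blast
  have "\<exists>y n. r n x y" for x
  proof -
    obtain n where "g n = x" using g by blast
    then have "\<exists>j. j \<sqsubset> i (Suc n) \<and> av (s (Suc n)) j = x" using FR[of n] unfolding R_def i_def s_def by blast
    then show ?thesis unfolding r_def by blast
  qed
  then obtain h N where h: "\<And>x. r (N x) x (h x)" by metis
  have agree: "(x = y \<longleftrightarrow> x' = y') \<and> (x = \<zero> \<longleftrightarrow> x' = \<zero>) \<and> (y = sc x \<longleftrightarrow> y' = sc x') \<and>
     (z = x \<oplus> y \<longleftrightarrow> z' = x' \<oplus> y') \<and> (z = x \<otimes> y \<longleftrightarrow> z' = x' \<otimes> y')"
    if "r m x x'" "r n y y'" "r l z z'" for l m n x y z x' y' z'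
  proof -
    let ?n = "max l (max m n)"
    have "r ?n x x'" "r ?n y y'" "r ?n z z'" using that by (auto elim!: r_mono)
    then obtain j k q where j: "j \<sqsubset> i ?n" "k \<sqsubset> i ?n" "q \<sqsubset> i ?n" and
      av: "av (s ?n) j = x" "av (s' ?n) j = x'" "av (s ?n) k = y" "av (s' ?n) k = y'" "av (s ?n) q = z" "av (s' ?n) q = z'"
      unfolding r_def by blast
    have "agr (i ?n) (s ?n) (s' ?n)" using Win_agr[OF W] by simp
    from this[unfolded agr_def, rule_format, OF conjI[OF j(1) conjI[OF j(2,3)]]] show ?thesis unfolding av .
  qed
  have hom: "h x = h y \<longleftrightarrow> x = y" "h \<zero> = \<zero>" "h (sc x) = sc (h x)" "h (x \<oplus> y) = h x \<oplus> h y" "h (x \<otimes> y) = h x \<otimes> h y" for x y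
  proof -
    show "h x = h y \<longleftrightarrow> x = y" using agree[OF h h h, of x y x, THEN conjunct1] by blast
    show "h \<zero> = \<zero>" using agree[OF h h h, of \<zero> \<zero> \<zero>, THEN conjunct2, THEN conjunct1] by blast
    show "h (sc x) = sc (h x)"
      using agree[OF h h h, of x "sc x" x, THEN conjunct2, THEN conjunct2, THEN conjunct1] by blast
    show "h (x \<oplus> y) = h x \<oplus> h y"
      using agree[OF h h h, of x y "x \<oplus> y", THEN conjunct2, THEN conjunct2, THEN conjunct2, THEN conjunct1] by blast
    show "h (x \<otimes> y) = h x \<otimes> h y"
      using agree[OF h h h, of x y "x \<otimes> y", THEN conjunct2, THEN conjunct2, THEN conjunct2, THEN conjunct2] by blast
  qed
  have r_h: "r n x y \<Longrightarrow> y = h x" for n x y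
    using agree[OF _ h h, of n x y x x, THEN conjunct1] by blast
  let ?I = "range h"
  have "r 0 c c" unfolding r_def i_def s_def s'_def F0 by (intro exI[of _ \<zero>]) (simp add: av_upd)
  then have c: "c \<in> ?I" using r_h by blast
  have hb: "h x \<sqsubset> b" for x
    using h[of x, unfolded r_def] by (elim exE conjE) (drule bd, simp)
  have down: "z \<in> ?I" if "z \<sqsubseteq> h x" for x z
  proof -
    \<comment> \<open>\<open>z\<close> is listed again when the entry \<open>h x\<close> above it is
      already present, so it is added to the second sequence.\<close>
    obtain n where n: "n \<ge> N x" "g n = z" using g by blast
    have "r n x (h x)" by (rule r_mono[OF h n(1)])
    then obtain j0 where "j0 \<sqsubset> i n" "av (s' n) j0 = h x" unfolding r_def by (elim exE conjE)
    then have "\<exists>j. j \<sqsubset> fst (F n) \<and> g n \<sqsubseteq> av (snd (snd (F n))) j"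
      using that n(2) unfolding i_def s'_def by (intro exI[of _ j0]) simp
    then have "\<exists>j. j \<sqsubset> fst (F (Suc n)) \<and> av (snd (snd (F (Suc n)))) j = g n"
      using FR[of n] unfolding R_def by (elim conjE) (erule mp)
    then obtain j where "j \<sqsubset> i (Suc n)" "av (s' (Suc n)) j = z"
      unfolding n(2) i_def s'_def by (elim exE conjE)
    then have "r (Suc n) (av (s (Suc n)) j) z" unfolding r_def by blast
    then show ?thesis using r_h by blast
  qed
  have pc: "proper_cut M ?I"
    unfolding proper_cut_def cut_def UN
  proof (intro conjI ballI impI)
    fix x y assume "x \<in> ?I" "y \<sqsubset> x"
    then show "y \<in> ?I" using down A.less_imp_le by blast
  next
    fix x assume "x \<in> ?I"
    then have "sc x \<in> ?I" "x \<sqsubset> sc x" using hom(3) by (auto simp: image_iff) metis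
    then show "\<exists>y\<in>?I. x \<sqsubset> y" by blast
  next
    show "?I \<noteq> UNIV" using hb A.less_irrefl by (metis rangeE UNIV_I)
  qed auto
  have str: "lpa_structure M" using PA unfolding PA_model_def by blast
  have iso: "isom h M (restr M ?I)"
    unfolding isom_def restr_def using hom by (simp add: UN bij_betw_def inj_def)
  have sat_h: "sat M (\<lambda>v. h (e v)) p \<longleftrightarrow> sat M e p" for e p
  proof -
    \<comment> \<open>The finitely many values relevant to \<open>p\<close> have all been entered by
      this stage.\<close>
    define n where "n = Max (insert 0 (N ` e ` fm_vars p))"
    have "N (e v) \<le> n" if "v \<in> fm_vars p" for v
      unfolding n_def using that finite_fm_vars[of p] by (intro Max_ge) auto
    then have "r n (e v) (h (e v))" if "v \<in> fm_vars p" for v using r_mono[OF h] that by blast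
    then have v: "\<exists>j. j \<sqsubset> i n \<and> e v = av (s n) j \<and> h (e v) = av (s' n) j" if "v \<in> fm_vars p" for v
      using that unfolding r_def by metis
    show ?thesis by (rule Win_sat[OF M Win_drop[OF W[of n]] v, symmetric])
  qed
  have "elementary ?I M"
    unfolding elementary_def
  proof (intro conjI allI impI)
    have m: "\<zero> \<in> ?I" "x \<in> ?I \<Longrightarrow> sc x \<in> ?I" "x \<in> ?I \<Longrightarrow> y \<in> ?I \<Longrightarrow> x \<oplus> y \<in> ?I \<and> x \<otimes> y \<in> ?I" for x y
      using hom by (auto simp: image_iff) metis+
    then show "lpa_structure (restr M ?I)" unfolding lpa_structure_def restr_def by simp
    fix p and e :: "nat \<Rightarrow> 'a" assume "range e \<subseteq> ?I"
    then have "\<forall>v. \<exists>x. e v = h x" by blast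
    then obtain e0 where "\<forall>v. e v = h (e0 v)" by metis
    then have e0: "e = (\<lambda>v. h (e0 v))" by (simp add: fun_eq_iff)
    show "sat (restr M ?I) e p = sat M e p" unfolding e0 sat_h by (rule sat_isom[OF iso str]) (simp add: UN)
  qed (simp add: UN)
  moreover have "lpa_iso (restr M ?I) M" unfolding lpa_iso_isom using isom_inv[OF iso str] by blast
  ultimately show ?thesis using c pc by blast
qed

end

section \<open>Transport along an isomorphism\<close>

lemma isom_trans: "isom f L M \<Longrightarrow> isom g M N \<Longrightarrow> isom (g \<circ> f) L N"
  unfolding isom_def by (auto intro: bij_betw_trans dest: bij_betwE)

text \<open>Each arithmetized notion is a formula interpreted in the structure, so it is preserved
  by isomorphisms; the lemmas follow the order of the definitions and unfold one notion at a
  time.\<close>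

locale transport =
  fixes f :: "'a \<Rightarrow> 'b" and M :: "'a lpa" and N :: "'b lpa"
  assumes f: "isom f M N" and M: "lpa_structure M"
begin

lemma U [simp]: "univ N = f ` univ M"
  using f by (simp add: isom_def bij_betw_def)

lemma inj [simp]: "x \<in> univ M \<Longrightarrow> y \<in> univ M \<Longrightarrow> f x = f y \<longleftrightarrow> x = y"
  using f inj_on_eq_iff[of f "univ M" x y] by (simp add: isom_def bij_betw_def)

lemma hom [simp]: "zer N = f (zer M)" "x \<in> univ M \<Longrightarrow> suc N (f x) = f (suc M x)"
  "x \<in> univ M \<Longrightarrow> y \<in> univ M \<Longrightarrow> pls N (f x) (f y) = f (pls M x y)"
  "x \<in> univ M \<Longrightarrow> y \<in> univ M \<Longrightarrow> tms N (f x) (f y) = f (tms M x y)"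
  using f by (simp_all add: isom_def)

lemma clo [simp]: "zer M \<in> univ M" "x \<in> univ M \<Longrightarrow> suc M x \<in> univ M"
  "x \<in> univ M \<Longrightarrow> y \<in> univ M \<Longrightarrow> pls M x y \<in> univ M"
  "x \<in> univ M \<Longrightarrow> y \<in> univ M \<Longrightarrow> tms M x y \<in> univ M"
  using M by (simp_all add: lpa_structure_def)

lemma num [simp]: "(suc M ^^ n) (zer M) \<in> univ M" "(suc N ^^ n) (f (zer M)) = f ((suc M ^^ n) (zer M))"
proof -
  show *: "(suc M ^^ n) (zer M) \<in> univ M" for n by (induction n) simp_all
  show "(suc N ^^ n) (f (zer M)) = f ((suc M ^^ n) (zer M))" by (induction n) (simp_all add: *)
qed

lemma pair_clo [simp]: "x \<in> univ M \<Longrightarrow> y \<in> univ M \<Longrightarrow> pair M x y \<in> univ M"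
  "x \<in> univ M \<Longrightarrow> y \<in> univ M \<Longrightarrow> pair N (f x) (f y) = f (pair M x y)"
  by (simp_all add: pair_def)

lemma tagged_clo [simp]: "x \<in> univ M \<Longrightarrow> tagged M n x \<in> univ M"
  "x \<in> univ M \<Longrightarrow> tagged N n (f x) = f (tagged M n x)"
  by (simp_all add: tagged_def)

lemmas codes = c_var_def c_zero_def c_suc_def c_add_def c_mul_def c_eq_def c_neg_def c_dsj_def c_exi_def

lemma code_clo [simp]: "x \<in> univ M \<Longrightarrow> c_var M x \<in> univ M" "c_zero M \<in> univ M" "x \<in> univ M \<Longrightarrow> c_suc M x \<in> univ M"
  "x \<in> univ M \<Longrightarrow> y \<in> univ M \<Longrightarrow> c_add M x y \<in> univ M" "x \<in> univ M \<Longrightarrow> y \<in> univ M \<Longrightarrow> c_mul M x y \<in> univ M"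
  "x \<in> univ M \<Longrightarrow> y \<in> univ M \<Longrightarrow> c_eq M x y \<in> univ M" "x \<in> univ M \<Longrightarrow> c_neg M x \<in> univ M"
  "x \<in> univ M \<Longrightarrow> y \<in> univ M \<Longrightarrow> c_dsj M x y \<in> univ M" "x \<in> univ M \<Longrightarrow> y \<in> univ M \<Longrightarrow> c_exi M x y \<in> univ M"
  by (simp_all add: codes)

lemma code_hom [simp]: "x \<in> univ M \<Longrightarrow> c_var N (f x) = f (c_var M x)" "c_zero N = f (c_zero M)"
  "x \<in> univ M \<Longrightarrow> c_suc N (f x) = f (c_suc M x)"
  "x \<in> univ M \<Longrightarrow> y \<in> univ M \<Longrightarrow> c_add N (f x) (f y) = f (c_add M x y)"
  "x \<in> univ M \<Longrightarrow> y \<in> univ M \<Longrightarrow> c_mul N (f x) (f y) = f (c_mul M x y)"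
  "x \<in> univ M \<Longrightarrow> y \<in> univ M \<Longrightarrow> c_eq N (f x) (f y) = f (c_eq M x y)" "x \<in> univ M \<Longrightarrow> c_neg N (f x) = f (c_neg M x)"
  "x \<in> univ M \<Longrightarrow> y \<in> univ M \<Longrightarrow> c_dsj N (f x) (f y) = f (c_dsj M x y)"
  "x \<in> univ M \<Longrightarrow> y \<in> univ M \<Longrightarrow> c_exi N (f x) (f y) = f (c_exi M x y)"
  by (simp_all add: codes)

lemma lt [simp]: "x \<in> univ M \<Longrightarrow> y \<in> univ M \<Longrightarrow> lt N (f x) (f y) = lt M x y"
  by (simp add: lt_def cong: bex_cong)

lemma beta [simp]: "x \<in> univ M \<Longrightarrow> y \<in> univ M \<Longrightarrow> z \<in> univ M \<Longrightarrow> w \<in> univ M \<Longrightarrow>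
    beta N (f x) (f y) (f z) (f w) = beta M x y z w"
  by (simp add: beta_def cong: bex_cong)

lemma pow2 [simp]: "x \<in> univ M \<Longrightarrow> y \<in> univ M \<Longrightarrow> pow2 N (f x) (f y) = pow2 M x y"
  by (simp add: pow2_def cong: bex_cong ball_cong)

lemma bit [simp]: "x \<in> univ M \<Longrightarrow> y \<in> univ M \<Longrightarrow> bit N (f x) (f y) = bit M x y"
  by (simp add: bit_def cong: bex_cong)

lemma is_term [simp]: "x \<in> univ M \<Longrightarrow> is_term N (f x) = is_term M x"
  by (simp add: is_term_def cong: bex_cong ball_cong)

lemma occurs [simp]: "x \<in> univ M \<Longrightarrow> y \<in> univ M \<Longrightarrow> occurs N (f x) (f y) = occurs M x y"
  by (simp add: occurs_def cong: bex_cong ball_cong)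

lemma is_closed_term [simp]: "x \<in> univ M \<Longrightarrow> is_closed_term N (f x) = is_closed_term M x"
  by (simp add: is_closed_term_def cong: ball_cong)

lemma is_form [simp]: "x \<in> univ M \<Longrightarrow> is_form N (f x) = is_form M x"
  by (simp add: is_form_def cong: bex_cong ball_cong)

lemma free_in [simp]: "x \<in> univ M \<Longrightarrow> y \<in> univ M \<Longrightarrow> free_in N (f x) (f y) = free_in M x y"
  by (simp add: free_in_def cong: bex_cong ball_cong)

lemma Form: "Form N = f ` Form M" and Sent: "Sent N = f ` Sent M" and ClTerm: "ClTerm N = f ` ClTerm M"
  unfolding Sent_def Form_def ClTerm_def by (auto simp: image_iff)

lemma in_univ: "x \<in> Form M \<Longrightarrow> x \<in> univ M" "x \<in> Sent M \<Longrightarrow> x \<in> univ M" "x \<in> ClTerm M \<Longrightarrow> x \<in> univ M"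
  by (simp_all add: Form_def Sent_def ClTerm_def)

lemma value_of [simp]: "x \<in> univ M \<Longrightarrow> y \<in> univ M \<Longrightarrow> value_of N (f x) (f y) = value_of M x y"
  by (simp add: value_of_def cong: bex_cong ball_cong)

lemma numeral_of [simp]: "x \<in> univ M \<Longrightarrow> y \<in> univ M \<Longrightarrow> numeral_of N (f x) (f y) = numeral_of M x y"
  by (simp add: numeral_of_def cong: bex_cong ball_cong)

lemma tm_subst [simp]: "x \<in> univ M \<Longrightarrow> y \<in> univ M \<Longrightarrow> z \<in> univ M \<Longrightarrow> tm_subst N (f x) (f y) (f z) = tm_subst M x y z"
  by (simp add: tm_subst_def cong: bex_cong ball_cong)

lemma drop_var [simp]: "x \<in> univ M \<Longrightarrow> y \<in> univ M \<Longrightarrow> z \<in> univ M \<Longrightarrow> drop_var N (f x) (f y) (f z) = drop_var M x y z"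
  by (simp add: drop_var_def cong: bex_cong ball_cong)

lemma fm_subst [simp]: "x \<in> univ M \<Longrightarrow> y \<in> univ M \<Longrightarrow> z \<in> univ M \<Longrightarrow> fm_subst N (f x) (f y) (f z) = fm_subst M x y z"
  by (simp add: fm_subst_def cong: bex_cong ball_cong)

lemma subst1 [simp]: "w \<in> univ M \<Longrightarrow> x \<in> univ M \<Longrightarrow> y \<in> univ M \<Longrightarrow> z \<in> univ M \<Longrightarrow>
    subst1 N (f w) (f x) (f y) (f z) = subst1 M w x y z"
  by (simp add: subst1_def cong: bex_cong ball_cong)

lemma free_for [simp]: "x \<in> univ M \<Longrightarrow> y \<in> univ M \<Longrightarrow> z \<in> univ M \<Longrightarrow> free_for N (f x) (f y) (f z) = free_for M x y z"
  by (simp add: free_for_def cong: bex_cong ball_cong)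

lemma imp_clo [simp]: "x \<in> univ M \<Longrightarrow> y \<in> univ M \<Longrightarrow> c_imp M x y \<in> univ M"
  "x \<in> univ M \<Longrightarrow> y \<in> univ M \<Longrightarrow> c_eqv M x y \<in> univ M"
  "x \<in> univ M \<Longrightarrow> y \<in> univ M \<Longrightarrow> c_imp N (f x) (f y) = f (c_imp M x y)"
  "x \<in> univ M \<Longrightarrow> y \<in> univ M \<Longrightarrow> c_eqv N (f x) (f y) = f (c_eqv M x y)"
  by (simp_all add: c_imp_def c_eqv_def)

lemma logical_axiom [simp]: "x \<in> univ M \<Longrightarrow> logical_axiom N (f x) = logical_axiom M x"
  by (simp add: logical_axiom_def Form in_univ cong: bex_cong)

lemma rule1 [simp]: "x \<in> univ M \<Longrightarrow> y \<in> univ M \<Longrightarrow> rule1 N (f x) (f y) = rule1 M x y"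
  by (simp add: rule1_def Form in_univ cong: bex_cong)

lemma rule2 [simp]: "x \<in> univ M \<Longrightarrow> y \<in> univ M \<Longrightarrow> z \<in> univ M \<Longrightarrow> rule2 N (f x) (f y) (f z) = rule2 M x y z"
  by (simp add: rule2_def Form in_univ cong: bex_cong)

lemma Ex1_in: "(\<exists>!x. x \<in> A \<and> P x) \<longleftrightarrow> (\<exists>x\<in>A. P x \<and> (\<forall>y\<in>A. P y \<longrightarrow> y = x))"
  by blast

lemma is_seq [simp]: "x \<in> univ M \<Longrightarrow> y \<in> univ M \<Longrightarrow> is_seq N (f x) (f y) = is_seq M x y"
  unfolding is_seq_def Ex1_in by (simp cong: bex_cong ball_cong)

lemma is_disjunction [simp]: "x \<in> univ M \<Longrightarrow> y \<in> univ M \<Longrightarrow> z \<in> univ M \<Longrightarrow>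
    is_disjunction N (f x) (f y) (f z) = is_disjunction M x y z"
  by (simp add: is_disjunction_def cong: bex_cong ball_cong)

lemma mem_Form [simp]: "x \<in> univ M \<Longrightarrow> f x \<in> Form N \<longleftrightarrow> x \<in> Form M" "x \<in> univ M \<Longrightarrow> f x \<in> Sent N \<longleftrightarrow> x \<in> Sent M"
  unfolding Sent_def Form_def by simp_all

lemma is_proof [simp]: "w \<in> univ M \<Longrightarrow> x \<in> univ M \<Longrightarrow> y \<in> univ M \<Longrightarrow> z \<in> univ M \<Longrightarrow>
    is_proof N (f w) (f x) (f y) (f z) = is_proof M w x y z"
  by (simp add: is_proof_def cong: bex_cong ball_cong)

lemma closed_assignment [simp]: "x \<in> univ M \<Longrightarrow> closed_assignment N (f x) = closed_assignment M x"
  by (simp add: closed_assignment_def ClTerm in_univ cong: bex_cong ball_cong)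

context
  fixes T' :: "'b set" and T :: "'a set"
  assumes T: "T = {x \<in> univ M. f x \<in> T'}"
begin

lemma mem_T [simp]: "x \<in> univ M \<Longrightarrow> f x \<in> T' \<longleftrightarrow> x \<in> T"
  by (simp add: T)

lemma full_truth: assumes tc: "full_truth_class N T'" shows "full_truth_class M T"
proof -
  have A: "T' \<subseteq> Sent N"
     "\<And>s t. s \<in> ClTerm N \<Longrightarrow> t \<in> ClTerm N \<Longrightarrow> c_eq N s t \<in> T' \<longleftrightarrow> (\<exists>a\<in>univ N. value_of N s a \<and> value_of N t a)"
     "\<And>x. x \<in> Sent N \<Longrightarrow> c_neg N x \<in> T' \<longleftrightarrow> x \<notin> T'"
     "\<And>x y. x \<in> Sent N \<Longrightarrow> y \<in> Sent N \<Longrightarrow> c_dsj N x y \<in> T' \<longleftrightarrow> x \<in> T' \<or> y \<in> T'"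
     "\<And>v x. v \<in> univ N \<Longrightarrow> x \<in> Form N \<Longrightarrow> \<forall>u\<in>univ N. free_in N u x \<longrightarrow> u = v \<Longrightarrow>
        c_exi N v x \<in> T' \<longleftrightarrow>
         (\<exists>a\<in>univ N. \<exists>n\<in>univ N. \<exists>x'\<in>univ N. numeral_of N a n \<and> subst1 N v n x x' \<and> x' \<in> T')"
  proof -
    note c = tc[unfolded full_truth_class_def]
    show "T' \<subseteq> Sent N" using c by (elim conjE)
    show "s \<in> ClTerm N \<Longrightarrow> t \<in> ClTerm N \<Longrightarrow> c_eq N s t \<in> T' \<longleftrightarrow> (\<exists>a\<in>univ N. value_of N s a \<and> value_of N t a)" for s t
      by (rule c[THEN conjunct2, THEN conjunct1, THEN bspec, THEN bspec])
    show "x \<in> Sent N \<Longrightarrow> c_neg N x \<in> T' \<longleftrightarrow> x \<notin> T'" for x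
      by (rule c[THEN conjunct2, THEN conjunct2, THEN conjunct1, THEN bspec])
    show "x \<in> Sent N \<Longrightarrow> y \<in> Sent N \<Longrightarrow> c_dsj N x y \<in> T' \<longleftrightarrow> x \<in> T' \<or> y \<in> T'" for x y
      by (rule c[THEN conjunct2, THEN conjunct2, THEN conjunct2, THEN conjunct1, THEN bspec, THEN bspec])
    show "v \<in> univ N \<Longrightarrow> x \<in> Form N \<Longrightarrow> \<forall>u\<in>univ N. free_in N u x \<longrightarrow> u = v \<Longrightarrow>
        c_exi N v x \<in> T' \<longleftrightarrow>
         (\<exists>a\<in>univ N. \<exists>n\<in>univ N. \<exists>x'\<in>univ N. numeral_of N a n \<and> subst1 N v n x x' \<and> x' \<in> T')" for v x
      by (rule c[THEN conjunct2, THEN conjunct2, THEN conjunct2, THEN conjunct2, THEN bspec, THEN bspec, THEN mp])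
  qed
  show ?thesis unfolding full_truth_class_def
  proof (intro conjI ballI impI)
    show "T \<subseteq> Sent M"
    proof
      fix x assume "x \<in> T"
      then have "x \<in> univ M" "f x \<in> T'" unfolding T by blast+
      then show "x \<in> Sent M" using A(1) mem_Form(2) by blast
    qed
  next
    fix s t assume "s \<in> ClTerm M" "t \<in> ClTerm M"
    then show "c_eq M s t \<in> T \<longleftrightarrow> (\<exists>a\<in>univ M. value_of M s a \<and> value_of M t a)"
      using A(2)[of "f s" "f t"] in_univ(3) by (simp add: ClTerm cong: bex_cong)
  next
    fix x assume "x \<in> Sent M"
    then show "c_neg M x \<in> T \<longleftrightarrow> x \<notin> T" using A(3)[of "f x"] in_univ(2) by simp
  next
    fix x y assume "x \<in> Sent M" "y \<in> Sent M"
    then show "c_dsj M x y \<in> T \<longleftrightarrow> x \<in> T \<or> y \<in> T" using A(4)[of "f x" "f y"] in_univ(2) by simp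
  next
    fix v x assume "v \<in> univ M" "x \<in> Form M" "\<forall>u\<in>univ M. free_in M u x \<longrightarrow> u = v"
    then show "c_exi M v x \<in> T \<longleftrightarrow>
         (\<exists>a\<in>univ M. \<exists>n\<in>univ M. \<exists>x'\<in>univ M. numeral_of M a n \<and> subst1 M v n x x' \<and> x' \<in> T)"
      using A(5)[of "f v" "f x"] in_univ(1) by (simp cong: bex_cong ball_cong)
  qed
qed

lemma disj:
  assumes I: "I \<subseteq> univ M" and d: "disj_correct N (f ` I) T'"
  shows "disj_correct M I T"
  unfolding disj_correct_def
proof (intro ballI impI)
  fix m s x
  assume *: "m \<in> I" "s \<in> univ M" "x \<in> Sent M"
    and s: "is_seq M m s \<and> (\<forall>i\<in>univ M. lt M i m \<longrightarrow> (\<forall>x\<in>univ M. bit M (pair M i x) s \<longrightarrow> x \<in> Sent M)) \<and>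
      is_disjunction M m s x"
  have u: "m \<in> univ M" "x \<in> univ M" using * I in_univ by blast+
  have "f x \<in> T' \<longleftrightarrow> (\<exists>i\<in>univ N. lt N i (f m) \<and> (\<exists>y\<in>univ N. bit N (pair N i y) (f s) \<and> y \<in> T'))"
  proof (rule d[unfolded disj_correct_def, rule_format])
    show "f m \<in> f ` I" "f s \<in> univ N" "f x \<in> Sent N" using * u by auto
    show "is_seq N (f m) (f s) \<and> (\<forall>i\<in>univ N. lt N i (f m) \<longrightarrow> (\<forall>x\<in>univ N. bit N (pair N i x) (f s) \<longrightarrow> x \<in> Sent N)) \<and>
      is_disjunction N (f m) (f s) (f x)" using s * u by (simp cong: ball_cong)
  qed
  then show "x \<in> T \<longleftrightarrow> (\<exists>i\<in>univ M. lt M i m \<and> (\<exists>y\<in>univ M. bit M (pair M i y) s \<and> y \<in> T))"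
    using * u by (simp cong: bex_cong)
qed

lemma deductive:
  assumes I: "I \<subseteq> univ M" and d: "strongly_deductively_correct N (f ` I) T'"
  shows "strongly_deductively_correct M I T"
  unfolding strongly_deductively_correct_def
proof (intro ballI impI, elim conjE bexE)
  fix x' x e h p n
  assume *: "x' \<in> Sent M" "x \<in> Form M \<inter> I" "e \<in> univ M" "closed_assignment M e" "fm_subst M e x x'"
    "h \<in> univ M" "coded_set M h \<subseteq> T" "p \<in> univ M" "n \<in> I" "is_proof M h p n x'"
  have u: "x' \<in> univ M" "x \<in> univ M" "n \<in> univ M" using * I in_univ by blast+
  have 1: "f x \<in> Form N \<inter> f ` I" "closed_assignment N (f e)" "fm_subst N (f e) (f x) (f x')" using * u by auto
  have h: "coded_set N (f h) \<subseteq> T'" using *(6,7) by (auto simp: coded_set_def)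
  have p: "is_proof N (f h) (f p) (f n) (f x')" using *(6,8,10) u by simp
  have m: "f x' \<in> Sent N" "f e \<in> univ N" "f h \<in> univ N" "f p \<in> univ N" "f n \<in> f ` I" using * u by auto
  have "\<exists>x\<in>Form N \<inter> f ` I. \<exists>e\<in>univ N. closed_assignment N e \<and> fm_subst N e x (f x')"
    by (rule bexI[OF _ 1(1)], rule bexI[OF _ m(2)], rule conjI[OF 1(2,3)])
  moreover have "\<exists>h\<in>univ N. coded_set N h \<subseteq> T' \<and> (\<exists>p\<in>univ N. \<exists>n\<in>f ` I. is_proof N h p n (f x'))"
    by (rule bexI[OF _ m(3)], rule conjI[OF h], rule bexI[OF _ m(4)], rule bexI[OF _ m(5)], rule p)
  ultimately have "f x' \<in> T'"
    using d[unfolded strongly_deductively_correct_def, THEN bspec, OF m(1)] by simp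
  then show "x' \<in> T" using u by simp
qed

end

lemma proper_cut: "I \<subseteq> univ M \<Longrightarrow> proper_cut N (f ` I) \<longleftrightarrow> proper_cut M I"
proof -
  assume I: "I \<subseteq> univ M"
  have mm: "f ` I = f ` univ M \<longleftrightarrow> I = univ M" using f I by (auto simp: isom_def bij_betw_def inj_on_image_eq_iff)
  have mem: "f y \<in> f ` I \<longleftrightarrow> y \<in> I" if "y \<in> univ M" for y
    using I that by (auto simp: image_iff)
  have sub: "x \<in> I \<Longrightarrow> x \<in> univ M" for x using I by blast
  have bi: "(\<forall>x\<in>f ` A. P x) = (\<forall>x\<in>A. P (f x))" "(\<exists>x\<in>f ` A. P x) = (\<exists>x\<in>A. P (f x))" for A P by blast+
  note mm
  moreover have "(\<forall>x\<in>f ` I. \<forall>y\<in>univ N. lt N y x \<longrightarrow> y \<in> f ` I) \<longleftrightarrow> (\<forall>x\<in>I. \<forall>y\<in>univ M. lt M y x \<longrightarrow> y \<in> I)"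
    unfolding U bi
  proof (rule ball_cong[OF refl], rule ball_cong[OF refl])
    fix x y assume "x \<in> I" "y \<in> univ M"
    then show "(lt N (f y) (f x) \<longrightarrow> f y \<in> f ` I) = (lt M y x \<longrightarrow> y \<in> I)"
      using lt[of y x] mem[of y] sub[of x] by blast
  qed
  moreover have "(\<forall>x\<in>f ` I. \<exists>y\<in>f ` I. lt N x y) \<longleftrightarrow> (\<forall>x\<in>I. \<exists>y\<in>I. lt M x y)"
    unfolding bi
  proof (rule ball_cong[OF refl], rule bex_cong[OF refl])
    fix x y assume "x \<in> I" "y \<in> I"
    then show "lt N (f x) (f y) = lt M x y" using lt[of x y] sub by blast
  qed
  moreover have "f ` I \<subseteq> f ` univ M" using I by (rule image_mono)
  ultimately show ?thesis unfolding proper_cut_def cut_def using I by (simp only: U image_is_empty simp_thms)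
qed

lemma recursively_saturated: "recursively_saturated M \<Longrightarrow> recursively_saturated N"
  unfolding recursively_saturated_def
proof (intro allI impI)
  fix G n and e :: "nat \<Rightarrow> 'b"
  assume rs: "\<forall>G n e. recursive_set (gn ` G) \<and> (\<forall>p\<in>G. fm_vars p \<subseteq> {..n}) \<and> range e \<subseteq> univ M \<and>
     (\<forall>D. finite D \<and> D \<subseteq> G \<longrightarrow> (\<exists>x\<in>univ M. \<forall>p\<in>D. sat M (e(0 := x)) p)) \<longrightarrow>
     (\<exists>x\<in>univ M. \<forall>p\<in>G. sat M (e(0 := x)) p)"
    and G: "recursive_set (gn ` G) \<and> (\<forall>p\<in>G. fm_vars p \<subseteq> {..n}) \<and> range e \<subseteq> univ N \<and>
     (\<forall>D. finite D \<and> D \<subseteq> G \<longrightarrow> (\<exists>x\<in>univ N. \<forall>p\<in>D. sat N (e(0 := x)) p))"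
  have "\<forall>v. \<exists>x\<in>univ M. e v = f x" using G by (auto simp: image_iff subset_iff)
  then obtain d where "\<forall>v. d v \<in> univ M \<and> e v = f (d v)" by metis
  then have d: "\<And>v. d v \<in> univ M" "e = (\<lambda>v. f (d v))" by (simp_all add: fun_eq_iff)
  have s: "sat N (e(0 := f x)) p = sat M (d(0 := x)) p" if "x \<in> univ M" for x p
  proof -
    have "e(0 := f x) = (\<lambda>v. f ((d(0 := x)) v))" by (auto simp: d(2))
    moreover have "range (d(0 := x)) \<subseteq> univ M" using d(1) that by auto
    ultimately show ?thesis using sat_isom[OF f M, of "d(0 := x)" p] by simp
  qed
  have "\<forall>D. finite D \<and> D \<subseteq> G \<longrightarrow> (\<exists>x\<in>univ M. \<forall>p\<in>D. sat M (d(0 := x)) p)"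
    using G by (simp add: s cong: bex_cong)
  then have "\<exists>x\<in>univ M. \<forall>p\<in>G. sat M (d(0 := x)) p"
    using rs[rule_format, of G n d] G d(1) by (simp add: image_subset_iff)
  then show "\<exists>x\<in>univ N. \<forall>p\<in>G. sat N (e(0 := x)) p" by (simp add: s cong: bex_cong)
qed

lemma restr_isom: "J \<subseteq> univ M \<Longrightarrow> isom f (restr M J) (restr N (f ` J))"
proof -
  assume J: "J \<subseteq> univ M"
  then have "x \<in> J \<Longrightarrow> x \<in> univ M" for x by blast
  moreover have "inj_on f J" using f J inj_on_subset unfolding isom_def bij_betw_def by blast
  ultimately show ?thesis unfolding isom_def restr_def by (simp add: bij_betw_def)
qed

lemma elementary:
  assumes J: "elementary J M" shows "elementary (f ` J) N"
proof -
  have JM: "J \<subseteq> univ M" and st: "lpa_structure (restr M J)"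
    and eq: "\<And>p e. range e \<subseteq> J \<Longrightarrow> sat (restr M J) e p \<longleftrightarrow> sat M e p"
    using J unfolding elementary_def by blast+
  note r = restr_isom[OF JM]
  have "zer M \<in> J" "\<And>x. x \<in> J \<Longrightarrow> suc M x \<in> J" "\<And>x y. x \<in> J \<Longrightarrow> y \<in> J \<Longrightarrow> pls M x y \<in> J \<and> tms M x y \<in> J"
    using st unfolding lpa_structure_def restr_def by simp_all
  then have "lpa_structure (restr N (f ` J))"
    using JM unfolding lpa_structure_def restr_def by (simp add: subset_iff)
  moreover have "sat (restr N (f ` J)) e p \<longleftrightarrow> sat N e p" if e: "range e \<subseteq> f ` J" for e p
  proof -
    have "\<forall>v. \<exists>x\<in>J. e v = f x" using e by (auto simp: image_iff subset_iff)
    then obtain d where "\<forall>v. d v \<in> J \<and> e v = f (d v)" by metis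
    then have d: "range d \<subseteq> J" "e = (\<lambda>v. f (d v))" by (auto simp: fun_eq_iff)
    have "sat (restr N (f ` J)) e p = sat (restr M J) d p"
      unfolding d(2) by (rule sat_isom[OF r st]) (use d(1) in \<open>simp add: restr_def\<close>)
    also have "\<dots> = sat M d p" by (rule eq[OF d(1)])
    also have "\<dots> = sat N e p" unfolding d(2) by (rule sat_isom[OF f M, symmetric]) (use d(1) JM in blast)
    finally show ?thesis .
  qed
  ultimately show ?thesis unfolding elementary_def using JM by auto
qed

lemma PA_model: "PA_model M \<Longrightarrow> PA_model N"
proof -
  assume PA: "PA_model M"
  have ind: "\<forall>x\<in>univ M. sat M (d(k := x)) p" if "range d \<subseteq> univ M" "sat M (d(k := zer M)) p"
    "\<forall>x\<in>univ M. sat M (d(k := x)) p \<longrightarrow> sat M (d(k := suc M x)) p" for d k p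
    using PA that unfolding PA_model_def by blast
  have "\<forall>x\<in>univ N. sat N (e(k := x)) p" if e: "range e \<subseteq> univ N" and 0: "sat N (e(k := zer N)) p"
    and S: "\<forall>x\<in>univ N. sat N (e(k := x)) p \<longrightarrow> sat N (e(k := suc N x)) p" for e k p
  proof -
    have "\<forall>v. \<exists>x\<in>univ M. e v = f x" using e by (auto simp: image_iff subset_iff)
    then obtain d where "\<forall>v. d v \<in> univ M \<and> e v = f (d v)" by metis
  then have d: "\<And>v. d v \<in> univ M" "e = (\<lambda>v. f (d v))" by (simp_all add: fun_eq_iff)
    have s: "sat N (e(k := f x)) p = sat M (d(k := x)) p" if "x \<in> univ M" for x
    proof -
      have "e(k := f x) = (\<lambda>v. f ((d(k := x)) v))" by (auto simp: d(2))
      moreover have "range (d(k := x)) \<subseteq> univ M" using d(1) that by auto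
      ultimately show ?thesis using sat_isom[OF f M, of "d(k := x)" p] by simp
    qed
    show ?thesis using ind[of d k p] 0 S d(1) by (simp add: s image_subset_iff)
  qed
  moreover have "lpa_structure N" unfolding lpa_structure_def by simp
  ultimately show ?thesis using PA unfolding PA_model_def by simp
qed

end

section \<open>Countable models as structures on the natural numbers\<close>

lemma PA_infinite: assumes "PA_model M" shows "infinite (univ M)"
proof
  assume fin: "finite (univ M)"
  have st: "lpa_structure M" and s: "\<forall>x\<in>univ M. suc M x \<noteq> zer M"
    and i: "\<forall>x\<in>univ M. \<forall>y\<in>univ M. suc M x = suc M y \<longrightarrow> x = y"
    using assms unfolding PA_model_def by simp_all
  have M: "zer M \<in> univ M" "suc M ` univ M \<subseteq> univ M" using st unfolding lpa_structure_def by blast+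
  have "inj_on (suc M) (univ M)" "zer M \<notin> suc M ` univ M" using s i unfolding inj_on_def by force+
  note M = M this
  have "suc M ` univ M = univ M" using endo_inj_surj[OF fin M(2,3)] .
  then show False using M(1,4) by simp
qed

text \<open>The locale \<open>pa\<close> takes the whole type as universe, which a copy of the model
  on \<open>nat\<close> makes possible.\<close>

lemma nat_copy:
  assumes PA: "PA_model M" and count: "countable (univ M)"
  shows "\<exists>f (N :: nat lpa). isom f M N \<and> univ N = UNIV"
proof -
  obtain f :: "'a \<Rightarrow> nat" where f: "bij_betw f (univ M) UNIV"
    using to_nat_on_infinite[OF count PA_infinite[OF PA]] by blast
  define g where "g = inv_into (univ M) f"
  have g: "x \<in> univ M \<Longrightarrow> g (f x) = x" for x
    unfolding g_def using bij_betw_inv_into_left[OF f] by blast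
  let ?N = "\<lparr>univ = UNIV, zer = f (zer M), suc = (\<lambda>x. f (suc M (g x))),
    pls = (\<lambda>x y. f (pls M (g x) (g y))), tms = (\<lambda>x y. f (tms M (g x) (g y)))\<rparr>"
  have "isom f M ?N" unfolding isom_def using f by (simp add: g)
  then show ?thesis by (intro exI[where x = f] exI[where x = ?N]) simp
qed

theorem theorem4p5:
  fixes M :: "'a lpa"
  assumes "PA_model M"
    and "countable (univ M)"
    and "recursively_saturated M"
  shows "(\<forall>c\<in>univ M. \<exists>I. c \<in> I \<and> proper_cut M I \<and> elementary I M \<and> lpa_iso (restr M I) M) \<and>
    (\<forall>I. proper_cut M I \<and> elementary I M \<and> lpa_iso (restr M I) M \<longrightarrow>
      (\<exists>T. full_truth_class M T \<and> disj_correct M I T \<and> strongly_deductively_correct M I T))"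
  proof -
  obtain f and N :: "nat lpa" where f: "isom f M N" and U: "univ N = UNIV"
    using nat_copy[OF assms(1,2)] by blast
  have M: "lpa_structure M" using assms(1) unfolding PA_model_def by blast
  interpret t: transport f M N by unfold_locales (fact f M)+
  have PA: "PA_model N" by (rule t.PA_model[OF assms(1)])
  then interpret P: pa N using U by unfold_locales
  have sat: "recursively_saturated N" by (rule t.recursively_saturated[OF assms(3)])
  define g where "g = inv_into (univ M) f"
  have g: "isom g N M" unfolding g_def by (rule isom_inv[OF f M])
  have N: "lpa_structure N" using PA unfolding PA_model_def by blast
  have gt: "transport g N M" by unfold_locales (fact g N)+
  have b: "bij_betw f (univ M) (univ N)" using f unfolding isom_def by (elim conjE)
  have gf: "g (f x) = x" if "x \<in> univ M" for x
    unfolding g_def by (rule bij_betw_inv_into_left[OF b that])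
  show ?thesis
  proof (intro conjI ballI allI impI; (elim conjE)?)
    fix c assume c: "c \<in> univ M"
    obtain J where J: "f c \<in> J" "proper_cut N J" "elementary J N" "lpa_iso (restr N J) N"
      using P.cut_ex[OF sat countableI_type, of "f c"] by (elim exE conjE)
    have JN: "J \<subseteq> univ N" using U by simp
    obtain h where h: "isom h (restr N J) N" using J(4) unfolding lpa_iso_isom by blast
    have str: "lpa_structure (restr N J)" using J(3) unfolding elementary_def by blast
    \<comment> \<open>From the image of \<open>J\<close> back to \<open>J\<close>, by
      \<open>h\<close> onto the copy \<open>N\<close>, and by \<open>g\<close> to the given
      model.\<close>
    have "lpa_iso (restr M (g ` J)) M"
      unfolding lpa_iso_isom
      using isom_trans[OF isom_trans[OF isom_inv[OF transport.restr_isom[OF gt JN] str] h] g] by blast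
    moreover have "c \<in> g ` J" using J(1) gf[OF c] by (metis imageI)
    ultimately show "\<exists>I. c \<in> I \<and> proper_cut M I \<and> elementary I M \<and> lpa_iso (restr M I) M"
      using transport.proper_cut[OF gt JN] J(2) transport.elementary[OF gt J(3)] by blast
  next
    fix I assume I: "proper_cut M I"
    then have IM: "I \<subseteq> univ M" unfolding proper_cut_def cut_def by blast
    obtain B where B: "\<And>m. m \<in> f ` I \<Longrightarrow> P.le m B"
      using P.cut_bounded t.proper_cut[OF IM] I by blast
    obtain T' where T': "full_truth_class N T'" "disj_correct N (f ` I) T'"
      "strongly_deductively_correct N (f ` I) T'"
      using P.truth_class_ex[OF sat countableI_type, of B] B by (elim exE conjE) blast
    define T where "T = {x \<in> univ M. f x \<in> T'}"
    show "\<exists>T. full_truth_class M T \<and> disj_correct M I T \<and> strongly_deductively_correct M I T"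
      using t.full_truth[OF T_def T'(1)] t.disj[OF T_def IM T'(2)] t.deductive[OF T_def IM T'(3)] by blast
  qed
qed

end
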